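(* For every prime $p$ and every $i\in\{1,\dots,p-1\}$, the triplet vertex operator algebra $\mathcal{W}(p)$ admits a logarithmic module with a two-dimensional lowest weight subspace of generalized conformal weight $h_{i,1}$ (that is, a two-dimensional lowest weight subspace on which $L(0)$ acts non-diagonalizably with generalized eigenvalue $h_{i,1}$).
   Context: Definition of $\mathcal{W}(p)$ (for an integer $p\ge2$). Let $L=\mathbb{Z}\alpha$ with $\langle\alpha,\alpha\rangle=2p$, and let $V_L=\mathcal{U}(\hat{\mathfrak h}_{<0})\otimes\mathbb{C}[L]$ be the lattice vertex algebra with vacuum $\mathbf 1$ and conformal vector $\omega=\frac{\alpha(-1)^2}{4p}\mathbf 1+\frac{p-1}{2p}\alpha(-2)\mathbf 1$ (central charge $1-\frac{6(p-1)^2}{p}$), with Virasoro operators $L(n)$. Let $L^\circ=\mathbb{Z}\frac{\alpha}{2p}$, let $V_{L^\circ}$ be the associated generalized vertex algebra, and let $\tilde Q=e^{-\alpha/p}_0:V_L\to V_{L^\circ}$, where $u_n$ is the coefficient of $x^{-n-1}$ in $Y(u,x)$. Then $\mathcal{W}(p)=\operatorname{Ker}(\tilde Q|_{V_L})$, a vertex operator algebra with conformal vector $\omega$. Weights: $h_{m,1}=\frac{(m-1)(m-2p+1)}{4p}$. A logarithmic module is a weak module which decomposes into generalized $L(0)$-eigenspaces; here it is understood to be non-trivially logarithmic, i.e. $L(0)$ has a non-trivial Jordan block. Weak $\mathcal{W}(p)$-modules are $\mathbb{Z}_{\ge0}$-gradable, and the lowest weight subspace is the top (degree $0$) component of such a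 grading. *)

theory Defs
  imports Complex_Main "HOL-Library.Multiset" "HOL-Library.Poly_Mapping"
    "HOL-Library.Groups_Big_Fun" "HOL-Computational_Algebra.Primes"
begin

section \<open>Diagonalizability and generalized eigenspaces\<close>

context vector_space
begin

definition gen_eigenspace :: "('b \<Rightarrow> 'b) \<Rightarrow> 'b set \<Rightarrow> 'a \<Rightarrow> 'b set" where
  "gen_eigenspace T U c = {w \<in> U. \<exists>k. ((\<lambda>u. T u - scale c u) ^^ k) w = 0}"

definition diagonalizable_on :: "('b \<Rightarrow> 'b) \<Rightarrow> 'b set \<Rightarrow> bool" where
  "diagonalizable_on T U \<longleftrightarrow> U \<subseteq> span {w \<in> U. \<exists>c. T w = scale c w}"

definition has_nontrivial_jordan_block :: "('b \<Rightarrow> 'b) \<Rightarrow> 'b set \<Rightarrow> bool" where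
  "has_nontrivial_jordan_block T U \<longleftrightarrow>
     (\<exists>c. \<exists>v\<in>U. \<exists>w\<in>U. w \<noteq> 0 \<and> T w = scale c w \<and> T v = scale c v + w)"

text \<open>\<open>U\<close> is the internal direct sum of its subspaces \<open>G 0, G 1, \<dots>\<close>.\<close>

definition direct_sum_decomposition :: "(nat \<Rightarrow> 'b set) \<Rightarrow> 'b set \<Rightarrow> bool" where
  "direct_sum_decomposition G U \<longleftrightarrow>
     (\<forall>n. subspace (G n) \<and> G n \<subseteq> U) \<and>
     (\<forall>w\<in>U. \<exists>!f. (\<forall>n. f n \<in> G n) \<and> finite {n. f n \<noteq> 0} \<and> w = Sum_any f)"

end


section \<open>The generalized vertex algebra of the dual lattice\<close>

text \<open>
  \<open>V\<^bsub>L\<degree>\<^esub> = \<complex>[\<alpha>(-1), \<alpha>(-2), \<dots>] \<otimes> \<complex>[L\<degree>]\<close> with \<open>L\<degree> = \<int> \<alpha>/(2p)\<close>. The basis vector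
  indexed by \<open>(\<mu>, m)\<close> is \<open>\<Prod>\<^bsub>j \<in> \<mu>\<^esub> \<alpha>(-j-1) \<otimes> e\<^bsup>m\<alpha>/(2p)\<^esup>\<close>; note the shift by one, which keeps
  \<open>\<alpha>(0)\<close> from being a creation operator. The form is \<open>\<langle>m\<alpha>/(2p), l\<alpha>/(2p)\<rangle> = ml/(2p)\<close>,
  and the cocycle is trivial since the lattice has rank one.
\<close>

type_synonym fock = "(nat multiset \<times> int) \<Rightarrow>\<^sub>0 complex"

definition smul :: "complex \<Rightarrow> ('k \<Rightarrow>\<^sub>0 complex) \<Rightarrow> ('k \<Rightarrow>\<^sub>0 complex)" where
  "smul c v = Poly_Mapping.map ((*) c) v"

lemma lookup_smul: "Poly_Mapping.lookup (smul c v) k = c * Poly_Mapping.lookup v k"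
  by (simp add: smul_def Poly_Mapping.map.rep_eq when_def)

global_interpretation smul: vector_space "smul :: complex \<Rightarrow> ('k \<Rightarrow>\<^sub>0 complex) \<Rightarrow> _"
  by unfold_locales (auto intro!: poly_mapping_eqI simp: lookup_smul lookup_add algebra_simps)

definition basis_vector :: "nat multiset \<Rightarrow> int \<Rightarrow> fock" where
  "basis_vector \<mu> m = Poly_Mapping.single (\<mu>, m) 1"

definition linear_extension :: "(nat multiset \<Rightarrow> int \<Rightarrow> fock) \<Rightarrow> fock \<Rightarrow> fock" where
  "linear_extension f v =
     (\<Sum>(\<mu>, m) \<in> Poly_Mapping.keys v. smul (Poly_Mapping.lookup v (\<mu>, m)) (f \<mu> m))"

text \<open>\<open>heisenberg p n\<close> is \<open>\<alpha>(n)\<close>, so that \<open>[\<alpha>(m), \<alpha>(n)] = 2pm \<delta>\<^bsub>m+n,0\<^esub>\<close>.\<close>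

definition heisenberg :: "nat \<Rightarrow> int \<Rightarrow> fock \<Rightarrow> fock" where
  "heisenberg p n = linear_extension (\<lambda>\<mu> m.
     if n < 0 then basis_vector (add_mset (nat (- n - 1)) \<mu>) m
     else if n = 0 then smul (of_int m) (basis_vector \<mu> m)
     else smul (of_nat (2 * p * nat n * count \<mu> (nat (n - 1))))
            (basis_vector (\<mu> - {#nat (n - 1)#}) m))"

text \<open>
  A field \<open>B(x)\<close> is represented by its modes: \<open>B s\<close> is the coefficient of \<open>x\<^bsup>-s-1\<^esup>\<close>, where
  \<open>s\<close> is rational because fractional powers of \<open>x\<close> occur.
\<close>

type_synonym field_modes = "rat \<Rightarrow> fock \<Rightarrow> fock"

text \<open>The coefficient of \<open>z\<^bsup>k\<^esup>\<close> in \<open>exp (\<Sum>\<^bsub>n\<ge>1\<^esub> c n z\<^bsup>n\<^esup>)\<close>: \<open>ns\<close> runs over the compositions of \<open>k\<close>.\<close>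

definition exp_coeff :: "(nat \<Rightarrow> fock \<Rightarrow> fock) \<Rightarrow> nat \<Rightarrow> fock \<Rightarrow> fock" where
  "exp_coeff c k w =
     (\<Sum>ns | 0 \<notin> set ns \<and> sum_list ns = k. smul (1 / fact (length ns)) (foldr c ns w))"

text \<open>
  With \<open>\<beta> = m\<alpha>/(2p)\<close>,
  \<open>Y(e\<^bsup>\<beta>\<^esup>, x) = exp (\<Sum>\<^bsub>n\<ge>1\<^esub> \<beta>(-n)/n x\<^bsup>n\<^esup>) exp (- \<Sum>\<^bsub>n\<ge>1\<^esub> \<beta>(n)/n x\<^bsup>-n\<^esup>) e\<^bsup>\<beta>\<^esup> x\<^bsup>\<beta>(0)\<^esup>\<close>.
\<close>

definition exp_creation :: "nat \<Rightarrow> int \<Rightarrow> nat \<Rightarrow> fock \<Rightarrow> fock" where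
  "exp_creation p m =
     exp_coeff (\<lambda>n w. smul (of_int m / of_nat (2 * p * n)) (heisenberg p (- int n) w))"

definition exp_annihilation :: "nat \<Rightarrow> int \<Rightarrow> nat \<Rightarrow> fock \<Rightarrow> fock" where
  "exp_annihilation p m =
     exp_coeff (\<lambda>n w. smul (- of_int m / of_nat (2 * p * n)) (heisenberg p (int n) w))"

definition lattice_shift :: "int \<Rightarrow> fock \<Rightarrow> fock" where
  "lattice_shift m = linear_extension (\<lambda>\<mu> l. basis_vector \<mu> (m + l))"

definition lattice_field :: "nat \<Rightarrow> int \<Rightarrow> field_modes" where
  "lattice_field p m s = linear_extension (\<lambda>\<mu> l.
     Sum_any (\<lambda>(a, b).
       if of_nat a - of_nat b + of_int (m * l) / of_nat (2 * p) = - s - 1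
       then exp_creation p m a (exp_annihilation p m b (lattice_shift m (basis_vector \<mu> l)))
       else 0))"

text \<open>
  The normally ordered product of \<open>1/j! (d/dx)\<^bsup>j\<^esup> \<alpha>(x) = \<Sum>\<^bsub>k\<^esub> (-k-1 choose j) \<alpha>(k) x\<^bsup>-k-1-j\<^esup>\<close>
  with \<open>B(x)\<close>: the \<open>\<alpha>(k)\<close> with \<open>k < 0\<close> (first sum, \<open>k = -i-1\<close>) go to the left of \<open>B(x)\<close>,
  those with \<open>k \<ge> 0\<close> (second sum, \<open>k = i\<close>) to the right.
\<close>

definition normal_ordered :: "nat \<Rightarrow> nat \<Rightarrow> field_modes \<Rightarrow> field_modes" where
  "normal_ordered p j B s w =
     Sum_any (\<lambda>i::nat. smul (of_nat (i choose j))
       (heisenberg p (- int i - 1) (B (s + of_nat i - of_nat j) w))) +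
     Sum_any (\<lambda>i::nat. smul ((- of_nat i - 1) gchoose j)
       (B (s - of_nat i - of_nat j - 1) (heisenberg p (int i) w)))"

text \<open>
  \<open>vertex_op p u s\<close> is the mode \<open>u\<^bsub>s\<^esub>\<close>, the coefficient of \<open>x\<^bsup>-s-1\<^esup>\<close> in \<open>Y(u, x)\<close>. The factors
  of a basis vector are listed in increasing order only to fix an expression; the normally
  ordered product is independent of the order.
\<close>

definition vertex_op :: "nat \<Rightarrow> fock \<Rightarrow> field_modes" where
  "vertex_op p u s w =
     linear_extension (\<lambda>\<mu> m.
       foldr (normal_ordered p) (sorted_list_of_multiset \<mu>) (lattice_field p m) s w) u"


section \<open>The triplet vertex operator algebra\<close>

record 'v vertex_data =
  carrier :: "'v set"
  scal :: "complex \<Rightarrow> 'v \<Rightarrow> 'v"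
  vacuum :: 'v
  conformal :: 'v
  mode :: "'v \<Rightarrow> int \<Rightarrow> 'v \<Rightarrow> 'v"

text \<open>\<open>V\<^bsub>L\<^esub> \<subseteq> V\<^bsub>L\<degree>\<^esub>\<close>, where \<open>L = \<int>\<alpha>\<close> consists of the \<open>m\<alpha>/(2p)\<close> with \<open>2p\<close> dividing \<open>m\<close>.\<close>

definition lattice_space :: "nat \<Rightarrow> fock set" where
  "lattice_space p = {v. \<forall>(\<mu>, m) \<in> Poly_Mapping.keys v. int (2 * p) dvd m}"

definition conformal_vector :: "nat \<Rightarrow> fock" where
  "conformal_vector p =
     smul (1 / (4 * of_nat p)) (basis_vector {#0, 0#} 0) +
     smul ((of_nat p - 1) / (2 * of_nat p)) (basis_vector {#1#} 0)"

text \<open>\<open>\<tilde>Q = e\<^bsup>-\<alpha>/p\<^esup>\<^bsub>0\<^esub>\<close>; recall \<open>-\<alpha>/p = -2 \<cdot> \<alpha>/(2p)\<close>.\<close>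

definition screening :: "nat \<Rightarrow> fock \<Rightarrow> fock" where
  "screening p = vertex_op p (basis_vector {#} (- 2)) 0"

definition triplet :: "nat \<Rightarrow> fock vertex_data" where
  "triplet p = \<lparr>
     carrier = {v \<in> lattice_space p. screening p v = 0},
     scal = smul,
     vacuum = basis_vector {#} 0,
     conformal = conformal_vector p,
     mode = (\<lambda>u n. vertex_op p u (of_int n)) \<rparr>"

definition conformal_weight :: "nat \<Rightarrow> nat \<Rightarrow> complex" where
  "conformal_weight p m =
     (of_nat m - 1) * (of_nat m - 2 * of_nat p + 1) / (4 * of_nat p)"


section \<open>Weak modules\<close>

text \<open>
  A weak module is a subspace \<open>M\<close> of a complex vector space with modes \<open>act v n\<close>, the coefficient
  of \<open>x\<^bsup>-n-1\<^esup>\<close> in \<open>Y\<^bsub>M\<^esub>(v, x)\<close>. The last assumption is the coefficient of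
  \<open>x\<^sub>0\<^bsup>-l-1\<^esup> x\<^sub>1\<^bsup>-m-1\<^esup> x\<^sub>2\<^bsup>-n-1\<^esup>\<close> in the Jacobi identity; all sums in it have finite support.
  For modules of a vertex algebra of countable dimension such as \<open>triplet p\<close>, taking \<open>'m = fock\<close>
  is no restriction up to isomorphism on the finitely generated ones: they have countable
  dimension, as does \<open>fock\<close>.
\<close>

locale weak_module = vector_space scale
  for scale :: "complex \<Rightarrow> 'm::ab_group_add \<Rightarrow> 'm" (infixr \<open>*s\<close> 75) +
  fixes V :: "'v::ab_group_add vertex_data"
    and M :: "'m set"
    and act :: "'v \<Rightarrow> int \<Rightarrow> 'm \<Rightarrow> 'm"
  assumes subspace_M: "subspace M"
    and act_closed: "\<lbrakk>v \<in> carrier V; w \<in> M\<rbrakk> \<Longrightarrow> act v n w \<in> M"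
    and act_add_left: "\<lbrakk>u \<in> carrier V; v \<in> carrier V; w \<in> M\<rbrakk> \<Longrightarrow>
          act (u + v) n w = act u n w + act v n w"
    and act_scale_left: "\<lbrakk>v \<in> carrier V; w \<in> M\<rbrakk> \<Longrightarrow> act (scal V c v) n w = c *s act v n w"
    and act_add_right: "\<lbrakk>v \<in> carrier V; w \<in> M; w' \<in> M\<rbrakk> \<Longrightarrow>
          act v n (w + w') = act v n w + act v n w'"
    and act_scale_right: "\<lbrakk>v \<in> carrier V; w \<in> M\<rbrakk> \<Longrightarrow> act v n (c *s w) = c *s act v n w"
    and truncation: "\<lbrakk>v \<in> carrier V; w \<in> M\<rbrakk> \<Longrightarrow> \<exists>N. \<forall>n\<ge>N. act v n w = 0"
    and act_vacuum: "w \<in> M \<Longrightarrow> act (vacuum V) n w = (if n = - 1 then w else 0)"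
    and jacobi: "\<lbrakk>u \<in> carrier V; v \<in> carrier V; w \<in> M\<rbrakk> \<Longrightarrow>
          Sum_any (\<lambda>i::nat. (of_int m gchoose i) *s act (mode V u (l + int i) v) (m + n - int i) w) =
          Sum_any (\<lambda>i::nat. ((- 1) ^ i * (of_int l gchoose i)) *s
            (act u (l + m - int i) (act v (n + int i) w)
             - ((- 1) powi l) *s act v (l + n - int i) (act u (m + int i) w)))"
begin

definition L :: "int \<Rightarrow> 'm \<Rightarrow> 'm" where
  "L n = act (conformal V) (n + 1)"

end

locale logarithmic_module = weak_module +
  assumes gen_eigenspaces_span: "span (\<Union>c. gen_eigenspace (L 0) M c) = M"
    and nontrivial: "has_nontrivial_jordan_block (L 0) M"

text \<open>
  A \<open>\<int>\<^bsub>\<ge>0\<^esub>\<close>-grading compatible with the action: if \<open>v\<close> has weight \<open>k\<close> (for the \<open>L(0)\<close> of \<open>V\<close>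
  itself), then \<open>v\<^bsub>m\<^esub>\<close> has degree \<open>k - m - 1\<close>.
\<close>

locale graded_weak_module = weak_module scale V M act
  for scale :: "complex \<Rightarrow> 'm::ab_group_add \<Rightarrow> 'm" (infixr \<open>*s\<close> 75)
    and V :: "'v::ab_group_add vertex_data" and M act +
  fixes G :: "nat \<Rightarrow> 'm set"
  assumes decomposition: "direct_sum_decomposition G M"
    and act_degree: "\<lbrakk>v \<in> carrier V; mode V (conformal V) 1 v = scal V (of_int k) v; w \<in> G n\<rbrakk> \<Longrightarrow>
          (if int n + k - m - 1 < 0 then act v m w = 0
           else act v m w \<in> G (nat (int n + k - m - 1)))"

end

theory Submission
  imports Defs "HOL-Computational_Algebra.Computational_Algebra" "HOL-Library.FuncSet"
begin

text \<open>
  The momenta \<open>i - 1\<close> and \<open>2p - 1 - i\<close> of \<open>V\<^sub>L\<^sub>\<degree>\<close> both have conformal weight \<open>h\<^sub>i\<^sub>,\<^sub>1\<close>, and the derivatives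
  of the weight in the direction of the momentum are opposite and nonzero there. Every mode of an
  element of \<open>W(p)\<close> has the same vacuum expectation value at these two momenta. Therefore, in the sum
  \<open>U\<close> of the two cosets, the difference of the two lattice elements generates a submodule that does
  not contain either of them; let \<open>Rad\<close> be the largest submodule on which the sum of the two vacuum
  coefficients vanishes. Up to logarithmic terms, the derivative of \<open>Y(v, x)\<close> in the direction of the
  momentum, taken with opposite signs on the two cosets, is a cocycle with which a copy of \<open>Rad\<close> is
  extended by \<open>U / Rad\<close>. On the top of this extension the nilpotent part of \<open>L(0)\<close> is the
  derivative of the weight.

  Equality of the expectation values: they are values at \<open>(0,\<dots>,0)\<close> and at \<open>(1,\<dots>,1)\<close> of a symmetric
  polynomial \<open>f\<close>, and the condition for the kernel of the screening operator says that a residue formed from \<open>f\<close>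
  and depending on a parameter \<open>k\<close> vanishes at \<open>k = 1/p\<close>. For a positive integer \<open>k\<close> the same residue
  governs an integral of Selberg type over a closed contour, by which \<open>f(1,\<dots>,1) - f(0,\<dots>,0)\<close> can be
  expressed. Integration by parts turns this into an identity of rational functions of \<open>k\<close>, which can
  be evaluated at \<open>k = 1/p\<close>; its denominators do not vanish there because \<open>p\<close> is prime.
\<close>

text \<open>The polynomial has \<open>p - i\<close> variables because the two momenta differ by
  \<open>p - i\<close> screening charges of momentum -2: moving a variable from 0 to 1 switches on
  the contribution of one charge. Applying the screening operator inserts one of these charges, and
  its weight as a function of the position is of Selberg type with exponent 1/p. Since that exponent
  is not an integer, no closed contour is available, and only identities that are rational in the
  exponent survive. On the side of the vertex algebra, generating functions and their expansions are
  avoided: a family of operators closed under commutators with the Heisenberg modes vanishes once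
  its vacuum coefficients do, which leaves binomial identities to check. The logarithm dropped from
  the derivative does no harm: what it would contribute is a combination of products of modes
  applied to a vector of the radical, hence zero in the quotient.\<close>

abbreviation "bv \<equiv> basis_vector"
abbreviation "keys \<equiv> Poly_Mapping.keys"
abbreviation "lookup \<equiv> Poly_Mapping.lookup"

section \<open>Linear maps on the Fock space\<close>

definition lin :: "(fock \<Rightarrow> fock) \<Rightarrow> bool" where
  "lin T \<longleftrightarrow> (\<forall>x y. T (x + y) = T x + T y) \<and> (\<forall>c x. T (smul c x) = smul c (T x))"

lemma linI: "(\<And>x y. T (x + y) = T x + T y) \<Longrightarrow> (\<And>c x. T (smul c x) = smul c (T x)) \<Longrightarrow> lin T"
  by (simp add: lin_def)

lemma lin_add: "lin T \<Longrightarrow> T (x + y) = T x + T y"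
  and lin_smul: "lin T \<Longrightarrow> T (smul c x) = smul c (T x)"
  by (simp_all add: lin_def)

lemma lin_zero: "lin T \<Longrightarrow> T 0 = 0"
  using lin_smul[of T 0 0] by simp

lemma lin_minus: "lin T \<Longrightarrow> T (- x) = - T x"
  using lin_smul[of T "-1" x] by simp

lemma lin_diff: "lin T \<Longrightarrow> T (x - y) = T x - T y"
  using lin_add[of T x "- y"] by (simp add: lin_minus)

lemma lin_sum: "lin T \<Longrightarrow> T (sum f A) = (\<Sum>x\<in>A. T (f x))"
  by (induction A rule: infinite_finite_induct) (auto simp: lin_zero lin_add)

lemma lin_id: "lin (\<lambda>w. w)" by (simp add: lin_def)
lemma lin_0: "lin (\<lambda>w. 0)" by (simp add: lin_def)
lemma lin_plus: "lin S \<Longrightarrow> lin T \<Longrightarrow> lin (\<lambda>w. S w + T w)"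
  by (simp add: lin_def smul.scale_right_distrib)
lemma lin_diff_fun: "lin S \<Longrightarrow> lin T \<Longrightarrow> lin (\<lambda>w. S w - T w)"
  by (simp add: lin_def smul.scale_right_diff_distrib)
lemma lin_comp: "lin S \<Longrightarrow> lin T \<Longrightarrow> lin (\<lambda>w. S (T w))"
  by (simp add: lin_def)
lemma lin_scale: "lin T \<Longrightarrow> lin (\<lambda>w. smul c (T w))"
  by (simp add: lin_def smul.scale_right_distrib mult.commute)
lemma lin_setsum: "(\<And>x. x \<in> A \<Longrightarrow> lin (f x)) \<Longrightarrow> lin (\<lambda>w. \<Sum>x\<in>A. f x w)"
  by (induction A rule: infinite_finite_induct) (auto simp: lin_0 lin_plus)

lemma keys_smul: "keys (smul c v) \<subseteq> keys v"
  by (auto simp: in_keys_iff lookup_smul)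

lemma lookup_basis_vector:
  "lookup (bv \<mu> m) k = (if k = (\<mu>, m) then 1 else 0)"
  by (auto simp: basis_vector_def lookup_single when_def)

lemma fock_expand:
  "v = (\<Sum>k\<in>keys v. smul (lookup v k) (bv (fst k) (snd k)))"
proof (rule poly_mapping_eqI)
  fix k
  have "lookup (\<Sum>k\<in>keys v. smul (lookup v k) (bv (fst k) (snd k))) k
    = (\<Sum>k'\<in>keys v. if k = k' then lookup v k' else 0)"
    unfolding lookup_sum lookup_smul lookup_basis_vector by (intro sum.cong) auto
  also have "\<dots> = lookup v k"
    by (simp add: in_keys_iff)
  finally show "lookup v k = lookup (\<Sum>k\<in>keys v.
      smul (lookup v k) (bv (fst k) (snd k))) k" ..
qed

lemma fock_expand_superset:
  assumes "finite K" "keys v \<subseteq> K"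
  shows "v = (\<Sum>k\<in>K. smul (lookup v k) (bv (fst k) (snd k)))"
proof -
  have "v = (\<Sum>k\<in>keys v. smul (lookup v k) (bv (fst k) (snd k)))"
    by (rule fock_expand)
  also have "\<dots> = (\<Sum>k\<in>K. smul (lookup v k) (bv (fst k) (snd k)))"
    using assms by (intro sum.mono_neutral_left) (auto simp: in_keys_iff)
  finally show ?thesis .
qed

lemma linear_extension_superset:
  assumes "finite K" "keys v \<subseteq> K"
  shows "linear_extension f v = (\<Sum>k\<in>K. smul (lookup v k) (f (fst k) (snd k)))"
proof -
  have "linear_extension f v =
      (\<Sum>k\<in>keys v. smul (lookup v k) (f (fst k) (snd k)))"
    by (simp add: linear_extension_def case_prod_unfold)
  also have "\<dots> = (\<Sum>k\<in>K. smul (lookup v k) (f (fst k) (snd k)))"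
    using assms by (intro sum.mono_neutral_left) (auto simp: in_keys_iff)
  finally show ?thesis .
qed

lemma lin_linear_extension: "lin (linear_extension f)"
proof (rule linI)
  fix x y :: fock
  let ?K = "keys x \<union> keys y"
  have "keys (x + y) \<subseteq> ?K" by (rule Poly_Mapping.keys_add)
  then show "linear_extension f (x + y) = linear_extension f x + linear_extension f y"
    by (simp add: linear_extension_superset[of ?K] lookup_add smul.scale_left_distrib sum.distrib)
next
  fix c and x :: fock
  show "linear_extension f (smul c x) = smul c (linear_extension f x)"
    by (simp add: linear_extension_superset[of "keys x"] keys_smul lookup_smul
        smul.scale_sum_right)
qed

lemma linear_extension_basis [simp]: "linear_extension f (bv \<mu> m) = f \<mu> m"
  by (subst linear_extension_superset[of "{(\<mu>, m)}"]) (auto simp: basis_vector_def)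

lemma keys_basis_vector [simp]: "keys (bv \<mu> m) = {(\<mu>, m)}"
  by (simp add: basis_vector_def)

lemma lin_ext_on:
  assumes S: "lin S" and T: "lin T"
    and eq: "\<And>\<mu> m. (\<mu>, m) \<in> keys v \<Longrightarrow> S (bv \<mu> m) = T (bv \<mu> m)"
  shows "S v = T v"
proof -
  have "S v = (\<Sum>k\<in>keys v. smul (lookup v k) (S (bv (fst k) (snd k))))"
    using arg_cong[OF fock_expand[of v], of S] by (simp only: lin_sum[OF S] lin_smul[OF S])
  also have "\<dots> = (\<Sum>k\<in>keys v. smul (lookup v k) (T (bv (fst k) (snd k))))"
    by (intro sum.cong refl) (metis eq prod.collapse)
  also have "\<dots> = T v"
    using arg_cong[OF fock_expand[of v], of T] by (simp only: lin_sum[OF T] lin_smul[OF T])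
  finally show ?thesis .
qed

lemma lin_ext:
  assumes "lin S" "lin T" "\<And>\<mu> m. S (bv \<mu> m) = T (bv \<mu> m)"
  shows "S v = T v"
  using assms by (rule lin_ext_on)

section \<open>Sums with finite support\<close>

text \<open>By convention \<open>Sum_any\<close> is 0 on a family of infinite support, so additivity
  and linearity need a support condition. Truncation of fields delivers it in the form of eventual
  vanishing, which is stable under sums and linear maps.\<close>

definition ez :: "(nat \<Rightarrow> 'a::zero) \<Rightarrow> bool" where
  "ez f \<longleftrightarrow> (\<exists>N. \<forall>i\<ge>N. f i = 0)"

lemma ezI: "(\<And>i. i \<ge> N \<Longrightarrow> f i = 0) \<Longrightarrow> ez f"
  by (auto simp: ez_def)

lemma Sum_any_lessThan:
  fixes f :: "nat \<Rightarrow> 'a::comm_monoid_add"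
  assumes "\<And>i. i \<ge> N \<Longrightarrow> f i = 0"
  shows "Sum_any f = (\<Sum>i<N. f i)"
  using assms by (intro Sum_any.expand_superset) (auto simp: not_less[symmetric])

lemma Sum_any_single:
  fixes f :: "nat \<Rightarrow> 'a::comm_monoid_add"
  assumes "\<And>i. i \<noteq> a \<Longrightarrow> f i = 0" shows "Sum_any f = f a"
  using Sum_any.expand_superset[of "{a}" f] assms by auto

lemma ez_finite: "ez f \<Longrightarrow> finite {i. f i \<noteq> (0::'a::zero)}"
proof -
  assume "ez f"
  then obtain N where "\<forall>i\<ge>N. f i = 0" by (auto simp: ez_def)
  then have "{i. f i \<noteq> 0} \<subseteq> {..<N}" by (auto simp: not_less[symmetric])
  then show ?thesis by (rule finite_subset) simp
qed

lemma ez_add: "ez f \<Longrightarrow> ez g \<Longrightarrow> ez (\<lambda>i. f i + (g i::'a::monoid_add))"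
  unfolding ez_def by (metis add_0 linorder_linear order.trans)

lemma ez_hom: "ez f \<Longrightarrow> T 0 = 0 \<Longrightarrow> ez (\<lambda>i. T (f i))"
  unfolding ez_def by metis

lemma ez_smul: "ez f \<Longrightarrow> ez (\<lambda>i. smul (c i) (f i))"
  unfolding ez_def by (metis smul.scale_zero_right)

lemma ez_mult: "ez f \<Longrightarrow> ez (\<lambda>i. c i * (f i::'a::mult_zero))"
  unfolding ez_def by (metis mult_zero_right)

lemma Sum_any_plus:
  fixes f g :: "nat \<Rightarrow> 'a::comm_monoid_add"
  shows "ez f \<Longrightarrow> ez g \<Longrightarrow> Sum_any (\<lambda>i. f i + g i) = Sum_any f + Sum_any g"
  by (rule Sum_any.distrib) (auto dest: ez_finite)

lemma Sum_any_hom: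
  fixes f :: "nat \<Rightarrow> 'a::comm_monoid_add"
  assumes "ez f" "T 0 = 0" "\<And>x y. T (x + y) = T x + (T y::'b::comm_monoid_add)"
  shows "T (Sum_any f) = Sum_any (\<lambda>i. T (f i))"
proof -
  obtain N where N: "\<And>i. i \<ge> N \<Longrightarrow> f i = 0" using assms(1) by (auto simp: ez_def)
  have "T (\<Sum>i<n. f i) = (\<Sum>i<n. T (f i))" for n
    by (induction n) (simp_all add: assms(2,3))
  then show ?thesis
    using N assms(2) by (simp add: Sum_any_lessThan[of N])
qed

lemma Sum_any_lin: "ez f \<Longrightarrow> lin T \<Longrightarrow> T (Sum_any f) = Sum_any (\<lambda>i. T (f i))"
  by (rule Sum_any_hom) (auto simp: lin_zero lin_add)

lemma Sum_any_lookup: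
  "ez f \<Longrightarrow> lookup (Sum_any f) k = Sum_any (\<lambda>i. lookup (f i) k)"
  by (rule Sum_any_hom) (auto simp: lookup_add)

lemma Sum_any_mult_left:
  fixes f :: "nat \<Rightarrow> complex"
  assumes "ez f" shows "Sum_any (\<lambda>i. c * f i) = c * Sum_any f"
  using Sum_any_hom[OF assms, of "\<lambda>x. c * x"] by (simp add: distrib_left)

lemma Sum_any_sum:
  fixes f :: "nat \<Rightarrow> 'b \<Rightarrow> 'a::comm_monoid_add"
  assumes "finite A" "\<And>x. x \<in> A \<Longrightarrow> ez (\<lambda>i. f i x)"
  shows "Sum_any (\<lambda>i. \<Sum>x\<in>A. f i x) = (\<Sum>x\<in>A. Sum_any (\<lambda>i. f i x))
    \<and> ez (\<lambda>i. \<Sum>x\<in>A. f i x)"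
  using assms
proof (induction A rule: finite_induct)
  case empty
  show ?case by (simp add: ez_def)
next
  case (insert x A)
  then show ?case by (auto simp: Sum_any_plus intro: ez_add)
qed

lemma Sum_any_shift:
  fixes f :: "nat \<Rightarrow> 'a::comm_monoid_add"
  assumes "\<And>i. i < q \<Longrightarrow> f i = 0"
  shows "Sum_any f = Sum_any (\<lambda>i. f (i + q))"
proof -
  have "bij_betw (\<lambda>i. i + q) {i. f (i + q) \<noteq> 0} {i. f i \<noteq> 0}"
    unfolding bij_betw_def inj_on_def
  proof safe
    fix i assume "f i \<noteq> 0"
    then have "i \<ge> q" using assms by (meson not_less)
    then have "i = (i - q) + q" by simp
    with \<open>f i \<noteq> 0\<close> show "i \<in> (\<lambda>i. i + q) ` {i. f (i + q) \<noteq> 0}"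
      by (metis (mono_tags, lifting) image_eqI mem_Collect_eq)
  qed auto
  then show ?thesis
    by (simp add: Sum_any.expand_set sum.reindex_bij_betw[symmetric])
qed

text \<open>Cauchy product. The weights \<open>c\<close> and \<open>d\<close> are arbitrary because
  only pairs with i + s below the cutoff of \<open>g\<close> survive. With binomial weights the
  inner sum is then evaluated by Vandermonde's convolution.\<close>

lemma Sum_any_conv:
  fixes g :: "nat \<Rightarrow> complex"
  assumes "ez g"
  shows "Sum_any (\<lambda>i. Sum_any (\<lambda>s. c i * d s * g (i + s)))
    = Sum_any (\<lambda>t. (\<Sum>i\<le>t. c i * d (t - i)) * g t)"
proof -
  obtain N where N: "\<And>i. i \<ge> N \<Longrightarrow> g i = 0" using assms by (auto simp: ez_def)
  have "Sum_any (\<lambda>i. Sum_any (\<lambda>s. c i * d s * g (i + s))) = (\<Sum>i<N. \<Sum>s<N. c i * d s * g (i + s))"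
    using N by (subst Sum_any_lessThan[of N]) (auto simp: Sum_any_lessThan[of N])
  also have "\<dots> = (\<Sum>(i,s)\<in>{..<N} \<times> {..<N}. c i * d s * g (i + s))"
    by (simp add: sum.cartesian_product)
  also have "\<dots> = (\<Sum>(i,s)\<in>{(i,s). i + s < N}. c i * d s * g (i + s))"
    using N by (intro sum.mono_neutral_right) (auto, meson not_less)
  also have "\<dots> = (\<Sum>(t,i)\<in>Sigma {..<N} (\<lambda>t. {..t}). c i * d (t - i) * g t)"
    by (rule sum.reindex_bij_witness[of _ "\<lambda>(t,i). (i, t - i)" "\<lambda>(i,s). (i + s, i)"]) auto
  also have "\<dots> = (\<Sum>t<N. \<Sum>i\<le>t. c i * d (t - i) * g t)"
    by (simp add: sum.Sigma)
  also have "\<dots> = Sum_any (\<lambda>t. (\<Sum>i\<le>t. c i * d (t - i)) * g t)"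
    using N by (simp add: Sum_any_lessThan[of N] sum_distrib_right)
  finally show ?thesis .
qed

section \<open>The Heisenberg algebra\<close>

definition deg :: "nat multiset \<Rightarrow> nat" where
  "deg \<mu> = (\<Sum>j\<in>#\<mu>. Suc j)"

lemma deg_simps [simp]: "deg {#} = 0" "deg (add_mset j \<mu>) = Suc j + deg \<mu>"
  by (simp_all add: deg_def)

lemma heisenberg_neg [simp]:
  "heisenberg p (- int j - 1) (bv \<mu> m) = bv (add_mset j \<mu>) m"
  by (simp add: heisenberg_def)

lemma heisenberg_0 [simp]: "heisenberg p 0 (bv \<mu> m) = smul (of_int m) (bv \<mu> m)"
  by (simp add: heisenberg_def)

lemma heisenberg_pos [simp]:
  "heisenberg p (int j + 1) (bv \<mu> m) =
     smul (of_nat (2 * p * (j + 1) * count \<mu> j)) (bv (\<mu> - {#j#}) m)"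
proof -
  have "nat (int j + 1) = Suc j" by simp
  then show ?thesis by (simp add: heisenberg_def)
qed

lemmas heisenberg_pos' [simp] = heisenberg_pos[unfolded add.commute[of "int j" for j] add.commute[of j 1 for j]]

lemma lin_heisenberg [simp]: "lin (heisenberg p n)"
  by (simp add: heisenberg_def lin_linear_extension)

lemmas heisenberg_lin_simps [simp] =
  lin_add[OF lin_heisenberg] lin_smul[OF lin_heisenberg] lin_zero[OF lin_heisenberg]
  lin_minus[OF lin_heisenberg] lin_diff[OF lin_heisenberg]

lemma lin_heisenberg_comp: "lin T \<Longrightarrow> lin (\<lambda>w. heisenberg p n (T w))"
  by (rule lin_comp[OF lin_heisenberg])

lemma int_cases3:
  obtains (neg) j where "n = - int j - 1" | (zero) "n = 0" | (pos) j where "n = int j + 1"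
proof (cases "n < 0")
  case True
  then have "n = - int (nat (- n - 1)) - 1" by simp
  then show ?thesis using neg by blast
next
  case False
  show ?thesis
  proof (cases "n = 0")
    case nz: False
    with False have "n = int (nat (n - 1)) + 1" by simp
    then show ?thesis using pos by blast
  qed (use zero in blast)
qed

lemma heisenberg_commute:
  "heisenberg p a (heisenberg p b w) = heisenberg p b (heisenberg p a w)
     + (if a + b = 0 then smul (of_int (2 * int p * a)) w else 0)"
proof -
  have "heisenberg p a (heisenberg p b w) - heisenberg p b (heisenberg p a w) =
     (if a + b = 0 then smul (of_int (2 * int p * a)) w else 0)"
  proof (rule lin_ext[where S = "\<lambda>w. heisenberg p a (heisenberg p b w) - heisenberg p b (heisenberg p a w)"
        and T = "\<lambda>w. if a + b = 0 then smul (of_int (2 * int p * a)) w else 0"])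
    show "lin (\<lambda>w. heisenberg p a (heisenberg p b w) - heisenberg p b (heisenberg p a w))"
      by (intro lin_diff_fun lin_heisenberg_comp lin_id)
    show "lin (\<lambda>w. if a + b = 0 then smul (of_int (2 * int p * a)) w else 0)"
      by (cases "a + b = 0") (simp_all add: lin_scale lin_id lin_0)
  next
    fix \<mu> m
    consider (nn) i j where "a = - int i - 1" "b = - int j - 1" | (zero) "a = 0 \<or> b = 0"
      | (pp) i j where "a = int i + 1" "b = int j + 1"
      | (np) i j where "a = - int i - 1" "b = int j + 1"
      | (pn) i j where "a = int i + 1" "b = - int j - 1"
      by (metis int_cases3)
    then show "heisenberg p a (heisenberg p b (bv \<mu> m)) - heisenberg p b (heisenberg p a (bv \<mu> m))
      = (if a + b = 0 then smul (of_int (2 * int p * a)) (bv \<mu> m) else 0)"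
    proof cases
      case nn
      then show ?thesis by (auto simp: add_mset_commute)
    next
      case zero
      have "heisenberg p a (heisenberg p 0 (bv \<mu> m)) = heisenberg p 0 (heisenberg p a (bv \<mu> m))" for a
        by (cases a rule: int_cases3) (auto simp: mult.commute)
      with zero show ?thesis by auto
    next
      case pp
      then have "a + b \<noteq> 0" by simp
      then show ?thesis
        by (cases "i = j") (auto simp: pp add.commute diff_diff_add algebra_simps)
    next
      case np
      show ?thesis
      proof (cases "i = j")
        case True
        show ?thesis unfolding np True
          by (cases "j \<in># \<mu>") (auto simp: not_in_iff smul.scale_left_distrib smul.scale_left_diff_distrib ring_distribs dest!: multi_member_split)
      next
        case False
        then show ?thesis using np
          apply (cases "j \<in># \<mu>")
          by (auto simp: not_in_iff add_mset_commute)
      qed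
    next
      case pn
      show ?thesis
      proof (cases "i = j")
        case True
        show ?thesis unfolding pn True
          by (cases "j \<in># \<mu>") (auto simp: not_in_iff smul.scale_left_distrib smul.scale_left_diff_distrib ring_distribs dest!: multi_member_split)
      next
        case False
        then show ?thesis using pn
          apply (cases "i \<in># \<mu>")
          by (auto simp: not_in_iff add_mset_commute)
      qed
    qed
  qed
  then show ?thesis by (simp add: algebra_simps)
qed

lemma truncation_from_basis:
  fixes B :: "int \<Rightarrow> fock \<Rightarrow> fock"
  assumes B: "\<And>n. lin (B n)" and basis: "\<And>\<mu> m. \<exists>N. \<forall>n\<ge>N. B n (bv \<mu> m) = 0"
  shows "\<exists>N. \<forall>n\<ge>N. B n w = 0"
proof -
  have "\<forall>k. \<exists>N. \<forall>n\<ge>N. B n (bv (fst k) (snd k)) = 0" using basis by blast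
  then obtain f where f: "\<And>n k. n \<ge> f k \<Longrightarrow> B n (bv (fst k) (snd k)) = 0"
    by metis
  have "\<exists>N. \<forall>k\<in>keys w. f k \<le> N"
    using finite_imageI[OF finite_keys, of f w] by (metis Max_ge imageI)
  then obtain N where N: "\<And>k. k \<in> keys w \<Longrightarrow> f k \<le> N" by blast
  have "B n w = (\<lambda>w. 0) w" if "n \<ge> N" for n
    by (rule lin_ext_on[OF B lin_0]) (metis N f fst_conv order_trans snd_conv that)
  then show ?thesis by blast
qed

lemma heisenberg_truncation: "\<exists>N. \<forall>n\<ge>N. heisenberg p n w = 0"
proof (rule truncation_from_basis[OF lin_heisenberg])
  fix \<mu> m
  have "\<forall>n\<ge>int (deg \<mu>) + 1. heisenberg p n (bv \<mu> m) = 0"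
  proof safe
    fix n assume n: "n \<ge> int (deg \<mu>) + 1"
    then obtain j where j: "n = int j + 1" by (cases n rule: int_cases3) auto
    have "j \<notin># \<mu>"
    proof
      assume "j \<in># \<mu>"
      then obtain \<nu> where "\<mu> = add_mset j \<nu>" by (meson multi_member_split)
      with n j show False by simp
    qed
    then show "heisenberg p n (bv \<mu> m) = 0"
      by (simp add: j not_in_iff)
  qed
  then show "\<exists>N. \<forall>n\<ge>N. heisenberg p n (bv \<mu> m) = 0" by blast
qed

text \<open>Read from right to left: for p > 0 the coefficient of \<open>y\<close> at a nonempty
  multiset is recovered from a coefficient of \<alpha>(j+1) y at a smaller one. This drives the
  first induction in \<open>schur\<close>.\<close>

lemma lookup_heisenberg_pos:
  "lookup (heisenberg p (int j + 1) y) (\<nu>, m) =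
     of_nat (2 * p * (j + 1) * (count \<nu> j + 1)) * lookup y (add_mset j \<nu>, m)"
proof -
  let ?L = "\<lambda>y. lookup (heisenberg p (int j + 1) y) (\<nu>, m)"
  have b: "?L (bv \<mu> l) = of_nat (2 * p * (j + 1) * (count \<nu> j + 1)) *
     lookup (bv \<mu> l) (add_mset j \<nu>, m)" for \<mu> l
  proof (cases "j \<in># \<mu>")
    case True
    then obtain \<mu>' where "\<mu> = add_mset j \<mu>'" by (meson multi_member_split)
    then show ?thesis by (auto simp: lookup_smul lookup_basis_vector)
  next
    case False
    then show ?thesis by (auto simp: lookup_smul lookup_basis_vector not_in_iff)
  qed
  have "?L (\<Sum>k\<in>K. smul (c k) (bv (fst k) (snd k))) = of_nat (2 * p * (j + 1) * (count \<nu> j + 1)) *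
     lookup (\<Sum>k\<in>K. smul (c k) (bv (fst k) (snd k))) (add_mset j \<nu>, m)" for K and c
    by (simp only: lin_sum[OF lin_heisenberg] lin_smul[OF lin_heisenberg] lookup_sum lookup_smul b
        sum_distrib_left mult.left_commute)
  from this[of "lookup y" "keys y"] show ?thesis
    by (simp only: fock_expand[symmetric])
qed

section \<open>Homogeneous vectors\<close>

text \<open>The degree is an integer so that it can drop below zero, which forces the vector to vanish.\<close>

definition homog :: "int \<Rightarrow> int \<Rightarrow> fock \<Rightarrow> bool" where
  "homog D m w \<longleftrightarrow> (\<forall>(\<mu>, l) \<in> keys w. l = m \<and> int (deg \<mu>) = D)"

lemma homog_basis: "homog (int (deg \<mu>)) m (bv \<mu> m)"
  by (simp add: homog_def)

lemma homog_zero [simp]: "homog D m 0"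
  by (simp add: homog_def)

lemma homog_add: "homog D m x \<Longrightarrow> homog D m y \<Longrightarrow> homog D m (x + y)"
  unfolding homog_def using Poly_Mapping.keys_add[of x y] by blast

lemma homog_smul: "homog D m x \<Longrightarrow> homog D m (smul c x)"
  unfolding homog_def using keys_smul[of c x] by blast

lemma homog_sum: "(\<And>x. x \<in> A \<Longrightarrow> homog D m (f x)) \<Longrightarrow> homog D m (sum f A)"
  by (induction A rule: infinite_finite_induct) (auto intro: homog_add)

lemma homog_Sum_any: "(\<And>i. homog D m (f i)) \<Longrightarrow> homog D m (Sum_any f)"
  unfolding Sum_any.expand_set by (rule homog_sum)

lemma homog_neg: "homog D m x \<Longrightarrow> D < 0 \<Longrightarrow> x = 0"
  unfolding homog_def by (metis (mono_tags, lifting) all_not_in_conv case_prodE keys_eq_empty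
      of_nat_less_0_iff)

lemma homog_lin:
  assumes "lin T" "homog D m w"
    and "\<And>\<mu>. int (deg \<mu>) = D \<Longrightarrow> homog D' m' (T (bv \<mu> m))"
  shows "homog D' m' (T w)"
proof -
  have "T w = (\<Sum>k\<in>keys w. smul (lookup w k) (T (bv (fst k) (snd k))))"
    using arg_cong[OF fock_expand[of w], of T] by (simp only: lin_sum[OF assms(1)] lin_smul[OF assms(1)])
  also have "homog D' m' \<dots>"
  proof (intro homog_sum homog_smul)
    fix k assume "k \<in> keys w"
    with assms(2) have "snd k = m" "int (deg (fst k)) = D" by (auto simp: homog_def)
    with assms(3) show "homog D' m' (T (bv (fst k) (snd k)))" by simp
  qed
  finally show ?thesis .
qed

lemma homog_heisenberg: "homog D m w \<Longrightarrow> homog (D - n) m (heisenberg p n w)"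
proof (erule homog_lin[OF lin_heisenberg])
  fix \<mu> assume D: "int (deg \<mu>) = D"
  show "homog (D - n) m (heisenberg p n (bv \<mu> m))"
  proof (cases n rule: int_cases3)
    case (pos j)
    show ?thesis
    proof (cases "j \<in># \<mu>")
      case True
      then obtain \<nu> where "\<mu> = add_mset j \<nu>" by (meson multi_member_split)
      with D pos show ?thesis by (auto simp: homog_def dest!: keys_smul[THEN subsetD])
    qed (simp add: pos not_in_iff)
  qed (use D in \<open>auto simp: homog_def dest!: keys_smul[THEN subsetD]\<close>)
qed

section \<open>Coefficients of operator exponentials\<close>

text \<open>The coefficient of z^k in the l-th power of X(z) = X 1 z + X 2 z^2 + ... . Splitting off
  the first factor replaces sums over lists by a recursion.\<close>

primrec comp_sum :: "(nat \<Rightarrow> fock \<Rightarrow> fock) \<Rightarrow> nat \<Rightarrow> nat \<Rightarrow> fock \<Rightarrow> fock" where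
  "comp_sum X 0 k w = (if k = 0 then w else 0)"
| "comp_sum X (Suc l) k w = (\<Sum>n\<in>{1..k}. X n (comp_sum X l (k - n) w))"

lemma comp_sum_lin:
  assumes X: "\<And>n. lin (X n)"
  shows "lin (comp_sum X l k)"
proof (induction l arbitrary: k)
  case 0
  have "comp_sum X 0 k = (if k = 0 then (\<lambda>w. w) else (\<lambda>w. 0))"
    by (rule ext) simp
  then show ?case by (simp add: lin_id lin_0)
next
  case (Suc l)
  have "lin (\<lambda>w. \<Sum>n\<in>{1..k}. X n (comp_sum X l (k - n) w))"
    by (rule lin_setsum, rule lin_comp[OF X Suc])
  moreover have "comp_sum X (Suc l) k = (\<lambda>w. \<Sum>n\<in>{1..k}. X n (comp_sum X l (k - n) w))"
    by (rule ext) simp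
  ultimately show ?case by simp
qed

definition comps :: "nat \<Rightarrow> nat \<Rightarrow> nat list set" where
  "comps l k = {ns. 0 \<notin> set ns \<and> sum_list ns = k \<and> length ns = l}"

lemma comps_Suc: "comps (Suc l) k = (\<Union>n\<in>{1..k}. (#) n ` comps l (k - n))"
proof (intro equalityI subsetI)
  fix ns assume "ns \<in> comps (Suc l) k"
  then show "ns \<in> (\<Union>n\<in>{1..k}. (#) n ` comps l (k - n))"
  proof (cases ns)
    case (Cons a list)
    with \<open>ns \<in> comps (Suc l) k\<close> have "a \<in> {1..k}" "list \<in> comps l (k - a)"
      by (auto simp: comps_def)
    with Cons show ?thesis by blast
  qed (use \<open>ns \<in> comps (Suc l) k\<close> in \<open>simp add: comps_def\<close>)
qed (auto simp: comps_def)

lemma comps_0: "comps 0 k = (if k = 0 then {[]} else {})"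
  by (auto simp: comps_def)

lemma finite_comps: "finite (comps l k)"
  by (induction l arbitrary: k) (auto simp: comps_0 comps_Suc)

lemma comp_sum_comps:
  assumes "\<And>n. lin (X n)"
  shows "comp_sum X l k w = (\<Sum>ns\<in>comps l k. foldr X ns w)"
proof (induction l arbitrary: k)
  case 0
  show ?case by (auto simp: comps_0)
next
  case (Suc l)
  have "(\<Sum>ns\<in>comps (Suc l) k. foldr X ns w) =
      (\<Sum>n\<in>{1..k}. \<Sum>ns\<in>(#) n ` comps l (k - n). foldr X ns w)"
    unfolding comps_Suc by (rule sum.UNION_disjoint) (auto simp: finite_comps)
  also have "\<dots> = (\<Sum>n\<in>{1..k}. X n (comp_sum X l (k - n) w))"
    by (intro sum.cong refl) (simp add: sum.reindex Suc lin_sum[OF assms])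
  finally show ?case by simp
qed

lemma length_le_sum_list: "0 \<notin> set ns \<Longrightarrow> length ns \<le> sum_list (ns :: nat list)"
  by (induction ns) (auto simp: Suc_le_eq intro: add_le_mono)

lemma exp_coeff_comp_sum:
  assumes "\<And>n. lin (X n)" "k < L"
  shows "exp_coeff X k w = (\<Sum>l<L. smul (1 / fact l) (comp_sum X l k w))"
proof -
  have "{ns. 0 \<notin> set ns \<and> sum_list ns = k} = (\<Union>l\<in>{..<L}. comps l k)"
    unfolding comps_def using assms(2) by (auto intro: le_less_trans[OF length_le_sum_list])
  then have "exp_coeff X k w =
      (\<Sum>l<L. \<Sum>ns\<in>comps l k. smul (1 / fact (length ns)) (foldr X ns w))"
    unfolding exp_coeff_def
    by (simp only:) (rule sum.UNION_disjoint, auto simp: finite_comps, auto simp: comps_def)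
  also have "\<dots> = (\<Sum>l<L. smul (1 / fact l) (comp_sum X l k w))"
    by (intro sum.cong refl)
      (simp add: comp_sum_comps[OF assms(1)] smul.scale_sum_right, simp add: comps_def)
  finally show ?thesis .
qed

lemma lin_exp_coeff: "(\<And>n. lin (X n)) \<Longrightarrow> lin (exp_coeff X k)"
proof -
  assume X: "\<And>n. lin (X n)"
  have "exp_coeff X k = (\<lambda>w. \<Sum>l<Suc k. smul (1 / fact l) (comp_sum X l k w))"
    by (rule ext) (rule exp_coeff_comp_sum[OF X], simp)
  moreover have "lin \<dots>" by (intro lin_setsum lin_scale comp_sum_lin X)
  ultimately show ?thesis by simp
qed

lemma exp_coeff_0: "(\<And>n. lin (X n)) \<Longrightarrow> exp_coeff X 0 w = w"
  by (subst exp_coeff_comp_sum[of X 0 1]) auto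

text \<open>Coefficients of z d/dz exp X(z) = (z X'(z)) exp X(z), valid because the
  \<open>X n\<close> commute. Together with the constant term this determines the exponential, and
  later computations use it in place of the sum over compositions.\<close>

lemma exp_coeff_rec:
  assumes X: "\<And>n. lin (X n)"
    and comm: "\<And>m n w. m \<ge> 1 \<Longrightarrow> n \<ge> 1 \<Longrightarrow> X m (X n w) = X n (X m w)"
  shows "smul (of_nat c) (exp_coeff X c w) = (\<Sum>n\<in>{1..c}. smul (of_nat n) (X n (exp_coeff X (c - n) w)))"
proof -
  have comm': "X m (comp_sum X l c w) = comp_sum X l c (X m w)" if "m \<ge> 1" for m l c w
  proof (induction l arbitrary: c)
    case (Suc l)
    then show ?case using that by (simp add: lin_sum[OF X] comm)
  qed (simp add: lin_zero[OF X])
  \<comment> \<open>The same for powers: z d/dz X(z)^(l+1) = (l+1) (z X'(z)) X(z)^l, by induction on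
    l with the product rule.\<close>
  have cs: "smul (of_nat c) (comp_sum X (Suc l) c w) =
      smul (of_nat (Suc l)) (\<Sum>n\<in>{1..c}. smul (of_nat n) (X n (comp_sum X l (c - n) w)))" for l c w
  proof (induction l arbitrary: c)
    case 0
    have "(\<Sum>n = 1..c. smul (of_nat c) (X n (comp_sum X 0 (c - n) w))) =
        (\<Sum>n = 1..c. smul (of_nat n) (X n (comp_sum X 0 (c - n) w)))"
      by (intro sum.cong refl) (auto simp: lin_zero[OF X])
    then show ?case
      by (simp add: smul.scale_sum_right del: comp_sum.simps(1))
  next
    case (Suc l)
    have "smul (of_nat c) (comp_sum X (Suc (Suc l)) c w) =
        (\<Sum>n\<in>{1..c}. smul (of_nat n) (X n (comp_sum X (Suc l) (c - n) w)) +
           X n (smul (of_nat (c - n)) (comp_sum X (Suc l) (c - n) w)))"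
      unfolding comp_sum.simps(2)[of X "Suc l"] smul.scale_sum_right
      by (intro sum.cong refl)
        (simp add: lin_smul[OF X] smul.scale_left_distrib[symmetric] of_nat_diff del: comp_sum.simps)
    also have "\<dots> = (\<Sum>n\<in>{1..c}. smul (of_nat n) (X n (comp_sum X (Suc l) (c - n) w))) +
        smul (of_nat (Suc l)) (\<Sum>n\<in>{1..c}. \<Sum>m\<in>{1..c-n}. smul (of_nat m) (X n (X m (comp_sum X l (c - n - m) w))))"
      unfolding sum.distrib Suc by (simp only: lin_smul[OF X] lin_sum[OF X] smul.scale_sum_right)
    also have "(\<Sum>n\<in>{1..c}. \<Sum>m\<in>{1..c-n}. smul (of_nat m) (X n (X m (comp_sum X l (c - n - m) w)))) =
        (\<Sum>(n,m)\<in>Sigma {1..c} (\<lambda>n. {1..c-n}). smul (of_nat m) (X n (X m (comp_sum X l (c - n - m) w))))"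
      by (rule sum.Sigma) auto
    also have "\<dots> = (\<Sum>(m,n)\<in>Sigma {1..c} (\<lambda>m. {1..c-m}). smul (of_nat m) (X m (X n (comp_sum X l (c - m - n) w))))"
      by (rule sum.reindex_bij_witness[of _ prod.swap prod.swap])
        (auto simp: comm add.commute)
    also have "\<dots> = (\<Sum>m\<in>{1..c}. \<Sum>n\<in>{1..c-m}. smul (of_nat m) (X m (X n (comp_sum X l (c - m - n) w))))"
      by (rule sum.Sigma[symmetric]) auto
    also have "\<dots> = (\<Sum>m\<in>{1..c}. smul (of_nat m) (X m (comp_sum X (Suc l) (c - m) w)))"
      by (simp add: lin_sum[OF X] smul.scale_sum_right)
    finally have e: "smul (of_nat c) (comp_sum X (Suc (Suc l)) c w) =
        (\<Sum>n\<in>{1..c}. smul (of_nat n) (X n (comp_sum X (Suc l) (c - n) w))) +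
        smul (of_nat (Suc l)) (\<Sum>n\<in>{1..c}. smul (of_nat n) (X n (comp_sum X (Suc l) (c - n) w)))" .
    have "B + smul (of_nat (Suc l)) B = smul (of_nat (Suc (Suc l))) B" for B :: fock
      unfolding of_nat_Suc[of "Suc l"] smul.scale_left_distrib smul.scale_one by simp
    with e show ?case by simp
  qed
  let ?L = "Suc c"
  have "smul (of_nat c) (exp_coeff X c w) =
      (\<Sum>l<Suc ?L. smul (1 / fact l) (smul (of_nat c) (comp_sum X l c w)))"
    by (subst exp_coeff_comp_sum[OF X, of c "Suc ?L"]) (simp_all add: smul.scale_sum_right mult.commute del: sum.lessThan_Suc)
  also have "\<dots> = (\<Sum>l<?L. smul (1 / fact (Suc l)) (smul (of_nat c) (comp_sum X (Suc l) c w)))"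
    by (subst sum.lessThan_Suc_shift) simp
  also have "\<dots> = (\<Sum>l<?L. \<Sum>n\<in>{1..c}. smul (of_nat n) (X n (smul (1 / fact l) (comp_sum X l (c - n) w))))"
  proof (intro sum.cong refl, goal_cases)
    case (1 l)
    have f: "1 / fact (Suc l) * of_nat (Suc l) = (1 / fact l :: complex)"
      by (simp add: field_simps del: of_nat_Suc)
    show ?case
      unfolding cs smul.scale_scale f
      by (simp add: smul.scale_sum_right lin_smul[OF X] mult.commute)
  qed
  also have "\<dots> = (\<Sum>n\<in>{1..c}. \<Sum>l<?L. smul (of_nat n) (X n (smul (1 / fact l) (comp_sum X l (c - n) w))))"
    by (rule sum.swap)
  also have "\<dots> = (\<Sum>n\<in>{1..c}. smul (of_nat n) (X n (exp_coeff X (c - n) w)))"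
  proof (intro sum.cong refl, goal_cases)
    case (1 n)
    show ?case
      by (subst exp_coeff_comp_sum[OF X, of "c - n" ?L])
        (simp_all add: smul.scale_sum_right lin_sum[OF X] del: sum.lessThan_Suc)
  qed
  finally show ?thesis .
qed

text \<open>If [T, X(z)] = a z^k is scalar, then [T, exp X(z)] = a z^k exp X(z). Both sides satisfy
  the recursion of \<open>exp_coeff_rec\<close>, so the coefficients are compared by
  induction.\<close>

lemma exp_coeff_commute:
  assumes X: "\<And>n. lin (X n)" and T: "lin T"
    and XX: "\<And>m n w. m \<ge> 1 \<Longrightarrow> n \<ge> 1 \<Longrightarrow> X m (X n w) = X n (X m w)"
    and comm: "\<And>n w. n \<ge> 1 \<Longrightarrow> T (X n w) = X n (T w) + (if n = k then smul a w else 0)"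
    and k: "k \<ge> 1"
  shows "T (exp_coeff X c w) = exp_coeff X c (T w) +
    (if k \<le> c then smul a (exp_coeff X (c - k) w) else 0)"
proof (induction c rule: less_induct)
  case (less c)
  have rec: "smul (of_nat c) (exp_coeff X c w) = (\<Sum>n\<in>{1..c}. smul (of_nat n) (X n (exp_coeff X (c - n) w)))" for c w
    by (rule exp_coeff_rec) (rule X XX; assumption)+
  show ?case
  proof (cases "c = 0")
    case False
    have "smul (of_nat c) (T (exp_coeff X c w)) = (\<Sum>n\<in>{1..c}. smul (of_nat n) (T (X n (exp_coeff X (c - n) w))))"
      unfolding lin_smul[OF T, symmetric] lin_sum[OF T, symmetric] rec ..
    also have "\<dots> = (\<Sum>n\<in>{1..c}. smul (of_nat n) (X n (exp_coeff X (c - n) (T w))) +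
        (if n \<le> c - k then smul a (smul (of_nat n) (X n (exp_coeff X (c - k - n) w))) else 0) +
        (if n = k then smul a (smul (of_nat k) (exp_coeff X (c - k) w)) else 0))"
    proof (intro sum.cong refl, goal_cases)
      case n: (1 n)
      then have "k \<le> c - n \<longleftrightarrow> n \<le> c - k" using k by auto
      moreover have "c - n - k = c - k - n" by simp
      ultimately show ?case
        using n less[of "c - n"]
        by (auto simp: comm lin_add[OF X] lin_smul[OF X] lin_zero[OF X] smul.scale_right_distrib mult.commute)
    qed
    also have "\<dots> = smul (of_nat c) (exp_coeff X c (T w)) +
        (\<Sum>n\<in>{1..c}. if n \<le> c - k then smul a (smul (of_nat n) (X n (exp_coeff X (c - k - n) w))) else 0) +
        (if k \<le> c then smul a (smul (of_nat k) (exp_coeff X (c - k) w)) else 0)"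
      unfolding sum.distrib rec[of c "T w", symmetric] using k by (simp add: sum.delta)
    also have "(\<Sum>n\<in>{1..c}. if n \<le> c - k then smul a (smul (of_nat n) (X n (exp_coeff X (c - k - n) w))) else 0) =
        smul a (smul (of_nat (c - k)) (exp_coeff X (c - k) w))"
      unfolding rec[of "c - k" w] smul.scale_sum_right by (rule sum.mono_neutral_cong_right) auto
    finally have "smul (of_nat c) (T (exp_coeff X c w)) = smul (of_nat c) (exp_coeff X c (T w) +
        (if k \<le> c then smul a (exp_coeff X (c - k) w) else 0))"
      by (cases "k \<le> c") (simp_all add: smul.scale_right_distrib smul.scale_left_distrib[symmetric] of_nat_diff
          mult.commute algebra_simps del: smul.scale_scale, simp_all add: smul.scale_left_distrib smul.scale_left_diff_distrib algebra_simps)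
    then show ?thesis unfolding smul.scale_cancel_left using False by simp
  qed (use k in \<open>simp add: exp_coeff_0 X\<close>)
qed

lemma exp_coeff_commute0:
  assumes X: "\<And>n. lin (X n)" and T: "lin T"
    and XX: "\<And>m n w. m \<ge> 1 \<Longrightarrow> n \<ge> 1 \<Longrightarrow> X m (X n w) = X n (X m w)"
    and comm: "\<And>n w. n \<ge> 1 \<Longrightarrow> T (X n w) = X n (T w)"
  shows "T (exp_coeff X c w) = exp_coeff X c (T w)"
  using exp_coeff_commute[OF X T XX, where a = 0 and k = 1] comm by simp

section \<open>The fields of lattice elements\<close>

locale heisenberg_level =
  fixes p :: nat
  assumes p_pos: "p > 0"
begin

abbreviation h :: "int \<Rightarrow> fock \<Rightarrow> fock" where "h \<equiv> heisenberg p"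

text \<open>The coefficients of the exponentials are indexed by integers and vanish at negative
  indices, so that the index shifts in commutators need no case distinction.\<close>

definition cre :: "int \<Rightarrow> int \<Rightarrow> fock \<Rightarrow> fock" where
  "cre a z w = (if z < 0 then 0 else exp_creation p a (nat z) w)"

definition ann :: "int \<Rightarrow> int \<Rightarrow> fock \<Rightarrow> fock" where
  "ann a z w = (if z < 0 then 0 else exp_annihilation p a (nat z) w)"

lemma lin_heis_scale: "lin (\<lambda>w. smul c (h n w))"
  by (intro lin_scale lin_heisenberg)

lemma lin_exp_creation: "lin (exp_creation p a n)"
  unfolding exp_creation_def by (rule lin_exp_coeff, rule lin_heis_scale)

lemma lin_exp_annihilation: "lin (exp_annihilation p a n)"
  unfolding exp_annihilation_def by (rule lin_exp_coeff, rule lin_heis_scale)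

lemma lin_cre: "lin (cre a z)"
proof -
  have "cre a z = (if z < 0 then (\<lambda>w. 0) else exp_creation p a (nat z))"
    by (rule ext) (simp add: cre_def)
  then show ?thesis by (simp add: lin_0 lin_exp_creation)
qed

lemma lin_ann: "lin (ann a z)"
proof -
  have "ann a z = (if z < 0 then (\<lambda>w. 0) else exp_annihilation p a (nat z))"
    by (rule ext) (simp add: ann_def)
  then show ?thesis by (simp add: lin_0 lin_exp_annihilation)
qed

lemma cre_0 [simp]: "cre a 0 w = w" and ann_0 [simp]: "ann a 0 w = w"
  unfolding cre_def ann_def exp_creation_def exp_annihilation_def
  by (simp_all only: exp_coeff_0[OF lin_heis_scale] if_False less_irrefl nat_0 if_cancel)

lemma lin_shift: "lin (lattice_shift a)"
  unfolding lattice_shift_def by (rule lin_linear_extension)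

lemma shift_basis [simp]: "lattice_shift a (bv \<mu> l) = bv \<mu> (a + l)"
  by (simp add: lattice_shift_def)

lemma heis_scale_commute:
  "k + l \<noteq> 0 \<Longrightarrow> smul x (h k (smul y (h l w))) = smul y (h l (smul x (h k w)))"
  using heisenberg_commute[of p k l w] by (simp add: mult.commute)

text \<open>The scalar is \<open>a\<close> because [\<alpha>(k), \<beta>(-k)/k] = a for \<beta> = a
  \<alpha>/(2p): the factor 2pk of the Heisenberg relation cancels the denominators.\<close>

lemma cre_heis:
  "h k (cre a z w) = cre a z (h k w) + (if k \<ge> 1 then smul (of_int a) (cre a (z - k) w) else 0)"
proof (cases "z < 0")
  case False
  define c where "c = nat z"
  have z: "z = int c" using False by (simp add: c_def)
  show ?thesis
  proof (cases "k \<ge> 1")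
    case True
    define k' where "k' = nat k"
    have k: "k = int k'" "k' \<ge> 1" using True by (auto simp: k'_def)
    have "h (int k') (exp_creation p a c w) = exp_creation p a c (h (int k') w) +
      (if k' \<le> c then smul (of_int a) (exp_creation p a (c - k') w) else 0)"
      unfolding exp_creation_def
    proof (rule exp_coeff_commute[OF lin_heis_scale lin_heisenberg heis_scale_commute _ k(2)])
      fix n :: nat and w assume n: "n \<ge> 1"
      have "smul (of_int a / of_nat (2 * p * n)) (h (int k') (h (- int n) w)) =
         smul (of_int a / of_nat (2 * p * n)) (h (- int n) (h (int k') w)) +
         (if int k' + - int n = 0 then smul (of_int a / of_nat (2 * p * n)) (smul (of_int (2 * int p * int k')) w) else 0)"
        unfolding heisenberg_commute[of p "int k'"] by (simp add: smul.scale_right_distrib)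
      also have "(if int k' + - int n = 0 then smul (of_int a / of_nat (2 * p * n)) (smul (of_int (2 * int p * int k')) w) else 0)
        = (if n = k' then smul (of_int a) w else 0)"
        using n p_pos by auto
      finally show "h (int k') (smul (of_int a / of_nat (2 * p * n)) (h (- int n) w)) =
         smul (of_int a / of_nat (2 * p * n)) (h (- int n) (h (int k') w)) + (if n = k' then smul (of_int a) w else 0)"
        unfolding heisenberg_lin_simps .
    qed simp
    then show ?thesis using k(2) by (auto simp: cre_def z k nat_diff_distrib' simp flip: of_nat_diff)
  next
    case k: False
    have "h k (exp_creation p a c w) = exp_creation p a c (h k w)"
      unfolding exp_creation_def
      by (rule exp_coeff_commute0[OF lin_heis_scale lin_heisenberg heis_scale_commute])
        (use k in \<open>auto simp: heisenberg_commute[of p k]\<close>)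
    then show ?thesis using k by (simp add: cre_def z)
  qed
qed (auto simp: cre_def)

lemma ann_heis:
  "h k (ann a z w) = ann a z (h k w) + (if k \<le> - 1 then smul (of_int a) (ann a (z + k) w) else 0)"
proof (cases "z < 0")
  case False
  define c where "c = nat z"
  have z: "z = int c" using False by (simp add: c_def)
  show ?thesis
  proof (cases "k \<le> - 1")
    case True
    define k' where "k' = nat (- k)"
    have k: "k = - int k'" "k' \<ge> 1" using True by (auto simp: k'_def)
    have "h (- int k') (exp_annihilation p a c w) = exp_annihilation p a c (h (- int k') w) +
      (if k' \<le> c then smul (of_int a) (exp_annihilation p a (c - k') w) else 0)"
      unfolding exp_annihilation_def
    proof (rule exp_coeff_commute[OF lin_heis_scale lin_heisenberg heis_scale_commute _ k(2)])
      fix n :: nat and w assume n: "n \<ge> 1"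
      have "smul (- of_int a / of_nat (2 * p * n)) (h (- int k') (h (int n) w)) =
         smul (- of_int a / of_nat (2 * p * n)) (h (int n) (h (- int k') w)) +
         (if - int k' + int n = 0 then smul (- of_int a / of_nat (2 * p * n)) (smul (of_int (2 * int p * - int k')) w) else 0)"
        unfolding heisenberg_commute[of p "- int k'"] by (simp add: smul.scale_right_distrib)
      also have "(if - int k' + int n = 0 then smul (- of_int a / of_nat (2 * p * n)) (smul (of_int (2 * int p * - int k')) w) else 0)
        = (if n = k' then smul (of_int a) w else 0)"
        using n p_pos by auto
      finally show "h (- int k') (smul (- of_int a / of_nat (2 * p * n)) (h (int n) w)) =
         smul (- of_int a / of_nat (2 * p * n)) (h (int n) (h (- int k') w)) + (if n = k' then smul (of_int a) w else 0)"
        unfolding heisenberg_lin_simps .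
    qed simp
    then show ?thesis using k(2) by (auto simp: ann_def z k nat_diff_distrib' simp flip: of_nat_diff)
  next
    case k: False
    have "h k (exp_annihilation p a c w) = exp_annihilation p a c (h k w)"
      unfolding exp_annihilation_def
      by (rule exp_coeff_commute0[OF lin_heis_scale lin_heisenberg heis_scale_commute])
        (use k in \<open>auto simp: heisenberg_commute[of p k]\<close>)
    then show ?thesis using k by (simp add: ann_def z)
  qed
qed (auto simp: ann_def)

lemma homog_comp_sum:
  assumes "\<And>n D w. homog D m w \<Longrightarrow> homog (D + s * int n) m (X n w)" "homog D m w"
  shows "homog (D + s * int k) m (comp_sum X l k w)"
proof (induction l arbitrary: k)
  case (Suc l)
  have "homog (D + s * int k) m (X n (comp_sum X l (k - n) w))" if "n \<in> {1..k}" for n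
    using assms(1)[OF Suc[of "k - n"], of n] that by (simp add: of_nat_diff algebra_simps)
  then show ?case unfolding comp_sum.simps by (rule homog_sum)
qed (use assms in simp)

lemma homog_exp_coeff:
  assumes "\<And>n. lin (X n)" "\<And>n D w. homog D m w \<Longrightarrow> homog (D + s * int n) m (X n w)" "homog D m w"
  shows "homog (D + s * int k) m (exp_coeff X k w)"
  unfolding exp_coeff_comp_sum[OF assms(1) lessI]
  by (intro homog_sum homog_smul homog_comp_sum assms)

lemma homog_cre: assumes "homog D m w" shows "homog (D + z) m (cre a z w)"
proof -
  have "homog (D + 1 * int (nat z)) m (exp_creation p a (nat z) w)"
    unfolding exp_creation_def
    by (rule homog_exp_coeff[OF lin_heis_scale _ assms], rule homog_smul)
      (use homog_heisenberg[of _ m _ "- int n" p for n] in simp)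
  then show ?thesis by (cases "z < 0") (simp_all add: cre_def)
qed

lemma homog_ann: assumes "homog D m w" shows "homog (D - z) m (ann a z w)"
proof -
  have "homog (D + (-1) * int (nat z)) m (exp_annihilation p a (nat z) w)"
    unfolding exp_annihilation_def
    by (rule homog_exp_coeff[OF lin_heis_scale _ assms], rule homog_smul)
      (use homog_heisenberg[of _ m _ "int n" p for n] in simp)
  then show ?thesis by (cases "z < 0") (simp_all add: ann_def)
qed

lemma ann_eq_0: "homog D m w \<Longrightarrow> z > D \<Longrightarrow> ann a z w = 0"
  using homog_ann[of D m w z a] homog_neg by force

text \<open>Integral modes suffice. On momentum l the powers of x that occur are al/(2p) plus
  integers, so these modes vanish unless 2p divides al.\<close>

definition lf :: "int \<Rightarrow> int \<Rightarrow> fock \<Rightarrow> fock" where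
  "lf a n = lattice_field p a (of_int n)"

lemma lin_lf: "lin (lf a n)"
  by (simp add: lf_def lattice_field_def lin_linear_extension)

lemma exponent_iff:
  assumes "int (2 * p) dvd a * l"
  shows "(of_nat c - of_nat d + of_int (a * l) / of_nat (2 * p) = - of_int n - (1::rat)) \<longleftrightarrow>
    int c = int d - a * l div int (2 * p) - n - 1"
proof -
  from assms obtain e where e: "a * l = int (2 * p) * e" by (auto elim: dvdE)
  have "of_int (a * l) / of_nat (2 * p) = (of_int e :: rat)"
    using p_pos by (simp add: e)
  then have "(of_nat c - of_nat d + of_int (a * l) / of_nat (2 * p) = - of_int n - (1::rat)) \<longleftrightarrow>
     of_int (int c - int d + e) = (of_int (- n - 1) :: rat)"
    by simp
  also have "\<dots> \<longleftrightarrow> int c - int d + e = - n - 1" by (rule of_int_eq_iff)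
  also have "\<dots> \<longleftrightarrow> int c = int d - a * l div int (2 * p) - n - 1"
    using p_pos by (auto simp: e)
  finally show ?thesis .
qed

lemma lf_basis_ndvd:
  assumes "\<not> int (2 * p) dvd a * l"
  shows "lf a n (bv \<mu> l) = 0"
proof -
  have "of_nat c - of_nat d + of_int (a * l) / of_nat (2 * p) \<noteq> - of_int n - (1::rat)" for c d
  proof
    assume "of_nat c - of_nat d + of_int (a * l) / of_nat (2 * p) = - of_int n - (1::rat)"
    then have "of_int (a * l) = of_int (int (2 * p) * (- n - 1 - int c + int d)) * (1::rat)"
      using p_pos by (simp add: field_simps)
    then have "a * l = int (2 * p) * (- n - 1 - int c + int d)"
      by (simp only: mult_1_right of_int_eq_iff)
    with assms show False by (metis dvd_triv_left)
  qed
  then show ?thesis by (simp add: lf_def lattice_field_def)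
qed

text \<open>The prescribed power of x determines the creation index from the annihilation index d,
  and d is bounded by the degree of \<mu>; so the double sum collapses to a finite one. Values of d
  with a negative creation index are absorbed by \<open>cre\<close>.\<close>

lemma lf_basis:
  assumes dvd: "int (2 * p) dvd a * l" and N: "deg \<mu> < N"
  shows "lf a n (bv \<mu> l) =
    (\<Sum>d<N. cre a (int d - a * l div int (2 * p) - n - 1) (ann a (int d) (bv \<mu> (a + l))))"
proof -
  let ?e = "a * l div int (2 * p)"
  let ?f = "\<lambda>(c, d). if int c = int d - ?e - n - 1
     then exp_creation p a c (exp_annihilation p a d (bv \<mu> (a + l))) else 0"
  let ?g = "\<lambda>d. (nat (int d - ?e - n - 1), d)"
  let ?S = "{d. d < N \<and> int d - ?e - n - 1 \<ge> 0}"
  have z: "exp_annihilation p a d (bv \<mu> (a + l)) = 0" if "d \<ge> N" for d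
    using ann_eq_0[OF homog_basis, of \<mu> "int d" a "a + l"] that N by (simp add: ann_def)
  have "lf a n (bv \<mu> l) = Sum_any ?f"
    by (simp only: lf_def lattice_field_def linear_extension_basis shift_basis exponent_iff[OF dvd])
  also have "\<dots> = sum ?f (?g ` ?S)"
  proof (rule Sum_any.expand_superset)
    show "{x. ?f x \<noteq> 0} \<subseteq> ?g ` ?S"
    proof clarify
      fix c d assume "(if int c = int d - ?e - n - 1
        then exp_creation p a c (exp_annihilation p a d (bv \<mu> (a + l))) else 0) \<noteq> 0"
      then have *: "int c = int d - ?e - n - 1"
        "exp_creation p a c (exp_annihilation p a d (bv \<mu> (a + l))) \<noteq> 0"
        by (auto split: if_splits)
      then have "d < N" using z lin_zero[OF lin_exp_creation] by (metis not_less)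
      moreover have "c = nat (int d - ?e - n - 1)" "int d - ?e - n - 1 \<ge> 0" using * by linarith+
      ultimately show "(c, d) \<in> ?g ` ?S" by (auto intro!: image_eqI[of _ _ d])
    qed
  qed simp
  also have "\<dots> = (\<Sum>d\<in>?S. ?f (?g d))"
    by (subst sum.reindex) (auto simp: inj_on_def)
  also have "\<dots> = (\<Sum>d\<in>?S. cre a (int d - ?e - n - 1) (ann a (int d) (bv \<mu> (a + l))))"
    by (intro sum.cong) (auto simp: cre_def ann_def)
  also have "\<dots> = (\<Sum>d<N. cre a (int d - ?e - n - 1) (ann a (int d) (bv \<mu> (a + l))))"
    by (intro sum.mono_neutral_left) (auto simp: cre_def)
  finally show ?thesis .
qed

lemma lf_ndvd:
  assumes "homog D l w" "\<not> int (2 * p) dvd a * l"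
  shows "lf a n w = 0"
proof -
  have "lf a n w = (\<lambda>w. 0) w"
    by (rule lin_ext_on[OF lin_lf lin_0]) (use assms lf_basis_ndvd in \<open>auto simp: homog_def\<close>)
  then show ?thesis by simp
qed

lemma lf_homog_eq:
  assumes dvd: "int (2 * p) dvd a * l" and w: "homog D l w" and N: "D < int N"
  shows "lf a n w =
    (\<Sum>d<N. cre a (int d - a * l div int (2 * p) - n - 1) (ann a (int d) (lattice_shift a w)))"
proof (rule lin_ext_on[OF lin_lf])
  show "lin (\<lambda>w. \<Sum>d<N. cre a (int d - a * l div int (2 * p) - n - 1) (ann a (int d) (lattice_shift a w)))"
    by (intro lin_setsum lin_comp[OF lin_cre] lin_comp[OF lin_ann] lin_shift)
next
  fix \<mu> m assume "(\<mu>, m) \<in> keys w"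
  with w N have "m = l" "deg \<mu> < N" by (auto simp: homog_def)
  then show "lf a n (bv \<mu> m) = (\<Sum>d<N. cre a (int d - a * l div int (2 * p) - n - 1)
      (ann a (int d) (lattice_shift a (bv \<mu> m))))"
    using lf_basis[OF dvd] by simp
qed

lemma homog_shift: "homog D l w \<Longrightarrow> homog D (a + l) (lattice_shift a w)"
  by (rule homog_lin[OF lin_shift]) (auto simp: homog_def)

lemma homog_lf:
  assumes w: "homog D l w"
  shows "homog (D - n - 1 - a * l div int (2 * p)) (a + l) (lf a n w)"
proof (cases "int (2 * p) dvd a * l")
  case True
  have "homog (D - n - 1 - a * l div int (2 * p)) (a + l)
     (cre a (int d - a * l div int (2 * p) - n - 1) (ann a (int d) (lattice_shift a w)))" for d
  proof -
    have "homog (D - int d + (int d - a * l div int (2 * p) - n - 1)) (a + l)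
       (cre a (int d - a * l div int (2 * p) - n - 1) (ann a (int d) (lattice_shift a w)))"
      by (rule homog_cre[OF homog_ann[OF homog_shift[OF w]]])
    then show ?thesis by (simp add: algebra_simps)
  qed
  then show ?thesis
    by (subst lf_homog_eq[OF True w, of "nat D + 1"]) (simp, rule homog_sum)
qed (use lf_ndvd[OF w] in simp)

lemma shift_heis: "k \<noteq> 0 \<Longrightarrow> lattice_shift a (h k w) = h k (lattice_shift a w)"
proof (rule lin_ext[OF lin_comp[OF lin_shift lin_heisenberg] lin_comp[OF lin_heisenberg lin_shift]])
  fix \<mu> m assume "k \<noteq> 0"
  then show "lattice_shift a (h k (bv \<mu> m)) = h k (lattice_shift a (bv \<mu> m))"
    by (cases k rule: int_cases3) (auto simp: lin_smul[OF lin_shift])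
qed

lemma heis0_homog: "homog D m w \<Longrightarrow> h 0 w = smul (of_int m) w"
  by (rule lin_ext_on[OF lin_heisenberg lin_scale[OF lin_id]]) (auto simp: homog_def)

text \<open>In generating functions, [\<alpha>(k), Y(e^\<beta>, x)] = a x^k Y(e^\<beta>, x). A
  positive k meets only the creation exponential, a negative k only the annihilation exponential,
  and k = 0 measures the change of momentum.\<close>

lemma lf_heis_homog:
  assumes w: "homog D l w"
  shows "h k (lf a n w) = lf a n (h k w) + smul (of_int a) (lf a (n + k) w)"
proof (cases "int (2 * p) dvd a * l")
  case False
  then show ?thesis
    using lf_ndvd[OF w] lf_ndvd[OF homog_heisenberg[OF w]] by simp
next
  case dvd: True
  let ?e = "a * l div int (2 * p)"
  have D0: "lf a n (h k w) = (\<Sum>d<N. cre a (int d - ?e - n - 1) (ann a (int d) (lattice_shift a (h k w))))"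
    if "D - k < int N" for N
    by (rule lf_homog_eq[OF dvd homog_heisenberg[OF w] that])
  consider "k = 0" | "k \<ge> 1" | "k \<le> -1" by linarith
  then show ?thesis
  proof cases
    case 1
    have "h 0 (lf a n w) = smul (of_int (a + l)) (lf a n w)"
      by (rule heis0_homog[OF homog_lf[OF w]])
    then show ?thesis using heis0_homog[OF w]
      by (simp add: 1 lin_smul[OF lin_lf] smul.scale_left_distrib)
  next
    case 2
    define N where "N = nat D + 1"
    have N: "D < int N" "D - k < int N" using 2 by (auto simp: N_def)
    have "h k (lf a n w) = (\<Sum>d<N. h k (cre a (int d - ?e - n - 1) (ann a (int d) (lattice_shift a w))))"
      by (simp add: lf_homog_eq[OF dvd w N(1)] lin_sum[OF lin_heisenberg])
    also have "\<dots> = (\<Sum>d<N. cre a (int d - ?e - n - 1) (ann a (int d) (lattice_shift a (h k w)))) +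
      smul (of_int a) (\<Sum>d<N. cre a (int d - ?e - (n + k) - 1) (ann a (int d) (lattice_shift a w)))"
      using 2 by (simp add: cre_heis ann_heis shift_heis sum.distrib smul.scale_sum_right algebra_simps)
    finally show ?thesis by (simp add: D0[OF N(2)] lf_homog_eq[OF dvd w N(1)])
  next
    case 3
    define k' where "k' = nat (- k)"
    have k': "k = - int k'" using 3 by (simp add: k'_def)
    \<comment> \<open>The vector \<open>h k w\<close> has degree \<open>D + k'\<close>, so the
      common cutoff is \<open>N + k'\<close>. In the commutator term the first \<open>k'\<close>
      summands have a negative annihilation index and vanish.\<close>
    define N where "N = nat D + 1"
    have N: "D < int N" "D - k < int (N + k')" using 3 k' by (auto simp: N_def)
    have N2: "D < int (N + k')" using N by simp
    have "h k (lf a n w) = (\<Sum>d<N+k'. h k (cre a (int d - ?e - n - 1) (ann a (int d) (lattice_shift a w))))"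
      by (simp add: lf_homog_eq[OF dvd w N2] lin_sum[OF lin_heisenberg])
    also have "\<dots> = (\<Sum>d<N+k'. cre a (int d - ?e - n - 1) (ann a (int d) (lattice_shift a (h k w)))) +
      smul (of_int a) (\<Sum>d<N+k'. cre a (int d - ?e - n - 1) (ann a (int d + k) (lattice_shift a w)))"
      using 3 by (simp add: cre_heis ann_heis shift_heis sum.distrib smul.scale_sum_right
          lin_add[OF lin_cre] lin_smul[OF lin_cre])
    also have "(\<Sum>d<N+k'. cre a (int d - ?e - n - 1) (ann a (int d + k) (lattice_shift a w))) =
       (\<Sum>d\<in>{k'..<N+k'}. cre a (int d - ?e - n - 1) (ann a (int d + k) (lattice_shift a w)))"
      by (intro sum.mono_neutral_right) (auto simp: k' ann_def lin_zero[OF lin_cre])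
    also have "\<dots> = (\<Sum>d<N. cre a (int d - ?e - (n + k) - 1) (ann a (int d) (lattice_shift a w)))"
      by (rule sum.reindex_bij_witness[of _ "\<lambda>d. d + k'" "\<lambda>d. d - k'"])
        (auto simp: k' of_nat_diff algebra_simps)
    finally show ?thesis by (simp add: D0[OF N(2)] lf_homog_eq[OF dvd w N(1)])
  qed
qed

lemma lf_heis: "h k (lf a n w) = lf a n (h k w) + smul (of_int a) (lf a (n + k) w)"
  by (rule lin_ext[OF lin_comp[OF lin_heisenberg lin_lf] lin_plus[OF lin_comp[OF lin_lf lin_heisenberg] lin_scale[OF lin_lf]]])
    (rule lf_heis_homog[OF homog_basis])

lemma lf_truncation_homog: "homog D l w \<Longrightarrow> n \<ge> D - a * l div int (2 * p) \<Longrightarrow> lf a n w = 0"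
  using homog_neg[OF homog_lf] by force

end

section \<open>Vertex operators and their commutators with the Heisenberg algebra\<close>

definition fld :: "(int \<Rightarrow> fock \<Rightarrow> fock) \<Rightarrow> bool" where
  "fld B \<longleftrightarrow> (\<forall>n. lin (B n)) \<and> (\<forall>w. \<exists>N. \<forall>n\<ge>N. B n w = 0)"

lemma fld_lin: "fld B \<Longrightarrow> lin (B n)"
  and fld_trunc: "fld B \<Longrightarrow> \<exists>N. \<forall>n\<ge>N. B n w = 0"
  by (auto simp: fld_def)

lemma fldI: "(\<And>n. lin (B n)) \<Longrightarrow> (\<And>\<mu> m. \<exists>N. \<forall>n\<ge>N. B n (bv \<mu> m) = 0) \<Longrightarrow> fld B"
  by (simp add: fld_def truncation_from_basis)

lemma ez_field_up: "fld B \<Longrightarrow> ez (\<lambda>i. B (n + int i) w)"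
proof -
  assume "fld B"
  then obtain N where "\<forall>n\<ge>N. B n w = 0" using fld_trunc by blast
  then show ?thesis by (intro ezI[of "nat (N - n)"]) (simp add: nat_le_iff)
qed

lemma ez_heisenberg: "ez (\<lambda>i. heisenberg p (int i) w)"
proof -
  obtain N where "\<forall>n\<ge>N. heisenberg p n w = 0" using heisenberg_truncation by blast
  then show ?thesis by (intro ezI[of "nat N"]) (simp add: nat_le_iff)
qed

lemma Sum_any_eventually:
  fixes f :: "nat \<Rightarrow> 'a::comm_monoid_add"
  assumes "ez f" shows "\<forall>\<^sub>F I in sequentially. Sum_any f = (\<Sum>i<I. f i)"
proof -
  obtain N where N: "\<And>i. i \<ge> N \<Longrightarrow> f i = 0" using assms by (auto simp: ez_def)
  have "Sum_any f = (\<Sum>i<I. f i)" if "I \<ge> N" for I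
    using N that by (intro Sum_any_lessThan) auto
  then show ?thesis by (auto simp: eventually_sequentially)
qed

context heisenberg_level
begin

lemma fld_lf: "fld (lf a)"
proof (rule fldI[OF lin_lf])
  fix \<mu> m
  show "\<exists>N. \<forall>n\<ge>N. lf a n (bv \<mu> m) = 0"
    using lf_truncation_homog[OF homog_basis] by blast
qed

definition nord :: "nat \<Rightarrow> (int \<Rightarrow> fock \<Rightarrow> fock) \<Rightarrow> int \<Rightarrow> fock \<Rightarrow> fock" where
  "nord j B n w =
     Sum_any (\<lambda>i. smul (of_nat (i choose j)) (h (- int i - 1) (B (n + int i - int j) w))) +
     Sum_any (\<lambda>i. smul ((- of_nat i - 1) gchoose j) (B (n - int i - int j - 1) (h (int i) w)))"

lemma normal_ordered_nord:
  "normal_ordered p j B (of_int n) w = nord j (\<lambda>n. B (of_int n)) n w"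
proof -
  have "(of_int n :: rat) + of_nat i - of_nat j = of_int (n + int i - int j)"
    "(of_int n :: rat) - of_nat i - of_nat j - 1 = of_int (n - int i - int j - 1)" for i
    by simp_all
  then show ?thesis by (simp only: normal_ordered_def nord_def)
qed

lemma nord_ez1: "fld B \<Longrightarrow> ez (\<lambda>i. smul (c i) (h (- int i - 1) (B (n + int i - int j) w)))"
proof -
  assume B: "fld B"
  have "ez (\<lambda>i. B (n - int j + int i) w)" by (rule ez_field_up[OF B])
  then have "ez (\<lambda>i. B (n + int i - int j) w)" by (simp add: algebra_simps)
  then show ?thesis unfolding ez_def by (metis heisenberg_lin_simps(3) smul.scale_zero_right)
qed

lemma nord_ez2: "fld B \<Longrightarrow> ez (\<lambda>i. smul (c i) (B (f i) (h (int i) w)))"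
  using ez_heisenberg[of p w] unfolding ez_def by (metis lin_zero fld_lin smul.scale_zero_right)

text \<open>For finitely many fields and vectors there is a common cutoff at which both series of
  \<open>nord\<close> are finite sums, so linear identities between normally ordered products become
  identities between finite sums.\<close>

definition nord_sum :: "nat \<Rightarrow> nat \<Rightarrow> (int \<Rightarrow> fock \<Rightarrow> fock) \<Rightarrow> int \<Rightarrow> fock \<Rightarrow> fock" where
  "nord_sum I j B n w =
     (\<Sum>i<I. smul (of_nat (i choose j)) (h (- int i - 1) (B (n + int i - int j) w))) +
     (\<Sum>i<I. smul ((- of_nat i - 1) gchoose j) (B (n - int i - int j - 1) (h (int i) w)))"

lemma nord_eventually: "fld B \<Longrightarrow> \<forall>\<^sub>F I in sequentially. nord j B n w = nord_sum I j B n w"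
  using Sum_any_eventually[OF nord_ez1, of B "\<lambda>i. of_nat (i choose j)" n j w]
    Sum_any_eventually[OF nord_ez2, of B "\<lambda>i. (- of_nat i - 1) gchoose j" "\<lambda>i. n - int i - int j - 1" w]
  by (auto simp: nord_def nord_sum_def elim: eventually_elim2)

lemma eventually_seq_ex: "\<forall>\<^sub>F I in sequentially. P I \<Longrightarrow> \<exists>I::nat. P I"
  by (auto simp: eventually_sequentially)

lemma lin_nord_sum:
  assumes B: "fld B" shows "lin (nord_sum I j B n)"
proof -
  have 1: "lin (\<lambda>w. smul c (h k (B m w)))" for c k m
    by (rule lin_scale, rule lin_heisenberg_comp, rule fld_lin[OF B])
  have 2: "lin (\<lambda>w. smul c (B m (h k w)))" for c k m
    by (rule lin_scale, rule lin_comp[OF fld_lin[OF B] lin_heisenberg])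
  show ?thesis
    unfolding nord_sum_def by (rule lin_plus; rule lin_setsum; rule 1 2)
qed

lemma lin_nord: assumes B: "fld B" shows "lin (nord j B n)"
proof (rule linI)
  fix x y
  from eventually_conj[OF nord_eventually[OF B, of j n "x + y"]
      eventually_conj[OF nord_eventually[OF B, of j n x] nord_eventually[OF B, of j n y]]]
  show "nord j B n (x + y) = nord j B n x + nord j B n y"
    by (auto dest!: eventually_seq_ex simp: lin_add[OF lin_nord_sum[OF B]])
next
  fix c x
  from eventually_conj[OF nord_eventually[OF B, of j n "smul c x"] nord_eventually[OF B, of j n x]]
  show "nord j B n (smul c x) = smul c (nord j B n x)"
    by (auto dest!: eventually_seq_ex simp: lin_smul[OF lin_nord_sum[OF B]])
qed

lemma fld_nord: assumes B: "fld B" shows "fld (nord j B)"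
  unfolding fld_def
proof safe
  show "lin (nord j B n)" for n by (rule lin_nord[OF B])
  fix w
  obtain N where N: "\<And>n. n \<ge> N \<Longrightarrow> B n w = 0" using fld_trunc[OF B] by blast
  obtain I where I: "\<And>i. i \<ge> I \<Longrightarrow> h (int i) w = 0"
    using ez_heisenberg[of p w] unfolding ez_def by blast
  have "\<forall>i. \<exists>N. \<forall>n\<ge>N. B n (h (int i) w) = 0" using fld_trunc[OF B] by blast
  then obtain f where f: "\<And>i n. n \<ge> f i \<Longrightarrow> B n (h (int i) w) = 0" by metis
  define K where "K = Max (insert 0 (f ` {..<I}))"
  have K: "f i \<le> K" if "i < I" for i unfolding K_def using that by auto
  have "nord j B n w = 0" if n: "n \<ge> max (N + int j) (K + int I + int j + 1)" for n
  proof -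
    have "B (n + int i - int j) w = 0" for i using n by (intro N) simp
    moreover have "B (n - int i - int j - 1) (h (int i) w) = 0" for i
    proof (cases "i < I")
      case True
      with K[OF True] n show ?thesis by (intro f) simp
    qed (simp add: I lin_zero[OF fld_lin[OF B]])
    ultimately show ?thesis by (simp add: nord_def)
  qed
  then show "\<exists>N. \<forall>n\<ge>N. nord j B n w = 0" by blast
qed

text \<open>The commutator with \<alpha>(k) is a derivation. On the factor 1/j! (d/dx)^j \<alpha>(x)
  it gives the scalar 2pk (k-1 choose j) x^(k-1-j), and the constant takes the stated form by k (k-1
  choose j) = (j+1) (k choose j+1).\<close>

lemma nord_heis:
  assumes B: "fld B" and Bt: "\<And>t. t \<in> T \<Longrightarrow> fld (Bt t)" and T: "finite T"
    and comm: "\<And>n w. h k (B n w) = B n (h k w) + (\<Sum>t\<in>T. smul (c t) (Bt t (n + s t) w))"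
  shows "h k (nord j B n w) = nord j B n (h k w) + (\<Sum>t\<in>T. smul (c t) (nord j (Bt t) (n + s t) w))
    + smul (of_nat (2 * p * (j + 1)) * (of_int k gchoose (j + 1))) (B (n + k - int j - 1) w)"
proof -
  have "\<forall>\<^sub>F I in sequentially. nord j B n w = nord_sum I j B n w \<and>
      nord j B n (h k w) = nord_sum I j B n (h k w) \<and>
      (\<forall>t\<in>T. nord j (Bt t) (n + s t) w = nord_sum I j (Bt t) (n + s t) w) \<and> I > nat \<bar>k\<bar>"
    by (intro eventually_conj nord_eventually[OF B] eventually_gt_at_top
        eventually_ball_finite[OF T] ballI nord_eventually[OF Bt])
  then obtain I where I: "nord j B n w = nord_sum I j B n w"
      "nord j B n (h k w) = nord_sum I j B n (h k w)"
      "\<And>t. t \<in> T \<Longrightarrow> nord j (Bt t) (n + s t) w = nord_sum I j (Bt t) (n + s t) w"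
      "I > nat \<bar>k\<bar>"
    by (auto dest!: eventually_seq_ex)
  define c1 where "c1 i = (of_nat (i choose j) :: complex)" for i
  define c2 where "c2 i = ((- of_nat i - 1 :: complex) gchoose j)" for i
  let ?K = "smul (of_int (2 * int p * k))"
  have t1: "h k (smul (c1 i) (h (- int i - 1) (B (n + int i - int j) w))) =
      smul (c1 i) (h (- int i - 1) (B (n + int i - int j) (h k w))) +
      (\<Sum>t\<in>T. smul (c t) (smul (c1 i) (h (- int i - 1) (Bt t (n + s t + int i - int j) w)))) +
      (if k = int i + 1 then smul (c1 i) (?K (B (n + int i - int j) w)) else 0)" for i
  proof -
    have "h k (smul (c1 i) (h (- int i - 1) (B (n + int i - int j) w))) =
       smul (c1 i) (h (- int i - 1) (h k (B (n + int i - int j) w)) +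
         (if k + (- int i - 1) = 0 then ?K (B (n + int i - int j) w) else 0))"
      unfolding heisenberg_lin_simps heisenberg_commute[of p k] ..
    also have "h k (B (n + int i - int j) w) = B (n + int i - int j) (h k w) +
       (\<Sum>t\<in>T. smul (c t) (Bt t (n + s t + int i - int j) w))"
      unfolding comm by (simp add: algebra_simps)
    finally show ?thesis
      by (auto simp: smul.scale_right_distrib lin_sum[OF lin_heisenberg] smul.scale_sum_right mult.commute)
  qed
  have t2: "h k (smul (c2 i) (B (n - int i - int j - 1) (h (int i) w))) =
      smul (c2 i) (B (n - int i - int j - 1) (h (int i) (h k w))) +
      (\<Sum>t\<in>T. smul (c t) (smul (c2 i) (Bt t (n + s t - int i - int j - 1) (h (int i) w)))) +
      (if k = - int i then smul (c2 i) (?K (B (n - int i - int j - 1) w)) else 0)" for i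
  proof -
    have "h k (smul (c2 i) (B (n - int i - int j - 1) (h (int i) w))) =
      smul (c2 i) (B (n - int i - int j - 1) (h k (h (int i) w)) +
         (\<Sum>t\<in>T. smul (c t) (Bt t (n + s t - int i - int j - 1) (h (int i) w))))"
      unfolding heisenberg_lin_simps comm by (simp add: algebra_simps)
    also have "h k (h (int i) w) = h (int i) (h k w) + (if k + int i = 0 then ?K w else 0)"
      by (rule heisenberg_commute)
    finally show ?thesis
      by (auto simp: smul.scale_right_distrib smul.scale_sum_right mult.commute
          lin_add[OF fld_lin[OF B]] lin_smul[OF fld_lin[OF B]] lin_zero[OF fld_lin[OF B]] lin_minus[OF fld_lin[OF B]])
  qed
  \<comment> \<open>Exactly one of the two halves contains the mode \<alpha>(-k): the creation half
    for k \<ge> 1, the annihilation half for k \<le> 0. Both give it the coefficient (k-1 choose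
    j).\<close>
  have extra: "(\<Sum>i<I. if k = int i + 1 then smul (c1 i) (?K (B (n + int i - int j) w)) else 0) +
      (\<Sum>i<I. if k = - int i then smul (c2 i) (?K (B (n - int i - int j - 1) w)) else 0) =
      smul (of_nat (2 * p * (j + 1)) * (of_int k gchoose (j + 1))) (B (n + k - int j - 1) w)"
  proof -
    have "of_nat (2 * p * (j + 1)) * (of_int k gchoose (j + 1)) =
       of_nat (2 * p) * (of_nat (Suc j) * (of_int k gchoose Suc j) :: complex)"
      by (simp only: of_nat_mult mult.assoc Suc_eq_plus1)
    then have abs: "of_nat (2 * p * (j + 1)) * (of_int k gchoose (j + 1)) =
       ((of_int k - 1) gchoose j) * (of_int (2 * int p * k) :: complex)"
      unfolding gbinomial_absorption by (simp add: mult_ac)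
    show ?thesis
    proof (cases "k \<ge> 1")
      case True
      define q where "q = nat k - 1"
      have q: "k = int q + 1" using True by (simp add: q_def)
      have qI: "q < I" using I(4) q by linarith
      have "(\<Sum>i<I. if k = int i + 1 then smul (c1 i) (?K (B (n + int i - int j) w)) else 0) =
          (\<Sum>i<I. if i = q then smul (c1 q) (?K (B (n + int q - int j) w)) else 0)"
        by (intro sum.cong refl) (auto simp: q)
      also have "\<dots> = smul (c1 q) (?K (B (n + int q - int j) w))"
        using qI by (simp add: sum.delta)
      finally have a: "(\<Sum>i<I. if k = int i + 1 then smul (c1 i) (?K (B (n + int i - int j) w)) else 0) =
        smul (c1 q) (?K (B (n + int q - int j) w))" .
      have b: "(\<Sum>i<I. if k = - int i then smul (c2 i) (?K (B (n - int i - int j - 1) w)) else 0) = 0"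
        using True by (intro sum.neutral) auto
      have "c1 q = (of_int k - 1) gchoose j"
        by (simp add: c1_def q binomial_gbinomial)
      then show ?thesis unfolding a b abs by (simp add: q algebra_simps)
    next
      case False
      define q where "q = nat (- k)"
      have q: "k = - int q" using False by (simp add: q_def)
      have qI: "q < I" using I(4) q by linarith
      have "(\<Sum>i<I. if k = - int i then smul (c2 i) (?K (B (n - int i - int j - 1) w)) else 0) =
          (\<Sum>i<I. if i = q then smul (c2 q) (?K (B (n - int q - int j - 1) w)) else 0)"
        by (intro sum.cong refl) (auto simp: q)
      also have "\<dots> = smul (c2 q) (?K (B (n - int q - int j - 1) w))"
        using qI by (simp add: sum.delta)
      finally have a: "(\<Sum>i<I. if k = - int i then smul (c2 i) (?K (B (n - int i - int j - 1) w)) else 0) =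
        smul (c2 q) (?K (B (n - int q - int j - 1) w))" .
      have b: "(\<Sum>i<I. if k = int i + 1 then smul (c1 i) (?K (B (n + int i - int j) w)) else 0) = 0"
        using False by (intro sum.neutral) auto
      have "c2 q = (of_int k - 1) gchoose j"
        by (simp add: c2_def q)
      then show ?thesis unfolding a b abs by (simp add: q algebra_simps)
    qed
  qed
  have ns: "nord_sum I j B n (h k w) =
      (\<Sum>i<I. smul (c1 i) (h (- int i - 1) (B (n + int i - int j) (h k w)))) +
      (\<Sum>i<I. smul (c2 i) (B (n - int i - int j - 1) (h (int i) (h k w))))"
    by (simp only: nord_sum_def c1_def c2_def)
  have "h k (nord j B n w) = (\<Sum>i<I. h k (smul (c1 i) (h (- int i - 1) (B (n + int i - int j) w)))) +
      (\<Sum>i<I. h k (smul (c2 i) (B (n - int i - int j - 1) (h (int i) w))))"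
    unfolding I(1) nord_sum_def lin_add[OF lin_heisenberg] lin_sum[OF lin_heisenberg] c1_def c2_def ..
  also have "\<dots> = nord_sum I j B n (h k w) +
     ((\<Sum>i<I. \<Sum>t\<in>T. smul (c t) (smul (c1 i) (h (- int i - 1) (Bt t (n + s t + int i - int j) w)))) +
      (\<Sum>i<I. \<Sum>t\<in>T. smul (c t) (smul (c2 i) (Bt t (n + s t - int i - int j - 1) (h (int i) w))))) +
     ((\<Sum>i<I. if k = int i + 1 then smul (c1 i) (?K (B (n + int i - int j) w)) else 0) +
      (\<Sum>i<I. if k = - int i then smul (c2 i) (?K (B (n - int i - int j - 1) w)) else 0))"
    unfolding t1 t2 sum.distrib ns by (simp only: ac_simps)
  also have "(\<Sum>i<I. \<Sum>t\<in>T. smul (c t) (smul (c1 i) (h (- int i - 1) (Bt t (n + s t + int i - int j) w)))) =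
     (\<Sum>t\<in>T. smul (c t) (\<Sum>i<I. smul (c1 i) (h (- int i - 1) (Bt t (n + s t + int i - int j) w))))"
    by (subst sum.swap) (simp only: smul.scale_sum_right)
  also have "(\<Sum>i<I. \<Sum>t\<in>T. smul (c t) (smul (c2 i) (Bt t (n + s t - int i - int j - 1) (h (int i) w)))) =
     (\<Sum>t\<in>T. smul (c t) (\<Sum>i<I. smul (c2 i) (Bt t (n + s t - int i - int j - 1) (h (int i) w))))"
    by (subst sum.swap) (simp only: smul.scale_sum_right)
  also have "(\<Sum>t\<in>T. smul (c t) (\<Sum>i<I. smul (c1 i) (h (- int i - 1) (Bt t (n + s t + int i - int j) w)))) +
     (\<Sum>t\<in>T. smul (c t) (\<Sum>i<I. smul (c2 i) (Bt t (n + s t - int i - int j - 1) (h (int i) w)))) =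
     (\<Sum>t\<in>T. smul (c t) (nord j (Bt t) (n + s t) w))"
    unfolding sum.distrib[symmetric] smul.scale_right_distrib[symmetric]
    by (intro sum.cong refl) (simp add: I(3) nord_sum_def c1_def c2_def sum.distrib)
  finally show ?thesis unfolding extra I(2) .
qed

primrec Yl :: "nat list \<Rightarrow> int \<Rightarrow> int \<Rightarrow> fock \<Rightarrow> fock" where
  "Yl [] a = lf a"
| "Yl (j # js) a = nord j (Yl js a)"

lemma fld_Yl: "fld (Yl js a)"
  by (induction js) (auto simp: fld_lf fld_nord)

lemma foldr_normal_ordered:
  "foldr (normal_ordered p) js (lattice_field p a) (of_int n) w = Yl js a n w"
proof (induction js arbitrary: n w)
  case Nil
  show ?case by (simp add: lf_def)
next
  case (Cons j js)
  have "(\<lambda>n. foldr (normal_ordered p) js (lattice_field p a) (of_int n)) = Yl js a"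
    by (intro ext Cons)
  then show ?case by (simp add: normal_ordered_nord)
qed

definition Y :: "fock \<Rightarrow> int \<Rightarrow> fock \<Rightarrow> fock" where
  "Y u n = vertex_op p u (of_int n)"

lemma Y_eq: "Y u n w = linear_extension (\<lambda>\<mu> a. Yl (sorted_list_of_multiset \<mu>) a n w) u"
  by (simp add: Y_def vertex_op_def foldr_normal_ordered)

lemma Y_basis: "Y (bv \<mu> a) n w = Yl (sorted_list_of_multiset \<mu>) a n w"
  by (simp add: Y_eq)

lemma lin_Y_left: "lin (\<lambda>u. Y u n w)"
  by (simp add: Y_eq lin_linear_extension)

lemma fld_Y: "fld (Y u)"
proof -
  have e: "Y u n = (\<lambda>w. \<Sum>k\<in>keys u. smul (lookup u k)
      (Yl (sorted_list_of_multiset (fst k)) (snd k) n w))" for n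
    by (rule ext) (simp add: Y_eq linear_extension_superset[of "keys u"])
  show ?thesis
    unfolding fld_def
  proof safe
    show "lin (Y u n)" for n
      unfolding e by (intro lin_setsum lin_scale fld_lin[OF fld_Yl])
    fix w
    have "\<forall>k. \<exists>N. \<forall>n\<ge>N. Yl (sorted_list_of_multiset (fst k)) (snd k) n w = 0"
      using fld_trunc[OF fld_Yl] by blast
    then obtain f where f: "\<And>k n. n \<ge> f k \<Longrightarrow> Yl (sorted_list_of_multiset (fst k)) (snd k) n w = 0"
      by metis
    have "\<exists>N. \<forall>k\<in>keys u. f k \<le> N"
      using finite_imageI[OF finite_keys, of f u] by (metis Max_ge imageI)
    then obtain N where N: "\<And>k. k \<in> keys u \<Longrightarrow> f k \<le> N" by blast
    have "Y u n w = 0" if "n \<ge> N" for n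
      unfolding e using N f that by (intro sum.neutral) (metis order_trans smul.scale_zero_right)
    then show "\<exists>N. \<forall>n\<ge>N. Y u n w = 0" by blast
  qed
qed

lemma lin_Y: "lin (Y u n)"
  by (rule fld_lin[OF fld_Y])

lemmas Y_simps [simp] = lin_add[OF lin_Y] lin_smul[OF lin_Y] lin_zero[OF lin_Y] lin_minus[OF lin_Y] lin_diff[OF lin_Y]
  lin_add[OF lin_Y_left] lin_smul[OF lin_Y_left] lin_zero[OF lin_Y_left] lin_minus[OF lin_Y_left] lin_diff[OF lin_Y_left]

lemma lin_nord_Y_left: "lin (\<lambda>u. nord j (Y u) n w)"
proof (rule linI)
  fix x y
  from eventually_conj[OF nord_eventually[OF fld_Y, of j "x + y" n w]
      eventually_conj[OF nord_eventually[OF fld_Y, of j x n w] nord_eventually[OF fld_Y, of j y n w]]]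
  show "nord j (Y (x + y)) n w = nord j (Y x) n w + nord j (Y y) n w"
    by (auto dest!: eventually_seq_ex simp: nord_sum_def sum.distrib smul.scale_right_distrib)
next
  fix c x
  from eventually_conj[OF nord_eventually[OF fld_Y, of j "smul c x" n w] nord_eventually[OF fld_Y, of j x n w]]
  show "nord j (Y (smul c x)) n w = smul c (nord j (Y x) n w)"
    by (auto dest!: eventually_seq_ex simp: nord_sum_def smul.scale_right_distrib smul.scale_sum_right mult.commute)
qed

text \<open>Since \<open>vertex_op\<close> sorts the factors, putting a new one in front is
  immediate only if it is minimal. This restricted form supports the induction in
  \<open>Y_heis_basis\<close>; the restriction is removed in \<open>Y_creation\<close>.\<close>

lemma Y_creation_Min:
  assumes "\<And>\<mu> m. (\<mu>, m) \<in> keys u \<Longrightarrow> \<forall>x\<in>#\<mu>. j \<le> x"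
  shows "Y (h (- int j - 1) u) n w = nord j (Y u) n w"
proof (rule lin_ext_on[OF lin_comp[OF lin_Y_left lin_heisenberg] lin_nord_Y_left])
  fix \<mu> m assume "(\<mu>, m) \<in> keys u"
  then have "sorted_list_of_multiset (add_mset j \<mu>) = j # sorted_list_of_multiset \<mu>"
    using assms by (simp add: insort_is_Cons)
  moreover have "Y (bv \<mu> m) = Yl (sorted_list_of_multiset \<mu>) m"
    by (intro ext Y_basis)
  ultimately show "Y (h (- int j - 1) (bv \<mu> m)) n w = nord j (Y (bv \<mu> m)) n w"
    by (simp add: Y_basis)
qed

lemma HC_ez: "ez (\<lambda>i. smul (c i) (Y (h (int i) u) (f i) w))"
  using ez_heisenberg[of p u] unfolding ez_def by (metis lin_zero lin_Y_left smul.scale_zero_right)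

text \<open>Each step of the induction adds a new minimal factor. Its contraction with \<alpha>(k),
  computed in \<open>nord_heis\<close>, is what the commutator of \<alpha>(j+1) with the new
  \<alpha>(-j-1) contributes to the summand i = j + 1.\<close>

lemma Y_heis_basis:
  "h k (Y (bv \<mu> a) n w) = Y (bv \<mu> a) n (h k w) +
    Sum_any (\<lambda>i. smul (of_int k gchoose i) (Y (h (int i) (bv \<mu> a)) (n + k - int i) w))"
proof (induction \<mu> arbitrary: n w rule: multiset_induct_min)
  case empty
  have "Sum_any (\<lambda>i. smul (of_int k gchoose i) (Y (h (int i) (bv {#} a)) (n + k - int i) w)) =
     (\<Sum>i<1. smul (of_int k gchoose i) (Y (h (int i) (bv {#} a)) (n + k - int i) w))"
  proof (rule Sum_any_lessThan)
    fix i :: nat assume "i \<ge> 1"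
    then obtain j where "i = Suc j" by (cases i) auto
    then show "smul (of_int k gchoose i) (Y (h (int i) (bv {#} a)) (n + k - int i) w) = 0"
      by simp
  qed
  then show ?case by (simp add: Y_basis lf_heis)
next
  case (add j \<nu>)
  let ?v = "bv \<nu> a"
  obtain I0 where I0: "\<And>i. i \<ge> I0 \<Longrightarrow> h (int i) ?v = 0"
    using ez_heisenberg[of p ?v] unfolding ez_def by blast
  define I where "I = max I0 (j + 2)"
  have jI: "j + 1 < I" by (simp add: I_def)
  have Iv: "h (int i) ?v = 0" if "i \<ge> I" for i using I0 that by (simp add: I_def)
  \<comment> \<open>The mode \<alpha>(i) can only remove parts of \<nu>, so j stays minimal and
    \<open>Y_creation_Min\<close> applies to every summand of the commutator.\<close>
  have min: "\<forall>x\<in>#\<mu>. j \<le> x" if "(\<mu>, m) \<in> keys (h (int i) ?v)" for \<mu> m i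
  proof -
    have "\<mu> \<subseteq># \<nu>"
      using that by (cases "int i" rule: int_cases3) (auto dest!: keys_smul[THEN subsetD])
    then show ?thesis using add by (meson mset_subset_eqD)
  qed
  have Yv: "Y (bv (add_mset j \<nu>) a) n w = nord j (Y ?v) n w" for n w
    using Y_creation_Min[of ?v j n w] add by simp
  have "h k (nord j (Y ?v) n w) = nord j (Y ?v) n (h k w) +
    (\<Sum>i\<in>{..<I}. smul (of_int k gchoose i) (nord j (Y (h (int i) ?v)) (n + (k - int i)) w))
    + smul (of_nat (2 * p * (j + 1)) * (of_int k gchoose (j + 1))) (Y ?v (n + k - int j - 1) w)"
  proof (rule nord_heis[OF fld_Y fld_Y])
    fix n w
    show "h k (Y ?v n w) = Y ?v n (h k w) + (\<Sum>i<I. smul (of_int k gchoose i) (Y (h (int i) ?v) (n + (k - int i)) w))"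
      using add(1)[of n w] Sum_any_lessThan[of I "\<lambda>i. smul (of_int k gchoose i) (Y (h (int i) ?v) (n + k - int i) w)"] Iv
      by (simp add: algebra_simps)
  qed simp
  also have "(\<Sum>i\<in>{..<I}. smul (of_int k gchoose i) (nord j (Y (h (int i) ?v)) (n + (k - int i)) w)) =
    (\<Sum>i\<in>{..<I}. smul (of_int k gchoose i) (Y (h (- int j - 1) (h (int i) ?v)) (n + k - int i) w))"
    using Y_creation_Min[OF min] by (simp add: algebra_simps)
  also have "smul (of_nat (2 * p * (j + 1)) * (of_int k gchoose (j + 1))) (Y ?v (n + k - int j - 1) w) =
    (\<Sum>i\<in>{..<I}. if i = j + 1 then smul (of_int k gchoose i) (Y (smul (of_nat (2 * p * (j + 1))) ?v) (n + k - int i) w) else 0)"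
    using jI by (simp add: mult.commute diff_diff_eq ac_simps)
  also have "nord j (Y ?v) n (h k w) +
     (\<Sum>i\<in>{..<I}. smul (of_int k gchoose i) (Y (h (- int j - 1) (h (int i) ?v)) (n + k - int i) w)) +
     (\<Sum>i\<in>{..<I}. if i = j + 1 then smul (of_int k gchoose i) (Y (smul (of_nat (2 * p * (j + 1))) ?v) (n + k - int i) w) else 0) =
     nord j (Y ?v) n (h k w) +
     (\<Sum>i\<in>{..<I}. smul (of_int k gchoose i) (Y (h (int i) (h (- int j - 1) ?v)) (n + k - int i) w))"
    unfolding add.assoc sum.distrib[symmetric]
    by (intro arg_cong2[of _ _ _ _ "(+)"] refl sum.cong)
      (auto simp: heisenberg_commute[of p "int i" "- int j - 1" for i] smul.scale_right_distrib algebra_simps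
        simp del: heisenberg_neg)
  also have "(\<Sum>i\<in>{..<I}. smul (of_int k gchoose i) (Y (h (int i) (h (- int j - 1) ?v)) (n + k - int i) w)) =
     Sum_any (\<lambda>i. smul (of_int k gchoose i) (Y (h (int i) (h (- int j - 1) ?v)) (n + k - int i) w))"
  proof (rule Sum_any_lessThan[symmetric])
    fix i assume "i \<ge> I"
    then have "h (int i) (h (- int j - 1) ?v) = 0"
      using Iv by (subst heisenberg_commute) (simp add: I_def)
    then show "smul (of_int k gchoose i) (Y (h (int i) (h (- int j - 1) ?v)) (n + k - int i) w) = 0" by simp
  qed
  finally show ?case using Yv by simp
qed

lemma Y_heis:
  "h k (Y u n w) = Y u n (h k w) +
    Sum_any (\<lambda>i. smul (of_int k gchoose i) (Y (h (int i) u) (n + k - int i) w))"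
proof (rule lin_ext[OF lin_comp[OF lin_heisenberg lin_Y_left] lin_plus[OF lin_Y_left]])
  show "lin (\<lambda>u. Sum_any (\<lambda>i. smul (of_int k gchoose i) (Y (h (int i) u) (n + k - int i) w)))"
  proof (rule linI)
    fix x y
    show "Sum_any (\<lambda>i. smul (of_int k gchoose i) (Y (h (int i) (x + y)) (n + k - int i) w)) =
      Sum_any (\<lambda>i. smul (of_int k gchoose i) (Y (h (int i) x) (n + k - int i) w)) +
      Sum_any (\<lambda>i. smul (of_int k gchoose i) (Y (h (int i) y) (n + k - int i) w))"
      by (simp add: smul.scale_right_distrib Sum_any_plus[OF HC_ez HC_ez])
  next
    fix c x
    show "Sum_any (\<lambda>i. smul (of_int k gchoose i) (Y (h (int i) (smul c x)) (n + k - int i) w)) =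
      smul c (Sum_any (\<lambda>i. smul (of_int k gchoose i) (Y (h (int i) x) (n + k - int i) w)))"
      by (simp add: Sum_any_lin[OF HC_ez lin_scale[OF lin_id]] mult.commute)
  qed
qed (rule Y_heis_basis)

end

section \<open>Vacuum expectation values\<close>

definition vac :: "int \<Rightarrow> fock \<Rightarrow> complex" where
  "vac d w = lookup w ({#}, d)"

lemma vac_simps [simp]:
  "vac d (x + y) = vac d x + vac d y" "vac d (x - y) = vac d x - vac d y" "vac d (- x) = - vac d x"
  "vac d (smul c x) = c * vac d x" "vac d 0 = 0" "vac d (sum f A) = (\<Sum>x\<in>A. vac d (f x))"
  by (simp_all add: vac_def lookup_add lookup_minus lookup_smul lookup_sum)

lemma vac_Sum_any: "ez f \<Longrightarrow> vac d (Sum_any f) = Sum_any (\<lambda>i. vac d (f i))"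
  by (simp add: vac_def Sum_any_lookup)

lemma vac_expand:
  assumes "lin T"
  shows "vac d (T w) = (\<Sum>k\<in>keys w. lookup w k * vac d (T (bv (fst k) (snd k))))"
  using arg_cong[OF fock_expand[of w], of "\<lambda>w. vac d (T w)"]
  by (simp only: lin_sum[OF assms] lin_smul[OF assms] vac_simps)

lemma vac_creation [simp]: "vac d (heisenberg p (- int i - 1) w) = 0"
  by (simp add: vac_expand[OF lin_heisenberg]) (simp add: vac_def lookup_basis_vector)

lemma vac_homog: "homog D m w \<Longrightarrow> D \<noteq> 0 \<or> m \<noteq> d \<Longrightarrow> vac d w = 0"
  unfolding vac_def homog_def by (force simp: in_keys_iff[symmetric] simp flip: not_in_keys_iff_lookup_eq_zero)

context heisenberg_level
begin

text \<open>Positive modes reduce each coefficient of \<open>X\<close> on the vacuum vector to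
  vacuum coefficients of other members of the family; negative modes then carry the vanishing to all
  of the Fock space of momentum c. Identities between fields are reduced in this way to vacuum
  expectation values.\<close>

lemma schur:
  assumes lin: "\<And>X. X \<in> XX \<Longrightarrow> lin X"
    and vac: "\<And>X d. X \<in> XX \<Longrightarrow> vac d (X (bv {#} c)) = 0"
    and comm: "\<And>X k. X \<in> XX \<Longrightarrow> k \<noteq> 0 \<Longrightarrow> \<exists>I::nat. \<exists>cs Xs. (\<forall>i<I. Xs i \<in> XX) \<and>
       (\<forall>w. h k (X w) = X (h k w) + (\<Sum>i<I. smul (cs i) (Xs i w)))"
    and X: "X \<in> XX"
  shows "X (bv \<mu> c) = 0"
  using X
proof (induction \<mu> arbitrary: X)
  case empty
  have "\<forall>X\<in>XX. lookup (X (bv {#} c)) (\<nu>, m) = 0" for \<nu> m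
  proof (induction \<nu>)
    case empty
    then show ?case using vac by (simp add: vac_def)
  next
    case (add j \<nu>)
    show ?case
    proof
      fix X assume "X \<in> XX"
      have ne: "int j + 1 \<noteq> 0" by simp
      from comm[OF \<open>X \<in> XX\<close> ne] obtain I :: nat and cs Xs where
        Xs: "\<And>i. i < I \<Longrightarrow> Xs i \<in> XX" and
        eq: "\<And>w. h (int j + 1) (X w) = X (h (int j + 1) w) + (\<Sum>i<I. smul (cs i) (Xs i w))"
        by blast
      have "h (int j + 1) (X (bv {#} c)) = (\<Sum>i<I. smul (cs i) (Xs i (bv {#} c)))"
        unfolding eq using lin_zero[OF lin[OF \<open>X \<in> XX\<close>]] by simp
      then have "lookup (h (int j + 1) (X (bv {#} c))) (\<nu>, m) = 0"
        using Xs add by (simp add: lookup_sum lookup_smul)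
      then show "lookup (X (bv {#} c)) (add_mset j \<nu>, m) = 0"
        unfolding lookup_heisenberg_pos mult_eq_0_iff of_nat_eq_0_iff using p_pos by auto
    qed
  qed
  then show ?case using empty by (auto intro!: poly_mapping_eqI)
next
  case (add j \<mu>)
  have ne: "- int j - 1 \<noteq> 0" by simp
  from comm[OF add.prems ne] obtain I :: nat and cs Xs where
    Xs: "\<And>i. i < I \<Longrightarrow> Xs i \<in> XX" and
    eq: "\<And>w. h (- int j - 1) (X w) = X (h (- int j - 1) w) + (\<Sum>i<I. smul (cs i) (Xs i w))"
    by blast
  from eq[of "bv \<mu> c"] show ?case
    using add.IH[OF add.prems] add.IH[OF Xs] by simp
qed

lemma heis_vac [simp]: "h (int i) (bv {#} c) = (if i = 0 then smul (of_int c) (bv {#} c) else 0)"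
  by (cases i) auto

lemma vac_nord:
  assumes B: "fld B"
  shows "vac d (nord j B n w) =
    Sum_any (\<lambda>i. ((- of_nat i - 1) gchoose j) * vac d (B (n - int i - int j - 1) (h (int i) w)))"
  unfolding nord_def by (simp add: vac_Sum_any nord_ez1[OF B] nord_ez2[OF B])

lemma gchoose_minus1: "(- 1 :: complex) gchoose j = (-1) ^ j"
  using gbinomial_minus[of 1 j] by (simp flip: binomial_gbinomial)

text \<open>Creation modes have no vacuum coefficient and positive modes annihilate the vacuum
  vector. Only \<alpha>(0) survives, with the coefficient (-1 choose j) = (-1)^j.\<close>

lemma vac_nord_vac:
  assumes B: "fld B"
  shows "vac d (nord j B n (bv {#} c)) =
    (- 1) ^ j * of_int c * vac d (B (n - int j - 1) (bv {#} c))"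
proof -
  have "vac d (nord j B n (bv {#} c)) =
      (\<Sum>i<1. ((- of_nat i - 1) gchoose j) * vac d (B (n - int i - int j - 1) (h (int i) (bv {#} c))))"
    unfolding vac_nord[OF B]
    by (rule Sum_any_lessThan) (simp add: lin_zero[OF fld_lin[OF B]])
  then show ?thesis by (simp add: lin_smul[OF fld_lin[OF B]] gchoose_minus1)
qed

lemma vac_Yl:
  "vac d (Yl js a n (bv {#} c)) =
    (\<Prod>j\<leftarrow>js. (- 1) ^ j * of_int c) * vac d (lf a (n - int (deg (mset js))) (bv {#} c))"
  by (induction js arbitrary: n) (simp_all add: vac_nord_vac fld_Yl algebra_simps)

text \<open>The expectation value replaces each \<alpha>(-j-1) by the number (-1)^j c, whatever the
  order of the factors. This is the source of the numbers substituted in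
  \<open>charge_poly\<close>.\<close>

lemma vac_Y:
  "vac d (Y (bv \<mu> a) n (bv {#} c)) =
    (\<Prod>j\<in>#\<mu>. (- 1) ^ j * of_int c) * vac d (lf a (n - int (deg \<mu>)) (bv {#} c))"
proof -
  have "(\<Prod>j\<leftarrow>sorted_list_of_multiset \<mu>. (- 1) ^ j * of_int c :: complex) = (\<Prod>j\<in>#\<mu>. (- 1) ^ j * of_int c)"
    by (metis mset_map mset_sorted_list_of_multiset prod_mset_prod_list)
  then show ?thesis by (simp add: Y_basis vac_Yl)
qed

lemma vac_lf:
  "vac d (lf a n (bv {#} c)) =
    (if int (2 * p) dvd a * c \<and> d = a + c \<and> n = - 1 - a * c div int (2 * p) then 1 else 0)"
proof (cases "int (2 * p) dvd a * c")
  case True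
  let ?e = "a * c div int (2 * p)"
  have eq: "lf a n (bv {#} c) = cre a (- ?e - n - 1) (bv {#} (a + c))"
    using lf_basis[OF True, of "{#}" 1 n] by simp
  show ?thesis
  proof (cases "- ?e - n - 1 = 0 \<and> d = a + c")
    case t: True
    then show ?thesis using True eq by (auto simp: vac_def lookup_basis_vector)
  next
    case f: False
    have "homog (0 + (- ?e - n - 1)) (a + c) (lf a n (bv {#} c))"
      unfolding eq by (rule homog_cre) (simp add: homog_def)
    then have "vac d (lf a n (bv {#} c)) = 0"
      using f by (intro vac_homog) auto
    then show ?thesis using f by auto
  qed
next
  case False
  then show ?thesis by (simp add: lf_basis_ndvd)
qed

text \<open>Independence of the order of the factors: the commutators of both sides with the
  Heisenberg modes have the same form, and their expectation values agree because by
  \<open>vac_Y\<close> these do not see the order.\<close>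

lemma Y_creation: "Y (h (- int j - 1) u) n w = nord j (Y u) n w"
proof -
  define XX where "XX = {X. \<exists>u n. X = (\<lambda>w. Y (h (- int j - 1) u) n w - nord j (Y u) n w)}"
  have basis: "Y (h (- int j - 1) u) n (bv \<mu> c) - nord j (Y u) n (bv \<mu> c) = 0" for u n \<mu> c
  proof (rule schur[where XX = XX])
    show "(\<lambda>w. Y (h (- int j - 1) u) n w - nord j (Y u) n w) \<in> XX" by (auto simp: XX_def)
    show "lin X" if "X \<in> XX" for X
      using that by (auto simp: XX_def intro!: lin_diff_fun lin_Y lin_nord fld_Y)
    show "vac d (X (bv {#} c)) = 0" if "X \<in> XX" for X d
    proof -
      from that obtain u n where X: "X = (\<lambda>w. Y (h (- int j - 1) u) n w - nord j (Y u) n w)"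
        by (auto simp: XX_def)
      have "vac d (Y (h (- int j - 1) (bv \<mu> a)) n (bv {#} c)) =
          vac d (nord j (Y (bv \<mu> a)) n (bv {#} c))" for \<mu> a
        by (simp add: vac_Y vac_nord_vac fld_Y algebra_simps)
      then show ?thesis
        using vac_expand[where T = "\<lambda>u. Y (h (- int j - 1) u) n (bv {#} c)" and d = d and w = u,
              OF lin_comp[OF lin_Y_left lin_heisenberg]]
          vac_expand[where T = "\<lambda>u. nord j (Y u) n (bv {#} c)" and d = d and w = u,
              OF lin_nord_Y_left]
        by (simp add: X)
    qed
    show "\<exists>I::nat. \<exists>cs Xs. (\<forall>i<I. Xs i \<in> XX) \<and>
        (\<forall>w. h k (X w) = X (h k w) + (\<Sum>i<I. smul (cs i) (Xs i w)))" if "X \<in> XX" for X k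
    proof -
      from that obtain u n where X: "X = (\<lambda>w. Y (h (- int j - 1) u) n w - nord j (Y u) n w)"
        by (auto simp: XX_def)
      obtain I0 where I0: "\<And>i. i \<ge> I0 \<Longrightarrow> h (int i) u = 0"
        using ez_heisenberg[of p u] unfolding ez_def by blast
      define I where "I = max I0 (j + 2)"
      have I: "h (int i) u = 0" if "i \<ge> I" for i using I0 that by (simp add: I_def)
      have jI: "j + 1 < I" by (simp add: I_def)
      have I': "h (int i) (h (- int j - 1) u) = 0" if "i \<ge> I" for i
        using I[OF that] jI that by (subst heisenberg_commute) simp
      let ?Xs = "\<lambda>i w. Y (h (- int j - 1) (h (int i) u)) (n + k - int i) w - nord j (Y (h (int i) u)) (n + k - int i) w"
      have "h k (X w) = X (h k w) + (\<Sum>i<I. smul (of_int k gchoose i) (?Xs i w))" for w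
      proof -
        have Yh: "h k (Y u n w) = Y u n (h k w) + (\<Sum>i<I. smul (of_int k gchoose i) (Y (h (int i) u) (n + (k - int i)) w))" for n w
          using Y_heis[of k u n w] Sum_any_lessThan[of I "\<lambda>i. smul (of_int k gchoose i) (Y (h (int i) u) (n + k - int i) w)"] I
          by (simp add: algebra_simps)
        have 1: "h k (nord j (Y u) n w) = nord j (Y u) n (h k w) +
            (\<Sum>i\<in>{..<I}. smul (of_int k gchoose i) (nord j (Y (h (int i) u)) (n + (k - int i)) w)) +
            smul (of_nat (2 * p * (j + 1)) * (of_int k gchoose (j + 1))) (Y u (n + k - int j - 1) w)"
          by (rule nord_heis[OF fld_Y fld_Y finite_lessThan Yh])
        have 2: "h k (Y (h (- int j - 1) u) n w) = Y (h (- int j - 1) u) n (h k w) +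
            (\<Sum>i<I. smul (of_int k gchoose i) (Y (h (int i) (h (- int j - 1) u)) (n + k - int i) w))"
          using Y_heis[of k "h (- int j - 1) u" n w]
            Sum_any_lessThan[of I "\<lambda>i. smul (of_int k gchoose i) (Y (h (int i) (h (- int j - 1) u)) (n + k - int i) w)"] I'
          by simp
        have 3: "(\<Sum>i<I. smul (of_int k gchoose i) (Y (h (int i) (h (- int j - 1) u)) (n + k - int i) w)) =
           (\<Sum>i<I. smul (of_int k gchoose i) (Y (h (- int j - 1) (h (int i) u)) (n + k - int i) w) +
             (if i = j + 1 then smul (of_int k gchoose i) (Y (smul (of_nat (2 * p * (j + 1))) u) (n + k - int i) w) else 0))"
          by (intro sum.cong refl)
            (auto simp: heisenberg_commute[of p "int i" "- int j - 1" for i] smul.scale_right_distrib algebra_simps)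
        have 4: "(\<Sum>i<I. if i = j + 1 then smul (of_int k gchoose i) (Y (smul (of_nat (2 * p * (j + 1))) u) (n + k - int i) w) else 0) =
            smul (of_nat (2 * p * (j + 1)) * (of_int k gchoose (j + 1))) (Y u (n + k - int j - 1) w)"
          using jI by (simp add: mult.commute diff_diff_eq ac_simps)
        show ?thesis
          unfolding X lin_diff[OF lin_heisenberg] 1 2 3 sum.distrib 4 smul.scale_right_diff_distrib sum_subtractf
          by (simp add: algebra_simps)
      qed
      moreover have "\<forall>i<I. ?Xs i \<in> XX" by (auto simp: XX_def)
      ultimately show ?thesis
        by (intro exI[of _ I] exI[of _ "\<lambda>i. of_int k gchoose i"] exI[of _ ?Xs]) simp
    qed
  qed
  have "Y (h (- int j - 1) u) n w = nord j (Y u) n w"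
    by (rule lin_ext[OF lin_Y lin_nord[OF fld_Y]]) (use basis in simp)
  then show ?thesis .
qed

lemma vac_Y_creation:
  "vac d (Y (h (- int j - 1) u) n (bv {#} c)) =
    (- 1) ^ j * of_int c * vac d (Y u (n - int j - 1) (bv {#} c))"
  unfolding Y_creation by (rule vac_nord_vac[OF fld_Y])

end

section \<open>The Borcherds identity for vacuum expectation values\<close>

lemma neg_gchoose: "(- of_nat x - 1 :: complex) gchoose j = (- 1) ^ j * of_nat (x + j choose j)"
  using gbinomial_negated_upper[of "- of_nat x - 1 :: complex" j]
  by (simp add: binomial_gbinomial add.commute)

lemma choose_mult_swap: "(s + q + j choose j) * (s + q choose q) = (q + j choose j) * (s + q + j choose s)"
proof -
  have f: "fact n \<noteq> (0::complex)" for n by simp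
  have "of_nat ((s + q + j choose j) * (s + q choose q)) = (of_nat ((q + j choose j) * (s + q + j choose s)) :: complex)"
    using f by (simp add: binomial_fact field_simps)
  then show ?thesis by (simp only: of_nat_eq_iff)
qed

lemma choose_neg1: "of_nat (s + j choose j) = (- 1) ^ s * ((- of_nat j - 1 :: complex) gchoose s)"
proof -
  have "(s + j choose j) = (j + s choose s)"
    using binomial_symmetric[of j "s + j"] by (simp add: add.commute)
  then show ?thesis
    unfolding neg_gchoose by (simp add: mult.assoc[symmetric] flip: power_add)
qed

text \<open>With t = s + q (here) or t = s + j (in \<open>choose_neg3\<close>) as summation index,
  the product of binomials splits into a factor free of s and the coefficient of a power of 1 - z,
  ready for the convolution.\<close>

lemma choose_neg2:
  "((- of_nat (s + q) - 1 :: complex) gchoose j) * (of_nat (s + q) gchoose q) =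
    ((- of_nat q - 1) gchoose j) * ((- 1) ^ s * ((- of_nat (q + j) - 1) gchoose s))"
proof -
  have "(of_nat (s + q + j choose j) * of_nat (s + q choose q) :: complex) = of_nat (q + j choose j) * of_nat (s + q + j choose s)"
    using choose_mult_swap[of s q j] by (metis of_nat_mult)
  moreover have "(- 1) ^ s * (- 1) ^ s = (1::complex)" by (simp flip: power_add)
  ultimately show ?thesis
    unfolding neg_gchoose binomial_gbinomial[symmetric]
    by (simp add: ac_simps)
qed

lemma choose_neg3:
  "of_nat (s + j choose j) * ((- of_nat (s + j) - 1 :: complex) gchoose q) =
    ((- 1) ^ (j + q) * ((- of_nat q - 1) gchoose j)) * ((- 1) ^ s * ((- of_nat (q + j) - 1) gchoose s))"
proof -
  have "(of_nat (s + j + q choose q) * of_nat (s + j choose j) :: complex) = of_nat (j + q choose q) * of_nat (s + j + q choose s)"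
    using choose_mult_swap[of s j q] by (metis of_nat_mult)
  moreover have "(j + q choose q) = (q + j choose j)"
    using binomial_symmetric[of q "j + q"] by (simp add: add.commute)
  moreover have "(- 1) ^ s * (- 1) ^ s = (1::complex)" "(- 1) ^ j * (- 1) ^ j = (1::complex)"
    by (simp_all flip: power_add)
  ultimately show ?thesis
    unfolding neg_gchoose by (simp add: ac_simps power_add)
qed

lemma Vandermonde_signed:
  "(\<Sum>i\<le>t. ((- 1) ^ i * (a gchoose i)) * ((- 1) ^ (t - i) * ((b :: complex) gchoose (t - i)))) =
    (- 1) ^ t * (a + b gchoose t)"
proof -
  have "(\<Sum>i\<le>t. ((- 1) ^ i * (a gchoose i)) * ((- 1) ^ (t - i) * (b gchoose (t - i)))) =
     (\<Sum>i\<le>t. (- 1) ^ t * ((a gchoose i) * (b gchoose (t - i))))"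
  proof (intro sum.cong refl, goal_cases)
    case (1 i)
    then have "(- 1) ^ i * (- 1) ^ (t - i) = (- 1 :: complex) ^ t" by (simp flip: power_add)
    then show ?case
      by (simp add: ac_simps)
  qed
  then show ?thesis
    using gbinomial_Vandermonde[of a b t] by (simp add: sum_distrib_left[symmetric] atLeast0AtMost)
qed

lemma Vandermonde': "(\<Sum>i\<le>t. (a gchoose i) * ((b :: complex) gchoose (t - i))) = (a + b gchoose t)"
  using gbinomial_Vandermonde[of a b t] by (simp add: atLeast0AtMost)

lemma ez_shift: "ez g \<Longrightarrow> ez (\<lambda>s. g (i + s :: nat))"
  unfolding ez_def by (metis trans_le_add2)

lemma Sum_any_conv':
  fixes g :: "nat \<Rightarrow> complex"
  assumes "ez g"
  shows "Sum_any (\<lambda>i. c i * Sum_any (\<lambda>s. e * d s * g (i + s))) =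
    e * Sum_any (\<lambda>t. (\<Sum>i\<le>t. c i * d (t - i)) * g t)"
    and "ez (\<lambda>i. c i * Sum_any (\<lambda>s. e * d s * g (i + s)))"
proof -
  have 1: "c i * Sum_any (\<lambda>s. e * d s * g (i + s)) = e * Sum_any (\<lambda>s. c i * d s * g (i + s))" for i
  proof -
    have z: "ez (\<lambda>s. d s * g (i + s))" by (rule ez_mult[OF ez_shift[OF assms]])
    show ?thesis
      using Sum_any_mult_left[OF z, of e] Sum_any_mult_left[OF z, of "c i"]
      by (simp add: mult.assoc)
  qed
  have ez: "ez (\<lambda>i. Sum_any (\<lambda>s. c i * d s * g (i + s)))"
  proof -
    obtain N where "\<And>i. i \<ge> N \<Longrightarrow> g i = 0" using assms unfolding ez_def by blast
    then show ?thesis by (intro ezI[of N]) simp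
  qed
  show "Sum_any (\<lambda>i. c i * Sum_any (\<lambda>s. e * d s * g (i + s))) =
    e * Sum_any (\<lambda>t. (\<Sum>i\<le>t. c i * d (t - i)) * g t)"
    unfolding 1 Sum_any_mult_left[OF ez] Sum_any_conv[OF assms] ..
  show "ez (\<lambda>i. c i * Sum_any (\<lambda>s. e * d s * g (i + s)))"
    unfolding 1 by (rule ez_mult[OF ez])
qed

lemma Sum_any_conv_sum:
  fixes f :: "nat \<Rightarrow> complex" and Q :: nat
  assumes f: "ez f" and g: "\<And>q. ez (g q)"
  shows "Sum_any (\<lambda>i. c i * (a * f i + (\<Sum>q<Q. Sum_any (\<lambda>s. e q * d q s * g q (i + s))))) =
    a * Sum_any (\<lambda>i. c i * f i) + (\<Sum>q<Q. e q * Sum_any (\<lambda>t. (\<Sum>i\<le>t. c i * d q (t - i)) * g q t))"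
proof -
  have 1: "ez (\<lambda>i. a * (c i * f i))" by (intro ez_mult f)
  note 2 = Sum_any_sum[of "{..<Q}" "\<lambda>i q. c i * Sum_any (\<lambda>s. e q * d q s * g q (i + s))",
      OF finite_lessThan Sum_any_conv'(2)[OF g]]
  show ?thesis
    unfolding distrib_left sum_distrib_left mult.left_commute[of _ a]
    unfolding Sum_any_plus[OF 1 conjunct2[OF 2]] conjunct1[OF 2] Sum_any_conv'(1)[OF g]
      Sum_any_mult_left[OF ez_mult[OF f]] ..
qed

context heisenberg_level
begin

lemma ez_Y_up: "ez (\<lambda>i. Y u (n + int i) w)"
  by (rule ez_field_up[OF fld_Y])

lemma vac_Y_creation_left:
  "vac d (Y (h (- int j - 1) u) A w) =
    Sum_any (\<lambda>i. ((- of_nat i - 1) gchoose j) * vac d (Y u (A - int i - int j - 1) (h (int i) w)))"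
  unfolding Y_creation by (rule vac_nord[OF fld_Y])

lemma Y_creation_vac:
  "Y (h (- int j - 1) u) A (bv {#} c) =
    Sum_any (\<lambda>i. smul (of_nat (i choose j)) (h (- int i - 1) (Y u (A + int i - int j) (bv {#} c)))) +
    smul ((- 1) ^ j * of_int c) (Y u (A - int j - 1) (bv {#} c))"
proof -
  have "Sum_any (\<lambda>i. smul ((- of_nat i - 1) gchoose j) (Y u (A - int i - int j - 1) (h (int i) (bv {#} c)))) =
     (\<Sum>i<1. smul ((- of_nat i - 1) gchoose j) (Y u (A - int i - int j - 1) (h (int i) (bv {#} c))))"
    by (rule Sum_any_lessThan) simp
  then show ?thesis by (simp add: Y_creation nord_def gchoose_minus1)
qed

lemma vac_Y_heis_neg:
  assumes Q: "\<forall>q\<ge>Q. h (int q) v = 0"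
  shows "vac d (Y v B (h (- int s - 1) x)) =
    - (\<Sum>q<Q. ((- of_nat s - 1) gchoose q) * vac d (Y (h (int q) v) (B - int s - 1 - int q) x))"
proof -
  have "0 = vac d (h (- int s - 1) (Y v B x))" by simp
  also have "\<dots> = vac d (Y v B (h (- int s - 1) x)) +
      (\<Sum>q<Q. ((- of_nat s - 1) gchoose q) * vac d (Y (h (int q) v) (B - int s - 1 - int q) x))"
    unfolding Y_heis using Q
    by (subst Sum_any_lessThan[of Q]) (auto simp: algebra_simps)
  finally show ?thesis by (simp add: eq_neg_iff_add_eq_0)
qed

lemma Y_heis_vac:
  assumes Q: "\<forall>q\<ge>Q. h (int q) v = 0"
  shows "h (int i) (Y v B w) = Y v B (h (int i) w) +
    (\<Sum>q<Q. smul (of_nat i gchoose q) (Y (h (int q) v) (B + int i - int q) w))"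
  unfolding Y_heis using Q by (subst Sum_any_lessThan[of Q]) auto

text \<open>One of the two products on the right of the Borcherds identity, in expectation values.
  The other is \<open>R1\<close> with (u, m) and (v, n) exchanged, up to the sign (-1)^l.\<close>

definition R1 :: "int \<Rightarrow> int \<Rightarrow> int \<Rightarrow> int \<Rightarrow> int \<Rightarrow> fock \<Rightarrow> fock \<Rightarrow> complex" where
  "R1 c d l m n u v = Sum_any (\<lambda>i. (- 1) ^ i * (of_int l gchoose i) *
     vac d (Y u (l + m - int i) (Y v (n + int i) (bv {#} c))))"

definition LV :: "int \<Rightarrow> int \<Rightarrow> int \<Rightarrow> int \<Rightarrow> int \<Rightarrow> fock \<Rightarrow> fock \<Rightarrow> complex" where
  "LV c d l m n u v = Sum_any (\<lambda>i. (of_int m gchoose i) *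
     vac d (Y (Y u (l + int i) v) (m + n - int i) (bv {#} c)))"

lemma ez_YY: "ez (\<lambda>i. vac d (Y u (f i) (Y v (n + int i) w)))"
  using ez_Y_up[of v n w] unfolding ez_def by (metis Y_simps(3) vac_simps(5))

lemma ez_YY': "ez (\<lambda>i. vac d (Y (Y u (n + int i) v) (f i) w))"
  using ez_Y_up[of u n v] unfolding ez_def by (metis Y_simps(8) vac_simps(5))

text \<open>In generating functions, 1/j! (d/dx1)^j \<alpha>(x1) either meets the vacuum and gives
  (-1)^j c x1^(-j-1), or is contracted with v(x2) and gives multiples of (x1 - x2)^(-q-j-1), which
  are absorbed into (x1 - x2)^l. Both outcomes are again of the form \<open>R1\<close>, with one
  factor fewer.\<close>

lemma R1_rec_left:
  assumes Q: "\<forall>q\<ge>Q. h (int q) v = 0"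
  shows "R1 c d l m n (h (- int j - 1) u) v = (- 1) ^ j * of_int c * R1 c d l (m - int j - 1) n u v +
    (\<Sum>q<Q. ((- of_nat q - 1) gchoose j) * R1 c d (l - int q - int j - 1) m n u (h (int q) v))"
proof -
  let ?E = "bv {#} c"
  define g where "g q t = vac d (Y u (l - int q - int j - 1 + m - int t) (Y (h (int q) v) (n + int t) ?E))" for q t
  have ezg: "ez (g q)" for q unfolding g_def by (rule ez_YY)
  let ?e = "\<lambda>q. (- of_nat q - 1 :: complex) gchoose j"
  let ?d = "\<lambda>q s. (- 1) ^ s * ((- of_nat (q + j) - 1 :: complex) gchoose s)"
  let ?f = "\<lambda>i. vac d (Y u (l + (m - int j - 1) - int i) (Y v (n + int i) ?E))"
  have T: "vac d (Y (h (- int j - 1) u) (l + m - int i) (Y v (n + int i) ?E)) =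
      (- 1) ^ j * of_int c * ?f i + (\<Sum>q<Q. Sum_any (\<lambda>s. ?e q * ?d q s * g q (i + s)))" for i
  proof -
    let ?A = "\<lambda>t. l + m - int i - int t - int j - 1"
    let ?F = "\<lambda>t. ?e t * vac d (Y u (?A t) (Y v (n + int i) (h (int t) ?E)))"
    let ?k = "\<lambda>t q. ?e t * (of_nat t gchoose q) * vac d (Y u (?A t) (Y (h (int q) v) (n + int i + int t - int q) ?E))"
    have ezk: "ez (\<lambda>t. ?k t q)" for q
      using ez_mult[OF ez_YY[of d u ?A "h (int q) v" "n + int i - int q" ?E],
          of "\<lambda>t. ?e t * (of_nat t gchoose q)"] by (simp add: algebra_simps)
    note S = Sum_any_sum[of "{..<Q}" ?k, OF finite_lessThan ezk]
    have F: "Sum_any ?F = (- 1) ^ j * of_int c * ?f i"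
      by (subst Sum_any_single[of 0]) (simp_all add: gchoose_minus1 algebra_simps)
    have K: "Sum_any (\<lambda>t. ?k t q) = Sum_any (\<lambda>s. ?e q * ?d q s * g q (i + s))" for q
    proof -
      have "?A (s + q) = l - int q - int j - 1 + m - int (i + s)"
        "n + int i + int (s + q) - int q = n + int (i + s)" for s by simp_all
      then have "?k (s + q) q = ?e q * ?d q s * g q (i + s)" for s
        unfolding g_def choose_neg2[symmetric] by (simp only:)
      moreover have "Sum_any (\<lambda>t. ?k t q) = Sum_any (\<lambda>s. ?k (s + q) q)"
        by (rule Sum_any_shift) (simp flip: binomial_gbinomial)
      ultimately show ?thesis by (simp only:)
    qed
    have ezF: "ez ?F" by (rule ezI[of 1]) auto
    have "Sum_any (\<lambda>t. ?F t + (\<Sum>q<Q. ?k t q)) = Sum_any ?F + (\<Sum>q<Q. Sum_any (\<lambda>t. ?k t q))"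
      unfolding Sum_any_plus[OF ezF conjunct2[OF S]] conjunct1[OF S] ..
    then show ?thesis unfolding F K vac_Y_creation_left Y_heis_vac[OF Q]
      by (simp add: lin_sum[OF lin_Y] distrib_left sum_distrib_left mult.assoc)
  qed
  have e: "of_int l + (- of_nat (q + j) - 1 :: complex) = of_int (l - int q - int j - 1)" for q by simp
  show ?thesis
    unfolding R1_def T unfolding Sum_any_conv_sum[OF ez_YY ezg] unfolding Vandermonde_signed e g_def ..
qed

text \<open>Now the factor sits at x2, and the sign comes from (x2 - x1)^(-q-j-1) = (-1)^(q+j+1) (x1
  - x2)^(-q-j-1).\<close>

lemma R1_rec_right:
  assumes Q: "\<forall>q\<ge>Q. h (int q) v = 0"
  shows "R1 c d l n m v (h (- int j - 1) u) = (- 1) ^ j * of_int c * R1 c d l n (m - int j - 1) v u +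
    (\<Sum>q<Q. (- ((- 1) ^ (j + q)) * ((- of_nat q - 1) gchoose j)) * R1 c d (l - int q - int j - 1) n m (h (int q) v) u)"
proof -
  let ?E = "bv {#} c"
  define g where "g q t = vac d (Y (h (int q) v) (l - int q - int j - 1 + n - int t) (Y u (m + int t) ?E))" for q t
  have ezg: "ez (g q)" for q unfolding g_def by (rule ez_YY)
  let ?e = "\<lambda>q. - ((- 1) ^ (j + q)) * ((- of_nat q - 1 :: complex) gchoose j)"
  let ?d = "\<lambda>q s. (- 1) ^ s * ((- of_nat (q + j) - 1 :: complex) gchoose s)"
  let ?f = "\<lambda>i. vac d (Y v (l + n - int i) (Y u (m - int j - 1 + int i) ?E))"
  have T: "vac d (Y v (l + n - int i) (Y (h (- int j - 1) u) (m + int i) ?E)) =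
      (- 1) ^ j * of_int c * ?f i + (\<Sum>q<Q. Sum_any (\<lambda>s. ?e q * ?d q s * g q (i + s)))" for i
  proof -
    let ?B = "l + n - int i"
    let ?F = "\<lambda>t. smul (of_nat (t choose j)) (h (- int t - 1) (Y u (m + int i + int t - int j) ?E))"
    let ?k = "\<lambda>t q. - (of_nat (t choose j) * ((- of_nat t - 1) gchoose q)) *
      vac d (Y (h (int q) v) (?B - int t - 1 - int q) (Y u (m + int i + int t - int j) ?E))"
    have ezF: "ez ?F" using nord_ez1[OF fld_Y] .
    have ezk: "ez (\<lambda>t. ?k t q)" for q
      using ez_mult[OF ez_YY[of d "h (int q) v" "\<lambda>t. ?B - int t - 1 - int q" u "m + int i - int j" ?E],
          of "\<lambda>t. - (of_nat (t choose j) * ((- of_nat t - 1) gchoose q))"] by (simp add: algebra_simps)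
    have ezY: "ez (\<lambda>t. Y v ?B (?F t))" using ez_hom[OF ezF, of "Y v ?B"] by simp
    have K: "Sum_any (\<lambda>t. ?k t q) = Sum_any (\<lambda>s. ?e q * ?d q s * g q (i + s))" for q
    proof -
      have "?B - int (s + j) - 1 - int q = l - int q - int j - 1 + n - int (i + s)"
        "m + int i + int (s + j) - int j = m + int (i + s)" for s by simp_all
      then have "?k (s + j) q = ?e q * ?d q s * g q (i + s)" for s
        unfolding g_def mult_minus_left by (simp only: choose_neg3)
      moreover have "Sum_any (\<lambda>t. ?k t q) = Sum_any (\<lambda>s. ?k (s + j) q)" by (rule Sum_any_shift) simp
      ultimately show ?thesis by (simp only:)
    qed
    have "vac d (Y v ?B (Sum_any ?F)) = Sum_any (\<lambda>t. vac d (Y v ?B (?F t)))"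
      by (simp only: Sum_any_lin[OF ezF lin_Y] vac_Sum_any[OF ezY])
    also have "\<dots> = Sum_any (\<lambda>t. \<Sum>q<Q. ?k t q)"
      by (simp add: vac_Y_heis_neg[OF Q] sum_negf sum_distrib_left mult.assoc)
    also have "\<dots> = (\<Sum>q<Q. Sum_any (\<lambda>s. ?e q * ?d q s * g q (i + s)))"
      using Sum_any_sum[of "{..<Q}" ?k, OF finite_lessThan ezk] unfolding K by (rule conjunct1)
    finally have "vac d (Y v ?B (Sum_any ?F)) = (\<Sum>q<Q. Sum_any (\<lambda>s. ?e q * ?d q s * g q (i + s)))" .
    moreover have "m + int i - int j - 1 = m - int j - 1 + int i" by simp
    ultimately show ?thesis
      unfolding Y_creation_vac lin_add[OF lin_Y] lin_smul[OF lin_Y] vac_simps by (simp only: add.commute)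
  qed
  have e: "of_int l + (- of_nat (q + j) - 1 :: complex) = of_int (l - int q - int j - 1)" for q by simp
  show ?thesis
    unfolding R1_def T unfolding Sum_any_conv_sum[OF ez_YY ezg] unfolding Vandermonde_signed e g_def ..
qed


text \<open>With x1 - x2 = x0 the iterate obeys the recursion of \<open>R1_rec_left\<close>: a
  contraction inside the iterate lowers the power of x0, and the vacuum term x1^(-j-1) appears as
  the expansion of (x2 + x0)^(-j-1), recombined by Vandermonde.\<close>

lemma LV_rec:
  assumes Q: "\<forall>q\<ge>Q. h (int q) v = 0"
  shows "LV c d l m n (h (- int j - 1) u) v = (- 1) ^ j * of_int c * LV c d l (m - int j - 1) n u v +
    (\<Sum>q<Q. ((- of_nat q - 1) gchoose j) * LV c d (l - int q - int j - 1) m n u (h (int q) v))"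
proof -
  let ?E = "bv {#} c"
  define g where "g t = vac d (Y (Y u (l + int t) v) (m - int j - 1 + n - int t) ?E)" for t
  have ezg: "ez g" unfolding g_def by (rule ez_YY')
  let ?e = "(- 1) ^ j * of_int c :: complex"
  let ?d = "\<lambda>s. (- of_nat j - 1 :: complex) gchoose s"
  let ?cf = "\<lambda>i. of_int m gchoose i :: complex"
  let ?k = "\<lambda>i q. ((- of_nat q - 1) gchoose j) *
      vac d (Y (Y u (l + int i - int q - int j - 1) (h (int q) v)) (m + n - int i) ?E)"
  have T1: "vac d (Y (Y (h (- int j - 1) u) (l + int i) v) (m + n - int i) ?E) =
      Sum_any (\<lambda>s. ?e * ?d s * g (i + s)) + (\<Sum>q<Q. ?k i q)" for i
  proof -
    let ?A = "l + int i" and ?N = "m + n - int i"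
    let ?f = "\<lambda>s. smul (of_nat (s choose j)) (h (- int s - 1) (Y u (?A + int s - int j) v))"
    have ezf: "ez ?f" by (rule nord_ez1[OF fld_Y])
    have ezY: "ez (\<lambda>s. Y (?f s) ?N ?E)" using ez_hom[OF ezf, of "\<lambda>x. Y x ?N ?E"] by simp
    have 1: "vac d (Y (Sum_any ?f) ?N ?E) = Sum_any (\<lambda>s. vac d (Y (?f s) ?N ?E))"
      by (simp only: Sum_any_lin[OF ezf lin_Y_left] vac_Sum_any[OF ezY])
    have 2: "\<dots> = Sum_any (\<lambda>s. vac d (Y (?f (s + j)) ?N ?E))"
      by (rule Sum_any_shift) simp
    have 3: "vac d (Y (?f (s + j)) ?N ?E) = ?e * ?d s * g (i + s)" for s
    proof -
      have i: "?A + int (s + j) - int j = l + int (i + s)"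
        "?N - int (s + j) - 1 = m - int j - 1 + n - int (i + s)" by simp_all
      have sg: "(- 1) ^ s * (- 1) ^ (s + j) = ((- 1) ^ j :: complex)"
        by (simp add: power_add mult.assoc[symmetric] flip: power_mult_distrib)
      have "vac d (Y (?f (s + j)) ?N ?E) = of_nat (s + j choose j) *
          ((- 1) ^ (s + j) * of_int c * g (i + s))"
        unfolding g_def using vac_Y_creation[of d "s + j" "Y u (?A + int (s + j) - int j) v" ?N c]
        by (simp add: i del: of_nat_add)
      also have "\<dots> = ((- 1) ^ s * (- 1) ^ (s + j)) * of_int c * ?d s * g (i + s)"
        unfolding choose_neg1 by (simp only: ac_simps)
      finally show ?thesis unfolding sg .
    qed
    have 4: "Sum_any (\<lambda>s. smul ((- of_nat s - 1) gchoose j) (Y u (?A - int s - int j - 1) (h (int s) v))) =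
        (\<Sum>q<Q. smul ((- of_nat q - 1) gchoose j) (Y u (?A - int q - int j - 1) (h (int q) v)))"
      by (rule Sum_any_lessThan) (simp add: Q)
    show ?thesis
      unfolding Y_creation nord_def 4 lin_add[OF lin_Y_left] vac_simps(1) 1 2 3
      by (simp only: vac_simps lin_sum[OF lin_Y_left] lin_smul[OF lin_Y_left])
  qed
  have ez1: "ez (\<lambda>i. ?cf i * Sum_any (\<lambda>s. ?e * ?d s * g (i + s)))"
    by (rule Sum_any_conv'(2)[OF ezg])
  have ezk: "ez (\<lambda>i. ?cf i * ?k i q)" for q
  proof -
    have "ez (\<lambda>i. vac d (Y (Y u (l - int q - int j - 1 + int i) (h (int q) v)) (m + n - int i) ?E))"
      by (rule ez_YY')
    then show ?thesis by (intro ez_mult) (simp add: algebra_simps)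
  qed
  note S = Sum_any_sum[of "{..<Q}" "\<lambda>i q. ?cf i * ?k i q", OF finite_lessThan ezk]
  have T: "LV c d l m n (h (- int j - 1) u) v =
      Sum_any (\<lambda>i. ?cf i * Sum_any (\<lambda>s. ?e * ?d s * g (i + s))) + (\<Sum>q<Q. Sum_any (\<lambda>i. ?cf i * ?k i q))"
    unfolding LV_def T1 distrib_left sum_distrib_left
    unfolding Sum_any_plus[OF ez1 conjunct2[OF S]] conjunct1[OF S] ..
  have e: "of_int m + (- of_nat j - 1 :: complex) = of_int (m - int j - 1)" by simp
  have F: "Sum_any (\<lambda>i. ?cf i * Sum_any (\<lambda>s. ?e * ?d s * g (i + s))) = ?e * LV c d l (m - int j - 1) n u v"
    unfolding Sum_any_conv'(1)[OF ezg] Vandermonde' e unfolding LV_def g_def ..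
  have K: "Sum_any (\<lambda>i. ?cf i * ?k i q) = ((- of_nat q - 1) gchoose j) * LV c d (l - int q - int j - 1) m n u (h (int q) v)" for q
  proof -
    have "Sum_any (\<lambda>i. ?cf i * ?k i q) = Sum_any (\<lambda>i. ((- of_nat q - 1) gchoose j) * (?cf i *
        vac d (Y (Y u (l - int q - int j - 1 + int i) (h (int q) v)) (m + n - int i) ?E)))"
      by (simp add: algebra_simps)
    then show ?thesis
      unfolding LV_def Sum_any_mult_left[OF ez_mult[OF ez_YY']] .
  qed
  show ?thesis unfolding T F K ..
qed

lemma R1_smul: "R1 c d l m n (smul k u) v = k * R1 c d l m n u v" "R1 c d l m n u (smul k v) = k * R1 c d l m n u v"
  unfolding R1_def Sum_any_mult_left[OF ez_mult[OF ez_YY], symmetric] by (simp_all add: ac_simps)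

lemma R1_rec_lattice:
  assumes "\<And>q. h (int q) u = (if q = 0 then smul a u else 0)"
  shows "R1 c d l m n u (h (- int j - 1) v) = (- 1) ^ j * of_int c * R1 c d l m (n - int j - 1) u v
      - a * R1 c d (l - int j - 1) m n u v"
    and "R1 c d l n m (h (- int j - 1) v) u = (- 1) ^ j * of_int c * R1 c d l (n - int j - 1) m v u
      + (- 1) ^ j * a * R1 c d (l - int j - 1) n m v u"
proof -
  have Q: "\<forall>q\<ge>1. h (int q) u = 0" by (simp add: assms)
  have 0: "h 0 u = smul a u" using assms[of 0] by simp
  note R1_rec_right[OF Q, of c d l m n j v]
  moreover have "(- 1) ^ j * ((- 1) ^ j * x) = x" for x :: complex by (simp add: mult.assoc[symmetric] flip: power_mult_distrib)
  ultimately show "R1 c d l m n u (h (- int j - 1) v) = (- 1) ^ j * of_int c * R1 c d l m (n - int j - 1) u v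
      - a * R1 c d (l - int j - 1) m n u v"
    by (simp add: 0 R1_smul gchoose_minus1 mult.assoc)
  show "R1 c d l n m (h (- int j - 1) v) u = (- 1) ^ j * of_int c * R1 c d l (n - int j - 1) m v u
      + (- 1) ^ j * a * R1 c d (l - int j - 1) n m v u"
    unfolding R1_rec_left[OF Q] by (simp add: 0 R1_smul gchoose_minus1)
qed

text \<open>Removing a factor of \<open>v\<close> means moving \<alpha>(-j-1) through Y(u, x0). This
  produces a single extra term when u behaves like a lattice element, which is why the factors of u
  are removed before those of v.\<close>

lemma LV_rec_lattice:
  assumes HU: "\<And>k A w. h k (Y u A w) = Y u A (h k w) + smul a (Y u (A + k) w)"
  shows "LV c d l m n u (h (- int j - 1) v) = (- 1) ^ j * of_int c * LV c d l m (n - int j - 1) u v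
    - a * LV c d (l - int j - 1) m n u v"
proof -
  let ?E = "bv {#} c"
  let ?cf = "\<lambda>i. of_int m gchoose i :: complex"
  let ?f = "\<lambda>i. vac d (Y (Y u (l + int i) v) (m + (n - int j - 1) - int i) ?E)"
  let ?k = "\<lambda>i. vac d (Y (Y u (l - int j - 1 + int i) v) (m + n - int i) ?E)"
  have T1: "vac d (Y (Y u (l + int i) (h (- int j - 1) v)) (m + n - int i) ?E) =
     (- 1) ^ j * of_int c * ?f i + (- a) * ?k i" for i
  proof -
    have "Y u (l + int i) (h (- int j - 1) v) = h (- int j - 1) (Y u (l + int i) v) - smul a (Y u (l + int i + (- int j - 1)) v)"
      using HU[of "- int j - 1" "l + int i" v] by simp
    moreover have "l + int i + (- int j - 1) = l - int j - 1 + int i" "m + n - int i - int j - 1 = m + (n - int j - 1) - int i"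
      by simp_all
    ultimately show ?thesis
      by (simp only: lin_diff[OF lin_Y_left] lin_smul[OF lin_Y_left] vac_simps vac_Y_creation) simp
  qed
  have ez: "ez (\<lambda>i. ?cf i * ((- 1) ^ j * of_int c * ?f i))" "ez (\<lambda>i. ?cf i * ((- a) * ?k i))"
    by (intro ez_mult ez_YY')+
  have T: "LV c d l m n u (h (- int j - 1) v) = Sum_any (\<lambda>i. ?cf i * ((- 1) ^ j * of_int c * ?f i)) + Sum_any (\<lambda>i. ?cf i * ((- a) * ?k i))"
    unfolding LV_def T1 distrib_left unfolding Sum_any_plus[OF ez] ..
  have F: "Sum_any (\<lambda>i. ?cf i * ((- 1) ^ j * of_int c * ?f i)) = (- 1) ^ j * of_int c * LV c d l m (n - int j - 1) u v"
    unfolding LV_def Sum_any_mult_left[OF ez_mult[OF ez_YY'], symmetric] by (simp only: ac_simps)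
  have K: "Sum_any (\<lambda>i. ?cf i * ((- a) * ?k i)) = (- a) * LV c d (l - int j - 1) m n u v"
    unfolding LV_def Sum_any_mult_left[OF ez_mult[OF ez_YY'], symmetric] by (simp only: ac_simps)
  show ?thesis unfolding T F K by simp
qed

end

section \<open>Correlation functions of two lattice elements\<close>

lemma gchoose_alt_sum:
  "(\<Sum>m<Suc q. (- 1) ^ m * (C gchoose m)) = (- 1) ^ q * ((C :: complex) - 1 gchoose q)"
  using gbinomial_sum_lower_neg[of C q] by (simp add: lessThan_Suc_atMost mult.commute del: sum.lessThan_Suc)

text \<open>For the generating function the recursion reads f' = - C f/(1 - z), solved by (1 - z)^C.
  In \<open>gchoose_rec_unique2\<close> it is f' = A f/(1 + z), solved by (1 + z)^A.\<close>

lemma gchoose_rec_unique1: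
  fixes f :: "nat \<Rightarrow> complex"
  assumes "f 0 = 1" and rec: "\<And>q. of_nat (Suc q) * f (Suc q) = - C * (\<Sum>m<Suc q. f m)"
  shows "f q = (- 1) ^ q * (C gchoose q)"
proof (induction q rule: less_induct)
  case (less q)
  show ?case
  proof (cases q)
    case (Suc k)
    have "of_nat (Suc k) * f (Suc k) = - C * (\<Sum>m<Suc k. (- 1) ^ m * (C gchoose m))"
      unfolding rec using less Suc by simp
    also have "\<dots> = (- 1) ^ Suc k * (C * (C - 1 gchoose k))"
      unfolding gchoose_alt_sum by simp
    also have "\<dots> = of_nat (Suc k) * ((- 1) ^ Suc k * (C gchoose Suc k))"
      unfolding gbinomial_absorption[symmetric] by (simp only: ac_simps)
    finally show ?thesis using Suc by (simp del: of_nat_Suc power_Suc)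
  qed (simp add: assms)
qed

lemma gchoose_rec_unique2:
  fixes f :: "nat \<Rightarrow> complex"
  assumes "f 0 = 1" and rec: "\<And>q. of_nat (Suc q) * f (Suc q) = A * (\<Sum>m<Suc q. (- 1) ^ (q - m) * f m)"
  shows "f q = A gchoose q"
proof -
  have "(- 1) ^ q * f q = (- 1) ^ q * (A gchoose q)" for q
  proof (rule gchoose_rec_unique1[of "\<lambda>q. (- 1) ^ q * f q"])
    fix q
    have "(\<Sum>m<Suc q. (- 1) ^ q * ((- 1) ^ (q - m) * f m)) = (\<Sum>m<Suc q. (- 1) ^ m * f m)"
    proof (intro sum.cong refl, goal_cases)
      case (1 m)
      then have "q + (q - m) = m + 2 * (q - m)" by simp
      then have "(- 1) ^ q * (- 1) ^ (q - m) = ((- 1) ^ (m + 2 * (q - m)) :: complex)"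
        by (metis power_add)
      then show ?case
        by (simp add: power_add power_mult mult.assoc[symmetric])
    qed
    then have "(- 1) ^ q * (\<Sum>m<Suc q. (- 1) ^ (q - m) * f m) = (\<Sum>m<Suc q. (- 1) ^ m * f m)"
      by (simp only: sum_distrib_left)
    moreover have "of_nat (Suc q) * ((- 1) ^ Suc q * f (Suc q)) = - A * ((- 1) ^ q * (\<Sum>m<Suc q. (- 1) ^ (q - m) * f m))"
      using rec[of q] by (simp only: power_Suc) (simp add: mult.left_commute del: of_nat_Suc sum.lessThan_Suc)
    ultimately show "of_nat (Suc q) * ((- 1) ^ Suc q * f (Suc q)) = - A * (\<Sum>m<Suc q. (- 1) ^ m * f m)"
      by simp
  qed (simp add: assms)
  then show ?thesis by simp
qed

lemma sum_rev_shift: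
  fixes F :: "nat \<Rightarrow> 'a::comm_monoid_add"
  shows "(\<Sum>n\<in>{1..Suc q}. F (Suc q - n)) = (\<Sum>m<Suc q. F m)"
  by (rule sum.reindex_bij_witness[of _ "\<lambda>m. Suc q - m" "\<lambda>n. Suc q - n"]) auto

context heisenberg_level
begin

lemma cre_rec:
  "smul (of_nat q) (cre b (int q) w) =
    (\<Sum>n\<in>{1..q}. smul (of_int b / of_nat (2 * p)) (h (- int n) (cre b (int (q - n)) w)))"
proof -
  have "smul (of_nat q) (exp_creation p b q w) = (\<Sum>n\<in>{1..q}. smul (of_nat n)
      (smul (of_int b / of_nat (2 * p * n)) (h (- int n) (exp_creation p b (q - n) w))))"
    unfolding exp_creation_def
    by (rule exp_coeff_rec[OF lin_heis_scale heis_scale_commute]) simp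
  also have "\<dots> = (\<Sum>n\<in>{1..q}. smul (of_int b / of_nat (2 * p)) (h (- int n) (exp_creation p b (q - n) w)))"
    by (intro sum.cong refl) (use p_pos in auto)
  finally show ?thesis unfolding cre_def by (simp only: nat_int of_nat_less_0_iff if_False)
qed

text \<open>Moving the annihilation exponential past the creation exponential produces (1 -
  z)^(ab/(2p)), where ab/(2p) is the inner product of the two lattice elements.\<close>

lemma vac_ann_cre:
  "vac d (ann a (int q) (cre b (int q) (bv {#} d))) =
    (- 1) ^ q * (of_int (a * b) / of_nat (2 * p) gchoose q)"
proof (rule gchoose_rec_unique1[where f = "\<lambda>q. vac d (ann a (int q) (cre b (int q) (bv {#} d)))"])
  show "vac d (ann a (int 0) (cre b (int 0) (bv {#} d))) = 1"
    by (simp add: vac_def lookup_basis_vector)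
  fix q
  let ?E = "bv {#} d"
  have "of_nat (Suc q) * vac d (ann a (int (Suc q)) (cre b (int (Suc q)) ?E)) =
      vac d (ann a (int (Suc q)) (smul (of_nat (Suc q)) (cre b (int (Suc q)) ?E)))"
    by (simp only: lin_smul[OF lin_ann] vac_simps)
  also have "\<dots> = (\<Sum>n\<in>{1..Suc q}. of_int b / of_nat (2 * p) *
      vac d (ann a (int (Suc q)) (h (- int n) (cre b (int (Suc q - n)) ?E))))"
    unfolding cre_rec by (simp only: lin_sum[OF lin_ann] lin_smul[OF lin_ann] vac_simps)
  also have "\<dots> = (\<Sum>n\<in>{1..Suc q}. of_int b / of_nat (2 * p) *
      (- of_int a * vac d (ann a (int (Suc q - n)) (cre b (int (Suc q - n)) ?E))))"
  proof (intro sum.cong refl arg_cong2[of _ _ _ _ "(*)"])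
    fix n assume n: "n \<in> {1..Suc q}"
    then have n1: "- int n = - int (n - 1) - 1" and le: "- int n \<le> - 1" and
      i: "int (Suc q) + - int n = int (Suc q - n)" by auto
    have "0 = vac d (h (- int n) (ann a (int (Suc q)) (cre b (int (Suc q - n)) ?E)))"
      unfolding n1 by simp
    also have "\<dots> = vac d (ann a (int (Suc q)) (h (- int n) (cre b (int (Suc q - n)) ?E))) +
       of_int a * vac d (ann a (int (Suc q - n)) (cre b (int (Suc q - n)) ?E))"
      unfolding ann_heis[of "- int n"] i using le by (simp only: if_True vac_simps)
    finally show "vac d (ann a (int (Suc q)) (h (- int n) (cre b (int (Suc q - n)) ?E))) =
        - of_int a * vac d (ann a (int (Suc q - n)) (cre b (int (Suc q - n)) ?E))"
      by (simp add: eq_neg_iff_add_eq_0)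
  qed
  also have "\<dots> = (\<Sum>n\<in>{1..Suc q}. - (of_int (a * b) / of_nat (2 * p)) *
      vac d (ann a (int (Suc q - n)) (cre b (int (Suc q - n)) ?E)))"
    by (intro sum.cong refl) simp
  also have "\<dots> = (\<Sum>m<Suc q. - (of_int (a * b) / of_nat (2 * p)) * vac d (ann a (int m) (cre b (int m) ?E)))"
    by (rule sum_rev_shift)
  finally show "of_nat (Suc q) * vac d (ann a (int (Suc q)) (cre b (int (Suc q)) ?E)) =
      - (of_int (a * b) / of_nat (2 * p)) * (\<Sum>m<Suc q. vac d (ann a (int m) (cre b (int m) ?E)))"
    by (simp only: sum_distrib_left)
qed

lemma shift_cre: "lattice_shift a (cre b z w) = cre b z (lattice_shift a w)"
proof -
  have "lattice_shift a (exp_creation p b n w) = exp_creation p b n (lattice_shift a w)" for n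
    unfolding exp_creation_def
    by (rule exp_coeff_commute0[OF lin_heis_scale lin_shift heis_scale_commute]) (simp_all add: lin_smul[OF lin_shift] shift_heis)
  then show ?thesis by (simp add: cre_def lin_zero[OF lin_shift])
qed

lemma Y_e [simp]: "Y (bv {#} a) n w = lf a n w"
  by (simp add: Y_basis)

lemma HU_e: "h k (Y (bv {#} a) A w) = Y (bv {#} a) A (h k w) + smul (of_int a) (Y (bv {#} a) (A + k) w)"
  by (simp add: lf_heis)

lemma lf_vac_cre:
  assumes "int (2 * p) dvd b * c"
  shows "lf b y (bv {#} c) = cre b (- (b * c div int (2 * p)) - y - 1) (bv {#} (b + c))"
  using lf_basis[OF assms, of "{#}" 1 y] by simp

text \<open>Coefficients of x1^A x2^B (x1 - x2)^C, expanded in nonnegative powers of x2. The power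
  of x2 contributed by the last factor is -y - 1 - B.\<close>

lemma vac_lf_lf:
  assumes A: "a * c = int (2 * p) * A" and B: "b * c = int (2 * p) * B" and C: "a * b = int (2 * p) * C"
  shows "vac d (lf a x (lf b y (bv {#} c))) =
    (if d = a + b + c \<and> - y - 1 - B \<ge> 0 \<and> x + y = - 2 - A - B - C
     then (- 1) ^ nat (- y - 1 - B) * (of_int C gchoose nat (- y - 1 - B)) else 0)"
proof (cases "- y - 1 - B \<ge> 0")
  case False
  then have "lf b y (bv {#} c) = 0"
    using B p_pos by (subst lf_vac_cre) (auto simp: cre_def)
  then show ?thesis using False by (simp add: lin_zero[OF lin_lf])
next
  case True
  define q where "q = nat (- y - 1 - B)"
  have q: "int q = - y - 1 - B" using True by (simp add: q_def)
  let ?w = "cre b (int q) (bv {#} (b + c))"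
  have Bd: "b * c div int (2 * p) = B" using B p_pos by simp
  have w: "lf b y (bv {#} c) = ?w"
  proof -
    have "int (2 * p) dvd b * c" unfolding B by simp
    moreover have "- B - y - 1 = int q" using q by simp
    ultimately show ?thesis using lf_vac_cre[of b c y] Bd by simp
  qed
  have hw: "homog (int q) (b + c) ?w"
    using homog_cre[of 0 "b + c" "bv {#} (b + c)" "int q" b] by (simp add: homog_def)
  have ac: "a * (b + c) = int (2 * p) * (A + C)" using A C by (simp add: algebra_simps)
  have acd: "a * (b + c) div int (2 * p) = A + C" unfolding ac using p_pos by simp
  show ?thesis
  proof (cases "d = a + b + c \<and> x + y = - 2 - A - B - C")
    case False
    have "homog (int q - x - 1 - (A + C)) (a + (b + c)) (lf a x ?w)"
      using homog_lf[OF hw, of x a] unfolding acd .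
    then have "vac d (lf a x ?w) = 0"
      by (rule vac_homog) (use False q in auto)
    then show ?thesis using False w by auto
  next
    case t: True
    have dd: "a + (b + c) = d" using t by simp
    have sw: "lattice_shift a ?w = cre b (int q) (bv {#} d)"
      by (simp add: shift_cre dd)
    have "lf a x ?w = (\<Sum>e<Suc q. cre a (int e - (A + C) - x - 1) (ann a (int e) (lattice_shift a ?w)))"
      using lf_homog_eq[OF _ hw, of a "Suc q" x] acd ac by simp
    also have "\<dots> = (\<Sum>e<Suc q. if e = q then ann a (int q) (lattice_shift a ?w) else 0)"
    proof (intro sum.cong refl, goal_cases)
      case (1 e)
      moreover have "int e - (A + C) - x - 1 = int e - int q" using t q by linarith
      ultimately show ?case
        by (cases "e = q") (simp_all, simp add: cre_def)
    qed
    also have "\<dots> = ann a (int q) (lattice_shift a ?w)" by simp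
    finally have "vac d (lf a x ?w) = (- 1) ^ q * (of_int (a * b) / of_nat (2 * p) gchoose q)"
      unfolding sw by (simp only: vac_ann_cre)
    also have "of_int (a * b) / of_nat (2 * p) = (of_int C :: complex)"
      unfolding C using p_pos by simp
    finally show ?thesis using t True w by (simp add: q_def)
  qed
qed

text \<open>Here \<open>cre a q\<close> is a coefficient of Y(e^a, x0) e^b. The generating function
  in q is (1 + x0/x2)^A, that is x1^A at x1 = x2 + x0 divided by x2^A.\<close>

lemma vac_Y_cre:
  assumes A: "a * c = int (2 * p) * A" and B: "b * c = int (2 * p) * B"
  shows "vac d (Y (cre a (int q) (bv {#} (a + b))) N (bv {#} c)) =
    (if d = a + b + c \<and> N - int q = - 1 - A - B then of_int A gchoose q else 0)"
proof -
  let ?E = "bv {#} c" and ?F = "bv {#} (a + b)"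
  define M where "M = N - int q"
  define f where "f q = vac d (Y (cre a (int q) ?F) (M + int q) ?E)" for q
  have AB: "(a + b) * c = int (2 * p) * (A + B)" using A B by (simp add: algebra_simps)
  have ABd: "(a + b) * c div int (2 * p) = A + B" unfolding AB using p_pos by simp
  have f0: "f 0 = (if d = a + b + c \<and> M = - 1 - A - B then 1 else 0)"
    using AB ABd by (auto simp: f_def vac_lf)
  have rec: "of_nat (Suc q) * f (Suc q) = of_int A * (\<Sum>m<Suc q. (- 1) ^ (q - m) * f m)" for q
  proof -
    have "of_nat (Suc q) * f (Suc q) = vac d (Y (smul (of_nat (Suc q)) (cre a (int (Suc q)) ?F)) (M + int (Suc q)) ?E)"
      unfolding f_def by (simp only: lin_smul[OF lin_Y_left] vac_simps)
    also have "\<dots> = (\<Sum>n\<in>{1..Suc q}. of_int a / of_nat (2 * p) *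
        vac d (Y (h (- int n) (cre a (int (Suc q - n)) ?F)) (M + int (Suc q)) ?E))"
      unfolding cre_rec by (simp only: lin_sum[OF lin_Y_left] lin_smul[OF lin_Y_left] vac_simps)
    also have "\<dots> = (\<Sum>n\<in>{1..Suc q}. of_int A * ((- 1) ^ (q - (Suc q - n)) * f (Suc q - n)))"
    proof (intro sum.cong refl, goal_cases)
      case n: (1 n)
      then have n1: "- int n = - int (n - 1) - 1" and
        i: "M + int (Suc q) - int (n - 1) - 1 = M + int (Suc q - n)" and e: "q - (Suc q - n) = n - 1" by auto
      have aA: "of_int a / of_nat (2 * p) * of_int c = (of_int A :: complex)"
        using arg_cong[OF A, of "of_int :: int \<Rightarrow> complex"] p_pos by (simp add: field_simps)
      have "vac d (Y (h (- int n) (cre a (int (Suc q - n)) ?F)) (M + int (Suc q)) ?E) =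
        (- 1) ^ (n - 1) * of_int c * f (Suc q - n)"
        unfolding n1 vac_Y_creation i f_def ..
      then show ?case
        unfolding e aA[symmetric] by (simp only: ac_simps)
    qed
    also have "\<dots> = (\<Sum>m<Suc q. of_int A * ((- 1) ^ (q - m) * f m))"
      by (rule sum_rev_shift)
    finally show ?thesis by (simp only: sum_distrib_left)
  qed
  have "f q = f 0 * (of_int A gchoose q)"
  proof (cases "f 0 = 0")
    case True
    have "f q = 0" for q
    proof (induction q rule: less_induct)
      case (less q)
      show ?case
      proof (cases q)
        case (Suc k)
        have "(\<Sum>m<Suc k. (- 1) ^ (k - m) * f m) = 0"
          using less Suc by (intro sum.neutral) auto
        then show ?thesis using rec[of k] Suc by (simp del: of_nat_Suc sum.lessThan_Suc)
      qed (use True in simp)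
    qed
    then show ?thesis by simp
  next
    case False
    have "f q / f 0 = of_int A gchoose q"
    proof (rule gchoose_rec_unique2[of "\<lambda>q. f q / f 0"])
      fix q
      show "of_nat (Suc q) * (f (Suc q) / f 0) = of_int A * (\<Sum>m<Suc q. (- 1) ^ (q - m) * (f m / f 0))"
        using rec[of q] by (simp only: times_divide_eq_right sum_divide_distrib[symmetric])
    qed (use False in simp)
    then show ?thesis using False by (simp add: field_simps)
  qed
  then show ?thesis unfolding f0 by (auto simp: f_def M_def)
qed

end

section \<open>The Borcherds identity\<close>

lemma neg_one_powi: "(- 1 :: complex) powi (l - int k) = (- 1) ^ k * (- 1) powi l"
proof -
  have "(- 1 :: complex) ^ k * (- 1) ^ k = 1" by (simp flip: power_mult_distrib)
  then have "1 / (- 1 :: complex) ^ k = (- 1) ^ k" by (simp add: field_simps)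
  then show ?thesis by (simp add: power_int_diff power_int_of_nat divide_inverse)
qed

lemma Sum_any_cutoff:
  "Sum_any (\<lambda>i. c i * (if E - int i \<ge> 0 then f (nat (E - int i)) else 0)) =
    (if E \<ge> 0 then (\<Sum>i\<le>nat E. c i * f (nat E - i)) else (0::complex))"
proof (cases "E \<ge> 0")
  case True
  then obtain e where e: "E = int e" by (metis nonneg_eq_int)
  have "Sum_any (\<lambda>i. c i * (if E - int i \<ge> 0 then f (nat (E - int i)) else 0)) =
     (\<Sum>i<Suc e. c i * (if E - int i \<ge> 0 then f (nat (E - int i)) else 0))"
    by (rule Sum_any_lessThan) (simp add: e)
  also have "\<dots> = (\<Sum>i<Suc e. c i * f (e - i))"
  proof (intro sum.cong refl, goal_cases)
    case (1 i)
    then have "E - int i \<ge> 0" "nat (E - int i) = e - i" by (auto simp: e nat_diff_distrib)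
    then show ?case by simp
  qed
  finally show ?thesis by (simp add: e lessThan_Suc_atMost)
qed simp

text \<open>The two expansions of (x1 - x2)^N, in powers of x2 and in powers of x1, agree for N
  \<ge> 0 and differ by a derivative of the delta function for N < 0; the left-hand side is a
  coefficient of that difference. The parity condition identifies the sign (-1)^l with the sign
  (-1)^N of (x2 - x1)^N.\<close>

lemma scalar_Jacobi:
  fixes l E1 E2 N M :: int
  assumes K: "E1 + E2 = N" and M: "M = - N - 1" and C: "even (l + N)"
  shows "(if M \<ge> 0 then ((of_int (- 1 - E2) :: complex) gchoose nat M) else 0) =
    (if E1 \<ge> 0 then (- 1) ^ nat E1 * (of_int N gchoose nat E1) else 0) -
    (- 1) powi l * (if E2 \<ge> 0 then (- 1) ^ nat E2 * (of_int N gchoose nat E2) else 0)"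
proof -
  have neg1: "(- 1 :: complex) powi x = (if even x then 1 else - 1)" for x :: int
    by (simp add: power_int_minus_one_minus power_int_minus_left)
  have pw: "(- 1 :: complex) ^ nat x = (if even x then 1 else - 1)" if "x \<ge> 0" for x :: int
    using that by (simp add: minus_one_power_iff even_nat_iff)
  have gb: "(of_int x :: complex) gchoose k = of_nat (nat x choose k)" if "x \<ge> 0" for x k
    using that by (simp add: binomial_gbinomial)
  have gn: "(of_int x :: complex) gchoose k = (- 1) ^ k * of_nat (nat (- x - 1) + k choose k)" if "x < 0" for x k
  proof -
    have "of_int x = (- of_nat (nat (- x - 1)) - 1 :: complex)" using that by simp
    then show ?thesis by (simp only: neg_gchoose)
  qed
  show ?thesis
  proof (cases "N \<ge> 0")
    case True
    then have M0: "\<not> M \<ge> 0" using M by simp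
    consider (a) "E1 \<ge> 0" "E2 \<ge> 0" | (b) "E1 \<ge> 0" "E2 < 0" | (c) "E1 < 0" "E2 \<ge> 0"
      using K True by linarith
    then show ?thesis
    proof cases
      case a
      have "(nat N choose nat E1) = (nat N choose nat E2)"
      proof -
        have "nat N - nat E1 = nat E2" "nat E1 \<le> nat N" using K a by linarith+
        then show ?thesis using binomial_symmetric[of "nat E1" "nat N"] by simp
      qed
      moreover have "even (l + E1 + E2)" using C K by presburger
      ultimately show ?thesis using a M0 by (auto simp: neg1 pw gb[OF True])
    next
      case b
      then have "nat N choose nat E1 = 0" using K True by (intro binomial_eq_0) linarith
      then show ?thesis using b M0 by (simp add: gb[OF True])
    next
      case c
      then have "nat N choose nat E2 = 0" using K True by (intro binomial_eq_0) linarith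
      then show ?thesis using c M0 by (simp add: gb[OF True])
    qed
  next
    case False
    then have M0: "M \<ge> 0" using M by simp
    consider (a) "E1 \<ge> 0" "E2 < 0" | (b) "E1 < 0" "E2 \<ge> 0" | (c) "E1 < 0" "E2 < 0"
      using K False by linarith
    then show ?thesis
    proof cases
      case a
      have e: "nat (- 1 - E2) = nat (- N - 1) + nat E1" "nat M = nat (- N - 1)"
        using K M a False by linarith+
      have "(nat (- N - 1) + nat E1 choose nat (- N - 1)) = (nat (- N - 1) + nat E1 choose nat E1)"
        using binomial_symmetric[of "nat E1" "nat (- N - 1) + nat E1"] by simp
      moreover have "(- 1 :: complex) ^ nat E1 * (- 1) ^ nat E1 = 1" by (simp flip: power_mult_distrib)
      ultimately show ?thesis
        using a M0 False gb[of "- 1 - E2" "nat M"] gn[of "N" "nat E1"]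
        by (simp add: e mult.assoc[symmetric])
    next
      case b
      have e: "nat (- (- 1 - E2) - 1) + nat M = nat (- N - 1) + nat E2"  "nat M = nat (- N - 1)"
        using K M b False by linarith+
      have "(nat (- N - 1) + nat E2 choose nat (- N - 1)) = (nat (- N - 1) + nat E2 choose nat E2)"
        using binomial_symmetric[of "nat E2" "nat (- N - 1) + nat E2"] by simp
      moreover have "(- 1 :: complex) ^ nat E2 * (- 1) ^ nat E2 = 1" by (simp flip: power_mult_distrib)
      moreover have "(- 1 :: complex) ^ nat M = - ((- 1) powi l)"
        using M M0 C by (simp add: pw neg1)
      ultimately show ?thesis
        using b M0 False gn[of "- 1 - E2" "nat M"] gn[of "N" "nat E2"]
        by (simp add: e mult.assoc[symmetric] add.commute)
    next
      case c
      then have "nat (- 1 - E2) choose nat M = 0" using K M by (intro binomial_eq_0) linarith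
      then show ?thesis using c M0 gb[of "- 1 - E2" "nat M"] by simp
    qed
  qed
qed

context heisenberg_level
begin

abbreviation BV :: "int \<Rightarrow> int \<Rightarrow> int \<Rightarrow> int \<Rightarrow> int \<Rightarrow> fock \<Rightarrow> fock \<Rightarrow> bool" where
  "BV c d l m n u v \<equiv> LV c d l m n u v = R1 c d l m n u v - (- 1) powi l * R1 c d l n m v u"

lemma R1_base:
  assumes A: "a * c = int (2 * p) * A" and B: "b * c = int (2 * p) * B" and C: "a * b = int (2 * p) * C"
  shows "R1 c d l m n (bv {#} a) (bv {#} b) =
    (if d = a + b + c \<and> l + m + n = - 2 - A - B - C \<and> - n - 1 - B \<ge> 0
     then (- 1) ^ nat (- n - 1 - B) * (of_int (l + C) gchoose nat (- n - 1 - B)) else 0)"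
proof (cases "d = a + b + c \<and> l + m + n = - 2 - A - B - C")
  case False
  have "vac d (lf a (l + m - int i) (lf b (n + int i) (bv {#} c))) = 0" for i
    using vac_lf_lf[OF A B C, of d "l + m - int i" "n + int i"] False by auto
  then show ?thesis using False by (auto simp: R1_def)
next
  case W: True
  define E where "E = - n - 1 - B"
  have 2: "vac d (lf a (l + m - int i) (lf b (n + int i) (bv {#} c))) =
     (if E - int i \<ge> 0 then (- 1) ^ nat (E - int i) * (of_int C gchoose nat (E - int i)) else 0)" for i
    using vac_lf_lf[OF A B C, of d "l + m - int i" "n + int i"] W by (simp add: E_def algebra_simps)
  have "R1 c d l m n (bv {#} a) (bv {#} b) =
     (if E \<ge> 0 then (\<Sum>i\<le>nat E. (- 1) ^ i * (of_int l gchoose i) * ((- 1) ^ (nat E - i) * (of_int C gchoose (nat E - i)))) else 0)"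
    unfolding R1_def Y_e 2 by (rule Sum_any_cutoff[of _ _ "\<lambda>k. (- 1) ^ k * (of_int C gchoose k)"])
  then show ?thesis unfolding Vandermonde_signed using W by (simp add: E_def)
qed

lemma BV_base:
  assumes A: "a * c = int (2 * p) * A" and B: "b * c = int (2 * p) * B" and C: "a * b = int (2 * p) * C"
    and ev: "even C"
  shows "BV c d l m n (bv {#} a) (bv {#} b)"
proof -
  have ba: "b * a = int (2 * p) * C" using C by (simp add: mult.commute)
  have lfe: "lf a s (bv {#} b) = cre a (- C - s - 1) (bv {#} (a + b))" for s
    using C p_pos lf_vac_cre[of a b s] by simp
  show ?thesis
  proof (cases "d = a + b + c \<and> l + m + n = - 2 - A - B - C")
    case False
    then have "vac d (Y (lf a (l + int i) (bv {#} b)) (m + n - int i) (bv {#} c)) = 0" for i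
      unfolding lfe using vac_Y_cre[OF A B, of d "nat (- C - (l + int i) - 1)" "m + n - int i"]
      by (cases "- C - (l + int i) - 1 \<ge> 0") (auto simp: cre_def)
    then show ?thesis unfolding R1_base[OF A B C] R1_base[OF B A ba] using False by (auto simp: LV_def)
  next
    case W: True
    define M where "M = - C - l - 1"
    define E1 where "E1 = - n - 1 - B"
    define E2 where "E2 = - m - 1 - A"
    have 1: "vac d (Y (lf a (l + int i) (bv {#} b)) (m + n - int i) (bv {#} c)) =
       (if M - int i \<ge> 0 then of_int A gchoose nat (M - int i) else 0)" for i
    proof (cases "M - int i \<ge> 0")
      case True
      have e: "- C - (l + int i) - 1 = int (nat (M - int i))" using True by (simp add: M_def)
      have "m + n - int i - int (nat (M - int i)) = - 1 - A - B" using True W by (simp add: M_def)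
      then show ?thesis unfolding lfe e vac_Y_cre[OF A B] using W True by simp
    next
      case False
      then show ?thesis unfolding lfe by (simp add: cre_def M_def)
    qed
    have "LV c d l m n (bv {#} a) (bv {#} b) =
       (if M \<ge> 0 then (\<Sum>i\<le>nat M. (of_int m gchoose i) * (of_int A gchoose (nat M - i))) else 0)"
      unfolding LV_def Y_e 1 by (rule Sum_any_cutoff)
    also have "\<dots> = (if M \<ge> 0 then (of_int (- 1 - E2) :: complex) gchoose nat M else 0)"
      unfolding Vandermonde' by (simp add: E2_def)
    also have "\<dots> = (if E1 \<ge> 0 then (- 1) ^ nat E1 * (of_int (l + C) gchoose nat E1) else 0) -
        (- 1) powi l * (if E2 \<ge> 0 then (- 1) ^ nat E2 * (of_int (l + C) gchoose nat E2) else 0)"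
      by (rule scalar_Jacobi) (use W ev in \<open>auto simp: E1_def E2_def M_def\<close>)
    finally show ?thesis
      unfolding R1_base[OF A B C] R1_base[OF B A ba] using W by (simp add: E1_def E2_def)
  qed
qed

lemma BV_smul:
  assumes "BV c d l m n u v" shows "BV c d l m n u (smul k v)"
proof -
  have 1: "LV c d l m n u (smul k v) = k * LV c d l m n u v"
    unfolding LV_def Sum_any_mult_left[OF ez_mult[OF ez_YY'], symmetric] by (simp add: ac_simps)
  show ?thesis
    unfolding 1 R1_smul assms by (simp only: right_diff_distrib mult.left_commute)
qed

lemma BV_rec1:
  assumes 1: "BV c d l (m - int j - 1) n u v" and 2: "\<And>q. BV c d (l - int q - int j - 1) m n u (h (int q) v)"
  shows "BV c d l m n (h (- int j - 1) u) v"
proof -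
  obtain Q where Q: "\<forall>q\<ge>Q. h (int q) v = 0"
    using ez_heisenberg[of p v] unfolding ez_def by blast
  have pw: "(- 1 :: complex) powi (l - int q - int j - 1) = - ((- 1) ^ (j + q) * (- 1) powi l)" for q
    using neg_one_powi[of l "Suc (j + q)"] by (simp add: algebra_simps)
  show ?thesis
    unfolding LV_rec[OF Q] R1_rec_left[OF Q] R1_rec_right[OF Q] 1 2 pw
    by (simp add: right_diff_distrib distrib_left sum_subtractf sum.distrib sum_distrib_left sum_negf ac_simps)
qed

lemma BV_rec2:
  assumes HU: "\<And>k A w. h k (Y u A w) = Y u A (h k w) + smul a (Y u (A + k) w)"
    and hu: "\<And>q. h (int q) u = (if q = 0 then smul a u else 0)"
    and 1: "BV c d l m (n - int j - 1) u v" and 2: "BV c d (l - int j - 1) m n u v"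
  shows "BV c d l m n u (h (- int j - 1) v)"
proof -
  have pw: "(- 1 :: complex) powi (l - int j - 1) = - ((- 1) ^ j * (- 1) powi l)"
    using neg_one_powi[of l "Suc j"] by (simp add: algebra_simps)
  show ?thesis
    unfolding LV_rec_lattice[OF HU] R1_rec_lattice[OF hu] 1 2 pw
    by (simp add: algebra_simps)
qed

text \<open>The factors of the left element are removed first, which requires the identity for all
  right elements; once the left element is a bare lattice element, those of the right one follow.
  What remains is \<open>BV_base\<close>.\<close>

lemma BV_all:
  assumes A: "a * c = int (2 * p) * A" and B: "b * c = int (2 * p) * B" and C: "a * b = int (2 * p) * C"
    and ev: "even C"
  shows "BV c d l m n (bv \<mu> a) (bv \<nu> b)"
proof (induction \<mu> arbitrary: l m n \<nu>)
  case empty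
  show ?case
  proof (induction \<nu> arbitrary: l m n)
    case empty
    show ?case by (rule BV_base[OF A B C ev])
  next
    case (add j \<nu>)
    show ?case
        using BV_rec2[OF HU_e, of a c d l m n j "bv \<nu> b"] add by simp
  qed
next
  case (add j \<mu>)
  have "BV c d l m n (bv \<mu> a) (h (int q) (bv \<nu> b))" for l m n q
    by (cases q) (auto simp: add intro!: BV_smul)
  then show ?case
    using BV_rec1[of c d l m j n "bv \<mu> a" "bv \<nu> b"] add by simp
qed

end

section \<open>From expectation values to operators\<close>

lemma lin_Sum_any:
  assumes "\<And>i. lin (T i)" "\<And>x. ez (\<lambda>i. T i x)"
  shows "lin (\<lambda>x. Sum_any (\<lambda>i. T i x))"
  using assms
  by (intro linI) (simp_all add: lin_add[OF assms(1)] lin_smul[OF assms(1)] Sum_any_plus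
      Sum_any_lin[OF assms(2) lin_scale[OF lin_id]])

lemma Sum_any_conv_fock:
  fixes g :: "nat \<Rightarrow> fock"
  assumes g: "ez g"
  shows "Sum_any (\<lambda>i. smul (c i) (Sum_any (\<lambda>s. smul (e * d s) (g (i + s))))) =
    smul e (Sum_any (\<lambda>t. smul (\<Sum>i\<le>t. c i * d (t - i)) (g t)))"
    and "ez (\<lambda>i. smul (c i) (Sum_any (\<lambda>s. smul (e * d s) (g (i + s)))))"
proof -
  obtain N where N: "\<And>i. i \<ge> N \<Longrightarrow> g i = 0" using g unfolding ez_def by blast
  show ez: "ez (\<lambda>i. smul (c i) (Sum_any (\<lambda>s. smul (e * d s) (g (i + s)))))"
    by (rule ezI[of N]) (simp add: N)
  have ezi: "ez (\<lambda>s. smul (e * d s) (g (i + s)))" for i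
    by (rule ezI[of N]) (simp add: N)
  have ezt: "ez (\<lambda>t. smul (\<Sum>i\<le>t. c i * d (t - i)) (g t))"
    by (rule ez_smul[OF g])
  show "Sum_any (\<lambda>i. smul (c i) (Sum_any (\<lambda>s. smul (e * d s) (g (i + s))))) =
    smul e (Sum_any (\<lambda>t. smul (\<Sum>i\<le>t. c i * d (t - i)) (g t)))"
  proof (rule poly_mapping_eqI)
    fix k
    have "ez (\<lambda>i. lookup (g i) k)" by (rule ezI[of N]) (simp add: N)
    from Sum_any_conv'(1)[OF this, of c e d]
    show "lookup (Sum_any (\<lambda>i. smul (c i) (Sum_any (\<lambda>s. smul (e * d s) (g (i + s)))))) k =
        lookup (smul e (Sum_any (\<lambda>t. smul (\<Sum>i\<le>t. c i * d (t - i)) (g t)))) k"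
      by (simp only: Sum_any_lookup[OF ez] Sum_any_lookup[OF ezi] Sum_any_lookup[OF ezt] lookup_smul mult.assoc)
  qed
qed

lemma sum_double:
  fixes f g :: "nat \<Rightarrow> 'a::comm_monoid_add"
  shows "(\<Sum>i<Q + Q. if i < Q then f i else g (i - Q)) = (\<Sum>i<Q. f i) + (\<Sum>i<Q. g i)"
proof -
  have "{..<Q + Q} = {..<Q} \<union> {Q..<Q + Q}" by auto
  then have "(\<Sum>i<Q + Q. if i < Q then f i else g (i - Q)) =
      (\<Sum>i<Q. if i < Q then f i else g (i - Q)) + (\<Sum>i\<in>{Q..<Q + Q}. if i < Q then f i else g (i - Q))"
    by (simp add: sum.union_disjoint ivl_disj_int)
  also have "(\<Sum>i\<in>{Q..<Q + Q}. if i < Q then f i else g (i - Q)) = (\<Sum>i<Q. g i)"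
    by (rule sum.reindex_bij_witness[of _ "\<lambda>i. i + Q" "\<lambda>i. i - Q"]) auto
  finally show ?thesis by simp
qed

definition mom :: "int \<Rightarrow> fock \<Rightarrow> bool" where
  "mom a w \<longleftrightarrow> (\<forall>(\<mu>, m) \<in> keys w. m = a)"

lemma mom_basis [simp]: "mom a (bv \<mu> m) \<longleftrightarrow> m = a"
  by (simp add: mom_def)

lemma mom_zero [simp]: "mom a 0"
  by (simp add: mom_def)

lemma mom_add: "mom a x \<Longrightarrow> mom a y \<Longrightarrow> mom a (x + y)"
  unfolding mom_def using Poly_Mapping.keys_add[of x y] by blast

lemma mom_smul: "mom a x \<Longrightarrow> mom a (smul c x)"
  unfolding mom_def using keys_smul[of c x] by blast

lemma mom_sum: "(\<And>x. x \<in> A \<Longrightarrow> mom a (f x)) \<Longrightarrow> mom a (sum f A)"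
  by (induction A rule: infinite_finite_induct) (auto intro: mom_add)

lemma mom_lin:
  assumes "lin T" "mom m w" "\<And>\<mu>. mom m' (T (bv \<mu> m))"
  shows "mom m' (T w)"
proof -
  have "T w = (\<Sum>k\<in>keys w. smul (lookup w k) (T (bv (fst k) (snd k))))"
    using arg_cong[OF fock_expand[of w], of T] by (simp only: lin_sum[OF assms(1)] lin_smul[OF assms(1)])
  also have "mom m' \<dots>"
  proof (intro mom_sum mom_smul)
    fix k assume "k \<in> keys w"
    with assms(2) have "snd k = m" by (auto simp: mom_def)
    with assms(3) show "mom m' (T (bv (fst k) (snd k)))" by simp
  qed
  finally show ?thesis .
qed

lemma mom_heisenberg: "mom a w \<Longrightarrow> mom a (heisenberg p k w)"
proof (rule mom_lin[OF lin_heisenberg])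
  fix \<mu> show "mom a (heisenberg p k (bv \<mu> a))"
    by (cases k rule: int_cases3) (auto intro: mom_smul)
qed

context heisenberg_level
begin

definition BL :: "int \<Rightarrow> int \<Rightarrow> int \<Rightarrow> fock \<Rightarrow> fock \<Rightarrow> fock \<Rightarrow> fock" where
  "BL l m n u v w = Sum_any (\<lambda>i. smul (of_int m gchoose i) (Y (Y u (l + int i) v) (m + n - int i) w))"

definition BR :: "int \<Rightarrow> int \<Rightarrow> int \<Rightarrow> fock \<Rightarrow> fock \<Rightarrow> fock \<Rightarrow> fock" where
  "BR l m n u v w = Sum_any (\<lambda>i. smul ((- 1) ^ i * (of_int l gchoose i))
     (Y u (l + m - int i) (Y v (n + int i) w) - smul ((- 1) powi l) (Y v (l + n - int i) (Y u (m + int i) w))))"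

lemma ez_BL: "ez (\<lambda>i. smul (c i) (Y (Y u (l + int i) v) (f i) w))"
  using ez_Y_up[of u l v] unfolding ez_def by (metis Y_simps(8) smul.scale_zero_right)

lemma ez_YYw: "ez (\<lambda>i. Y u (f i) (Y v (n + int i) w))"
  using ez_Y_up[of v n w] unfolding ez_def by (metis Y_simps(3))

lemma ez_BR: "ez (\<lambda>i. smul (c i) (Y u (f i) (Y v (n + int i) w) - smul e (Y v (g i) (Y u (m + int i) w))))"
proof -
  have "ez (\<lambda>i. Y u (f i) (Y v (n + int i) w) + smul (- e) (Y v (g i) (Y u (m + int i) w)))"
    by (intro ez_add ez_smul ez_YYw)
  then show ?thesis by (intro ez_smul) simp
qed

lemma lin_YY: "lin (\<lambda>w. Y u m (Y v n w))" "lin (\<lambda>u. Y u m w)" "lin (\<lambda>v. Y u m (Y v n w))"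
  "lin (\<lambda>u. Y (Y u m v) n w)" "lin (\<lambda>v. Y (Y u m v) n w)"
  by (rule lin_comp[OF lin_Y lin_Y] lin_Y_left lin_comp[OF lin_Y lin_Y_left]
      lin_comp[OF lin_Y_left lin_Y_left] lin_comp[OF lin_Y_left lin_Y])+

lemma lin_B:
  "lin (\<lambda>w. BL l m n u v w - BR l m n u v w)"
  "lin (\<lambda>u. BL l m n u v w - BR l m n u v w)"
  "lin (\<lambda>v. BL l m n u v w - BR l m n u v w)"
  unfolding BL_def BR_def
  by (rule lin_diff_fun, (rule lin_Sum_any, rule lin_scale, rule lin_YY lin_Y lin_Y_left, rule ez_BL),
      rule lin_Sum_any, rule lin_scale, rule lin_diff_fun, rule lin_YY lin_Y, rule lin_scale, rule lin_YY lin_Y, rule ez_BR)+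

lemma vac_B:
  "vac d (BL l m n u v (bv {#} c) - BR l m n u v (bv {#} c)) =
    LV c d l m n u v - (R1 c d l m n u v - (- 1) powi l * R1 c d l n m v u)"
proof -
  have 1: "vac d (BL l m n u v (bv {#} c)) = LV c d l m n u v"
    by (simp add: BL_def LV_def vac_Sum_any[OF ez_BL])
  have "vac d (BR l m n u v (bv {#} c)) = R1 c d l m n u v + (- ((- 1) powi l)) * R1 c d l n m v u"
    unfolding R1_def R1_def BR_def vac_Sum_any[OF ez_BR]
      Sum_any_mult_left[OF ez_mult[OF ez_YY], symmetric]
      Sum_any_plus[OF ez_mult[OF ez_YY] ez_mult[OF ez_mult[OF ez_YY]], symmetric]
    by (simp add: algebra_simps)
  then show ?thesis using 1 by simp
qed

text \<open>The weights are general because two choices occur: (k choose j) gives the commutator of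
  \<alpha>(k) with the iterate, and the coefficients of the logarithm give
  \<open>DY_Borcherds\<close>. If f is the series with coefficients \<open>kk\<close>, the
  hypothesis says that f^(q)/q! has the coefficients \<open>e q * d q s\<close>.\<close>

lemma BL_weighted:
  fixes u v w :: fock and l m n k :: int and kk e :: "nat \<Rightarrow> complex"
  assumes Qu: "\<forall>q\<ge>Q. h (int q) u = 0" and Qv: "\<forall>q\<ge>Q. h (int q) v = 0"
    and c: "\<And>q s. kk (s + q) * (of_nat (s + q) gchoose q) = e q * d q s"
  defines "S \<equiv> \<lambda>i. Sum_any (\<lambda>j. smul (kk j) (Y (h (int j) (Y u (l + int i) v)) (m + n - int i + k - int j) w))"
  shows "Sum_any (\<lambda>i. smul (of_int m gchoose i) (S i)) =
      (\<Sum>q<Q. smul (e q) (Sum_any (\<lambda>t. smul (\<Sum>i\<le>t. (of_int m gchoose i) * d q (t - i))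
         (Y (Y (h (int q) u) (l + int t) v) (m + (k - int q) + n - int t) w)))) +
      (\<Sum>q<Q. smul (kk q) (BL l m (n + (k - int q)) u (h (int q) v) w))"
    and "ez (\<lambda>i. smul (of_int m gchoose i) (S i))"
proof -
  let ?cf = "\<lambda>i. of_int m gchoose i :: complex"
  define g where "g q t = Y (Y (h (int q) u) (l + int t) v) (m + (k - int q) + n - int t) w" for q t
  have ezg: "ez (g q)" for q
    using ez_BL[of "\<lambda>_. 1" "h (int q) u" l v] unfolding g_def by simp
  have T1: "S i = (\<Sum>q<Q. Sum_any (\<lambda>s. smul (e q * d q s) (g q (i + s)))) +
      (\<Sum>q<Q. smul (kk q) (Y (Y u (l + int i) (h (int q) v)) (m + (n + (k - int q)) - int i) w))" for i
  proof -
    let ?X = "Y u (l + int i) v" and ?N = "m + n - int i"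
    let ?f = "\<lambda>j q. smul (kk j * (of_nat j gchoose q)) (Y (Y (h (int q) u) (l + int i + int j - int q) v) (?N + k - int j) w)"
    let ?e = "\<lambda>j. smul (kk j) (Y (Y u (l + int i) (h (int j) v)) (?N + k - int j) w)"
    have H: "h (int j) ?X = Y u (l + int i) (h (int j) v) +
       (\<Sum>q<Q. smul (of_nat j gchoose q) (Y (h (int q) u) (l + int i + int j - int q) v))" for j
      by (rule Y_heis_vac) (use Qu in simp)
    have eze: "ez ?e" by (rule ezI[of Q]) (simp add: Qv)
    have ezf: "ez (\<lambda>j. ?f j q)" for q
    proof -
      have "ez (\<lambda>j. smul (kk j * (of_nat j gchoose q)) (Y (Y (h (int q) u) ((l + int i - int q) + int j) v) (?N + k - int j) w))"
        by (rule ez_BL)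
      then show ?thesis by (simp add: algebra_simps)
    qed
    note SS = Sum_any_sum[of "{..<Q}" ?f, OF finite_lessThan ezf]
    have "S i = Sum_any (\<lambda>j. (\<Sum>q<Q. ?f j q) + ?e j)"
      unfolding S_def H lin_add[OF lin_Y_left] lin_sum[OF lin_Y_left] lin_smul[OF lin_Y_left]
        smul.scale_right_distrib smul.scale_sum_right smul.scale_scale
      by (simp only: add.commute)
    also have "\<dots> = (\<Sum>q<Q. Sum_any (\<lambda>j. ?f j q)) + Sum_any ?e"
      unfolding Sum_any_plus[OF conjunct2[OF SS] eze] conjunct1[OF SS] ..
    finally have T: "S i = (\<Sum>q<Q. Sum_any (\<lambda>j. ?f j q)) + Sum_any ?e" .
    have E: "Sum_any ?e = (\<Sum>q<Q. smul (kk q) (Y (Y u (l + int i) (h (int q) v)) (m + (n + (k - int q)) - int i) w))"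
      by (subst Sum_any_lessThan[of Q]) (simp_all add: Qv algebra_simps)
    have F: "Sum_any (\<lambda>j. ?f j q) = Sum_any (\<lambda>s. smul (e q * d q s) (g q (i + s)))" for q
    proof -
      have "Sum_any (\<lambda>j. ?f j q) = Sum_any (\<lambda>s. ?f (s + q) q)"
        by (rule Sum_any_shift) (simp flip: binomial_gbinomial)
      also have "(\<lambda>s. ?f (s + q) q) = (\<lambda>s. smul (e q * d q s) (g q (i + s)))"
      proof
        fix s
        have i: "l + int i + int (s + q) - int q = l + int (i + s)"
          "?N + k - int (s + q) = m + (k - int q) + n - int (i + s)" by simp_all
        show "?f (s + q) q = smul (e q * d q s) (g q (i + s))"
          unfolding i c g_def ..
      qed
      finally show ?thesis .
    qed
    show ?thesis unfolding T E F ..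
  qed
  let ?e = "\<lambda>i q. smul (?cf i) (smul (kk q) (Y (Y u (l + int i) (h (int q) v)) (m + (n + (k - int q)) - int i) w))"
  let ?f = "\<lambda>i q. smul (?cf i) (Sum_any (\<lambda>s. smul (e q * d q s) (g q (i + s))))"
  have eze: "ez (\<lambda>i. ?e i q)" for q by (intro ez_smul ez_BL)
  have ezf: "ez (\<lambda>i. ?f i q)" for q by (rule Sum_any_conv_fock(2)[OF ezg])
  note SE = Sum_any_sum[of "{..<Q}" ?e, OF finite_lessThan eze]
  note SF = Sum_any_sum[of "{..<Q}" ?f, OF finite_lessThan ezf]
  have T: "Sum_any (\<lambda>i. smul (?cf i) (S i)) = (\<Sum>q<Q. Sum_any (\<lambda>i. ?f i q)) + (\<Sum>q<Q. Sum_any (\<lambda>i. ?e i q))"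
    unfolding T1 smul.scale_right_distrib smul.scale_sum_right
    unfolding Sum_any_plus[OF conjunct2[OF SF] conjunct2[OF SE]] conjunct1[OF SF] conjunct1[OF SE] ..
  show "ez (\<lambda>i. smul (?cf i) (S i))"
    unfolding T1 smul.scale_right_distrib smul.scale_sum_right
    by (rule ez_add[OF conjunct2[OF SF] conjunct2[OF SE]])
  have E: "Sum_any (\<lambda>i. ?e i q) = smul (kk q) (BL l m (n + (k - int q)) u (h (int q) v) w)" for q
    unfolding BL_def Sum_any_lin[OF ez_BL lin_scale[OF lin_id]] by (simp add: mult.commute)
  have F: "Sum_any (\<lambda>i. ?f i q) = smul (e q) (Sum_any (\<lambda>t. smul (\<Sum>i\<le>t. ?cf i * d q (t - i)) (g q t)))" for q
    by (rule Sum_any_conv_fock(1)[OF ezg])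
  show "Sum_any (\<lambda>i. smul (?cf i) (S i)) =
      (\<Sum>q<Q. smul (e q) (Sum_any (\<lambda>t. smul (\<Sum>i\<le>t. ?cf i * d q (t - i))
         (Y (Y (h (int q) u) (l + int t) v) (m + (k - int q) + n - int t) w)))) +
      (\<Sum>q<Q. smul (kk q) (BL l m (n + (k - int q)) u (h (int q) v) w))"
    unfolding T E F unfolding g_def ..
qed

lemma BL_heis:
  assumes Qu: "\<forall>q\<ge>Q. h (int q) u = 0" and Qv: "\<forall>q\<ge>Q. h (int q) v = 0"
  shows "h k (BL l m n u v w) = BL l m n u v (h k w) +
    ((\<Sum>q<Q. smul (of_int k gchoose q) (BL l (m + (k - int q)) n (h (int q) u) v w)) +
     (\<Sum>q<Q. smul (of_int k gchoose q) (BL l m (n + (k - int q)) u (h (int q) v) w)))"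
proof -
  let ?kk = "\<lambda>q. of_int k gchoose q :: complex"
  let ?d = "\<lambda>q s. of_int (k - int q) gchoose s :: complex"
  have c: "?kk (s + q) * (of_nat (s + q) gchoose q) = ?kk q * ?d q s" for q s
    using gbinomial_trinomial_revision[of q "s + q" "of_int k :: complex"] by simp
  note W = BL_weighted[where d = ?d and l = l and m = m and n = n and k = k and w = w, OF Qu Qv c]
  have V: "(\<Sum>i\<le>t. (of_int m gchoose i) * ?d q (t - i)) = (of_int (m + (k - int q)) gchoose t)" for q t
    unfolding Vandermonde' by simp
  have "h k (BL l m n u v w) = BL l m n u v (h k w) + Sum_any (\<lambda>i. smul (of_int m gchoose i)
      (Sum_any (\<lambda>j. smul (?kk j) (Y (h (int j) (Y u (l + int i) v)) (m + n - int i + k - int j) w))))"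
    unfolding BL_def Sum_any_lin[OF ez_BL lin_heisenberg] lin_smul[OF lin_heisenberg] Y_heis[of k "Y u (l + int i) v" for i]
      smul.scale_right_distrib
    by (rule Sum_any_plus, rule ez_BL, rule W(2))
  then show ?thesis unfolding W(1) V unfolding BL_def .
qed

lemma BR_heis:
  assumes Qu: "\<And>q. q \<ge> Q \<Longrightarrow> h (int q) u = 0" and Qv: "\<And>q. q \<ge> Q \<Longrightarrow> h (int q) v = 0"
  shows "h k (BR l m n u v w) = BR l m n u v (h k w) +
    ((\<Sum>q<Q. smul (of_int k gchoose q) (BR l (m + (k - int q)) n (h (int q) u) v w)) +
     (\<Sum>q<Q. smul (of_int k gchoose q) (BR l m (n + (k - int q)) u (h (int q) v) w)))"
proof -
  let ?cf = "\<lambda>i. (- 1) ^ i * (of_int l gchoose i) :: complex"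
  let ?kk = "\<lambda>q. of_int k gchoose q :: complex"
  have H: "h k (Y x N w) = Y x N (h k w) + (\<Sum>q<Q. smul (?kk q) (Y (h (int q) x) (N + (k - int q)) w))"
    if "\<And>q. q \<ge> Q \<Longrightarrow> h (int q) x = 0" for x N w
    unfolding Y_heis[of k x] using that by (subst Sum_any_lessThan[of Q]) (auto simp: algebra_simps)
  have Hu: "h k (Y u N w) = Y u N (h k w) + (\<Sum>q<Q. smul (?kk q) (Y (h (int q) u) (N + (k - int q)) w))" for N w
    by (rule H) (rule Qu)
  have Hv: "h k (Y v N w) = Y v N (h k w) + (\<Sum>q<Q. smul (?kk q) (Y (h (int q) v) (N + (k - int q)) w))" for N w
    by (rule H) (rule Qv)
  let ?t = "\<lambda>m n u v w i. smul (?cf i) (Y u (l + m - int i) (Y v (n + int i) w) -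
      smul ((- 1) powi l) (Y v (l + n - int i) (Y u (m + int i) w)))"
  have ezt: "ez (?t m n u v w)" for m n u v w by (rule ez_BR)
  let ?e = "\<lambda>i q. smul (?kk q) (?t (m + (k - int q)) n (h (int q) u) v w i)"
  let ?f = "\<lambda>i q. smul (?kk q) (?t m (n + (k - int q)) u (h (int q) v) w i)"
  have T1: "h k (?t m n u v w i) = ?t m n u v (h k w) i + ((\<Sum>q<Q. ?e i q) + (\<Sum>q<Q. ?f i q))" for i
  proof -
    have i: "l + m - int i + (k - int q) = l + (m + (k - int q)) - int i"
      "n + int i + (k - int q) = n + (k - int q) + int i"
      "l + n - int i + (k - int q) = l + (n + (k - int q)) - int i"
      "m + int i + (k - int q) = m + (k - int q) + int i" for q by simp_all
    have a: "h k (Y u (l + m - int i) (Y v (n + int i) w)) = Y u (l + m - int i) (Y v (n + int i) (h k w)) +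
       ((\<Sum>q<Q. smul (?kk q) (Y (h (int q) u) (l + (m + (k - int q)) - int i) (Y v (n + int i) w))) +
        (\<Sum>q<Q. smul (?kk q) (Y u (l + m - int i) (Y (h (int q) v) (n + (k - int q) + int i) w))))"
      unfolding Hu Hv lin_add[OF lin_Y] lin_sum[OF lin_Y] lin_smul[OF lin_Y] i by (simp only: ac_simps)
    have b: "h k (Y v (l + n - int i) (Y u (m + int i) w)) = Y v (l + n - int i) (Y u (m + int i) (h k w)) +
       ((\<Sum>q<Q. smul (?kk q) (Y v (l + n - int i) (Y (h (int q) u) (m + (k - int q) + int i) w))) +
        (\<Sum>q<Q. smul (?kk q) (Y (h (int q) v) (l + (n + (k - int q)) - int i) (Y u (m + int i) w))))"
      unfolding Hu Hv lin_add[OF lin_Y] lin_sum[OF lin_Y] lin_smul[OF lin_Y] i by (simp only: ac_simps)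
    have c: "smul (?kk q) (smul x (A - smul y B)) = smul x (smul (?kk q) A - smul y (smul (?kk q) B))" for q x y A B
      by (simp add: smul.scale_right_diff_distrib mult.commute mult.left_commute)
    show ?thesis
      unfolding lin_smul[OF lin_heisenberg] lin_diff[OF lin_heisenberg] a b c
        smul.scale_sum_right[symmetric] sum_subtractf
      by (simp add: smul.scale_right_distrib smul.scale_right_diff_distrib)
  qed
  have eze: "ez (\<lambda>i. ?e i q)" for q by (rule ez_smul[OF ezt])
  have ezf: "ez (\<lambda>i. ?f i q)" for q by (rule ez_smul[OF ezt])
  note SE = Sum_any_sum[of "{..<Q}" ?e, OF finite_lessThan eze]
  note SF = Sum_any_sum[of "{..<Q}" ?f, OF finite_lessThan ezf]
  have T: "h k (BR l m n u v w) = BR l m n u v (h k w) + ((\<Sum>q<Q. Sum_any (\<lambda>i. ?e i q)) + (\<Sum>q<Q. Sum_any (\<lambda>i. ?f i q)))"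
  proof -
    have "h k (Sum_any (?t m n u v w)) = Sum_any (\<lambda>i. h k (?t m n u v w i))"
      by (rule Sum_any_lin[OF ezt lin_heisenberg])
    also have "\<dots> = Sum_any (\<lambda>i. ?t m n u v (h k w) i + ((\<Sum>q<Q. ?e i q) + (\<Sum>q<Q. ?f i q)))"
      by (rule arg_cong[of _ _ Sum_any], rule ext, rule T1)
    also have "\<dots> = Sum_any (?t m n u v (h k w)) + Sum_any (\<lambda>i. (\<Sum>q<Q. ?e i q) + (\<Sum>q<Q. ?f i q))"
      by (rule Sum_any_plus[OF ezt ez_add[OF conjunct2[OF SE] conjunct2[OF SF]]])
    also have "Sum_any (\<lambda>i. (\<Sum>q<Q. ?e i q) + (\<Sum>q<Q. ?f i q)) =
        (\<Sum>q<Q. Sum_any (\<lambda>i. ?e i q)) + (\<Sum>q<Q. Sum_any (\<lambda>i. ?f i q))"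
      unfolding Sum_any_plus[OF conjunct2[OF SE] conjunct2[OF SF]] conjunct1[OF SF] conjunct1[OF SE] ..
    finally show ?thesis unfolding BR_def .
  qed
  have E: "Sum_any (\<lambda>i. ?e i q) = smul (?kk q) (BR l (m + (k - int q)) n (h (int q) u) v w)" for q
    unfolding BR_def by (rule Sum_any_lin[OF ezt lin_scale[OF lin_id], symmetric])
  have F: "Sum_any (\<lambda>i. ?f i q) = smul (?kk q) (BR l m (n + (k - int q)) u (h (int q) v) w)" for q
    unfolding BR_def by (rule Sum_any_lin[OF ezt lin_scale[OF lin_id], symmetric])
  show ?thesis
    unfolding T E F ..
qed

text \<open>\<open>BL_heis\<close> and \<open>BR_heis\<close> have the same shape, so the
  differences form a family as required by \<open>schur\<close>, and \<open>BV_all\<close> gives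
  their vacuum coefficients. Divisibility makes the powers of x integral; evenness of C makes the
  lattice fields local without a sign.\<close>

theorem Borcherds_mom:
  assumes A: "a * c = int (2 * p) * A" and B: "b * c = int (2 * p) * B" and C: "a * b = int (2 * p) * C"
    and ev: "even C" and u: "mom a u" and v: "mom b v" and w: "mom c w"
  shows "BL l m n u v w = BR l m n u v w"
proof -
  define XX where "XX = {X. \<exists>l m n u v. mom a u \<and> mom b v \<and> X = (\<lambda>w. BL l m n u v w - BR l m n u v w)}"
  have D_in: "(\<lambda>w. BL l m n u v w - BR l m n u v w) \<in> XX" if "mom a u" "mom b v" for l m n u v
    unfolding XX_def using that by blast
  have *: "BL l m n u v (bv \<mu> c) - BR l m n u v (bv \<mu> c) = 0" for \<mu>
  proof (rule schur[where XX = XX and X = "\<lambda>w. BL l m n u v w - BR l m n u v w"])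
    show "(\<lambda>w. BL l m n u v w - BR l m n u v w) \<in> XX" by (rule D_in[OF u v])
    show "lin X" if "X \<in> XX" for X
    proof -
      from that obtain l m n u v where X: "X = (\<lambda>w. BL l m n u v w - BR l m n u v w)"
        unfolding XX_def by blast
      show ?thesis unfolding X by (rule lin_B(1))
    qed
    show "vac d (X (bv {#} c)) = 0" if "X \<in> XX" for X d
    proof -
      from that obtain l m n u v where uv: "mom a u" "mom b v" and X: "X = (\<lambda>w. BL l m n u v w - BR l m n u v w)"
        unfolding XX_def by blast
      let ?D = "\<lambda>u v. BL l m n u v (bv {#} c) - BR l m n u v (bv {#} c)"
      have 0: "vac d (?D (bv \<mu> a) (bv \<nu> b)) = 0" for \<mu> \<nu>
        unfolding vac_B using BV_all[OF A B C ev] by simp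
      have 1: "vac d (?D (bv \<mu> a) v) = 0" for \<mu>
      proof -
        have "vac d (?D (bv \<mu> a) v) =
            (\<Sum>k\<in>keys v. lookup v k * vac d (?D (bv \<mu> a) (bv (fst k) (snd k))))"
          by (rule vac_expand[OF lin_B(3)])
        also have "\<dots> = 0"
          by (intro sum.neutral ballI) (use uv 0 in \<open>force simp: mom_def\<close>)
        finally show ?thesis .
      qed
      have "vac d (?D u v) =
          (\<Sum>k\<in>keys u. lookup u k * vac d (?D (bv (fst k) (snd k)) v))"
        by (rule vac_expand[OF lin_B(2)])
      also have "\<dots> = 0"
        by (intro sum.neutral ballI) (use uv 1 in \<open>force simp: mom_def\<close>)
      finally show ?thesis unfolding X .
    qed
    show "\<exists>I::nat. \<exists>cs Xs. (\<forall>i<I. Xs i \<in> XX) \<and>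
        (\<forall>w. h k (X w) = X (h k w) + (\<Sum>i<I. smul (cs i) (Xs i w)))" if "X \<in> XX" for X k
    proof -
      from that obtain l m n u v where uv: "mom a u" "mom b v" and X: "X = (\<lambda>w. BL l m n u v w - BR l m n u v w)"
        unfolding XX_def by blast
      obtain Q1 where Q1: "\<And>i. i \<ge> Q1 \<Longrightarrow> h (int i) u = 0"
        using ez_heisenberg[of p u] unfolding ez_def by blast
      obtain Q2 where Q2: "\<And>i. i \<ge> Q2 \<Longrightarrow> h (int i) v = 0"
        using ez_heisenberg[of p v] unfolding ez_def by blast
      define Q where "Q = max Q1 Q2"
      have Q: "h (int i) u = 0" "h (int i) v = 0" if "i \<ge> Q" for i
        using Q1 Q2 that by (simp_all add: Q_def)
      let ?D = "\<lambda>l m n u v w. BL l m n u v w - BR l m n u v w"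
      \<comment> \<open>The commutator consists of two sums, one for each of u and v; they are
        concatenated because \<open>schur\<close> expects a single indexed family.\<close>
      let ?Xs = "\<lambda>i. if i < Q then ?D l (m + (k - int i)) n (h (int i) u) v
         else ?D l m (n + (k - int (i - Q))) u (h (int (i - Q)) v)"
      let ?cs = "\<lambda>i. if i < Q then of_int k gchoose i else of_int k gchoose (i - Q) :: complex"
      have "h k (X w) = X (h k w) + (\<Sum>i<Q + Q. smul (?cs i) (?Xs i w))" for w
      proof -
        have "(\<Sum>i<Q + Q. smul (?cs i) (?Xs i w)) = (\<Sum>i<Q + Q. if i < Q
             then smul (of_int k gchoose i) (?D l (m + (k - int i)) n (h (int i) u) v w)
             else smul (of_int k gchoose (i - Q)) (?D l m (n + (k - int (i - Q))) u (h (int (i - Q)) v) w))"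
          by (intro sum.cong refl) auto
        also have "\<dots> = (\<Sum>q<Q. smul (of_int k gchoose q) (?D l (m + (k - int q)) n (h (int q) u) v w)) +
            (\<Sum>q<Q. smul (of_int k gchoose q) (?D l m (n + (k - int q)) u (h (int q) v) w))"
          by (rule sum_double)
        finally have s: "(\<Sum>i<Q + Q. smul (?cs i) (?Xs i w)) = \<dots>" .
        have hl: "h k (BL l m n u v w) = BL l m n u v (h k w) +
            ((\<Sum>q<Q. smul (of_int k gchoose q) (BL l (m + (k - int q)) n (h (int q) u) v w)) +
             (\<Sum>q<Q. smul (of_int k gchoose q) (BL l m (n + (k - int q)) u (h (int q) v) w)))"
          by (rule BL_heis) (simp_all add: Q)
        have hr: "h k (BR l m n u v w) = BR l m n u v (h k w) +
            ((\<Sum>q<Q. smul (of_int k gchoose q) (BR l (m + (k - int q)) n (h (int q) u) v w)) +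
             (\<Sum>q<Q. smul (of_int k gchoose q) (BR l m (n + (k - int q)) u (h (int q) v) w)))"
          by (rule BR_heis) (simp_all add: Q)
        show ?thesis
          unfolding s X lin_diff[OF lin_heisenberg] hl hr smul.scale_right_diff_distrib sum_subtractf
          by simp
      qed
      moreover have "?Xs i \<in> XX" for i
        using D_in[OF mom_heisenberg[OF uv(1)] uv(2)] D_in[OF uv(1) mom_heisenberg[OF uv(2)]]
        by (cases "i < Q") simp_all
      ultimately show ?thesis
        by (intro exI[of _ "Q + Q"] exI[of _ ?cs] exI[of _ ?Xs]) simp
    qed
  qed
  have "(\<lambda>w. BL l m n u v w - BR l m n u v w) w = (\<lambda>w. 0) w"
    by (rule lin_ext_on[OF lin_B(1) lin_0]) (use w * in \<open>auto simp: mom_def\<close>)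
  then show ?thesis by simp
qed

end

section \<open>The triplet algebra\<close>

definition fock_restrict :: "(nat multiset \<Rightarrow> int \<Rightarrow> bool) \<Rightarrow> fock \<Rightarrow> fock" where
  "fock_restrict P = linear_extension (\<lambda>\<mu> m. if P \<mu> m then bv \<mu> m else 0)"

lemma lin_restrict: "lin (fock_restrict P)"
  unfolding fock_restrict_def by (rule lin_linear_extension)

lemma lookup_restrict: "lookup (fock_restrict P w) (\<mu>, m) = (if P \<mu> m then lookup w (\<mu>, m) else 0)"
proof -
  have "lookup (fock_restrict P w) (\<mu>, m) =
     (\<Sum>k\<in>keys w. if k = (\<mu>, m) then (if P \<mu> m then lookup w (\<mu>, m) else 0) else 0)"
    unfolding fock_restrict_def linear_extension_superset[OF finite_keys order_refl] lookup_sum lookup_smul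
    by (intro sum.cong refl) (auto simp: lookup_basis_vector)
  then show ?thesis by (auto simp: in_keys_iff)
qed

lemma fock_restrict_basis [simp]: "fock_restrict P (bv \<mu> m) = (if P \<mu> m then bv \<mu> m else 0)"
  by (simp add: fock_restrict_def)

lemma keys_restrict: "keys (fock_restrict P w) = {(\<mu>, m) \<in> keys w. P \<mu> m}"
  by (auto simp: in_keys_iff lookup_restrict split: if_splits)

lemma homog_restrict:
  "homog (int D) a (fock_restrict (\<lambda>\<mu> m. deg \<mu> = D \<and> m = a) w)"
  by (auto simp: homog_def keys_restrict)

lemma fock_restrict_id:
  assumes "\<And>\<mu> m. (\<mu>, m) \<in> keys w \<Longrightarrow> P \<mu> m" shows "fock_restrict P w = w"
proof (rule poly_mapping_eqI)
  fix k show "lookup (fock_restrict P w) k = lookup w k"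
    by (cases k) (metis assms in_keys_iff lookup_restrict)
qed

lemma fock_restrict_0:
  assumes "\<And>\<mu> m. (\<mu>, m) \<in> keys w \<Longrightarrow> \<not> P \<mu> m" shows "fock_restrict P w = 0"
proof (rule poly_mapping_eqI)
  fix k show "lookup (fock_restrict P w) k = lookup 0 k"
    by (cases k) (metis assms in_keys_iff lookup_restrict lookup_zero)
qed

lemma homogeneous_components:
  "w = (\<Sum>(D, a)\<in>(\<lambda>(\<mu>, m). (deg \<mu>, m)) ` keys w. fock_restrict (\<lambda>\<mu> m. deg \<mu> = D \<and> m = a) w)"
proof (rule poly_mapping_eqI)
  fix k :: "nat multiset \<times> int"
  obtain \<mu> m where k: "k = (\<mu>, m)" by (cases k)
  let ?S = "(\<lambda>(\<mu>, m). (deg \<mu>, m)) ` keys w"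
  have "lookup (\<Sum>(D, a)\<in>?S. fock_restrict (\<lambda>\<mu> m. deg \<mu> = D \<and> m = a) w) k =
     (\<Sum>x\<in>?S. if x = (deg \<mu>, m) then lookup w k else 0)"
    unfolding k lookup_sum by (intro sum.cong refl) (auto simp: lookup_restrict split: if_splits prod.splits)
  also have "\<dots> = lookup w k"
  proof (cases "(deg \<mu>, m) \<in> ?S")
    case False
    then have "k \<notin> keys w" unfolding k by force
    then show ?thesis using False by (simp add: in_keys_iff)
  qed simp
  finally show "lookup w k = lookup (\<Sum>(D, a)\<in>?S. fock_restrict (\<lambda>\<mu> m. deg \<mu> = D \<and> m = a) w) k" ..
qed

context heisenberg_level
begin

lemma homog_nord:
  assumes "\<And>n D w. homog D m w \<Longrightarrow> homog (D + K - n - 1) m' (B n w)" "homog D m w"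
  shows "homog (D + (K + int j + 1) - n - 1) m' (nord j B n w)"
  unfolding nord_def
proof (intro homog_add homog_Sum_any homog_smul)
  fix i
  show "homog (D + (K + int j + 1) - n - 1) m' (h (- int i - 1) (B (n + int i - int j) w))"
    using homog_heisenberg[where p = p and n = "- int i - 1", OF assms(1)[OF assms(2), of "n + int i - int j"]]
    by (simp add: algebra_simps)
  show "homog (D + (K + int j + 1) - n - 1) m' (B (n - int i - int j - 1) (h (int i) w))"
    using assms(1)[OF homog_heisenberg[where p = p and n = "int i", OF assms(2)], of "n - int i - int j - 1"]
    by (simp add: algebra_simps)
qed

lemma homog_Yl:
  "homog D m w \<Longrightarrow> homog (D + (int (deg (mset js)) - a * m div int (2 * p)) - n - 1) (a + m) (Yl js a n w)"
proof (induction js arbitrary: D w n)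
  case Nil
  then show ?case using homog_lf[OF Nil, of n a] by (simp add: algebra_simps)
next
  case (Cons j js)
  have "homog (D + ((int (deg (mset js)) - a * m div int (2 * p)) + int j + 1) - n - 1) (a + m) (nord j (Yl js a) n w)"
    by (rule homog_nord[OF Cons.IH Cons.prems])
  then show ?case by (simp add: algebra_simps)
qed

lemma homog_Y:
  assumes u: "homog D' a u" and w: "homog D m w"
  shows "homog (D + D' - a * m div int (2 * p) - n - 1) (a + m) (Y u n w)"
proof (rule homog_lin[OF lin_Y_left u])
  fix \<mu> assume "int (deg \<mu>) = D'"
  then show "homog (D + D' - a * m div int (2 * p) - n - 1) (a + m) (Y (bv \<mu> a) n w)"
    using homog_Yl[OF w, of "sorted_list_of_multiset \<mu>" a n] by (simp add: Y_basis algebra_simps)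
qed

lemma lattice_space_iff: "v \<in> lattice_space p \<longleftrightarrow> (\<forall>\<mu> m. (\<mu>, m) \<in> keys v \<longrightarrow> int (2 * p) dvd m)"
  by (auto simp: lattice_space_def)

lemma mom_Y: "mom a u \<Longrightarrow> mom c w \<Longrightarrow> mom (a + c) (Y u n w)"
proof -
  assume u: "mom a u" and w: "mom c w"
  have b: "mom (a + c) (Y (bv \<mu> a) n (bv \<nu> c))" for \<mu> \<nu>
  proof -
    have "homog (int (deg \<nu>) + int (deg \<mu>) - a * c div int (2 * p) - n - 1) (a + c)
        (Y (bv \<mu> a) n (bv \<nu> c))"
      by (rule homog_Y[OF homog_basis homog_basis])
    then show ?thesis by (auto simp: homog_def mom_def)
  qed
  have "mom (a + c) (Y (bv \<mu> a) n w)" for \<mu>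
    by (rule mom_lin[OF lin_Y w b])
  then show ?thesis by (rule mom_lin[OF lin_Y_left u])
qed

lemma lattice_space_zero [simp]: "0 \<in> lattice_space p"
  by (simp add: lattice_space_iff)

lemma lattice_space_add: "u \<in> lattice_space p \<Longrightarrow> v \<in> lattice_space p \<Longrightarrow> u + v \<in> lattice_space p"
  unfolding lattice_space_iff using Poly_Mapping.keys_add[of u v] by blast

lemma lattice_space_smul: "v \<in> lattice_space p \<Longrightarrow> smul c v \<in> lattice_space p"
  unfolding lattice_space_iff using keys_smul[of c v] by blast

lemma lattice_space_sum: "(\<And>x. x \<in> A \<Longrightarrow> f x \<in> lattice_space p) \<Longrightarrow> sum f A \<in> lattice_space p"
  by (induction A rule: infinite_finite_induct) (auto intro: lattice_space_add)

lemma mom_lattice_space: "mom a v \<Longrightarrow> int (2 * p) dvd a \<Longrightarrow> v \<in> lattice_space p"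
  by (auto simp: mom_def lattice_space_iff)

lemma lattice_space_lin:
  assumes "lin T" "v \<in> lattice_space p"
    and "\<And>\<mu> m. int (2 * p) dvd m \<Longrightarrow> T (bv \<mu> m) \<in> lattice_space p"
  shows "T v \<in> lattice_space p"
proof -
  have "T v = (\<Sum>k\<in>keys v. smul (lookup v k) (T (bv (fst k) (snd k))))"
    using arg_cong[OF fock_expand[of v], of T] by (simp only: lin_sum[OF assms(1)] lin_smul[OF assms(1)])
  also have "\<dots> \<in> lattice_space p"
  proof (intro lattice_space_sum lattice_space_smul)
    fix k assume "k \<in> keys v"
    with assms(2) have "int (2 * p) dvd snd k" unfolding lattice_space_iff by (metis prod.collapse)
    with assms(3) show "T (bv (fst k) (snd k)) \<in> lattice_space p" .
  qed
  finally show ?thesis .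
qed

lemma lattice_space_Y: "u \<in> lattice_space p \<Longrightarrow> v \<in> lattice_space p \<Longrightarrow> Y u n v \<in> lattice_space p"
proof -
  assume u: "u \<in> lattice_space p" and v: "v \<in> lattice_space p"
  have "Y (bv \<mu> a) n (bv \<nu> c) \<in> lattice_space p"
    if "int (2 * p) dvd a" "int (2 * p) dvd c" for \<mu> a \<nu> c
    using mom_Y[of a "bv \<mu> a" c "bv \<nu> c" n] that by (auto intro: mom_lattice_space)
  then have "Y (bv \<mu> a) n v \<in> lattice_space p" if "int (2 * p) dvd a" for \<mu> a
    using that by (intro lattice_space_lin[OF lin_Y v])
  then show ?thesis by (intro lattice_space_lin[OF lin_Y_left u])
qed

lemma B_ext:
  assumes "\<And>\<mu> a \<nu> b \<kappa> c. (\<mu>, a) \<in> keys u \<Longrightarrow> (\<nu>, b) \<in> keys v \<Longrightarrow>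
     (\<kappa>, c) \<in> keys w \<Longrightarrow>
     BL l m n (bv \<mu> a) (bv \<nu> b) (bv \<kappa> c) =
     BR l m n (bv \<mu> a) (bv \<nu> b) (bv \<kappa> c)"
  shows "BL l m n u v w = BR l m n u v w"
proof -
  let ?D = "\<lambda>u v w. BL l m n u v w - BR l m n u v w"
  have 1: "?D (bv \<mu> a) (bv \<nu> b) w = 0"
    if "(\<mu>, a) \<in> keys u" "(\<nu>, b) \<in> keys v" for \<mu> a \<nu> b
    by (rule lin_ext_on[OF lin_B(1) lin_0]) (simp add: assms that)
  have 2: "?D (bv \<mu> a) v w = 0" if "(\<mu>, a) \<in> keys u" for \<mu> a
    by (rule lin_ext_on[OF lin_B(3) lin_0]) (rule 1[OF that])
  have "?D u v w = 0"
    by (rule lin_ext_on[OF lin_B(2) lin_0]) (rule 2)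
  then show ?thesis by simp
qed

text \<open>Inner products within L are even and those of L with the dual lattice are integers, so
  \<open>Borcherds_mom\<close> applies to each triple of basis vectors, the third of any
  momentum.\<close>

theorem Borcherds:
  assumes u: "u \<in> lattice_space p" and v: "v \<in> lattice_space p"
  shows "BL l m n u v w = BR l m n u v w"
proof (rule B_ext)
  fix \<mu> a \<nu> b \<kappa> c
  assume "(\<mu>, a) \<in> keys u" "(\<nu>, b) \<in> keys v"
  with u v obtain a' b' where a: "a = int (2 * p) * a'" and b: "b = int (2 * p) * b'"
    unfolding lattice_space_iff by (metis dvdE)
  show "BL l m n (bv \<mu> a) (bv \<nu> b) (bv \<kappa> c) =
     BR l m n (bv \<mu> a) (bv \<nu> b) (bv \<kappa> c)"
    by (rule Borcherds_mom[of a c "a' * c" b "b' * c" "int (2 * p) * (a' * b')"]) (simp_all add: a b)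
qed

lemma screening_Y: "screening p v = Y (bv {#} (- 2)) 0 v"
  by (simp add: screening_def Y_def)

lemma lin_screening: "lin (screening p)"
proof -
  have "screening p = Y (bv {#} (- 2)) 0" by (rule ext) (rule screening_Y)
  then show ?thesis by (simp only: lin_Y)
qed

text \<open>A zero mode acts as a derivation: this is the Borcherds identity at l = m = 0, where
  each sum has one term. It is available because -\<alpha>/p has even inner products with L.\<close>

lemma screening_derivation:
  assumes u: "u \<in> lattice_space p" and v: "v \<in> lattice_space p"
  shows "screening p (Y u n v) = Y u n (screening p v) + Y (screening p u) n v"
proof -
  let ?e = "bv {#} (- 2)"
  have "BL 0 0 n ?e u v = BR 0 0 n ?e u v"
  proof (rule B_ext)
    fix \<mu> a \<nu> b \<kappa> c
    assume "(\<mu>, a) \<in> keys ?e" "(\<nu>, b) \<in> keys u" "(\<kappa>, c) \<in> keys v"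
    with u v have a: "a = - 2" and "int (2 * p) dvd b" "int (2 * p) dvd c"
      unfolding lattice_space_iff by auto
    then obtain b' c' where b: "b = int (2 * p) * b'" and c: "c = int (2 * p) * c'"
      by (metis dvdE)
    show "BL 0 0 n (bv \<mu> a) (bv \<nu> b) (bv \<kappa> c) =
       BR 0 0 n (bv \<mu> a) (bv \<nu> b) (bv \<kappa> c)"
      by (rule Borcherds_mom[of a c "- 2 * c'" b "b' * c" "- 2 * b'"]) (simp_all add: a b c)
  qed
  moreover have "BL 0 0 n ?e u v = (\<Sum>i<1. smul (of_int 0 gchoose i) (Y (Y ?e (0 + int i) u) (0 + n - int i) v))"
    unfolding BL_def by (rule Sum_any_lessThan) (auto simp: gbinomial_0_left)
  moreover have "BR 0 0 n ?e u v = (\<Sum>i<1. smul ((- 1) ^ i * (of_int 0 gchoose i))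
     (Y ?e (0 + 0 - int i) (Y u (n + int i) v) - smul ((- 1) powi 0) (Y u (0 + n - int i) (Y ?e (0 + int i) v))))"
    unfolding BR_def by (rule Sum_any_lessThan) (auto simp: gbinomial_0_left)
  ultimately show ?thesis by (simp add: screening_Y algebra_simps)
qed

abbreviation W :: "fock set" where "W \<equiv> carrier (triplet p)"

lemma W_iff: "v \<in> W \<longleftrightarrow> v \<in> lattice_space p \<and> screening p v = 0"
  by (simp add: triplet_def)

lemma W_lattice: "v \<in> W \<Longrightarrow> v \<in> lattice_space p"
  by (simp add: W_iff)

lemma W_smul: "v \<in> W \<Longrightarrow> smul c v \<in> W"
  by (simp add: W_iff lattice_space_smul lin_smul[OF lin_screening])

lemma W_Y: "u \<in> W \<Longrightarrow> v \<in> W \<Longrightarrow> Y u n v \<in> W"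
  by (simp add: W_iff lattice_space_Y screening_derivation)

text \<open>The screening operator sends vectors homogeneous in degree and momentum to such vectors,
  and distinct bidegrees to distinct ones. Hence it intertwines projections to components, and its
  kernel is bigraded.\<close>

lemma W_restrict:
  assumes v: "v \<in> W"
  shows "fock_restrict (\<lambda>\<mu> m. deg \<mu> = D \<and> m = a) v \<in> W"
proof -
  let ?P = "\<lambda>\<mu> m. deg \<mu> = D \<and> m = a"
  let ?P' = "\<lambda>\<mu> m. int (deg \<mu>) = int D - 1 - (- 2 * a) div int (2 * p) \<and> m = a - 2"
  have "screening p (fock_restrict ?P v) = fock_restrict ?P' (screening p v)"
  proof (rule lin_ext[OF lin_comp[OF lin_screening lin_restrict] lin_comp[OF lin_restrict lin_screening]])
    fix \<mu> m
    have hs: "homog (int (deg \<mu>) - 1 - (- 2 * m) div int (2 * p)) (m - 2) (screening p (bv \<mu> m))"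
      using homog_lf[OF homog_basis, of \<mu> 0 "- 2" m] by (simp add: screening_Y)
    show "screening p (fock_restrict ?P (bv \<mu> m)) = fock_restrict ?P' (screening p (bv \<mu> m))"
    proof (cases "deg \<mu> = D \<and> m = a")
      case True
      have "fock_restrict ?P' (screening p (bv \<mu> m)) = screening p (bv \<mu> m)"
        by (rule fock_restrict_id) (use hs True in \<open>auto simp: homog_def\<close>)
      then show ?thesis using True by simp
    next
      case False
      have "fock_restrict ?P' (screening p (bv \<mu> m)) = 0"
        by (rule fock_restrict_0) (use hs False in \<open>auto simp: homog_def\<close>)
      then show ?thesis using False by (auto simp: lin_zero[OF lin_screening])
    qed
  qed
  then show ?thesis
    using v by (auto simp: W_iff lattice_space_iff keys_restrict lin_zero[OF lin_restrict])
qed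

section \<open>The conformal vector\<close>

lemma cre_zero: "cre 0 z w = (if z = 0 then w else 0)"
proof (cases "z > 0")
  case True
  then obtain q where q: "z = int q" "q > 0" by (metis zero_less_imp_eq_int)
  have "smul (of_nat q) (cre 0 (int q) w) = 0" by (simp add: cre_rec)
  then show ?thesis using q by simp
next
  case False
  then show ?thesis by (cases "z = 0") (simp_all, simp add: cre_def)
qed

lemma lf_vacuum: "lf 0 n w = (if n = - 1 then w else 0)"
proof -
  have ann0: "ann 0 (int d) x = (if d = 0 then x else 0)" for d x
  proof (cases d)
    case (Suc e)
    have "exp_annihilation p 0 = exp_creation p 0"
      by (rule ext, rule ext) (simp add: exp_annihilation_def exp_creation_def)
    then show ?thesis using cre_zero[of "int d" x] Suc by (simp add: ann_def cre_def)
  qed simp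
  have "lf 0 n w = (\<lambda>w. if n = - 1 then w else 0) w"
  proof (rule lin_ext[OF lin_lf])
    show "lin (\<lambda>w. if n = - 1 then w else 0)" by (cases "n = - 1") (simp_all add: lin_id lin_0)
    fix \<mu> m
    have "lf 0 n (bv \<mu> m) = (\<Sum>d<Suc (deg \<mu>). cre 0 (int d - n - 1) (ann 0 (int d) (bv \<mu> m)))"
      using lf_basis[of 0 m \<mu> "Suc (deg \<mu>)" n] by simp
    also have "\<dots> = (\<Sum>d<Suc (deg \<mu>). if d = 0 then cre 0 (- n - 1) (bv \<mu> m) else 0)"
      by (intro sum.cong refl) (auto simp: ann0 lin_zero[OF lin_cre])
    also have "\<dots> = (if n = - 1 then bv \<mu> m else 0)"
      by (auto simp: cre_zero)
    finally show "lf 0 n (bv \<mu> m) = (if n = - 1 then bv \<mu> m else 0)" .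
  qed
  then show ?thesis by simp
qed

lemma Y_vacuum: "Y (bv {#} 0) n w = (if n = - 1 then w else 0)"
  by (simp add: lf_vacuum)

lemma Y_alpha: "Y (bv {#0#} 0) n w = h n w"
proof -
  have e: "bv {#0#} 0 = h (- int 0 - 1) (bv {#} 0)"
    by (simp only: heisenberg_neg)
  have "Y (bv {#0#} 0) n w =
     Sum_any (\<lambda>i. h (- int i - 1) (if n + int i = - 1 then w else 0)) +
     Sum_any (\<lambda>i. if n - int i - 1 = - 1 then h (int i) w else 0)"
    unfolding e Y_creation nord_def Y_vacuum by simp
  also have "Sum_any (\<lambda>i. h (- int i - 1) (if n + int i = - 1 then w else 0)) = (if n < 0 then h n w else 0)"
  proof (cases "n < 0")
    case True
    then have "n + int i = - 1 \<longleftrightarrow> i = nat (- n - 1)" for i by auto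
    then show ?thesis
      using True Sum_any_single[of "nat (- n - 1)" "\<lambda>i. h (- int i - 1) (if n + int i = - 1 then w else 0)"] by simp
  next
    case False
    then have "n + int i \<noteq> - 1" for i by auto
    then show ?thesis using False by simp
  qed
  also have "Sum_any (\<lambda>i. if n - int i - 1 = - 1 then h (int i) w else 0) = (if n < 0 then 0 else h n w)"
  proof (cases "n < 0")
    case False
    then obtain k where "n = int k" by (metis nonneg_eq_int not_less)
    then show ?thesis
      using Sum_any_single[of k "\<lambda>i. if n - int i - 1 = - 1 then h (int i) w else 0"] by simp
  qed simp
  finally show ?thesis by simp
qed

abbreviation \<omega> :: fock where "\<omega> \<equiv> conformal_vector p"

lemma heis_omega:
  "h 0 \<omega> = 0" "h 1 \<omega> = bv {#0#} 0" "h 2 \<omega> = smul (2 * (of_nat p - 1)) (bv {#} 0)"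
  "i \<ge> 3 \<Longrightarrow> h (int i) \<omega> = 0"
proof -
  have b: "h (int j + 1) \<omega> = smul (1 / (4 * of_nat p)) (h (int j + 1) (bv {#0, 0#} 0)) +
     smul ((of_nat p - 1) / (2 * of_nat p)) (h (int j + 1) (bv {#1#} 0))" for j
    by (simp add: conformal_vector_def)
  show "h 0 \<omega> = 0" by (simp add: conformal_vector_def)
  show "h 1 \<omega> = bv {#0#} 0"
    using b[of 0] heisenberg_pos[of p 0 "{#0, 0#}" 0] heisenberg_pos[of p 0 "{#1#}" 0] p_pos by simp
  show "h 2 \<omega> = smul (2 * (of_nat p - 1)) (bv {#} 0)"
  proof -
    have c: "(of_nat p - 1) / (2 * of_nat p) * of_nat (2 * p * (1 + 1) * 1) = (2 * (of_nat p - 1) :: complex)"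
      using p_pos by (simp add: field_simps)
    have "h 2 \<omega> = smul ((of_nat p - 1) / (2 * of_nat p)) (smul (of_nat (2 * p * (1 + 1) * 1)) (bv {#} 0))"
      using b[of 1] heisenberg_pos[of p 1 "{#0, 0#}" 0] heisenberg_pos[of p 1 "{#1#}" 0] by simp
    then show ?thesis unfolding smul.scale_scale c .
  qed
  show "h (int i) \<omega> = 0" if "i \<ge> 3"
  proof -
    define j where "j = i - 1"
    have j: "i = Suc j" "j \<ge> 2" using that by (auto simp: j_def)
    then show ?thesis using b[of j] by (simp add: add.commute)
  qed
qed

text \<open>The linear term of \<omega> would enter through \<alpha>(2) \<omega>, a multiple of the
  vacuum. Its contribution is concentrated at k = 0 and carries the factor (k choose 2), which is 0
  there.\<close>

lemma heis_L0: "h k (Y \<omega> 1 w) = Y \<omega> 1 (h k w) + smul (of_int k) (h k w)"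
proof -
  have "Sum_any (\<lambda>i. smul (of_int k gchoose i) (Y (h (int i) \<omega>) (1 + k - int i) w)) =
     (\<Sum>i<3. smul (of_int k gchoose i) (Y (h (int i) \<omega>) (1 + k - int i) w))"
    by (rule Sum_any_lessThan) (simp add: heis_omega)
  also have "\<dots> = smul (of_int k) (h k w) + smul (of_int k gchoose 2) (smul (2 * (of_nat p - 1)) (if k = 0 then w else 0))"
  proof -
    have "{..<3} = {0, 1, 2 :: nat}" by auto
    then show ?thesis by (simp add: heis_omega Y_alpha lf_vacuum)
  qed
  also have "\<dots> = smul (of_int k) (h k w)"
    by (simp add: gbinomial_0_left)
  finally show ?thesis unfolding Y_heis[of k \<omega>] by simp
qed

definition wt0 :: "int \<Rightarrow> complex" where
  "wt0 m = of_int (m * (m - 2 * int p + 2)) / (4 * of_nat p)"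

lemma homog_omega: "homog 2 0 \<omega>"
  unfolding conformal_vector_def
  by (intro homog_add homog_smul) (simp_all add: homog_def)

lemma L0_vac: "Y \<omega> 1 (bv {#} m) = smul (wt0 m) (bv {#} m)"
proof -
  have "homog 0 m (Y \<omega> 1 (bv {#} m))"
    using homog_Y[OF homog_omega homog_basis, of "{#}" m 1] by simp
  then have k: "keys (Y \<omega> 1 (bv {#} m)) \<subseteq> {({#}, m)}"
  proof -
    assume hm: "homog 0 m (Y \<omega> 1 (bv {#} m))"
    have "\<mu> = {#}" if "deg \<mu> = 0" for \<mu> using that by (cases \<mu>) auto
    then show ?thesis using hm by (auto simp: homog_def)
  qed
  have v: "vac m (Y \<omega> 1 (bv {#} m)) = wt0 m"
    unfolding conformal_vector_def wt0_def
    using p_pos by (simp add: vac_Y vac_lf field_simps power2_eq_square)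
  show ?thesis
  proof (rule poly_mapping_eqI)
    fix x
    show "lookup (Y \<omega> 1 (bv {#} m)) x = lookup (smul (wt0 m) (bv {#} m)) x"
      using k v by (cases "x = ({#}, m)") (auto simp: vac_def lookup_smul lookup_basis_vector in_keys_iff)
  qed
qed

lemma L0_basis: "Y \<omega> 1 (bv \<mu> m) = smul (wt0 m + of_nat (deg \<mu>)) (bv \<mu> m)"
proof (induction \<mu>)
  case empty
  show ?case by (simp add: L0_vac)
next
  case (add j \<mu>)
  have "Y \<omega> 1 (h (- int j - 1) (bv \<mu> m)) =
      h (- int j - 1) (Y \<omega> 1 (bv \<mu> m)) - smul (of_int (- int j - 1)) (h (- int j - 1) (bv \<mu> m))"
    unfolding heis_L0[of "- int j - 1"] by (simp del: heisenberg_neg)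
  also have "\<dots> = smul (wt0 m + of_nat (deg \<mu>) + of_nat j + 1) (bv (add_mset j \<mu>) m)"
    unfolding add heisenberg_lin_simps heisenberg_neg smul.scale_left_diff_distrib[symmetric]
    by (rule arg_cong2[of _ _ _ _ smul]) simp_all
  finally show ?case by (simp add: ac_simps)
qed

end

section \<open>The derivative of the action in the direction of the momentum\<close>

text \<open>At \<open>i = 0\<close> the value is \<open>0\<close> by the convention for division.\<close>

definition log_coeff :: "nat \<Rightarrow> complex" where
  "log_coeff i = (- 1) ^ (i + 1) / of_nat i"

lemma log_coeff_0 [simp]: "log_coeff 0 = 0"
  by (simp add: log_coeff_def)

text \<open>Coefficients of log(1 + z + w) = log(1 + z) + (sum over q \<ge> 1 of
  \<open>log_coeff q\<close> w^q (1 + z)^(-q)). The exceptional term q = 0 is the origin of the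
  correction in \<open>DY_Borcherds\<close>.\<close>

lemma log_coeff_choose:
  assumes "q \<ge> 1"
  shows "log_coeff (s + q) * (of_nat (s + q) gchoose q) = log_coeff q * ((- of_nat q) gchoose s)"
proof -
  obtain r where r: "q = Suc r" using assms by (cases q) auto
  have "(- of_nat q :: complex) gchoose s = (- 1) ^ s * of_nat (r + s choose s)"
  proof -
    have "(- of_nat q :: complex) = - of_nat r - 1" by (simp add: r)
    then show ?thesis by (simp only: neg_gchoose)
  qed
  moreover have "(r + s choose s) = (s + r choose r)"
    using binomial_symmetric[of s "r + s"] by (simp add: add.commute)
  moreover have "of_nat q * of_nat (s + q choose q) = (of_nat (s + q) * of_nat (s + r choose r) :: complex)"
    using arg_cong[OF binomial_absorption[of r "s + q"], of "of_nat :: nat \<Rightarrow> complex"]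
    by (simp only: r of_nat_mult) simp
  moreover have "of_nat (s + q) \<noteq> (0::complex)" "of_nat q \<noteq> (0::complex)" using assms by (simp_all del: of_nat_add)
  ultimately show ?thesis
    unfolding log_coeff_def binomial_gbinomial[symmetric]
    by (simp add: field_simps power_add del: of_nat_add)
qed

context heisenberg_level
begin

text \<open>If the momentum is shifted by \<open>t\<close>, the field \<open>Y(v, x)\<close> becomes \<open>Y(\<Delta>(x) v, x)\<close> with
  \<open>\<Delta>(x) = x\<^bsup>t \<alpha>(0)\<^esup> exp (t \<Sum>\<^bsub>i\<ge>1\<^esub> (-1)\<^bsup>i+1\<^esup> \<alpha>(i) x\<^bsup>-i\<^esup>/i)\<close>, up to a scaling of \<open>t\<close>. The field
  \<open>DY v\<close> is the \<open>t\<close>-derivative at \<open>t = 0\<close> without the logarithmic term \<open>log x Y(\<alpha>(0) v, x)\<close>.\<close>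

definition DY :: "fock \<Rightarrow> int \<Rightarrow> fock \<Rightarrow> fock" where
  "DY v s w = Sum_any (\<lambda>i. smul (log_coeff i) (Y (h (int i) v) (s - int i) w))"

lemma lin_DY: "lin (DY v s)"
  unfolding DY_def by (rule lin_Sum_any, rule lin_scale, rule lin_Y, rule HC_ez)

lemma lin_DY_left: "lin (\<lambda>v. DY v s w)"
  unfolding DY_def by (rule lin_Sum_any, rule lin_scale, rule lin_comp[OF lin_Y_left lin_heisenberg], rule HC_ez)

lemma DY_lessThan:
  assumes "\<forall>q\<ge>Q. h (int q) v = 0"
  shows "DY v s w = (\<Sum>q<Q. smul (log_coeff q) (Y (h (int q) v) (s - int q) w))"
  unfolding DY_def using assms by (intro Sum_any_lessThan) simp

lemma ez_DY_up: "ez (\<lambda>i. DY v (n + int i) w)"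
proof -
  obtain Q where Q: "\<forall>q\<ge>Q. h (int q) v = 0"
    using ez_heisenberg[of p v] unfolding ez_def by blast
  have e: "ez (\<lambda>i. smul (log_coeff q) (Y (h (int q) v) (n + int i - int q) w))" for q
    using ez_smul[OF ez_Y_up[of "h (int q) v" "n - int q" w], of "\<lambda>_. log_coeff q"]
    by (simp add: algebra_simps)
  show ?thesis
    unfolding DY_lessThan[OF Q]
    using Sum_any_sum[of "{..<Q}" "\<lambda>i q. smul (log_coeff q) (Y (h (int q) v) (n + int i - int q) w)", OF finite_lessThan e]
    by (rule conjunct2)
qed

definition DBR :: "int \<Rightarrow> int \<Rightarrow> int \<Rightarrow> fock \<Rightarrow> fock \<Rightarrow> fock \<Rightarrow> nat \<Rightarrow> fock" where
  "DBR l m n u v w i = smul ((- 1) ^ i * (of_int l gchoose i))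
     ((DY u (l + m - int i) (Y v (n + int i) w) + Y u (l + m - int i) (DY v (n + int i) w)) -
      smul ((- 1) powi l) (DY v (l + n - int i) (Y u (m + int i) w) + Y v (l + n - int i) (DY u (m + int i) w)))"

text \<open>\<open>DBR\<close> is the product rule applied to the right-hand side of the Borcherds
  identity. As each \<open>DY\<close> is a combination of the fields of \<alpha>(q) u or \<alpha>(q)
  v, collecting terms by q gives ordinary right-hand sides.\<close>

lemma DBR_sum:
  assumes Qu: "\<forall>q\<ge>Q. h (int q) u = 0" and Qv: "\<forall>q\<ge>Q. h (int q) v = 0"
  shows "Sum_any (DBR l m n u v w) = (\<Sum>q<Q. smul (log_coeff q) (BR l (m - int q) n (h (int q) u) v w)) +
     (\<Sum>q<Q. smul (log_coeff q) (BR l m (n - int q) u (h (int q) v) w))"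
    and "ez (DBR l m n u v w)"
proof -
  let ?cf = "\<lambda>i. (- 1) ^ i * (of_int l gchoose i) :: complex"
  let ?t = "\<lambda>m n u v i. smul (?cf i) (Y u (l + m - int i) (Y v (n + int i) w) -
      smul ((- 1) powi l) (Y v (l + n - int i) (Y u (m + int i) w)))"
  have ezt: "ez (?t m n u v)" for m n u v by (rule ez_BR)
  let ?e = "\<lambda>i q. smul (log_coeff q) (?t (m - int q) n (h (int q) u) v i)"
  let ?f = "\<lambda>i q. smul (log_coeff q) (?t m (n - int q) u (h (int q) v) i)"
  have T1: "DBR l m n u v w i = (\<Sum>q<Q. ?e i q) + (\<Sum>q<Q. ?f i q)" for i
  proof -
    have i: "l + m - int i - int q = l + (m - int q) - int i"
      "n + int i - int q = n - int q + int i"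
      "l + n - int i - int q = l + (n - int q) - int i"
      "m + int i - int q = m - int q + int i" for q by simp_all
    have c: "smul (log_coeff q) (smul x (A - smul y B)) = smul x (smul (log_coeff q) A - smul y (smul (log_coeff q) B))" for q x y A B
      by (simp add: smul.scale_right_diff_distrib mult.commute mult.left_commute)
    show ?thesis
      unfolding DBR_def DY_lessThan[OF Qu] DY_lessThan[OF Qv] lin_sum[OF lin_Y] lin_smul[OF lin_Y] i c
        smul.scale_sum_right[symmetric] sum_subtractf
      by (simp add: smul.scale_right_distrib smul.scale_right_diff_distrib)
  qed
  have eze: "ez (\<lambda>i. ?e i q)" for q by (rule ez_smul[OF ezt])
  have ezf: "ez (\<lambda>i. ?f i q)" for q by (rule ez_smul[OF ezt])
  note SE = Sum_any_sum[of "{..<Q}" ?e, OF finite_lessThan eze]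
  note SF = Sum_any_sum[of "{..<Q}" ?f, OF finite_lessThan ezf]
  have "Sum_any (DBR l m n u v w) = Sum_any (\<lambda>i. (\<Sum>q<Q. ?e i q) + (\<Sum>q<Q. ?f i q))"
    by (rule arg_cong[of _ _ Sum_any], rule ext, rule T1)
  also have "\<dots> = (\<Sum>q<Q. Sum_any (\<lambda>i. ?e i q)) + (\<Sum>q<Q. Sum_any (\<lambda>i. ?f i q))"
    unfolding Sum_any_plus[OF conjunct2[OF SE] conjunct2[OF SF]] conjunct1[OF SF] conjunct1[OF SE] ..
  finally have T: "Sum_any (DBR l m n u v w) = \<dots>" .
  have E: "Sum_any (\<lambda>i. ?e i q) = smul (log_coeff q) (BR l (m - int q) n (h (int q) u) v w)" for q
    unfolding BR_def by (rule Sum_any_lin[OF ezt lin_scale[OF lin_id], symmetric])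
  have F: "Sum_any (\<lambda>i. ?f i q) = smul (log_coeff q) (BR l m (n - int q) u (h (int q) v) w)" for q
    unfolding BR_def by (rule Sum_any_lin[OF ezt lin_scale[OF lin_id], symmetric])
  show "Sum_any (DBR l m n u v w) = (\<Sum>q<Q. smul (log_coeff q) (BR l (m - int q) n (h (int q) u) v w)) +
     (\<Sum>q<Q. smul (log_coeff q) (BR l m (n - int q) u (h (int q) v) w))"
    unfolding T E F ..
  have "ez (\<lambda>i. (\<Sum>q<Q. ?e i q) + (\<Sum>q<Q. ?f i q))"
    by (rule ez_add[OF conjunct2[OF SE] conjunct2[OF SF]])
  then show "ez (DBR l m n u v w)"
    unfolding ez_def T1 .
qed

lemma lattice_space_heis: "v \<in> lattice_space p \<Longrightarrow> h k v \<in> lattice_space p"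
proof (rule lattice_space_lin[OF lin_heisenberg])
  fix \<mu> m assume "int (2 * p) dvd m"
  then show "h k (bv \<mu> m) \<in> lattice_space p"
    using mom_heisenberg[of m "bv \<mu> m" p k] by (auto intro: mom_lattice_space)
qed

lemma heis0_mom: "mom a u \<Longrightarrow> h 0 u = smul (of_int a) u"
  by (rule lin_ext_on[OF lin_heisenberg lin_scale[OF lin_id]]) (auto simp: mom_def)

text \<open>The right-hand side is what the dropped logarithmic terms contribute.\<close>

theorem DY_Borcherds:
  assumes u: "u \<in> lattice_space p" "mom a u" and v: "v \<in> lattice_space p"
  shows "Sum_any (\<lambda>i. smul (of_int m gchoose i) (DY (Y u (l + int i) v) (m + n - int i) w)) =
    Sum_any (DBR l m n u v w) + smul (of_int a) (Sum_any (\<lambda>t.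
      smul (\<Sum>i\<le>t. (of_int m gchoose i) * log_coeff (t - i)) (Y (Y u (l + int t) v) (m + n - int t) w)))"
proof -
  obtain Q1 where Q1: "\<forall>i\<ge>Q1. h (int i) u = 0"
    using ez_heisenberg[of p u] unfolding ez_def by blast
  obtain Q2 where Q2: "\<forall>i\<ge>Q2. h (int i) v = 0"
    using ez_heisenberg[of p v] unfolding ez_def by blast
  define Q where "Q = Suc (max Q1 Q2)"
  have Qu: "\<forall>q\<ge>Q. h (int q) u = 0" and Qv: "\<forall>q\<ge>Q. h (int q) v = 0"
    using Q1 Q2 by (auto simp: Q_def)
  \<comment> \<open>The input for \<open>BL_weighted\<close> when f = log(1 + z): its Taylor
    coefficient f^(q)/q! is f itself for q = 0 and \<open>log_coeff q\<close> (1 + z)^(-q) for q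
    \<ge> 1.\<close>
  let ?e = "\<lambda>q. if q = 0 then 1 else log_coeff q"
  let ?d = "\<lambda>q s. if q = 0 then log_coeff s else ((- of_nat q) gchoose s)"
  have c: "log_coeff (s + q) * (of_nat (s + q) gchoose q) = ?e q * ?d q s" for q s
    using log_coeff_choose[of q s] by (cases "q = 0") auto
  have W: "Sum_any (\<lambda>i. smul (of_int m gchoose i) (DY (Y u (l + int i) v) (m + n - int i) w)) =
      (\<Sum>q<Q. smul (?e q) (Sum_any (\<lambda>t. smul (\<Sum>i\<le>t. (of_int m gchoose i) * ?d q (t - i))
         (Y (Y (h (int q) u) (l + int t) v) (m + (0 - int q) + n - int t) w)))) +
      (\<Sum>q<Q. smul (log_coeff q) (BL l m (n + (0 - int q)) u (h (int q) v) w))"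
    using BL_weighted(1)[where kk = log_coeff and e = ?e and d = ?d and l = l and m = m and n = n and k = 0 and w = w, OF Qu Qv c]
    by (simp only: DY_def add_0_right)
  let ?g = "\<lambda>q. smul (?e q) (Sum_any (\<lambda>t. smul (\<Sum>i\<le>t. (of_int m gchoose i) * ?d q (t - i))
         (Y (Y (h (int q) u) (l + int t) v) (m + (0 - int q) + n - int t) w)))"
  have g0: "?g 0 = smul (of_int a) (Sum_any (\<lambda>t.
      smul (\<Sum>i\<le>t. (of_int m gchoose i) * log_coeff (t - i)) (Y (Y u (l + int t) v) (m + n - int t) w)))"
    unfolding Sum_any_lin[OF ez_BL lin_scale[OF lin_id]]
    by (simp add: heis0_mom[OF u(2)] mult.commute)
  have gq: "?g q = smul (log_coeff q) (BL l (m - int q) n (h (int q) u) v w)" if "q \<noteq> 0" for q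
  proof -
    have V: "(\<Sum>i\<le>t. (of_int m gchoose i) * ((- of_nat q) gchoose (t - i))) = (of_int (m - int q) gchoose t :: complex)" for t
      unfolding Vandermonde' by simp
    show ?thesis using that by (simp add: BL_def V)
  qed
  have "(\<Sum>q<Q. ?g q) = ?g 0 + (\<Sum>q<Q. smul (log_coeff q) (BL l (m - int q) n (h (int q) u) v w))"
  proof -
    have "(\<Sum>q<Q. ?g q) = (\<Sum>q<Q. (if q = 0 then ?g 0 else 0) + smul (log_coeff q) (BL l (m - int q) n (h (int q) u) v w))"
      by (intro sum.cong refl) (use gq in auto)
    also have "\<dots> = ?g 0 + (\<Sum>q<Q. smul (log_coeff q) (BL l (m - int q) n (h (int q) u) v w))"
      unfolding sum.distrib by (simp add: Q_def del: sum.lessThan_Suc)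
    finally show ?thesis .
  qed
  then have "Sum_any (\<lambda>i. smul (of_int m gchoose i) (DY (Y u (l + int i) v) (m + n - int i) w)) =
      ?g 0 + ((\<Sum>q<Q. smul (log_coeff q) (BL l (m - int q) n (h (int q) u) v w)) +
      (\<Sum>q<Q. smul (log_coeff q) (BL l m (n - int q) u (h (int q) v) w)))"
    unfolding W by simp
  also have "(\<Sum>q<Q. smul (log_coeff q) (BL l (m - int q) n (h (int q) u) v w)) +
      (\<Sum>q<Q. smul (log_coeff q) (BL l m (n - int q) u (h (int q) v) w)) = Sum_any (DBR l m n u v w)"
    unfolding DBR_sum(1)[OF Qu Qv] Borcherds[OF lattice_space_heis[OF u(1)] v] Borcherds[OF u(1) lattice_space_heis[OF v]] ..
  finally show ?thesis unfolding g0 by (simp only: add.commute)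
qed

lemma DY_vacuum: "DY (bv {#} 0) n w = 0"
proof -
  have "(\<lambda>i. smul (log_coeff i) (Y (h (int i) (bv {#} 0)) (n - int i) w)) = (\<lambda>_. 0)"
    by (rule ext) auto
  then show ?thesis unfolding DY_def by (simp only: Sum_any.neutral)
qed

text \<open>On momentum m this is m - p + 1, which is 2p times the derivative of \<open>wt0\<close>.
  It vanishes only at the midpoint p - 1 of the two momenta, and is opposite at the two.\<close>

lemma DY_omega1: "DY \<omega> 1 w = h 0 w - smul (of_nat p - 1) w"
proof -
  have "DY \<omega> 1 w = (\<Sum>q<3. smul (log_coeff q) (Y (h (int q) \<omega>) (1 - int q) w))"
    by (rule DY_lessThan) (simp add: heis_omega)
  moreover have "{..<3} = {0, 1, 2 :: nat}" by auto
  ultimately show ?thesis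
    by (simp add: heis_omega Y_alpha lf_vacuum log_coeff_def)
qed

end

section \<open>Linear functionals on polynomials\<close>

definition nodes :: "nat \<Rightarrow> complex set" where
  "nodes D = of_nat ` {..D}"

lemma finite_nodes [simp]: "finite (nodes D)"
  by (simp add: nodes_def)

lemma card_nodes: "card (nodes D) = Suc D"
  by (simp add: nodes_def card_image inj_on_def)

text \<open>By Lagrange interpolation a linear functional on polynomials of degree at most D is a
  weighted sum over D + 1 nodes. Residues thereby become finite sums, and iterated residues may be
  interchanged freely.\<close>

lemma quadrature:
  fixes m :: "nat \<Rightarrow> complex"
  shows "\<exists>c. \<forall>j\<le>D. (\<Sum>x\<in>nodes D. c x * x ^ j) = m j"
proof -
  define N where "N = nodes D"
  have fin: "finite N" by (simp add: N_def)
  define L where "L x = smult (1 / (\<Prod>y\<in>N - {x}. x - y)) (\<Prod>y\<in>N - {x}. [:- y, 1:])" for x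
  have L: "poly (L x) z = (if z = x then 1 else 0)" if "x \<in> N" "z \<in> N" for x z
  proof (cases "z = x")
    case True
    have "(\<Prod>y\<in>N - {x}. x - y) \<noteq> 0" using fin by simp
    then show ?thesis using True by (simp add: L_def poly_prod)
  next
    case False
    then have "(\<Prod>y\<in>N - {x}. z - y) = 0" using that fin by (intro prod_zero) auto
    then show ?thesis using False by (simp add: L_def poly_prod)
  qed
  have dL: "degree (L x) \<le> D" if "x \<in> N" for x
  proof -
    have "degree (\<Prod>y\<in>N - {x}. [:- y, 1:]) \<le> (\<Sum>y\<in>N - {x}. degree [:- y, 1:])"
      by (rule order_trans[OF degree_prod_sum_le]) (use fin in auto)
    also have "\<dots> = D" using that fin card_nodes[of D] by (simp add: N_def card_Diff_singleton)
    finally show ?thesis unfolding L_def by (rule order_trans[OF degree_smult_le])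
  qed
  define c where "c x = (\<Sum>i\<le>D. coeff (L x) i * m i)" for x
  have "(\<Sum>x\<in>N. c x * x ^ j) = m j" if j: "j \<le> D" for j
  proof -
    have p: "(\<Sum>x\<in>N. smult (x ^ j) (L x)) = monom 1 j"
    proof (rule poly_eqI_degree[where A = N])
      fix z assume z: "z \<in> N"
      have "poly (\<Sum>x\<in>N. smult (x ^ j) (L x)) z = (\<Sum>x\<in>N. if x = z then z ^ j else 0)"
        unfolding poly_sum by (intro sum.cong refl) (auto simp: L z)
      then show "poly (\<Sum>x\<in>N. smult (x ^ j) (L x)) z = poly (monom 1 j) z"
        using z fin by (simp add: poly_monom)
    next
      have "degree (\<Sum>x\<in>N. smult (x ^ j) (L x)) \<le> D"
        using fin dL by (intro degree_sum_le) (auto intro: order_trans[OF degree_smult_le])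
      then show "degree (\<Sum>x\<in>N. smult (x ^ j) (L x)) < card N"
        by (simp add: N_def card_nodes)
      show "degree (monom (1::complex) j) < card N"
        using j by (simp add: N_def card_nodes degree_monom_eq)
    qed
    have "(\<Sum>x\<in>N. c x * x ^ j) = (\<Sum>i\<le>D. (\<Sum>x\<in>N. x ^ j * coeff (L x) i) * m i)"
      unfolding c_def sum_distrib_right by (subst sum.swap) (simp add: sum_distrib_right mult_ac)
    also have "\<dots> = (\<Sum>i\<le>D. (if i = j then 1 else 0) * m i)"
    proof (intro sum.cong refl arg_cong2[of _ _ _ _ "(*)"])
      fix i
      show "(\<Sum>x\<in>N. x ^ j * coeff (L x) i) = (if i = j then 1 else 0)"
        using arg_cong[OF p, of "\<lambda>q. coeff q i"] by (simp add: coeff_sum)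
    qed
    also have "\<dots> = (\<Sum>i\<le>D. if i = j then m i else 0)" by (intro sum.cong refl) auto
    also have "\<dots> = m j" using j by simp
    finally show ?thesis .
  qed
  then show ?thesis unfolding N_def by blast
qed

definition functional :: "(nat \<Rightarrow> complex) \<Rightarrow> complex poly \<Rightarrow> complex" where
  "functional m p = (\<Sum>i\<le>degree p. coeff p i * m i)"

lemma functional_superset:
  assumes "degree p \<le> N" shows "functional m p = (\<Sum>i\<le>N. coeff p i * m i)"
  unfolding functional_def using assms
  by (intro sum.mono_neutral_left) (auto simp: coeff_eq_0 not_le)

lemma functional_add: "functional m (p + q) = functional m p + functional m q"
proof -
  let ?N = "max (degree p) (degree q)"
  have "degree (p + q) \<le> ?N" by (rule degree_add_le_max)
  then show ?thesis
    by (simp add: functional_superset[of _ ?N] distrib_right sum.distrib)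
qed

lemma functional_smult: "functional m (smult c p) = c * functional m p"
  by (simp add: functional_superset[of _ "degree p"] degree_smult_le sum_distrib_left mult.assoc)

lemma functional_0 [simp]: "functional m 0 = 0"
  by (simp add: functional_def)

lemma functional_sum: "functional m (sum f A) = (\<Sum>x\<in>A. functional m (f x))"
  by (induction A rule: infinite_finite_induct) (auto simp: functional_add)

lemma functional_monom: "functional m (monom c j) = c * m j"
proof -
  have "functional m (monom c j) = (\<Sum>i\<le>j. coeff (monom c j) i * m i)"
    by (rule functional_superset) (rule degree_monom_le)
  also have "\<dots> = (\<Sum>i\<le>j. if i = j then c * m j else 0)"
    by (intro sum.cong refl) auto
  finally show ?thesis by simp
qed

lemma functional_minus: "functional m (p - q) = functional m p - functional m q"
  using functional_add[of m p "- q"] functional_smult[of m "-1" q] by simp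

lemma functional_quadrature:
  assumes "\<forall>j\<le>D. (\<Sum>x\<in>nodes D. c x * x ^ j) = m j" "degree p \<le> D"
  shows "(\<Sum>x\<in>nodes D. c x * poly p x) = functional m p"
proof -
  have "(\<Sum>x\<in>nodes D. c x * poly p x) = (\<Sum>x\<in>nodes D. \<Sum>i\<le>D. coeff p i * (c x * x ^ i))"
  proof (intro sum.cong refl, goal_cases)
    case (1 x)
    have "poly p x = (\<Sum>i\<le>D. coeff p i * x ^ i)"
      unfolding poly_altdef using assms(2)
      by (intro sum.mono_neutral_left) (auto simp: coeff_eq_0 not_le)
    then show ?case
      by (simp add: sum_distrib_left mult_ac)
  qed
  also have "\<dots> = (\<Sum>i\<le>D. coeff p i * m i)"
    using assms(1) by (subst sum.swap) (simp add: sum_distrib_left[symmetric])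
  also have "\<dots> = functional m p"
    by (rule functional_superset[OF assms(2), symmetric])
  finally show ?thesis .
qed

definition mon :: "nat \<Rightarrow> (nat \<Rightarrow> nat) \<Rightarrow> (nat \<Rightarrow> complex) \<Rightarrow> complex" where
  "mon n \<mu> t = (\<Prod>i<n. t i ^ \<mu> i)"

text \<open>The weights \<open>C i\<close> on the nodes \<open>X\<close> represent a linear functional in the \<open>i\<close>-th variable.\<close>

definition wsum :: "(nat \<Rightarrow> complex \<Rightarrow> 'a::comm_ring_1) \<Rightarrow> complex set \<Rightarrow> nat \<Rightarrow> ((nat \<Rightarrow> complex) \<Rightarrow> 'a) \<Rightarrow> 'a" where
  "wsum C X n G = (\<Sum>t\<in>{..<n} \<rightarrow>\<^sub>E X. (\<Prod>i<n. C i (t i)) * G t)"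

lemma wsum_sum: "wsum C X n (\<lambda>t. \<Sum>j\<in>J. G j t) = (\<Sum>j\<in>J. wsum C X n (G j))"
  unfolding wsum_def sum_distrib_left by (rule sum.swap)

lemma wsum_add: "wsum C X n (\<lambda>t. G t + H t) = wsum C X n G + wsum C X n H"
  by (simp add: wsum_def distrib_left sum.distrib)

lemma wsum_diff: "wsum C X n (\<lambda>t. G t - H t) = wsum C X n G - wsum C X n H"
  by (simp add: wsum_def right_diff_distrib sum_subtractf)

lemma wsum_mult: "wsum C X n (\<lambda>t. c * G t) = c * wsum C X n G"
  by (simp add: wsum_def sum_distrib_left mult.left_commute)

lemma wsum_prod:
  "finite X \<Longrightarrow> wsum C X n (\<lambda>t. \<Prod>i<n. g i (t i)) = (\<Prod>i<n. \<Sum>x\<in>X. C i x * g i x)"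
  unfolding wsum_def by (simp add: prod.distrib[symmetric] prod_sum_PiE)

lemma wsum_Suc:
  assumes "finite X"
  shows "wsum C X (Suc n) G = wsum C X n (\<lambda>t. \<Sum>x\<in>X. C n x * G (t(n := x)))"
proof -
  have "{..<Suc n} \<rightarrow>\<^sub>E X = (\<lambda>(x, t). t(n := x)) ` (X \<times> ({..<n} \<rightarrow>\<^sub>E X))"
    by (simp add: lessThan_Suc PiE_insert_eq)
  moreover have "inj_on (\<lambda>(x, t). t(n := x)) (X \<times> ({..<n} \<rightarrow>\<^sub>E X))"
    using inj_combinator[of n "{..<n}" "\<lambda>_. X"] by simp
  ultimately have "wsum C X (Suc n) G =
      (\<Sum>(x, t)\<in>X \<times> ({..<n} \<rightarrow>\<^sub>E X). (\<Prod>i<Suc n. C i ((t(n := x)) i)) * G (t(n := x)))"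
    unfolding wsum_def by (simp add: sum.reindex case_prod_unfold)
  also have "\<dots> = (\<Sum>x\<in>X. \<Sum>t\<in>{..<n} \<rightarrow>\<^sub>E X. (\<Prod>i<Suc n. C i ((t(n := x)) i)) * G (t(n := x)))"
    by (rule sum.cartesian_product[symmetric])
  also have "\<dots> = (\<Sum>t\<in>{..<n} \<rightarrow>\<^sub>E X. \<Sum>x\<in>X. (\<Prod>i<n. C i (t i)) * (C n x * G (t(n := x))))"
    by (subst sum.swap) (simp add: mult.assoc)
  finally show ?thesis by (simp add: wsum_def sum_distrib_left)
qed

definition sw :: "nat \<Rightarrow> nat \<Rightarrow> nat \<Rightarrow> nat" where
  "sw i j = id(i := j, j := i)"

lemma sw_sw [simp]: "sw i j (sw i j k) = k"
  by (auto simp: sw_def)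

lemma sw_simps [simp]: "sw i j i = j" "sw i j j = i" "k \<noteq> i \<Longrightarrow> k \<noteq> j \<Longrightarrow> sw i j k = k"
  by (auto simp: sw_def)

lemma sw_less: "i < n \<Longrightarrow> j < n \<Longrightarrow> sw i j k < n \<longleftrightarrow> k < n"
  by (auto simp: sw_def)

lemma bij_betw_sw: "i < n \<Longrightarrow> j < n \<Longrightarrow> bij_betw (sw i j) {..<n} {..<n}"
  by (rule bij_betw_byWitness[of _ "sw i j"]) (auto simp: sw_less)

lemma wsum_swap:
  assumes "i < n" "j < n"
  shows "wsum C X n G = wsum (\<lambda>l. C (sw i j l)) X n (\<lambda>t. G (t \<circ> sw i j))"
proof -
  have PE: "t \<circ> sw i j \<in> {..<n} \<rightarrow>\<^sub>E X" if "t \<in> {..<n} \<rightarrow>\<^sub>E X" for t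
    using that assms by (auto simp: PiE_iff extensional_def sw_less)
  show ?thesis
    unfolding wsum_def
  proof (rule sum.reindex_bij_witness[of _ "\<lambda>t. t \<circ> sw i j" "\<lambda>t. t \<circ> sw i j"])
    fix t assume "t \<in> {..<n} \<rightarrow>\<^sub>E X"
    have "(\<Prod>l<n. C (sw i j l) (t (sw i j l))) = (\<Prod>l<n. C l (t l))"
      by (rule prod.reindex_bij_betw[OF bij_betw_sw[OF assms]])
    then show "(\<Prod>l<n. C (sw i j l) ((t \<circ> sw i j) l)) * G (t \<circ> sw i j \<circ> sw i j) = (\<Prod>l<n. C l (t l)) * G t"
      by (simp add: o_def)
  qed (rule PE, assumption | simp add: o_def)+
qed

lemma wsum_mon:
  assumes "finite X" "\<And>i. i < n \<Longrightarrow> (\<Sum>x\<in>X. C i x * x ^ \<mu> i) = m i"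
  shows "wsum C X n (mon n \<mu>) = (\<Prod>i<n. m i)"
proof -
  have "wsum C X n (mon n \<mu>) = (\<Prod>i<n. \<Sum>x\<in>X. C i x * x ^ \<mu> i)"
    using wsum_prod[OF assms(1), of C n "\<lambda>i x. x ^ \<mu> i"] by (simp add: mon_def[abs_def])
  then show ?thesis using assms(2) by simp
qed

text \<open>Functionals dual to the powers of each variable isolate the total coefficient of every
  exponent vector, so any function \<open>F\<close> of the exponent vector may replace the monomial.
  Exponents from n on are invisible to \<open>mon\<close>, hence the condition on
  \<open>F\<close>.\<close>

lemma mon_independent:
  assumes zero: "\<And>t. (\<Sum>e\<in>E. c e * mon n (\<nu> e) t) = 0" and fin: "finite E"
    and F: "\<And>\<mu> \<mu>'. (\<forall>i<n. \<mu> i = \<mu>' i) \<Longrightarrow> F \<mu> = F \<mu>'"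
  shows "(\<Sum>e\<in>E. c e * F (\<nu> e)) = (0::complex)"
proof -
  define D where "D = Max (insert 0 ((\<lambda>(e, i). \<nu> e i) ` (E \<times> {..<n})))"
  have D: "\<nu> e i \<le> D" if "e \<in> E" "i < n" for e i
    unfolding D_def using fin that by (intro Max_ge) auto
  define r where "r e = restrict (\<nu> e) {..<n}" for e
  have "\<exists>C. \<forall>j\<le>D. (\<Sum>x\<in>nodes D. C x * x ^ j) = (if j = b then 1 else 0)" for b
    by (rule quadrature)
  then obtain C where C: "\<And>b j. j \<le> D \<Longrightarrow> (\<Sum>x\<in>nodes D. C b x * x ^ j) = (if j = b then 1 else 0)"
    by metis
  have part: "(\<Sum>e\<in>{e\<in>E. r e = \<rho>}. c e) = 0" if "\<rho> \<in> r ` E" for \<rho>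
  proof -
    have W: "wsum (\<lambda>i. C (\<rho> i)) (nodes D) n (mon n (\<nu> e)) = (if r e = \<rho> then 1 else 0)" if "e \<in> E" for e
    proof -
      have "wsum (\<lambda>i. C (\<rho> i)) (nodes D) n (mon n (\<nu> e)) = (\<Prod>i<n. if \<nu> e i = \<rho> i then 1 else 0)"
        by (rule wsum_mon) (use C D that in auto)
      also have "\<dots> = (if \<forall>i<n. \<nu> e i = \<rho> i then 1 else 0)"
        by (cases "\<forall>i<n. \<nu> e i = \<rho> i") (auto intro!: prod.neutral prod_zero)
      also have "(\<forall>i<n. \<nu> e i = \<rho> i) \<longleftrightarrow> r e = \<rho>"
      proof
        assume a: "\<forall>i<n. \<nu> e i = \<rho> i"
        from \<open>\<rho> \<in> r ` E\<close> have "\<rho> i = undefined" if "\<not> i < n" for i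
          using that by (auto simp: r_def)
        with a show "r e = \<rho>" by (auto simp: r_def fun_eq_iff)
      qed (auto simp: r_def)
      finally show ?thesis .
    qed
    have "0 = wsum (\<lambda>i. C (\<rho> i)) (nodes D) n (\<lambda>t. \<Sum>e\<in>E. c e * mon n (\<nu> e) t)"
      by (simp add: zero wsum_def)
    also have "\<dots> = (\<Sum>e\<in>E. c e * wsum (\<lambda>i. C (\<rho> i)) (nodes D) n (mon n (\<nu> e)))"
      by (simp add: wsum_sum wsum_mult)
    also have "\<dots> = (\<Sum>e\<in>E. if r e = \<rho> then c e else 0)"
      by (intro sum.cong refl) (simp add: W)
    also have "\<dots> = (\<Sum>e\<in>{e\<in>E. r e = \<rho>}. c e)"
      using fin by (simp add: sum.inter_filter)
    finally show ?thesis ..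
  qed
  have "(\<Sum>e\<in>E. c e * F (\<nu> e)) = (\<Sum>e\<in>E. c e * F (r e))"
    by (intro sum.cong refl arg_cong2[of _ _ _ _ "(*)"] F) (simp add: r_def)
  also have "\<dots> = (\<Sum>\<rho>\<in>r ` E. \<Sum>e\<in>{e\<in>E. r e = \<rho>}. c e * F (r e))"
    by (rule sum.image_gen[OF fin])
  also have "\<dots> = (\<Sum>\<rho>\<in>r ` E. (\<Sum>e\<in>{e\<in>E. r e = \<rho>}. c e) * F \<rho>)"
    by (intro sum.cong refl) (simp add: sum_distrib_right)
  also have "\<dots> = 0" by (simp add: part)
  finally show ?thesis .
qed

section \<open>Selberg-type weights\<close>

definition pairs :: "nat \<Rightarrow> (nat \<times> nat) set" where
  "pairs n = {(i, j). i < n \<and> j < n \<and> i \<noteq> j}"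

text \<open>Ordered pairs are used, so that up to sign this is the 2k-th power of the usual product
  over i < j, and no sign appears under permutations.\<close>

definition vandermonde :: "nat \<Rightarrow> nat \<Rightarrow> (nat \<Rightarrow> complex) \<Rightarrow> complex" where
  "vandermonde k n t = (\<Prod>(i, j)\<in>pairs n. t i - t j) ^ k"

lemma finite_pairs [simp]: "finite (pairs n)"
  by (rule finite_subset[of _ "{..<n} \<times> {..<n}"]) (auto simp: pairs_def)

lemma pairs_0: "pairs 0 = {}" by (auto simp: pairs_def)

lemma vandermonde_cong: "(\<And>i. i < n \<Longrightarrow> t i = s i) \<Longrightarrow> vandermonde k n t = vandermonde k n s"
  unfolding vandermonde_def by (intro arg_cong[of _ _ "\<lambda>x. x ^ k"] prod.cong) (auto simp: pairs_def)

lemma vandermonde_Suc: "vandermonde k (Suc n) t = vandermonde k n t * ((- 1) ^ (k * n) * (\<Prod>l<n. (t n - t l) ^ (2 * k)))"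
proof -
  have p: "pairs (Suc n) = pairs n \<union> (\<lambda>l. (n, l)) ` {..<n} \<union> (\<lambda>l. (l, n)) ` {..<n}"
    by (auto simp: pairs_def less_Suc_eq)
  have "(\<Prod>(i, j)\<in>pairs (Suc n). t i - t j) =
     (\<Prod>(i, j)\<in>pairs n. t i - t j) * (\<Prod>l<n. t n - t l) * (\<Prod>l<n. t l - t n)"
    unfolding p
    by (subst prod.union_disjoint, simp, simp, force simp: pairs_def)
      (subst prod.union_disjoint, simp, simp, force simp: pairs_def,
        simp add: prod.reindex inj_on_def)
  also have "(\<Prod>l<n. t l - t n) = (\<Prod>l<n. - 1 * (t n - t l))" by simp
  also have "\<dots> = (- 1) ^ n * (\<Prod>l<n. t n - t l)"
    unfolding prod.distrib by simp
  finally show ?thesis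
    by (simp add: vandermonde_def power_mult_distrib power_mult mult_ac power_even_eq prod_power_distrib
        flip: power_mult prod_power_distrib)
      (simp add: power2_eq_square power_mult power_mult_distrib mult_ac prod_power_distrib)
qed

lemma vandermonde_swap: "i < n \<Longrightarrow> j < n \<Longrightarrow> vandermonde k n (t \<circ> sw i j) = vandermonde k n t"
proof -
  assume ij: "i < n" "j < n"
  have inj: "sw i j a = sw i j b \<longleftrightarrow> a = b" for a b by (metis sw_sw)
  have "(\<Prod>(a, b)\<in>pairs n. (t \<circ> sw i j) a - (t \<circ> sw i j) b) = (\<Prod>(a, b)\<in>pairs n. t a - t b)"
    by (rule prod.reindex_bij_witness[of _ "map_prod (sw i j) (sw i j)" "map_prod (sw i j) (sw i j)"])
      (auto simp: pairs_def sw_less ij inj)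
  then show ?thesis by (simp add: vandermonde_def)
qed

lemma vandermonde_eq_0: "i < n \<Longrightarrow> j < n \<Longrightarrow> i \<noteq> j \<Longrightarrow> t i = t j \<Longrightarrow> k > 0 \<Longrightarrow> vandermonde k n t = 0"
  unfolding vandermonde_def by (simp add: prod_zero_iff) (force simp: pairs_def)

lemma vandermonde_translate: "vandermonde k n (\<lambda>i. t i - c) = vandermonde k n t"
  by (simp add: vandermonde_def)

lemma vandermonde_0: "vandermonde k 0 t = 1"
  by (simp add: vandermonde_def pairs_0)

section \<open>Reduction of Selberg-type integrals\<close>

text \<open>Polynomials in \<open>x\<close> and \<open>t\<^sub>0, \<dots>, t\<^sub>n\<^sub>-\<^sub>1\<close>, as functions, whose total degrees in \<open>t\<close> lie in \<open>D\<close>.\<close>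

definition poly_fun :: "nat \<Rightarrow> nat set \<Rightarrow> (complex \<Rightarrow> (nat \<Rightarrow> complex) \<Rightarrow> complex) \<Rightarrow> bool" where
  "poly_fun n D H \<longleftrightarrow> (\<exists>xs. (\<forall>(P, \<nu>)\<in>set xs. (\<Sum>i<n. \<nu> i) \<in> D) \<and>
     (\<forall>x t. H x t = (\<Sum>(P, \<nu>)\<leftarrow>xs. poly P x * mon n \<nu> t)))"

lemma poly_fun_add:
  assumes "poly_fun n D G" "poly_fun n D H"
  shows "poly_fun n D (\<lambda>x t. G x t + H x t)"
proof -
  obtain xs ys where "\<forall>(P, \<nu>)\<in>set xs. (\<Sum>i<n. \<nu> i) \<in> D" "\<forall>x t. G x t = (\<Sum>(P, \<nu>)\<leftarrow>xs. poly P x * mon n \<nu> t)"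
    "\<forall>(P, \<nu>)\<in>set ys. (\<Sum>i<n. \<nu> i) \<in> D" "\<forall>x t. H x t = (\<Sum>(P, \<nu>)\<leftarrow>ys. poly P x * mon n \<nu> t)"
    using assms unfolding poly_fun_def by blast
  then show ?thesis
    unfolding poly_fun_def by (intro exI[of _ "xs @ ys"]) auto
qed

lemma poly_fun_monom: "(\<Sum>i<n. \<nu> i) \<in> D \<Longrightarrow> poly_fun n D (\<lambda>x t. poly P x * mon n \<nu> t)"
  unfolding poly_fun_def by (intro exI[of _ "[(P, \<nu>)]"]) auto

lemma poly_fun_poly: "0 \<in> D \<Longrightarrow> poly_fun n D (\<lambda>x t. poly P x)"
  using poly_fun_monom[where n = n and \<nu> = "\<lambda>_. 0" and D = D and P = P] by (simp add: mon_def)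

lemma poly_fun_const: "0 \<in> D \<Longrightarrow> poly_fun n D (\<lambda>x t. c)"
  using poly_fun_poly[of D n "[:c:]"] by simp

lemma poly_fun_x: "0 \<in> D \<Longrightarrow> poly_fun n D (\<lambda>x t. x)"
  using poly_fun_poly[of D n "[:0, 1:]"] by simp

lemma poly_fun_0: "poly_fun n D (\<lambda>x t. 0)"
  unfolding poly_fun_def by (intro exI[of _ "[]"]) auto

lemma poly_fun_var:
  assumes "i < n" "1 \<in> D" shows "poly_fun n D (\<lambda>x t. t i)"
proof -
  have "(\<Sum>j<n. if j = i then 1 else 0) = (1 :: nat)" using assms by simp
  moreover have "mon n (\<lambda>j. if j = i then 1 else 0) t = t i" for t
  proof -
    have "mon n (\<lambda>j. if j = i then 1 else 0) t = (\<Prod>j<n. if j = i then t j else 1)"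
      unfolding mon_def by (intro prod.cong) auto
    then show ?thesis using assms by simp
  qed
  ultimately show ?thesis
    using poly_fun_monom[where n = n and \<nu> = "\<lambda>j. if j = i then 1 else 0" and D = D and P = 1] assms by simp
qed

lemma poly_fun_sum:
  "(\<And>j. j \<in> J \<Longrightarrow> poly_fun n D (H j)) \<Longrightarrow> poly_fun n D (\<lambda>x t. \<Sum>j\<in>J. H j x t)"
  by (induction J rule: infinite_finite_induct) (auto simp: poly_fun_0 intro: poly_fun_add)

lemma poly_fun_sum_list:
  "(\<And>j. j \<in> set xs \<Longrightarrow> poly_fun n D (H j)) \<Longrightarrow> poly_fun n D (\<lambda>x t. \<Sum>j\<leftarrow>xs. H j x t)"
  by (induction xs) (auto simp: poly_fun_0 intro: poly_fun_add)

lemma mon_mult: "mon n \<mu> t * mon n \<nu> t = mon n (\<lambda>i. \<mu> i + \<nu> i) t"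
  by (simp add: mon_def power_add prod.distrib)

lemma poly_fun_mult:
  assumes "poly_fun n D G" "poly_fun n D' H" "\<And>d d'. d \<in> D \<Longrightarrow> d' \<in> D' \<Longrightarrow> d + d' \<in> D''"
  shows "poly_fun n D'' (\<lambda>x t. G x t * H x t)"
proof -
  obtain xs ys where xs: "\<forall>(P, \<nu>)\<in>set xs. (\<Sum>i<n. \<nu> i) \<in> D" "\<And>x t. G x t = (\<Sum>(P, \<nu>)\<leftarrow>xs. poly P x * mon n \<nu> t)"
    and ys: "\<forall>(P, \<nu>)\<in>set ys. (\<Sum>i<n. \<nu> i) \<in> D'" "\<And>x t. H x t = (\<Sum>(P, \<nu>)\<leftarrow>ys. poly P x * mon n \<nu> t)"
    using assms(1,2) unfolding poly_fun_def by blast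
  have "G x t * H x t = (\<Sum>b\<leftarrow>ys. \<Sum>a\<leftarrow>xs. poly (fst a * fst b) x * mon n (\<lambda>i. snd a i + snd b i) t)" for x t
    unfolding xs(2) ys(2) sum_list_mult_const[symmetric] sum_list_const_mult[symmetric]
    by (intro arg_cong[of _ _ sum_list] map_cong refl) (simp add: case_prod_unfold mon_mult[symmetric] mult_ac)
  moreover have "poly_fun n D'' (\<lambda>x t. \<Sum>b\<leftarrow>ys. \<Sum>a\<leftarrow>xs. poly (fst a * fst b) x * mon n (\<lambda>i. snd a i + snd b i) t)"
  proof (intro poly_fun_sum_list poly_fun_monom)
    fix a b assume "a \<in> set xs" "b \<in> set ys"
    then have "(\<Sum>i<n. snd a i) \<in> D" "(\<Sum>i<n. snd b i) \<in> D'" using xs(1) ys(1) by auto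
    then show "(\<Sum>i<n. snd a i + snd b i) \<in> D''" unfolding sum.distrib by (rule assms(3))
  qed
  ultimately show ?thesis by simp
qed

text \<open>\<open>selberg_rec n T k\<close> collects the properties of the integrals
  \<open>F \<mu> = \<integral>\<dots>\<integral> t\<^sup>\<mu> \<Prod>\<^sub>i t\<^sub>i\<^sup>-\<^sup>n\<^sup>k\<^sup>-\<^sup>1 (t\<^sub>i - 1)\<^sup>-\<^sup>n\<^sup>k\<^sup>-\<^sup>1 \<Prod>\<^sub>i\<^sub>\<noteq>\<^sub>j (t\<^sub>i - t\<^sub>j)\<^sup>k dt\<close> that are used to express them by \<open>F 0\<close>;
  the recursion is integration by parts in the last variable.\<close>

definition selberg_rec :: "nat \<Rightarrow> nat \<Rightarrow> nat \<Rightarrow> ((nat \<Rightarrow> nat) \<Rightarrow> complex) \<Rightarrow> bool" where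
  "selberg_rec n T k F \<longleftrightarrow>
     (\<forall>\<mu> \<mu>'. (\<forall>i<n. \<mu> i = \<mu>' i) \<longrightarrow> F \<mu> = F \<mu>') \<and>
     (\<forall>\<mu> i j. i < n \<longrightarrow> j < n \<longrightarrow> F (\<mu> \<circ> sw i j) = F \<mu>) \<and>
     (\<forall>\<mu> a m. n = Suc m \<longrightarrow> \<mu> m = Suc a \<longrightarrow> (\<forall>l<m. \<mu> l \<le> Suc a) \<longrightarrow> (\<Sum>i<n. \<mu> i) \<le> T \<longrightarrow>
        (of_nat a - 2 * of_nat (n * k)) * F \<mu> =
          (of_nat a - of_nat (n * k)) * F (\<mu>(m := a))
          - of_nat k * (\<Sum>l<m. \<Sum>s<Suc (Suc a) - \<mu> l. F (\<mu>(m := Suc a - s, l := \<mu> l + s)))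
          + of_nat k * (\<Sum>l<m. \<Sum>s<Suc a - \<mu> l. F (\<mu>(m := a - s, l := \<mu> l + s))))"

lemma selberg_rec_cong: "selberg_rec n T k F \<Longrightarrow> (\<And>i. i < n \<Longrightarrow> \<mu> i = \<mu>' i) \<Longrightarrow> F \<mu> = F \<mu>'"
  unfolding selberg_rec_def by (elim conjE) blast

lemma selberg_rec_sw: "selberg_rec n T k F \<Longrightarrow> i < n \<Longrightarrow> j < n \<Longrightarrow> F (\<mu> \<circ> sw i j) = F \<mu>"
  unfolding selberg_rec_def by (elim conjE) blast

lemma selberg_rec_Suc:
  assumes "selberg_rec n T k F" "n = Suc m" "\<mu> m = Suc a" "\<forall>l<m. \<mu> l \<le> Suc a" "(\<Sum>i<n. \<mu> i) \<le> T"
  shows "(of_nat a - 2 * of_nat (n * k)) * F \<mu> =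
          (of_nat a - of_nat (n * k)) * F (\<mu>(m := a))
          - of_nat k * (\<Sum>l<m. \<Sum>s<Suc (Suc a) - \<mu> l. F (\<mu>(m := Suc a - s, l := \<mu> l + s)))
          + of_nat k * (\<Sum>l<m. \<Sum>s<Suc a - \<mu> l. F (\<mu>(m := a - s, l := \<mu> l + s)))"
proof -
  note * = assms(1)[unfolded selberg_rec_def, THEN conjunct2, THEN conjunct2]
  show ?thesis by (rule *[rule_format]) (use assms(2-5) in auto)
qed

text \<open>The point is that A and B do not depend on k or F: the quotient B/A can then be
  evaluated at the non-integral point x, where no integral is defined.\<close>

definition reducible :: "nat \<Rightarrow> nat \<Rightarrow> complex \<Rightarrow> (nat \<Rightarrow> ((nat \<Rightarrow> nat) \<Rightarrow> complex) \<Rightarrow> complex) \<Rightarrow> bool" where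
  "reducible n T x \<Phi> \<longleftrightarrow> (\<exists>A B. poly A x \<noteq> 0 \<and>
     (\<forall>k F. k > 0 \<longrightarrow> selberg_rec n T k F \<longrightarrow> poly A (of_nat k) * \<Phi> k F = poly B (of_nat k) * F (\<lambda>_. 0)))"

lemma reducibleI:
  "poly A x \<noteq> 0 \<Longrightarrow>
    (\<And>k F. k > 0 \<Longrightarrow> selberg_rec n T k F \<Longrightarrow> poly A (of_nat k) * \<Phi> k F = poly B (of_nat k) * F (\<lambda>_. 0)) \<Longrightarrow>
    reducible n T x \<Phi>"
  unfolding reducible_def by blast

lemma reducible_add:
  assumes "reducible n T x \<Phi>" "reducible n T x \<Psi>"
  shows "reducible n T x (\<lambda>k F. \<Phi> k F + \<Psi> k F)"
proof -
  obtain A B A' B' where *: "poly A x \<noteq> 0" "poly A' x \<noteq> 0"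
    "\<And>k F. k > 0 \<Longrightarrow> selberg_rec n T k F \<Longrightarrow> poly A (of_nat k) * \<Phi> k F = poly B (of_nat k) * F (\<lambda>_. 0)"
    "\<And>k F. k > 0 \<Longrightarrow> selberg_rec n T k F \<Longrightarrow> poly A' (of_nat k) * \<Psi> k F = poly B' (of_nat k) * F (\<lambda>_. 0)"
    using assms unfolding reducible_def by blast
  show ?thesis
  proof (rule reducibleI[of "A * A'" _ _ _ _ "A' * B + A * B'"])
    fix k :: nat and F assume "k > 0" "selberg_rec n T k F"
    then show "poly (A * A') (of_nat k) * (\<Phi> k F + \<Psi> k F) = poly (A' * B + A * B') (of_nat k) * F (\<lambda>_. 0)"
      using *(3,4)[of k F] by (simp add: algebra_simps)
  qed (use * in simp)
qed

lemma reducible_mult: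
  assumes "reducible n T x \<Phi>"
  shows "reducible n T x (\<lambda>k F. poly P (of_nat k) * \<Phi> k F)"
proof -
  obtain A B where *: "poly A x \<noteq> 0"
    "\<And>k F. k > 0 \<Longrightarrow> selberg_rec n T k F \<Longrightarrow> poly A (of_nat k) * \<Phi> k F = poly B (of_nat k) * F (\<lambda>_. 0)"
    using assms unfolding reducible_def by blast
  show ?thesis
    by (rule reducibleI[of A _ _ _ _ "P * B"]) (use * in \<open>simp_all add: mult_ac\<close>)
qed

lemma reducible_cancel:
  assumes "reducible n T x (\<lambda>k F. poly P (of_nat k) * \<Phi> k F)" "poly P x \<noteq> 0"
  shows "reducible n T x \<Phi>"
proof -
  obtain A B where *: "poly A x \<noteq> 0"
    "\<And>k F. k > 0 \<Longrightarrow> selberg_rec n T k F \<Longrightarrow>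
      poly A (of_nat k) * (poly P (of_nat k) * \<Phi> k F) = poly B (of_nat k) * F (\<lambda>_. 0)"
    using assms(1) unfolding reducible_def by blast
  show ?thesis
    by (rule reducibleI[of "A * P" _ _ _ _ B]) (use * assms(2) in \<open>simp_all add: mult_ac\<close>)
qed

lemma reducible_0: "reducible n T x (\<lambda>k F. 0)"
  by (rule reducibleI[of 1 _ _ _ _ 0]) auto

lemma reducible_sum:
  "(\<And>j. j \<in> J \<Longrightarrow> reducible n T x (\<Phi> j)) \<Longrightarrow> reducible n T x (\<lambda>k F. \<Sum>j\<in>J. \<Phi> j k F)"
  by (induction J rule: infinite_finite_induct) (auto simp: reducible_0 intro: reducible_add)

lemma reducible_cong:
  assumes "reducible n T x \<Phi>"
    "\<And>k F. k > 0 \<Longrightarrow> selberg_rec n T k F \<Longrightarrow> \<Psi> k F = \<Phi> k F"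
  shows "reducible n T x \<Psi>"
  using assms unfolding reducible_def by simp

section \<open>Lowering the exponents\<close>

lemma sum_sw:
  "i < n \<Longrightarrow> j < n \<Longrightarrow> (\<Sum>l<n. g ((\<mu> \<circ> sw i j) l)) = (\<Sum>l<n. g (\<mu> l))"
  using sum.reindex_bij_betw[OF bij_betw_sw, of i n j "\<lambda>l. g (\<mu> l)"] by (simp add: o_def)

lemma sum_fun_upd2:
  fixes g :: "nat \<Rightarrow> nat"
  assumes "l < m"
  shows "(\<Sum>i<Suc m. g ((\<mu>(m := b, l := c)) i)) + g (\<mu> m) + g (\<mu> l) = (\<Sum>i<Suc m. g (\<mu> i)) + g b + g c"
proof -
  have "(\<Sum>i<m. g ((\<mu>(m := b, l := c)) i)) = (\<Sum>i\<in>insert l ({..<m} - {l}). g ((\<mu>(m := b, l := c)) i))"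
    using assms by (intro sum.cong) auto
  also have "\<dots> = g c + (\<Sum>i\<in>{..<m} - {l}. g (\<mu> i))"
    by (subst sum.insert) (auto intro!: sum.cong)
  finally show ?thesis
    using assms by (simp add: sum.remove[of "{..<m}" l "\<lambda>i. g (\<mu> i)"])
qed

text \<open>Induction on the sum of 2^(\<mu> i). Applied to a largest exponent a + 1, the recursion
  replaces a pair (a+1, d) by pairs (b, c) with b, c \<le> a, and 2^b + 2^c \<le> 2^(a+1). The
  remaining terms are copies of \<open>F \<mu>\<close>; moved to the left they turn its coefficient
  into a - k (2 + M), where M counts the other variables of exponent a + 1. The hypothesis keeps
  this nonzero at k = x.\<close>

lemma selberg_reduction:
  assumes "\<And>a M. M < n \<Longrightarrow> of_nat a \<noteq> x * (2 + of_nat M)"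
  shows "(\<Sum>i<n. \<mu> i) \<le> T \<Longrightarrow> reducible n T x (\<lambda>k F. F \<mu>)"
proof (induction "\<Sum>i<n. (2::nat) ^ \<mu> i" arbitrary: \<mu> rule: less_induct)
  case (less \<mu>)
  show ?case
  proof (cases "\<forall>i<n. \<mu> i = 0")
    case True
    show ?thesis
    proof (rule reducibleI[of 1 _ _ _ _ 1])
      fix k :: nat and F assume "selberg_rec n T k F"
      then have "F \<mu> = F (\<lambda>_. 0)" by (rule selberg_rec_cong) (use True in simp)
      then show "poly 1 (of_nat k) * F \<mu> = poly 1 (of_nat k) * F (\<lambda>_. 0)" by simp
    qed simp
  next
    case False
    then obtain m where n: "n = Suc m" by (cases n) auto
    define N where "N = Max (\<mu> ` {..<n})"
    have le: "\<mu> i \<le> N" if "i < n" for i unfolding N_def using that by simp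
    have "N \<in> \<mu> ` {..<n}" unfolding N_def using n by (intro Max_in) auto
    then obtain i where i: "i < n" "\<mu> i = N" by auto
    define \<eta> where "\<eta> = \<mu> \<circ> sw i m"
    from False le have "N \<noteq> 0" by force
    then obtain a where a: "N = Suc a" by (cases N) auto
    have eta: "\<eta> m = Suc a" "\<And>l. l < n \<Longrightarrow> \<eta> l \<le> Suc a"
      using i le sw_less[of i n m] n by (auto simp: \<eta>_def a)
    have deg: "(\<Sum>i<n. \<eta> i) \<le> T" 
      using less.prems sum_sw[of i n m "\<lambda>x. x" \<mu>] i n by (simp add: \<eta>_def)
    have size: "(\<Sum>i<n. (2::nat) ^ \<eta> i) = (\<Sum>i<n. 2 ^ \<mu> i)"
      using sum_sw[of i n m "\<lambda>x. 2 ^ x" \<mu>] i n by (simp add: \<eta>_def)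
    have IH0: "reducible n T x (\<lambda>k F. F (\<eta>(m := a)))"
    proof (rule less.hyps)
      show "(\<Sum>i<n. (2::nat) ^ (\<eta>(m := a)) i) < (\<Sum>i<n. 2 ^ \<mu> i)"
        unfolding size[symmetric] using eta by (simp add: n)
      show "(\<Sum>i<n. (\<eta>(m := a)) i) \<le> T" using deg eta by (simp add: n)
    qed
    have pw: "(2::nat) ^ b + 2 ^ c < 2 ^ Suc a + 2 ^ d" if "b \<le> a" "c \<le> a" for b c d
    proof -
      have "(2::nat) ^ b \<le> 2 ^ a" "(2::nat) ^ c \<le> 2 ^ a" using that by (simp_all add: power_increasing)
      then have "(2::nat) ^ b + 2 ^ c \<le> 2 ^ Suc a" by (simp only: power_Suc)
      also have "\<dots> < 2 ^ Suc a + 2 ^ d" by simp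
      finally show ?thesis .
    qed
    have IH: "reducible n T x (\<lambda>k F. F (\<eta>(m := b, l := c)))"
      if "l < m" "b \<le> a" "c \<le> a" "b + c \<le> Suc a + \<eta> l" for b c l
    proof (rule less.hyps)
      show "(\<Sum>i<n. (2::nat) ^ (\<eta>(m := b, l := c)) i) < (\<Sum>i<n. 2 ^ \<mu> i)"
        unfolding size[symmetric]
        using sum_fun_upd2[OF \<open>l < m\<close>, of "\<lambda>x. 2 ^ x" \<eta> b c] pw[OF that(2,3), of "\<eta> l"]
        unfolding n eta by linarith
      show "(\<Sum>i<n. (\<eta>(m := b, l := c)) i) \<le> T"
        using sum_fun_upd2[OF \<open>l < m\<close>, of "\<lambda>x. x" \<eta> b c] that deg unfolding n eta by linarith
    qed
    define M where "M = card {l. l < m \<and> \<eta> l = Suc a}"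
    have "M \<le> card {..<m}" unfolding M_def by (intro card_mono) auto
    then have M: "M < n" by (simp add: n)
    have count: "(\<Sum>l<m. if \<eta> l = Suc a then 1 else 2 :: complex) = 2 * of_nat m - of_nat M"
    proof -
      have "(\<Sum>l<m. if \<eta> l = Suc a then 1 else 2 :: complex) = (\<Sum>l<m. 2 - (if \<eta> l = Suc a then 1 else 0))"
        by (intro sum.cong) auto
      also have "\<dots> = 2 * of_nat m - (\<Sum>l<m. if \<eta> l = Suc a then 1 else 0)"
        by (simp add: sum_subtractf)
      also have "(\<Sum>l<m. if \<eta> l = Suc a then 1 else 0 :: complex) = of_nat M"
        unfolding M_def by (simp add: sum.If_cases Int_def)
      finally show ?thesis .
    qed
    have red: "reducible n T x (\<lambda>k F. poly [:of_nat a, - of_nat n:] (of_nat k) * F (\<eta>(m := a))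
        + poly [:0, - 1:] (of_nat k) * (\<Sum>l<m. \<Sum>s\<in>{1..<Suc a - \<eta> l}. F (\<eta>(m := Suc a - s, l := \<eta> l + s)))
        + poly [:0, 1:] (of_nat k) * (\<Sum>l<m. \<Sum>s<Suc a - \<eta> l. F (\<eta>(m := a - s, l := \<eta> l + s))))"
      by (intro reducible_add reducible_mult reducible_sum IH0 IH) auto
    show ?thesis
    proof (rule reducible_cancel[of _ _ _ "[:of_nat a, - (2 + of_nat M):]"])
      show "poly [:of_nat a, - (2 + of_nat M):] x \<noteq> 0"
        using assms[OF M, of a] by (simp add: algebra_simps)
      show "reducible n T x (\<lambda>k F. poly [:of_nat a, - (2 + of_nat M):] (of_nat k) * F \<mu>)"
      proof (rule reducible_cong[OF red])
        fix k :: nat and F assume "k > 0" and F: "selberg_rec n T k F"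
        have sym: "F (\<nu> \<circ> sw i j) = F \<nu>" if "i < n" "j < n" for \<nu> i j
          by (rule selberg_rec_sw[OF F that])
        have "F \<mu> = F \<eta>" unfolding \<eta>_def using sym i n by simp
        \<comment> \<open>The summand s = 0 is \<open>\<eta>\<close> itself and the last one has the
          exponents of the variables l and m exchanged, so by symmetry both equal
          \<open>F \<eta>\<close>. They are the same summand if \<open>\<eta> l\<close> is maximal
          too, whence the factor 1.\<close>
        have split: "(\<Sum>s<Suc (Suc a) - \<eta> l. F (\<eta>(m := Suc a - s, l := \<eta> l + s))) =
            (if \<eta> l = Suc a then 1 else 2) * F \<eta> + (\<Sum>s\<in>{1..<Suc a - \<eta> l}. F (\<eta>(m := Suc a - s, l := \<eta> l + s)))"
          if l: "l < m" for l
        proof (cases "\<eta> l = Suc a")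
          case True
          have "\<eta>(m := Suc a, l := Suc a) = \<eta>" using True eta(1) by (auto simp: fun_eq_iff)
          then show ?thesis using True by simp
        next
          case False
          then have lt: "\<eta> l < Suc a" using eta(2)[of l] l n by (simp add: less_le)
          define q where "q = a - \<eta> l"
          have q: "Suc (Suc a) - \<eta> l = Suc (Suc q)" "Suc a - \<eta> l = Suc q" "Suc a - Suc q = \<eta> l" "\<eta> l + Suc q = Suc a"
            using lt by (auto simp: q_def)
          have e0: "\<eta>(m := Suc a, l := \<eta> l) = \<eta>" using eta(1) by (auto simp: fun_eq_iff)
          have "\<eta>(m := \<eta> l, l := Suc a) = \<eta> \<circ> sw l m" using eta(1) l by (auto simp: fun_eq_iff sw_def)
          then have e1: "F (\<eta>(m := \<eta> l, l := Suc a)) = F \<eta>" using sym[of l m \<eta>] l n by simp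
          define g where "g s = F (\<eta>(m := Suc a - s, l := \<eta> l + s))" for s
          have "(\<Sum>s<Suc (Suc q). g s) = (\<Sum>s\<in>{0..<Suc q}. g s) + g (Suc q)"
            by (simp add: atLeast0LessThan)
          also have "(\<Sum>s\<in>{0..<Suc q}. g s) = g 0 + (\<Sum>s\<in>{1..<Suc q}. g s)"
            by (subst sum.atLeast_Suc_lessThan) auto
          also have "g 0 = F \<eta>" unfolding g_def using e0 by simp
          also have "g (Suc q) = F \<eta>" unfolding g_def q e1 ..
          finally have "(\<Sum>s<Suc (Suc q). g s) = 2 * F \<eta> + (\<Sum>s\<in>{1..<Suc q}. g s)" by simp
          then show ?thesis unfolding g_def q(1,2) using False by simp
        qed
        have "(of_nat a - 2 * of_nat (n * k)) * F \<eta> =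
          (of_nat a - of_nat (n * k)) * F (\<eta>(m := a))
          - of_nat k * (\<Sum>l<m. \<Sum>s<Suc (Suc a) - \<eta> l. F (\<eta>(m := Suc a - s, l := \<eta> l + s)))
          + of_nat k * (\<Sum>l<m. \<Sum>s<Suc a - \<eta> l. F (\<eta>(m := a - s, l := \<eta> l + s)))"
          by (rule selberg_rec_Suc[OF F n]) (use eta deg n in auto)
        also have "(\<Sum>l<m. \<Sum>s<Suc (Suc a) - \<eta> l. F (\<eta>(m := Suc a - s, l := \<eta> l + s))) =
           (2 * of_nat m - of_nat M) * F \<eta> + (\<Sum>l<m. \<Sum>s\<in>{1..<Suc a - \<eta> l}. F (\<eta>(m := Suc a - s, l := \<eta> l + s)))"
          unfolding count[symmetric] sum_distrib_right sum.distrib[symmetric]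
          by (intro sum.cong refl split) simp
        finally show "poly [:of_nat a, - (2 + of_nat M):] (of_nat k) * F \<mu> =
          poly [:of_nat a, - of_nat n:] (of_nat k) * F (\<eta>(m := a))
        + poly [:0, - 1:] (of_nat k) * (\<Sum>l<m. \<Sum>s\<in>{1..<Suc a - \<eta> l}. F (\<eta>(m := Suc a - s, l := \<eta> l + s)))
        + poly [:0, 1:] (of_nat k) * (\<Sum>l<m. \<Sum>s<Suc a - \<eta> l. F (\<eta>(m := a - s, l := \<eta> l + s)))"
          unfolding \<open>F \<mu> = F \<eta>\<close> n
          by (simp add: algebra_simps fun_upd_def)
      qed
    qed
  qed
qed

text \<open>Since monomials are linearly independent, the coefficient \<open>B\<close> may be taken to be linear in the
  integrand.\<close>

lemma selberg_reduction_poly_fun: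
  assumes x: "\<And>a M. M < n \<Longrightarrow> of_nat a \<noteq> x * (2 + of_nat M)" and zero: "\<And>t. H x t = 0"
    and xs: "\<And>x t. H x t = (\<Sum>(P, \<nu>)\<leftarrow>xs. poly P x * mon n \<nu> t)"
      "\<forall>(P, \<nu>)\<in>set xs. (\<Sum>i<n. \<nu> i) \<le> T"
  shows "\<exists>A B. poly A x \<noteq> 0 \<and> poly B x = 0 \<and>
     (\<forall>k F. k > 0 \<longrightarrow> selberg_rec n T k F \<longrightarrow>
        poly A (of_nat k) * (\<Sum>(P, \<nu>)\<leftarrow>xs. poly P (of_nat k) * F \<nu>) = poly B (of_nat k) * F (\<lambda>_. 0))"
proof -
  have red: "\<exists>A B. (\<Sum>i<n. \<mu> i) \<le> T \<longrightarrow> poly A x \<noteq> 0 \<and> (\<forall>k F. k > 0 \<longrightarrow> selberg_rec n T k F \<longrightarrow>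
       poly A (of_nat k) * F \<mu> = poly B (of_nat k) * F (\<lambda>_. 0))" for \<mu>
    using selberg_reduction[of n x \<mu> T] x unfolding reducible_def by blast
  then obtain A' B' where AB': "\<And>\<mu>. (\<Sum>i<n. \<mu> i) \<le> T \<Longrightarrow> poly (A' \<mu>) x \<noteq> 0"
    "\<And>\<mu> k F. (\<Sum>i<n. \<mu> i) \<le> T \<Longrightarrow> k > 0 \<Longrightarrow> selberg_rec n T k F \<Longrightarrow>
       poly (A' \<mu>) (of_nat k) * F \<mu> = poly (B' \<mu>) (of_nat k) * F (\<lambda>_. 0)"
    by metis
  \<comment> \<open>Numerator and denominator are chosen for the exponent vector cut off at n. They
    then depend only on the exponents that \<open>mon\<close> sees, as
    \<open>mon_independent\<close> demands.\<close>
  define r where "r \<mu> = (\<lambda>i. if i < n then \<mu> i else (0::nat))" for \<mu> :: "nat \<Rightarrow> nat"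
  define A1 B1 where "A1 \<mu> = A' (r \<mu>)" and "B1 \<mu> = B' (r \<mu>)" for \<mu>
  have A1: "poly (A1 \<mu>) x \<noteq> 0" if "(\<Sum>i<n. \<mu> i) \<le> T" for \<mu>
    unfolding A1_def by (rule AB') (use that in \<open>simp add: r_def\<close>)
  have AB1: "poly (A1 \<mu>) (of_nat k) * F \<mu> = poly (B1 \<mu>) (of_nat k) * F (\<lambda>_. 0)"
    if "(\<Sum>i<n. \<mu> i) \<le> T" "k > 0" "selberg_rec n T k F" for \<mu> k F
  proof -
    have "F (r \<mu>) = F \<mu>" by (rule selberg_rec_cong[OF that(3)]) (simp add: r_def)
    then show ?thesis using AB'(2)[of "r \<mu>" k F] that by (simp add: A1_def B1_def r_def)
  qed
  define N where "N = length xs"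
  define P where "P e = fst (xs ! e)" for e
  define \<nu> where "\<nu> e = snd (xs ! e)" for e
  have deg: "(\<Sum>i<n. \<nu> e i) \<le> T" if "e < N" for e
    using xs(2) that nth_mem[of e xs] unfolding N_def \<nu>_def by (auto simp: case_prod_unfold)
  have sl: "(\<Sum>(P, \<nu>)\<leftarrow>xs. g P \<nu>) = (\<Sum>e<N. g (P e) (\<nu> e))" for g :: "complex poly \<Rightarrow> (nat \<Rightarrow> nat) \<Rightarrow> complex"
    unfolding N_def P_def \<nu>_def by (simp add: sum_list_sum_nth atLeast0LessThan case_prod_unfold)
  define A where "A = (\<Prod>e<N. A1 (\<nu> e))"
  define A2 where "A2 e = (\<Prod>e'\<in>{..<N} - {e}. A1 (\<nu> e'))" for e
  have A2: "A = A1 (\<nu> e) * A2 e" if "e < N" for e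
    unfolding A_def A2_def using that by (simp add: prod.remove)
  define B where "B = (\<Sum>e<N. P e * A2 e * B1 (\<nu> e))"
  have Ax: "poly A x \<noteq> 0" unfolding A_def poly_prod using A1 deg by simp
  \<comment> \<open>The quotient plays the role of the integral of a monomial at the parameter x,
    normalized by \<open>F 0\<close>. Extended linearly, it sends the polynomial \<open>H x\<close>
    to 0 because this polynomial vanishes identically.\<close>
  have "(\<Sum>e<N. poly (P e) x * (poly (B1 (\<nu> e)) x / poly (A1 (\<nu> e)) x)) = 0"
  proof (rule mon_independent[where n = n and F = "\<lambda>\<mu>. poly (B1 \<mu>) x / poly (A1 \<mu>) x"])
    show "(\<Sum>e<N. poly (P e) x * mon n (\<nu> e) t) = 0" for t
      using zero[of t] unfolding xs(1)[of x t] sl .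
    show "poly (B1 \<mu>) x / poly (A1 \<mu>) x = poly (B1 \<mu>') x / poly (A1 \<mu>') x" if "\<forall>i<n. \<mu> i = \<mu>' i" for \<mu> \<mu>'
    proof -
      have "r \<mu> = r \<mu>'" using that by (auto simp: r_def)
      then show ?thesis by (simp add: A1_def B1_def)
    qed
  qed simp
  then have "0 = poly A x * (\<Sum>e<N. poly (P e) x * (poly (B1 (\<nu> e)) x / poly (A1 (\<nu> e)) x))" by simp
  also have "\<dots> = poly B x"
    unfolding B_def poly_sum sum_distrib_left
    by (intro sum.cong refl) (use A1 deg in \<open>simp add: A2\<close>)
  finally have "poly B x = 0" ..
  moreover have "poly A (of_nat k) * (\<Sum>(P, \<nu>)\<leftarrow>xs. poly P (of_nat k) * F \<nu>) = poly B (of_nat k) * F (\<lambda>_. 0)"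
    if k: "k > 0" "selberg_rec n T k F" for k F
    unfolding sl B_def poly_sum sum_distrib_left sum_distrib_right
  proof (intro sum.cong refl, goal_cases)
    case (1 e)
    then have "poly A (of_nat k) * (poly (P e) (of_nat k) * F (\<nu> e)) =
       poly (P e) (of_nat k) * poly (A2 e) (of_nat k) * (poly (A1 (\<nu> e)) (of_nat k) * F (\<nu> e))"
      by (simp add: A2)
    also have "\<dots> = poly (P e * A2 e * B1 (\<nu> e)) (of_nat k) * F (\<lambda>_. 0)"
      using AB1[of "\<nu> e" k F] deg \<open>e \<in> _\<close> k by simp
    finally show ?case .
  qed
  ultimately show ?thesis using Ax by blast
qed

text \<open>Up to sign, the residues of \<open>u\<^sup>b (u (u - 1))\<^sup>-\<^sup>\<kappa>\<^sup>-\<^sup>1\<close> at \<open>1\<close> and at \<open>0\<close>. Both functionals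
  vanish on \<open>(u (u - 1))\<^sup>\<kappa>\<^sup>+\<^sup>1\<close> times the derivative of \<open>g (u (u - 1))\<^sup>-\<^sup>\<kappa>\<close>.\<close>

definition moment_1 :: "nat \<Rightarrow> nat \<Rightarrow> complex" where
  "moment_1 \<kappa> b = (of_nat b - of_nat \<kappa> - 1) gchoose \<kappa>"

definition moment_0 :: "nat \<Rightarrow> nat \<Rightarrow> complex" where
  "moment_0 \<kappa> b = (if b \<le> \<kappa> then moment_1 \<kappa> b else 0)"

text \<open>A pencil joining the functional at 0 to the functional at 1. All members satisfy one
  recursion, so the reduction is uniform in \<theta>, while the two ends can be evaluated
  explicitly.\<close>

definition moment :: "nat \<Rightarrow> complex \<Rightarrow> nat \<Rightarrow> complex" where
  "moment \<kappa> \<theta> b = moment_0 \<kappa> b + \<theta> * (moment_1 \<kappa> b - moment_0 \<kappa> b)"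

lemma moment_1_Suc: "(of_nat a - 2 * of_nat \<kappa>) * moment_1 \<kappa> (Suc a) = (of_nat a - of_nat \<kappa>) * moment_1 \<kappa> a"
  using gbinomial_absorb_comp[of "of_nat a - of_nat \<kappa> :: complex" \<kappa>]
  by (simp add: moment_1_def algebra_simps)

text \<open>Cutting \<open>moment_1\<close> off above \<kappa> is compatible with the recursion,
  because the step from \<kappa> to \<kappa> + 1 carries the factor a - \<kappa> = 0.\<close>

lemma moment_0_Suc: "(of_nat a - 2 * of_nat \<kappa>) * moment_0 \<kappa> (Suc a) = (of_nat a - of_nat \<kappa>) * moment_0 \<kappa> a"
proof (cases "a = \<kappa>")
  case False
  then show ?thesis using moment_1_Suc[of a \<kappa>] by (simp add: moment_0_def)
qed (simp add: moment_0_def)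

lemma moment_Suc: "(of_nat a - 2 * of_nat \<kappa>) * moment \<kappa> \<theta> (Suc a) = (of_nat a - of_nat \<kappa>) * moment \<kappa> \<theta> a"
proof -
  have "(of_nat a - 2 * of_nat \<kappa>) * moment \<kappa> \<theta> (Suc a) =
     (1 - \<theta>) * ((of_nat a - 2 * of_nat \<kappa>) * moment_0 \<kappa> (Suc a)) + \<theta> * ((of_nat a - 2 * of_nat \<kappa>) * moment_1 \<kappa> (Suc a))"
    by (simp add: moment_def ring_distribs mult_ac)
  then show ?thesis unfolding moment_0_Suc moment_1_Suc by (simp add: moment_def algebra_simps)
qed

lemma functional_moment:
  "functional (moment \<kappa> \<theta>) ([:0, - 1, 1:] * pderiv g - smult (of_nat \<kappa>) ([:- 1, 2:] * g)) = 0"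
proof -
  define E where "E g = [:0, - 1, 1:] * pderiv g - smult (of_nat \<kappa>) ([:- 1, 2:] * g)" for g :: "complex poly"
  have X: "[:0, b, c:] * p = smult b (monom 1 1 * p) + smult c (monom 1 2 * p)"
    "[:b, c:] * p = smult b p + smult c (monom 1 1 * p)" for b c :: complex and p
    by (simp_all add: numeral_2_eq_2 monom_Suc monom_0 algebra_simps)
  have mon: "functional (moment \<kappa> \<theta>) (E (monom b a)) = 0" for a b
  proof -
    have "E (monom b a) = monom (of_nat a * b) (Suc a) - monom (of_nat a * b) a
        - (monom (2 * of_nat \<kappa> * b) (Suc a) - monom (of_nat \<kappa> * b) a)"
      unfolding E_def X pderiv_monom mult_monom
      by (intro poly_eqI, cases a) (auto simp: mult_monom smult_monom numeral_2_eq_2 algebra_simps)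
    then have "functional (moment \<kappa> \<theta>) (E (monom b a)) =
        b * ((of_nat a - 2 * of_nat \<kappa>) * moment \<kappa> \<theta> (Suc a) - (of_nat a - of_nat \<kappa>) * moment \<kappa> \<theta> a)"
      by (simp only: functional_minus functional_monom) (simp add: algebra_simps)
    then show ?thesis unfolding moment_Suc by simp
  qed
  have "E g = (\<Sum>i\<le>degree g. E (monom (coeff g i) i))"
  proof -
    have "E (f + g) = E f + E g" for f g
      unfolding E_def pderiv_add distrib_left smult_add_right by simp
    moreover have "E 0 = 0" by (simp add: E_def)
    ultimately have "E (sum f A) = (\<Sum>i\<in>A. E (f i))" for f and A :: "nat set"
      by (induction A rule: infinite_finite_induct) auto
    from this[of "\<lambda>i. monom (coeff g i) i" "{..degree g}"] show ?thesis
      by (simp add: poly_as_sum_of_monoms)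
  qed
  then show ?thesis unfolding E_def[symmetric] by (simp add: functional_sum mon)
qed

section \<open>Integration by parts for weighted sums\<close>

lemma mon_upd: "i < n \<Longrightarrow> mon n (\<mu>(i := b)) t = mon n (\<mu>(i := 0)) t * t i ^ b"
  unfolding mon_def by (subst (1 2) prod.remove[of _ i]) (auto intro!: prod.cong)

lemma mon_sw:
  assumes "i < n" "j < n"
  shows "mon n (\<mu> \<circ> sw i j) (t \<circ> sw i j) = mon n \<mu> t"
  using prod.reindex_bij_betw[OF bij_betw_sw[OF assms], of "\<lambda>l. t l ^ \<mu> l"] by (simp add: mon_def)

lemma mon_sw': "i < n \<Longrightarrow> j < n \<Longrightarrow> mon n \<mu> (t \<circ> sw i j) = mon n (\<mu> \<circ> sw i j) t"
  using mon_sw[of i n j "\<mu> \<circ> sw i j" t] by (simp add: o_assoc[symmetric]) (simp add: o_def)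

text \<open>Adding the image under the exchange of t_m and t_l turns the pole 1/(t_m - t_l) into a
  divided difference, which is a sum of monomials. On the diagonal the quotient is 0 by convention;
  this is harmless since the Vandermonde factor vanishes there.\<close>

lemma wsum_antisymmetric:
  fixes c :: "complex \<Rightarrow> complex"
  assumes l: "l < m" and k: "k > 0" and b: "\<mu> l \<le> b"
  shows "2 * wsum (\<lambda>_. c) X (Suc m) (\<lambda>t. t m ^ b / (t m - t l) * mon m \<mu> t * vandermonde k (Suc m) t) =
    (\<Sum>s<b - \<mu> l. wsum (\<lambda>_. c) X (Suc m) (\<lambda>t. mon (Suc m) (\<mu>(m := b - 1 - s, l := \<mu> l + s)) t * vandermonde k (Suc m) t))"
proof -
  let ?W = "wsum (\<lambda>_. c) X (Suc m)"
  define R where "R = mon (Suc m) (\<mu>(m := 0, l := 0))"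
  have R: "mon (Suc m) (\<mu>(m := u, l := v)) t = R t * t m ^ u * t l ^ v" for u v t
  proof -
    have "mon (Suc m) (\<mu>(m := u, l := v)) t = mon (Suc m) ((\<mu>(l := 0))(m := u)) t * t l ^ v"
      using l by (subst mon_upd) (auto simp: fun_upd_twist)
    also have "mon (Suc m) ((\<mu>(l := 0))(m := u)) t = R t * t m ^ u"
      using l by (subst mon_upd) (auto simp: R_def fun_upd_twist)
    finally show ?thesis by (simp only: mult_ac)
  qed
  have mm: "mon m \<mu> t = R t * t l ^ \<mu> l" for t
  proof -
    have "mon m \<mu> t = mon (Suc m) (\<mu>(m := 0, l := \<mu> l)) t"
      unfolding mon_def using l by (auto intro!: prod.cong)
    then show ?thesis by (simp add: R)
  qed
  have R_sw: "R (t \<circ> sw l m) = R t" for t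
  proof -
    have "\<mu>(m := 0, l := 0) \<circ> sw l m = \<mu>(m := 0, l := 0)"
      by (auto simp: fun_eq_iff sw_def)
    then show ?thesis unfolding R_def using l by (subst mon_sw') auto
  qed
  define G where "G t = t m ^ b / (t m - t l) * (R t * t l ^ \<mu> l) * vandermonde k (Suc m) t" for t
  have G: "?W G = ?W (\<lambda>t. G (t \<circ> sw l m))"
    using wsum_swap[of l "Suc m" m "\<lambda>_. c" X G] l by simp
  have pt: "G t + G (t \<circ> sw l m) =
      (\<Sum>s<b - \<mu> l. mon (Suc m) (\<mu>(m := b - 1 - s, l := \<mu> l + s)) t * vandermonde k (Suc m) t)" for t
  proof (cases "t m = t l")
    case True
    then have "vandermonde k (Suc m) t = 0" using l k by (intro vandermonde_eq_0[of m _ l]) auto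
    moreover have "vandermonde k (Suc m) (t \<circ> sw l m) = vandermonde k (Suc m) t" using l by (intro vandermonde_swap) auto
    ultimately show ?thesis by (simp add: G_def)
  next
    case False
    define q where "q = b - \<mu> l"
    have bq: "b = \<mu> l + q" using b by (simp add: q_def)
    have Vs: "vandermonde k (Suc m) (t \<circ> sw l m) = vandermonde k (Suc m) t" using l by (intro vandermonde_swap) auto
    have "G t + G (t \<circ> sw l m) =
        (t m ^ b * t l ^ \<mu> l - t l ^ b * t m ^ \<mu> l) / (t m - t l) * (R t * vandermonde k (Suc m) t)"
    proof -
      have "t l - t m = - (t m - t l)" by simp
      then show ?thesis unfolding G_def R_sw Vs
        by (simp only: comp_def sw_simps divide_minus_right) (simp add: diff_divide_distrib algebra_simps)
    qed
    also have "t m ^ b * t l ^ \<mu> l - t l ^ b * t m ^ \<mu> l = (t m * t l) ^ \<mu> l * (t m ^ q - t l ^ q)"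
      unfolding bq by (simp add: power_add power_mult_distrib algebra_simps)
    also have "t m ^ q - t l ^ q = (t m - t l) * (\<Sum>s<q. t l ^ s * t m ^ (q - Suc s))"
      using power_diff_sumr2[of "t l" q "t m"] by (simp add: mult_ac algebra_simps)
    also have "(t m * t l) ^ \<mu> l * ((t m - t l) * (\<Sum>s<q. t l ^ s * t m ^ (q - Suc s))) / (t m - t l) * (R t * vandermonde k (Suc m) t)
      = (\<Sum>s<q. (t m * t l) ^ \<mu> l * (t l ^ s * t m ^ (q - Suc s)) * (R t * vandermonde k (Suc m) t))"
      unfolding sum_distrib_left sum_distrib_right sum_divide_distrib using False by (intro sum.cong) auto
    also have "\<dots> = (\<Sum>s<b - \<mu> l. mon (Suc m) (\<mu>(m := b - 1 - s, l := \<mu> l + s)) t * vandermonde k (Suc m) t)"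
    proof (intro sum.cong)
      fix s assume "s \<in> {..<b - \<mu> l}"
      then have "b - 1 - s = \<mu> l + (q - Suc s)" unfolding q_def by auto
      then show "(t m * t l) ^ \<mu> l * (t l ^ s * t m ^ (q - Suc s)) * (R t * vandermonde k (Suc m) t) =
        mon (Suc m) (\<mu>(m := b - 1 - s, l := \<mu> l + s)) t * vandermonde k (Suc m) t"
        by (simp only: R) (simp add: power_add power_mult_distrib mult_ac)
    qed (simp add: q_def)
    finally show ?thesis .
  qed
  have "2 * ?W G = ?W (\<lambda>t. G t + G (t \<circ> sw l m))"
    unfolding wsum_add using G by simp
  also have "\<dots> = (\<Sum>s<b - \<mu> l. ?W (\<lambda>t. mon (Suc m) (\<mu>(m := b - 1 - s, l := \<mu> l + s)) t * vandermonde k (Suc m) t))"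
    unfolding pt wsum_sum ..
  finally show ?thesis unfolding G_def mm .
qed

text \<open>In the last variable, integrate by parts the function t_m^a times the product of the
  (t_m - t_l)^(2k). Its logarithmic derivative contains 2k/(t_m - t_l), and the 2 is consumed by
  \<open>wsum_antisymmetric\<close>. The bound on D makes the quadrature exact in all degrees that
  occur.\<close>

lemma selberg_rec_wsum:
  assumes c: "\<forall>j\<le>D. (\<Sum>x\<in>nodes D. c x * x ^ j) = moment (n * k) \<theta> j"
    and D: "T + 2 * k * n + 2 \<le> D" and k: "k > 0"
  shows "selberg_rec n T k (\<lambda>\<mu>. wsum (\<lambda>_. c) (nodes D) n (\<lambda>t. mon n \<mu> t * vandermonde k n t))"
  unfolding selberg_rec_def
proof (intro conjI allI impI)
  fix \<mu> \<mu>' :: "nat \<Rightarrow> nat" assume "\<forall>i<n. \<mu> i = \<mu>' i"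
  then have "mon n \<mu> = mon n \<mu>'" by (auto simp: mon_def fun_eq_iff)
  then show "wsum (\<lambda>_. c) (nodes D) n (\<lambda>t. mon n \<mu> t * vandermonde k n t) = wsum (\<lambda>_. c) (nodes D) n (\<lambda>t. mon n \<mu>' t * vandermonde k n t)"
    by simp
next
  fix \<mu> :: "nat \<Rightarrow> nat" and i j assume "i < n" "j < n"
  then show "wsum (\<lambda>_. c) (nodes D) n (\<lambda>t. mon n (\<mu> \<circ> sw i j) t * vandermonde k n t) = wsum (\<lambda>_. c) (nodes D) n (\<lambda>t. mon n \<mu> t * vandermonde k n t)"
    by (subst wsum_swap[of i n j]) (simp_all add: mon_sw vandermonde_swap)
next
  fix \<mu> :: "nat \<Rightarrow> nat" and a m
  assume n: "n = Suc m" and a: "\<mu> m = Suc a" and le: "\<forall>l<m. \<mu> l \<le> Suc a" and T: "(\<Sum>i<n. \<mu> i) \<le> T"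
  let ?W = "wsum (\<lambda>_. c) (nodes D) n"
  let ?F = "\<lambda>\<mu>. ?W (\<lambda>t. mon n \<mu> t * vandermonde k n t)"
  define \<kappa> where "\<kappa> = n * k"
  define I where "I b l = ?W (\<lambda>t. t m ^ b / (t m - t l) * mon m \<mu> t * vandermonde k n t)" for b l
  define P where "P t = (\<Prod>l<m. [:- t l, 1:] ^ (2 * k))" for t :: "nat \<Rightarrow> complex"
  have poly_P: "poly (P t) x = (\<Prod>l<m. (x - t l) ^ (2 * k))" for t x
    by (simp add: P_def poly_prod)
  have deg_P: "degree (P t) \<le> 2 * k * m" for t
  proof -
    have "degree (P t) \<le> (\<Sum>l<m. degree ([:- t l, 1:] ^ (2 * k)))"
      unfolding P_def by (rule degree_prod_sum_le[unfolded comp_def]) simp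
    also have "\<dots> = 2 * k * m" by (simp add: degree_linear_power)
    finally show ?thesis .
  qed
  \<comment> \<open>At x = \<open>t l\<close> the quotient is 0 by convention, and so is the term it
    stands for, because its exponent 2k - 1 is positive.\<close>
  have deriv_P: "poly (pderiv (P t)) x = 2 * of_nat k * (\<Sum>l<m. poly (P t) x / (x - t l))" for t x
  proof -
    have "poly (pderiv (P t)) x = (\<Sum>l<m. (\<Prod>j\<in>{..<m} - {l}. (x - t j) ^ (2 * k)) * (2 * of_nat k * (x - t l) ^ (2 * k - 1)))"
      unfolding P_def pderiv_prod poly_sum poly_mult poly_prod poly_power
    proof (intro sum.cong refl arg_cong2[of _ _ _ _ "(*)"] prod.cong)
      fix l
      obtain q where q: "2 * k = Suc q" using k by (cases "2 * k") auto
      then have "of_nat (Suc q) = (2 * of_nat k :: complex)" by (metis of_nat_mult of_nat_numeral)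
      then show "poly (pderiv ([:- t l, 1:] ^ (2 * k))) x = 2 * of_nat k * (x - t l) ^ (2 * k - 1)"
        unfolding q pderiv_power_Suc by (simp add: pderiv_pCons del: of_nat_Suc power_Suc)
    qed (simp_all)
    also have "\<dots> = (\<Sum>l<m. 2 * of_nat k * (poly (P t) x / (x - t l)))"
    proof (intro sum.cong refl, goal_cases)
      case l: (1 l)
      have "(x - t l) ^ (2 * k - 1) = (x - t l) ^ (2 * k) / (x - t l)"
        using k by (cases "x = t l") (auto simp: power_diff)
      moreover have "poly (P t) x = (x - t l) ^ (2 * k) * (\<Prod>j\<in>{..<m} - {l}. (x - t j) ^ (2 * k))"
        unfolding poly_P using l by (subst prod.remove[of _ l]) auto
      ultimately show ?case by simp
    qed
    finally show ?thesis by (simp add: sum_distrib_left)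
  qed
  have a_T: "Suc a \<le> T" using T a by (simp add: n)
  \<comment> \<open>With u = t_m, this is the derivative of u^a (u (u - 1))^(-\<kappa>) times the
    product of the (u - t_l)^(2k), divided by (u (u - 1))^(-\<kappa>-1) and by that product.\<close>
  define H where "H t = of_nat a * t m ^ a * (t m - 1) - of_nat \<kappa> * (2 * t m - 1) * t m ^ a
      + 2 * of_nat k * (\<Sum>l<m. t m ^ Suc a * (t m - 1) / (t m - t l))" for t :: "nat \<Rightarrow> complex"
  have ibp: "?W (\<lambda>t. H t * (mon m \<mu> t * vandermonde k n t)) = 0"
  proof -
    have "(\<Sum>x\<in>nodes D. c x * (H (t(m := x)) * (mon m \<mu> (t(m := x)) * vandermonde k (Suc m) (t(m := x))))) = 0" for t
    proof -
      let ?g = "monom 1 a * P t"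
      let ?p = "[:0, - 1, 1:] * pderiv ?g - smult (of_nat \<kappa>) ([:- 1, 2:] * ?g)"
      have dg: "degree ?g \<le> a + 2 * k * m"
        by (rule order_trans[OF degree_mult_le]) (simp add: degree_monom_eq deg_P)
      have d1: "degree ([:0, - 1, 1:] * pderiv ?g) \<le> D"
        by (rule order_trans[OF degree_mult_le]) (use dg a_T D in \<open>simp add: n degree_pderiv algebra_simps\<close>)
      have d2: "degree (smult (of_nat \<kappa>) ([:- 1, 2:] * ?g)) \<le> D"
        by (rule order_trans[OF degree_smult_le], rule order_trans[OF degree_mult_le])
          (use dg a_T D in \<open>simp add: n algebra_simps\<close>)
      have "degree ?p \<le> D" by (rule degree_diff_le[OF d1 d2])
      then have q: "(\<Sum>x\<in>nodes D. c x * poly ?p x) = 0"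
        using functional_quadrature[OF c, of ?p] functional_moment[of "n * k" \<theta> ?g] unfolding \<kappa>_def by simp
      have pp: "poly ?p x = H (t(m := x)) * poly (P t) x" for x
      proof -
        have "(\<Sum>l<m. x ^ Suc a * (x - 1) / (x - (t(m := x)) l)) * poly (P t) x =
            x ^ Suc a * (x - 1) * (\<Sum>l<m. poly (P t) x / (x - t l))"
          unfolding sum_distrib_left sum_distrib_right by (intro sum.cong) auto
        then have *: "2 * of_nat k * (\<Sum>l<m. x ^ Suc a * (x - 1) / (x - (t(m := x)) l)) * poly (P t) x =
            x ^ Suc a * (x - 1) * poly (pderiv (P t)) x"
          unfolding deriv_P by (simp only: mult_ac)
        have xa: "x * x * (x ^ (a - 1) * of_nat a) = x * (x ^ a * of_nat a)" "x * (x ^ (a - 1) * of_nat a) = x ^ a * of_nat a"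
          by (cases a; simp)+
        have "H (t(m := x)) * poly (P t) x = (of_nat a * x ^ a * (x - 1) - of_nat \<kappa> * (2 * x - 1) * x ^ a) * poly (P t) x
           + x ^ Suc a * (x - 1) * poly (pderiv (P t)) x"
          unfolding H_def *[symmetric] by (simp add: algebra_simps)
        also have "\<dots> = poly ?p x"
          unfolding pderiv_mult pderiv_monom
          by (cases a) (simp_all add: poly_monom algebra_simps)
        finally show ?thesis ..
      qed
      have "vandermonde k (Suc m) (t(m := x)) = vandermonde k m t * ((- 1) ^ (k * m) * poly (P t) x)" for x
        unfolding vandermonde_Suc poly_P by (simp cong: vandermonde_cong)
      moreover have "mon m \<mu> (t(m := x)) = mon m \<mu> t" for x by (simp add: mon_def)
      ultimately have "(\<Sum>x\<in>nodes D. c x * (H (t(m := x)) * (mon m \<mu> (t(m := x)) * vandermonde k (Suc m) (t(m := x))))) =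
         mon m \<mu> t * vandermonde k m t * (- 1) ^ (k * m) * (\<Sum>x\<in>nodes D. c x * poly ?p x)"
        unfolding pp sum_distrib_left by (simp only: mult_ac)
      then show ?thesis using q by simp
    qed
    then show ?thesis unfolding n by (simp add: wsum_Suc) (simp add: wsum_def)
  qed
  have monS: "mon n (\<mu>(m := b)) t = t m ^ b * mon m \<mu> t" for b t by (simp add: n mon_def)
  have mon\<mu>: "mon n \<mu> t = t m ^ Suc a * mon m \<mu> t" for t using monS[of "\<mu> m" t] unfolding a[symmetric] by (simp only: fun_upd_triv)
  have "H t * (mon m \<mu> t * vandermonde k n t) =
      of_nat a * (mon n \<mu> t * vandermonde k n t) - of_nat a * (mon n (\<mu>(m := a)) t * vandermonde k n t)
      - 2 * of_nat \<kappa> * (mon n \<mu> t * vandermonde k n t) + of_nat \<kappa> * (mon n (\<mu>(m := a)) t * vandermonde k n t)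
      + 2 * of_nat k * (\<Sum>l<m. t m ^ Suc (Suc a) / (t m - t l) * mon m \<mu> t * vandermonde k n t - t m ^ Suc a / (t m - t l) * mon m \<mu> t * vandermonde k n t)" for t
  proof -
    have "(\<Sum>l<m. t m ^ Suc (Suc a) / (t m - t l) * mon m \<mu> t * vandermonde k n t - t m ^ Suc a / (t m - t l) * mon m \<mu> t * vandermonde k n t)
      = (\<Sum>l<m. t m ^ Suc a * (t m - 1) / (t m - t l)) * (mon m \<mu> t * vandermonde k n t)"
      unfolding sum_distrib_right by (intro sum.cong refl) (simp add: diff_divide_distrib ring_distribs mult_ac)
    then show ?thesis unfolding H_def mon\<mu> monS by (simp add: algebra_simps)
  qed
  then have "?W (\<lambda>t. H t * (mon m \<mu> t * vandermonde k n t)) =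
    of_nat a * ?F \<mu> - of_nat a * ?F (\<mu>(m := a)) - 2 * of_nat \<kappa> * ?F \<mu> + of_nat \<kappa> * ?F (\<mu>(m := a))
    + 2 * of_nat k * (\<Sum>l<m. I (Suc (Suc a)) l - I (Suc a) l)"
    by (simp only: wsum_add wsum_diff wsum_mult wsum_sum I_def)
  also have "2 * of_nat k * (\<Sum>l<m. I (Suc (Suc a)) l - I (Suc a) l) =
     of_nat k * (\<Sum>l<m. 2 * I (Suc (Suc a)) l - 2 * I (Suc a) l)"
    by (simp add: sum_distrib_left algebra_simps)
  also have "(\<Sum>l<m. 2 * I (Suc (Suc a)) l - 2 * I (Suc a) l) =
     (\<Sum>l<m. (\<Sum>s<Suc (Suc a) - \<mu> l. ?F (\<mu>(m := Suc a - s, l := \<mu> l + s)))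
        - (\<Sum>s<Suc a - \<mu> l. ?F (\<mu>(m := a - s, l := \<mu> l + s))))"
  proof (intro sum.cong refl, goal_cases)
    case l: (1 l)
    then have "\<mu> l \<le> Suc a" using le by simp
    then show ?case
      using wsum_antisymmetric[of l m k \<mu> "Suc (Suc a)" c "nodes D"] wsum_antisymmetric[of l m k \<mu> "Suc a" c "nodes D"] l k
      unfolding I_def n by (simp add: fun_upd_def)
  qed
  finally show "(of_nat a - 2 * of_nat (n * k)) * ?F \<mu> = (of_nat a - of_nat (n * k)) * ?F (\<mu>(m := a))
          - of_nat k * (\<Sum>l<m. \<Sum>s<Suc (Suc a) - \<mu> l. ?F (\<mu>(m := Suc a - s, l := \<mu> l + s)))
          + of_nat k * (\<Sum>l<m. \<Sum>s<Suc a - \<mu> l. ?F (\<mu>(m := a - s, l := \<mu> l + s)))"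
    unfolding ibp \<kappa>_def[symmetric] sum_subtractf by (simp add: algebra_simps fun_upd_def)
qed

section \<open>Values at the two ends of the pencil\<close>

lemma card_pairs: "card (pairs n) = n * (n - 1)"
proof -
  have "pairs n = {..<n} \<times> {..<n} - (\<lambda>i. (i, i)) ` {..<n}"
    by (auto simp: pairs_def)
  moreover have "card ((\<lambda>i. (i, i)) ` {..<n}) = n"
    by (simp add: card_image inj_on_def)
  ultimately have "card (pairs n) = n * n - n"
    by (simp add: card_Diff_subset image_subset_iff)
  then show ?thesis by (simp add: diff_mult_distrib2)
qed

lemma poly_fun_prod_homogeneous:
  "finite J \<Longrightarrow> (\<And>j. j \<in> J \<Longrightarrow> poly_fun n {1} (H j)) \<Longrightarrow> poly_fun n {card J} (\<lambda>x t. \<Prod>j\<in>J. H j x t)"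
  by (induction J rule: finite_induct)
    (auto simp: poly_fun_const intro!: poly_fun_mult[where D = "{1}" and D' = "{card _}"])

lemma poly_fun_power_homogeneous:
  "poly_fun n {d} H \<Longrightarrow> poly_fun n {k * d} (\<lambda>x t. H x t ^ k)"
  by (induction k) (auto simp: poly_fun_const intro!: poly_fun_mult[where D = "{d}"])

lemma vandermonde_homogeneous: "poly_fun n {k * (n * (n - 1))} (\<lambda>x t. vandermonde k n t)"
proof -
  have "poly_fun n {1} (\<lambda>x t. t i - t j)" if "i < n" "j < n" for i j
  proof -
    have "poly_fun n {1} (\<lambda>x t. t i + (- 1) * t j)"
      using that by (intro poly_fun_add poly_fun_mult[where D = "{0}" and D' = "{1}"] poly_fun_var poly_fun_const) auto
    then show ?thesis by simp
  qed
  then have "poly_fun n {k * card (pairs n)} (\<lambda>x t. (\<Prod>e\<in>pairs n. t (fst e) - t (snd e)) ^ k)"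
    by (intro poly_fun_power_homogeneous poly_fun_prod_homogeneous finite_pairs) (auto simp: pairs_def)
  then show ?thesis by (simp add: card_pairs vandermonde_def case_prod_unfold)
qed

text \<open>The residue at u = 1 of u^a (u - 1)^s (u (u - 1))^(-\<kappa>-1) is the coefficient of (u
  - 1)^(\<kappa>-s) in u^(a-\<kappa>-1); for s > \<kappa> the pole has disappeared. The induction on
  s is Pascal's rule.\<close>

lemma quadrature_moment_1:
  assumes c: "\<forall>j\<le>D. (\<Sum>x\<in>nodes D. c x * x ^ j) = moment_1 \<kappa> j" and "a + s \<le> D"
  shows "(\<Sum>x\<in>nodes D. c x * (x ^ a * (x - 1) ^ s)) =
    (if s \<le> \<kappa> then (of_nat a - of_nat \<kappa> - 1) gchoose (\<kappa> - s) else 0)"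
  using assms(2)
proof (induction s arbitrary: a)
  case 0
  then show ?case using c by (simp add: moment_1_def)
next
  case (Suc s)
  have "(\<Sum>x\<in>nodes D. c x * (x ^ a * (x - 1) ^ Suc s)) =
     (\<Sum>x\<in>nodes D. c x * (x ^ Suc a * (x - 1) ^ s)) - (\<Sum>x\<in>nodes D. c x * (x ^ a * (x - 1) ^ s))"
    unfolding sum_subtractf[symmetric] by (intro sum.cong) (auto simp: algebra_simps)
  also have "\<dots> = (if s \<le> \<kappa> then (of_nat (Suc a) - of_nat \<kappa> - 1) gchoose (\<kappa> - s) else 0)
     - (if s \<le> \<kappa> then (of_nat a - of_nat \<kappa> - 1) gchoose (\<kappa> - s) else 0)"
    using Suc.IH[of a] Suc.IH[of "Suc a"] Suc.prems by simp
  also have "\<dots> = (if Suc s \<le> \<kappa> then (of_nat a - of_nat \<kappa> - 1) gchoose (\<kappa> - Suc s) else 0)"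
  proof (cases "Suc s \<le> \<kappa>")
    case True
    then obtain q where q: "\<kappa> - s = Suc q" "\<kappa> - Suc s = q" by (metis Suc_diff_Suc Suc_le_lessD)
    have "((of_nat a - of_nat \<kappa> - 1 :: complex) + 1) gchoose Suc q =
      ((of_nat a - of_nat \<kappa> - 1) gchoose q) + ((of_nat a - of_nat \<kappa> - 1) gchoose Suc q)"
      by (rule gbinomial_Suc_Suc)
    then show ?thesis using True unfolding q by simp
  qed auto
  finally show ?case .
qed

text \<open>On the unit circle -(a - b)^2 = a b |a - b|^2, so each pair of variables contributes a
  monomial times a nonnegative real number.\<close>

lemma vandermonde_unit_circle:
  "(\<And>i. i < n \<Longrightarrow> cmod (t i) = 1) \<Longrightarrow>
    vandermonde k n t = (\<Prod>i<n. t i ^ (k * (n - 1))) * of_real (\<Prod>i<n. \<Prod>l<i. cmod (t i - t l) ^ (2 * k))"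
proof (induction n)
  case (Suc n)
  have u: "- ((a - b)\<^sup>2) = a * b * of_real ((cmod (a - b))\<^sup>2)" if "cmod a = 1" "cmod b = 1" for a b
  proof -
    have ab: "a * cnj a = 1" "b * cnj b = 1"
      using that complex_norm_square[of a] complex_norm_square[of b] by simp_all
    have "a * b * of_real ((cmod (a - b))\<^sup>2) = a * b * ((a - b) * (cnj a - cnj b))"
      unfolding complex_norm_square by simp
    also have "\<dots> = (a - b) * (b * (a * cnj a) - a * (b * cnj b))" by (simp add: algebra_simps)
    finally show ?thesis unfolding ab by (simp add: power2_eq_square algebra_simps)
  qed
  have "(- 1) ^ (k * n) * (\<Prod>l<n. (t n - t l) ^ (2 * k)) = (\<Prod>l<n. (- ((t n - t l)\<^sup>2)) ^ k)"
  proof -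
    have "(- ((t n - t l)\<^sup>2)) ^ k = (- 1) ^ k * (t n - t l) ^ (2 * k)" for l
      by (subst power_minus) (simp add: power_mult)
    then show ?thesis by (simp add: prod.distrib power_mult)
  qed
  also have "\<dots> = (\<Prod>l<n. (t n * t l * of_real ((cmod (t n - t l))\<^sup>2)) ^ k)"
    by (intro prod.cong refl arg_cong[of _ _ "\<lambda>x. x ^ k"] u) (use Suc.prems in auto)
  also have "\<dots> = t n ^ (k * n) * (\<Prod>l<n. t l ^ k) * of_real (\<Prod>l<n. cmod (t n - t l) ^ (2 * k))"
    by (simp add: power_mult_distrib prod.distrib power_mult)
  finally have step: "(- 1) ^ (k * n) * (\<Prod>l<n. (t n - t l) ^ (2 * k)) =
     t n ^ (k * n) * (\<Prod>l<n. t l ^ k) * of_real (\<Prod>l<n. cmod (t n - t l) ^ (2 * k))" .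
  have "(\<Prod>i<n. t i ^ (k * (n - 1))) * (\<Prod>l<n. t l ^ k) = (\<Prod>i<n. t i ^ (k * n))"
    unfolding prod.distrib[symmetric] power_add[symmetric]
    by (intro prod.cong refl arg_cong[of _ _ "\<lambda>x. _ ^ x"]) (auto simp: diff_mult_distrib2 less_eq_Suc_le)
  then show ?case
    unfolding vandermonde_Suc step using Suc by (simp add: mult_ac)
qed (simp add: vandermonde_0)

text \<open>Roots of unity serve as a discrete circle. Among the exponents strictly between 0 and 2M
  only M is a multiple of M.\<close>

lemma sum_roots_of_unity_power:
  assumes "M > 0" "0 < j" "j < 2 * M"
  shows "(\<Sum>z | z ^ M = 1. z ^ j) = (if j = M then of_nat M else (0::complex))"
proof -
  define \<zeta> where "\<zeta> = cis (2 * pi / of_nat M)"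
  have b: "bij_betw (\<lambda>i. \<zeta> ^ i) {..<M} {z. z ^ M = 1}"
    using bij_betw_roots_unity[OF assms(1)] unfolding \<zeta>_def by (simp add: DeMoivre mult_ac)
  have \<zeta>M: "\<zeta> ^ M = 1" using assms(1) by (simp add: \<zeta>_def DeMoivre)
  have "\<zeta> ^ j = 1 \<longleftrightarrow> j = M"
  proof
    assume 1: "\<zeta> ^ j = 1"
    define e where "e = (if j < M then j else j - M)"
    have "\<zeta> ^ e = \<zeta> ^ 0"
    proof (cases "j < M")
      case False
      then have "\<zeta> ^ j = \<zeta> ^ M * \<zeta> ^ (j - M)" by (simp flip: power_add)
      then show ?thesis using False 1 \<zeta>M by (simp add: e_def)
    qed (use 1 in \<open>simp add: e_def\<close>)
    moreover have "e < M" using assms by (auto simp: e_def)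
    ultimately have "e = 0" using b assms(1) unfolding bij_betw_def inj_on_def by blast
    then show "j = M" using assms by (auto simp: e_def split: if_splits)
  qed (simp add: \<zeta>M)
  moreover have "(\<Sum>z | z ^ M = 1. z ^ j) = (\<Sum>i<M. (\<zeta> ^ j) ^ i)"
    unfolding sum.reindex_bij_betw[OF b, symmetric] by (simp add: power_mult[symmetric] mult.commute)
  moreover have "(\<zeta> ^ j) ^ M = 1" by (metis \<zeta>M power_mult mult.commute power_one)
  ultimately show ?thesis by (simp add: sum_gp_strict)
qed

lemma sum_eq_all_eq:
  fixes \<nu> :: "nat \<Rightarrow> nat"
  shows "(\<And>i. i < n \<Longrightarrow> \<nu> i \<le> \<kappa>) \<Longrightarrow> n * \<kappa> \<le> (\<Sum>i<n. \<nu> i) \<Longrightarrow> i < n \<Longrightarrow> \<nu> i = \<kappa>"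
proof (rule ccontr)
  assume *: "\<And>i. i < n \<Longrightarrow> \<nu> i \<le> \<kappa>" "n * \<kappa> \<le> (\<Sum>i<n. \<nu> i)" "i < n" "\<nu> i \<noteq> \<kappa>"
  have "(\<Sum>i<n. \<nu> i) < (\<Sum>i<n. \<kappa>)"
    by (rule sum_strict_mono_ex1) (use * in \<open>auto intro!: bexI[of _ i] simp: less_le\<close>)
  then show False using * by simp
qed

text \<open>The constant is the coefficient of \<open>\<Prod>\<^sub>i t\<^sub>i\<^sup>n\<^sup>k\<close> in \<open>\<Prod>\<^sub>i\<^sub>\<noteq>\<^sub>j (t\<^sub>i - t\<^sub>j)\<^sup>k\<close>; it is not zero because
  it is the mean value over a torus of a function that is nonnegative there.\<close>

lemma selberg_endpoints:
  assumes k: "k > 0"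
  obtains v where "v \<noteq> 0"
    "\<And>D c \<mu>. \<forall>j\<le>D. (\<Sum>x\<in>nodes D. c x * x ^ j) = moment_1 (n * k) j \<Longrightarrow>
       (\<Sum>i<Suc n. \<mu> i) + Suc n * (n * k) \<le> D \<Longrightarrow>
       wsum (\<lambda>_. c) (nodes D) (Suc n) (\<lambda>t. mon (Suc n) \<mu> t * vandermonde k (Suc n) t) = v"
    "\<And>D c \<mu>. \<forall>j\<le>D. (\<Sum>x\<in>nodes D. c x * x ^ j) = moment_0 (n * k) j \<Longrightarrow>
       (\<Sum>i<Suc n. \<mu> i) + Suc n * (n * k) \<le> D \<Longrightarrow>
       wsum (\<lambda>_. c) (nodes D) (Suc n) (\<lambda>t. mon (Suc n) \<mu> t * vandermonde k (Suc n) t) =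
         (if \<forall>i<Suc n. \<mu> i = 0 then v else 0)"
proof -
  define r \<kappa> where "r = Suc n" and "\<kappa> = n * k"
  have "poly_fun r {r * \<kappa>} (\<lambda>x t. vandermonde k r t)"
    using vandermonde_homogeneous[of r k] by (simp add: r_def \<kappa>_def mult_ac)
  then obtain xs where xs: "\<forall>(P, \<nu>)\<in>set xs. (\<Sum>i<r. \<nu> i) \<in> {r * \<kappa>}"
    "\<forall>x t. vandermonde k r t = (\<Sum>(P, \<nu>)\<leftarrow>xs. poly P x * mon r \<nu> t)"
    unfolding poly_fun_def by blast
  have expand: "vandermonde k r t = (\<Sum>(P, \<nu>)\<leftarrow>xs. poly P 0 * mon r \<nu> t)" for t using xs(2) by blast
  define v where "v = (\<Sum>(P, \<nu>)\<leftarrow>xs. if \<forall>i<r. \<nu> i = \<kappa> then poly P 0 else 0)"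
  have W: "wsum C X r (\<lambda>t. \<Sum>(P, \<nu>)\<leftarrow>xs. poly P 0 * h \<nu> t) = (\<Sum>(P, \<nu>)\<leftarrow>xs. poly P 0 * wsum C X r (h \<nu>))" for C X h
  proof -
    have "wsum C X r (\<lambda>t. \<Sum>(P, \<nu>)\<leftarrow>ys. poly P 0 * h \<nu> t) = (\<Sum>(P, \<nu>)\<leftarrow>ys. poly P 0 * wsum C X r (h \<nu>))" for ys
      by (induction ys) (auto simp: wsum_add wsum_mult, simp add: wsum_def)
    then show ?thesis .
  qed
  have Wv: "wsum C X r (\<lambda>t. \<Sum>(P, \<nu>)\<leftarrow>xs. poly P 0 * h \<nu> t) = e * v"
    if "\<And>\<nu>. (\<Sum>i<r. \<nu> i) = r * \<kappa> \<Longrightarrow> wsum C X r (h \<nu>) = (if \<forall>i<r. \<nu> i = \<kappa> then e else 0)" for C X h e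
    unfolding W v_def sum_list_const_mult[symmetric]
  proof (intro arg_cong[of _ _ sum_list] map_cong refl)
    fix a assume "a \<in> set xs"
    then have "(\<Sum>i<r. snd a i) = r * \<kappa>" using xs(1) by auto
    from that[OF this] show "(case a of (P, \<nu>) \<Rightarrow> poly P 0 * wsum C X r (h \<nu>)) =
        e * (case a of (P, \<nu>) \<Rightarrow> if \<forall>i<r. \<nu> i = \<kappa> then poly P 0 else 0)"
      by (cases "\<forall>i<r. snd a i = \<kappa>") (auto simp: case_prod_unfold)
  qed
  \<comment> \<open>The monomials of \<open>vandermonde\<close> have total degree r \<kappa>, so
    unless all exponents equal \<kappa>, one exceeds \<kappa>. The residue in that variable is then
    0, and only the coefficient \<open>v\<close> of the balanced monomial survives.\<close>
  have gt: "\<exists>i<r. \<nu> i > \<kappa>" if "(\<Sum>i<r. \<nu> i) \<ge> r * \<kappa>" "\<not> (\<forall>i<r. \<nu> i = \<kappa>)" for \<nu>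
    using sum_eq_all_eq[of r \<nu> \<kappa>] that by (meson not_le)
  have "v \<noteq> 0"
  proof -
    \<comment> \<open>Large enough that every exponent \<open>M - \<kappa> + \<nu> i\<close> lies
      strictly between 0 and 2M, and that there are r distinct M-th roots of unity, at which the
      nonnegative summand is positive.\<close>
    define M where "M = r * \<kappa> + r"
    define X where "X = {z::complex. z ^ M = 1}"
    have M: "M > 0" "\<kappa> < M" by (auto simp: M_def r_def)
    have fX: "finite X" unfolding X_def by (rule finite_roots_unity) (use M in simp)
    let ?W = "wsum (\<lambda>_ x. x ^ (M - \<kappa>)) X r"
    have e1: "?W (\<lambda>t. vandermonde k r t) = of_nat M ^ r * v"
      unfolding expand
    proof (rule Wv)
      fix \<nu> assume \<nu>: "(\<Sum>i<r. \<nu> i) = r * \<kappa>"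
      have le: "\<nu> i \<le> r * \<kappa>" if "i < r" for i
        unfolding \<nu>[symmetric] using that by (intro member_le_sum) auto
      have "?W (mon r \<nu>) = (\<Prod>i<r. if \<nu> i = \<kappa> then of_nat M else 0)"
      proof (rule wsum_mon[OF fX])
        fix i assume i: "i < r"
        have "(\<Sum>x\<in>X. x ^ (M - \<kappa>) * x ^ \<nu> i) = (\<Sum>x | x ^ M = 1. x ^ (M - \<kappa> + \<nu> i))"
          by (simp add: X_def power_add)
        also have "\<dots> = (if M - \<kappa> + \<nu> i = M then of_nat M else 0)"
        proof -
          have "\<nu> i < M" using le[OF i] by (simp add: M_def r_def)
          with M show ?thesis by (intro sum_roots_of_unity_power) linarith+
        qed
        finally show "(\<Sum>x\<in>X. x ^ (M - \<kappa>) * x ^ \<nu> i) = (if \<nu> i = \<kappa> then of_nat M else 0)"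
          using M by auto
      qed
      also have "\<dots> = (if \<forall>i<r. \<nu> i = \<kappa> then of_nat M ^ r else 0)"
      proof (cases "\<forall>i<r. \<nu> i = \<kappa>")
        case False
        then show ?thesis by (auto intro!: prod_zero)
      qed simp
      finally show "?W (mon r \<nu>) = (if \<forall>i<r. \<nu> i = \<kappa> then of_nat M ^ r else 0)" .
    qed
    have e2: "?W (\<lambda>t. vandermonde k r t) = of_real (\<Sum>t\<in>{..<r} \<rightarrow>\<^sub>E X. \<Prod>i<r. \<Prod>l<i. cmod (t i - t l) ^ (2 * k))"
      unfolding wsum_def of_real_sum
    proof (intro sum.cong refl, goal_cases)
      case (1 t)
      then have t: "t i ^ M = 1" if "i < r" for i using that by (auto simp: X_def)
      have "cmod (t i) = 1" if "i < r" for i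
      proof -
        have "cmod (t i) ^ M = 1" using t[OF that] by (metis norm_one norm_power)
        then have "cmod (t i) ^ M = 1 ^ M" by simp
        then show ?thesis by (rule power_eq_imp_eq_base) (use M in auto)
      qed
      then have "vandermonde k r t = (\<Prod>i<r. t i ^ \<kappa>) * of_real (\<Prod>i<r. \<Prod>l<i. cmod (t i - t l) ^ (2 * k))"
        using vandermonde_unit_circle[of r t k] by (simp add: r_def \<kappa>_def mult_ac)
      moreover have "(\<Prod>i<r. t i ^ (M - \<kappa>)) * (\<Prod>i<r. t i ^ \<kappa>) = 1"
        unfolding prod.distrib[symmetric] power_add[symmetric] using M t by simp
      ultimately show ?case
        by (simp add: mult.assoc[symmetric])
    qed
    have "(\<Sum>t\<in>{..<r} \<rightarrow>\<^sub>E X. \<Prod>i<r. \<Prod>l<i. cmod (t i - t l) ^ (2 * k)) > 0"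
    proof -
      have b: "bij_betw (\<lambda>i. cis (2 * pi * real i / real M)) {..<M} X"
        unfolding X_def by (rule bij_betw_roots_unity) (use M in simp)
      define t where "t = restrict (\<lambda>i. cis (2 * pi * real i / real M)) {..<r}"
      have rM: "i < M" if "i < r" for i using that by (simp add: M_def)
      have "t \<in> {..<r} \<rightarrow>\<^sub>E X"
        using bij_betwE[OF b] rM by (auto simp: t_def)
      moreover have "(\<Prod>i<r. \<Prod>l<i. cmod (t i - t l) ^ (2 * k)) > 0"
      proof (intro prod_pos ballI)
        fix i l assume il: "i \<in> {..<r}" "l \<in> {..<i}"
        then have "t i \<noteq> t l"
          using inj_onD[OF bij_betw_imp_inj_on[OF b], of i l] rM[of i] rM[of l] by (auto simp: t_def)
        then show "cmod (t i - t l) ^ (2 * k) > 0" by simp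
      qed
      moreover have "finite ({..<r} \<rightarrow>\<^sub>E X)" using fX by (intro finite_PiE) auto
      moreover have "(\<Prod>i<r. \<Prod>l<i. cmod (s i - s l) ^ (2 * k)) \<ge> 0" for s
        by (intro prod_nonneg ballI) simp
      ultimately show ?thesis by (intro sum_pos2[of _ t]) simp_all
    qed
    then have "?W (\<lambda>t. vandermonde k r t) \<noteq> 0" unfolding e2 of_real_eq_0_iff by (rule less_imp_neq[symmetric])
    then show "v \<noteq> 0" unfolding e1 by auto
  qed
  moreover have "wsum (\<lambda>_. c) (nodes D) r (\<lambda>t. mon r \<mu> t * vandermonde k r t) = v"
    if c: "\<forall>j\<le>D. (\<Sum>x\<in>nodes D. c x * x ^ j) = moment_1 \<kappa> j" and D: "(\<Sum>i<r. \<mu> i) + r * \<kappa> \<le> D" for c D \<mu>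
  proof -
    \<comment> \<open>By translation invariance \<open>vandermonde\<close> can be expanded around
      (1, ..., 1), where the residues are taken. The leading value of \<open>mon r \<mu>\<close>
      there is 1, so the result does not depend on \<mu>.\<close>
    have V1: "mon r \<mu> t * vandermonde k r t = (\<Sum>(P, \<nu>)\<leftarrow>xs. poly P 0 * (mon r \<mu> t * mon r \<nu> (\<lambda>i. t i - 1)))" for t
    proof -
      have "mon r \<mu> t * vandermonde k r t = mon r \<mu> t * (\<Sum>(P, \<nu>)\<leftarrow>xs. poly P 0 * mon r \<nu> (\<lambda>i. t i - 1))"
        using expand[of "\<lambda>i. t i - 1"] unfolding vandermonde_translate by (rule arg_cong)
      then show ?thesis unfolding sum_list_const_mult[symmetric]
        by (simp add: case_prod_unfold mult.left_commute)
    qed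
    have "wsum (\<lambda>_. c) (nodes D) r (\<lambda>t. mon r \<mu> t * vandermonde k r t) = 1 * v"
      unfolding V1
    proof (rule Wv)
      fix \<nu> assume \<nu>: "(\<Sum>i<r. \<nu> i) = r * \<kappa>"
      have le: "\<mu> i + \<nu> i \<le> D" if "i < r" for i
        using member_le_sum[of i "{..<r}" \<nu>] member_le_sum[of i "{..<r}" \<mu>] that D \<nu> by simp
      have "wsum (\<lambda>_. c) (nodes D) r (\<lambda>t. mon r \<mu> t * mon r \<nu> (\<lambda>i. t i - 1)) =
          (\<Prod>i<r. \<Sum>x\<in>nodes D. c x * (x ^ \<mu> i * (x - 1) ^ \<nu> i))"
        using wsum_prod[of "nodes D" "\<lambda>_. c" r "\<lambda>i x. x ^ \<mu> i * (x - 1) ^ \<nu> i"]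
        by (simp add: mon_def prod.distrib)
      also have "\<dots> = (\<Prod>i<r. if \<nu> i \<le> \<kappa> then (of_nat (\<mu> i) - of_nat \<kappa> - 1) gchoose (\<kappa> - \<nu> i) else 0)"
        by (intro prod.cong refl quadrature_moment_1[OF c] le) simp
      also have "\<dots> = (if \<forall>i<r. \<nu> i = \<kappa> then 1 else 0)"
      proof (cases "\<forall>i<r. \<nu> i = \<kappa>")
        case False
        then obtain i where "i < r" "\<nu> i > \<kappa>" using gt[of \<nu>] \<nu> by auto
        then show ?thesis using False by (auto intro!: prod_zero bexI[of _ i])
      qed simp
      finally show "wsum (\<lambda>_. c) (nodes D) r (\<lambda>t. mon r \<mu> t * mon r \<nu> (\<lambda>i. t i - 1)) = (if \<forall>i<r. \<nu> i = \<kappa> then 1 else 0)" .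
    qed
    then show ?thesis by simp
  qed
  moreover have "wsum (\<lambda>_. c) (nodes D) r (\<lambda>t. mon r \<mu> t * vandermonde k r t) = (if \<forall>i<r. \<mu> i = 0 then v else 0)"
    if c: "\<forall>j\<le>D. (\<Sum>x\<in>nodes D. c x * x ^ j) = moment_0 \<kappa> j" and D: "(\<Sum>i<r. \<mu> i) + r * \<kappa> \<le> D" for c D \<mu>
  proof -
    have V1: "mon r \<mu> t * vandermonde k r t = (\<Sum>(P, \<nu>)\<leftarrow>xs. poly P 0 * mon r (\<lambda>i. \<mu> i + \<nu> i) t)" for t
      unfolding expand sum_list_const_mult[symmetric] mon_mult[symmetric]
      by (intro arg_cong[of _ _ sum_list] map_cong refl) auto
    have "wsum (\<lambda>_. c) (nodes D) r (\<lambda>t. mon r \<mu> t * vandermonde k r t) = (if \<forall>i<r. \<mu> i = 0 then 1 else 0) * v"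
      unfolding V1
    proof (rule Wv)
      fix \<nu> assume \<nu>: "(\<Sum>i<r. \<nu> i) = r * \<kappa>"
      have le: "\<mu> i + \<nu> i \<le> D" if "i < r" for i
        using member_le_sum[of i "{..<r}" \<nu>] member_le_sum[of i "{..<r}" \<mu>] that D \<nu> by simp
      have w: "wsum (\<lambda>_. c) (nodes D) r (mon r (\<lambda>i. \<mu> i + \<nu> i)) = (\<Prod>i<r. moment_0 \<kappa> (\<mu> i + \<nu> i))"
        by (rule wsum_mon) (use c le in auto)
      show "wsum (\<lambda>_. c) (nodes D) r (mon r (\<lambda>i. \<mu> i + \<nu> i)) =
          (if \<forall>i<r. \<nu> i = \<kappa> then if \<forall>i<r. \<mu> i = 0 then 1 else 0 else 0)"
      proof (cases "\<forall>i<r. \<mu> i + \<nu> i \<le> \<kappa>")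
        case True
        have *: "\<mu> i + \<nu> i = \<kappa>" if "i < r" for i
          by (rule sum_eq_all_eq[of r "\<lambda>i. \<mu> i + \<nu> i" \<kappa>]) (use True \<nu> that in \<open>auto simp: sum.distrib\<close>)
        have "(\<Sum>i<r. \<mu> i + \<nu> i) = r * \<kappa>" using * by simp
        then have "\<forall>i<r. \<mu> i = 0" using \<nu> by (simp add: sum.distrib)
        \<comment> \<open>Each factor is (-1)^\<kappa>, and the signs cancel because r \<kappa> = n
          (n + 1) k is even.\<close>
        moreover have "(\<Prod>i<r. moment_0 \<kappa> (\<mu> i + \<nu> i)) = 1"
        proof -
          have "moment_0 \<kappa> \<kappa> = (- 1) ^ \<kappa>"
            using gbinomial_minus[of "1::complex" \<kappa>] by (simp add: moment_0_def moment_1_def binomial_gbinomial[symmetric])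
          moreover have "even (r * \<kappa>)" by (simp add: r_def \<kappa>_def)
          ultimately show ?thesis using * by (simp add: power_mult[symmetric] mult.commute)
        qed
        ultimately show ?thesis using * w by auto
      next
        case False
        then obtain i where i: "i < r" "\<mu> i + \<nu> i > \<kappa>" by (auto simp: not_le)
        then have "(\<Prod>i<r. moment_0 \<kappa> (\<mu> i + \<nu> i)) = 0"
          by (auto simp: moment_0_def intro!: prod_zero bexI[of _ i])
        moreover have "\<not> ((\<forall>i<r. \<nu> i = \<kappa>) \<and> (\<forall>i<r. \<mu> i = 0))" using i by auto
        ultimately show ?thesis unfolding w by auto
      qed
    qed
    then show ?thesis by (cases "\<forall>i<r. \<mu> i = 0") auto
  qed
  ultimately show thesis using that unfolding r_def \<kappa>_def by blast
qed

section \<open>Residues at infinity in the last variable\<close>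

definition binomial_series :: "complex \<Rightarrow> complex \<Rightarrow> complex fps" where
  "binomial_series a c = Abs_fps (\<lambda>q. (a gchoose q) * (- c) ^ q)"

text \<open>\<open>binomial_series a c\<close> is (1 - c z)^a. At x = k the product is what the
  factors of the integrand involving t_n become under t_n = 1/z, apart from t_n^(-2). Its
  coefficients are polynomials in x and t, so x may be any complex number.\<close>

definition selberg_series :: "nat \<Rightarrow> complex \<Rightarrow> (nat \<Rightarrow> complex) \<Rightarrow> complex fps" where
  "selberg_series n x t = binomial_series (- 1 - of_nat n * x) 1 * (\<Prod>l<n. binomial_series (2 * x) (t l))"

lemma selberg_series_0: "fps_nth (selberg_series n x t) 0 = 1"
proof -
  have "fps_nth (\<Prod>l\<in>L. binomial_series (2 * x) (t l)) 0 = 1" for L :: "nat set"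
    by (induction L rule: infinite_finite_induct) (simp_all add: binomial_series_def)
  then show ?thesis by (simp add: selberg_series_def) (simp add: binomial_series_def)
qed

text \<open>At \<open>x = k\<close> this is, up to sign, the residue at \<open>t\<^sub>n = \<infinity>\<close> of the integrand defined by
  the monomial \<open>t\<^sup>\<nu>\<close>, divided by the factors that do not involve \<open>t\<^sub>n\<close>.\<close>

definition selberg_residue :: "nat \<Rightarrow> (nat \<Rightarrow> nat) \<Rightarrow> complex \<Rightarrow> (nat \<Rightarrow> complex) \<Rightarrow> complex" where
  "selberg_residue n \<nu> x t =
     mon n \<nu> t * (if \<nu> n = 0 then 0 else fps_nth (selberg_series n x t) (\<nu> n - 1))"

lemma poly_fun_gbinomial:
  "poly_fun n UNIV G \<Longrightarrow> poly_fun n UNIV (\<lambda>x t. (G x t) gchoose q)"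
proof (induction q)
  case (Suc q)
  have "(G x t) gchoose Suc q = (1 / of_nat (Suc q)) * ((G x t + (- of_nat q)) * ((G x t) gchoose q))" for x t
  proof -
    have "of_nat (Suc q) * ((G x t) gchoose Suc q) = (G x t + (- of_nat q)) * ((G x t) gchoose q)"
      using gbinomial_mult_1[of "G x t" q] by (simp add: algebra_simps)
    then show ?thesis by (simp add: nonzero_eq_divide_eq mult.commute del: of_nat_Suc)
  qed
  then show ?case
    using Suc by (simp only:) (intro poly_fun_mult[where D = UNIV and D' = UNIV] poly_fun_add poly_fun_const; simp)
qed (simp add: poly_fun_const)

lemma poly_fun_fps_mult:
  assumes "\<And>q. poly_fun n UNIV (\<lambda>x t. fps_nth (F x t) q)" "\<And>q. poly_fun n UNIV (\<lambda>x t. fps_nth (G x t) q)"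
  shows "poly_fun n UNIV (\<lambda>x t. fps_nth (F x t * G x t) q)"
  unfolding fps_mult_nth
  by (intro poly_fun_sum poly_fun_mult[where D = UNIV and D' = UNIV] assms) simp

lemma poly_fun_power:
  "poly_fun n UNIV H \<Longrightarrow> poly_fun n UNIV (\<lambda>x t. H x t ^ k)"
  by (induction k) (auto simp: poly_fun_const intro!: poly_fun_mult[where D = UNIV and D' = UNIV])

lemma poly_fun_selberg_residue: "poly_fun n UNIV (selberg_residue n \<nu>)"
proof -
  have var: "poly_fun n UNIV (\<lambda>x t. - t l)" if "l < n" for l
    using poly_fun_mult[OF poly_fun_const[of UNIV n "- 1"] poly_fun_var[OF that, of UNIV], of UNIV] by simp
  have lin: "poly_fun n UNIV (\<lambda>x t. a + b * x)" for a b
    by (intro poly_fun_add poly_fun_mult[where D = UNIV and D' = UNIV] poly_fun_const poly_fun_x) auto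
  have prod: "poly_fun n UNIV (\<lambda>x t. fps_nth (\<Prod>l\<in>L. binomial_series (2 * x) (t l)) q)" if "finite L" "L \<subseteq> {..<n}" for L q
    using that
  proof (induction L arbitrary: q rule: finite_induct)
    case empty
    show ?case by (cases "q = 0") (simp_all add: poly_fun_const)
  next
    case (insert l L)
    have "poly_fun n UNIV (\<lambda>x t. fps_nth (binomial_series (2 * x) (t l)) q)" for q
      using lin[of 0 2] insert.prems unfolding binomial_series_def
      by (auto intro!: poly_fun_mult[where D = UNIV and D' = UNIV] poly_fun_gbinomial poly_fun_power var)
    then show ?case using insert by (simp add: poly_fun_fps_mult)
  qed
  have "poly_fun n UNIV (\<lambda>x t. fps_nth (binomial_series (- 1 - of_nat n * x) 1) q)" for q
    using poly_fun_gbinomial[OF lin[of "- 1" "- of_nat n"]] unfolding binomial_series_def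
    by (auto intro!: poly_fun_mult[where D = UNIV and D' = UNIV] poly_fun_const)
  then have "poly_fun n UNIV (\<lambda>x t. fps_nth (selberg_series n x t) q)" for q
    unfolding selberg_series_def by (intro poly_fun_fps_mult prod) auto
  moreover have "poly_fun n UNIV (\<lambda>x t. mon n \<nu> t)"
    using poly_fun_monom[where n = n and \<nu> = \<nu> and D = UNIV and P = 1] by simp
  ultimately show ?thesis
    unfolding selberg_residue_def[abs_def]
    by (cases "\<nu> n = 0") (auto simp: poly_fun_0 intro!: poly_fun_mult[where D = UNIV and D' = UNIV])
qed

text \<open>The difference of the two moments is the sum of the residues at 0 and 1, hence up to
  sign the residue at infinity. It is found by reading the polynomial factor backwards, in powers of
  1/x.\<close>

lemma selberg_residue_quadrature:
  assumes c: "\<forall>j\<le>D. (\<Sum>x\<in>nodes D. c x * x ^ j) = moment_1 (n * k) j - moment_0 (n * k) j"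
    and D: "b + 2 * k * n \<le> D"
  shows "(\<Sum>x\<in>nodes D. c x * (x ^ b * (\<Prod>l<n. (x - t l) ^ (2 * k)))) =
    (if b = 0 then 0 else fps_nth (selberg_series n (of_nat k) t) (b - 1))"
proof -
  define \<kappa> N where "\<kappa> = n * k" and "N = 2 * k * n"
  define P where "P = (\<Prod>l<n. [:- t l, 1:] ^ (2 * k))"
  have degP: "degree P = N"
    unfolding P_def by (subst degree_prod_eq_sum_degree) (auto simp: degree_linear_power N_def)
  have "reflect_poly P = (\<Prod>l<n. [:1, - t l:] ^ (2 * k))"
  proof -
    have "reflect_poly [:- a, 1:] = [:1, - a:]" for a :: complex
      by (cases "a = 0") (simp_all add: reflect_poly_def)
    then show ?thesis by (simp add: P_def reflect_poly_prod reflect_poly_power)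
  qed
  moreover have "binomial_series (2 * of_nat k) a = fps_of_poly ([:1, - a:] ^ (2 * k))" for a
  proof (rule fps_ext)
    fix q
    have "coeff ([:1, - a:] ^ (2 * k)) q = of_nat (2 * k choose q) * (- a) ^ q"
    proof (cases "q \<le> 2 * k")
      case False
      moreover have "degree ([:1, - a:] ^ (2 * k)) \<le> 2 * k"
        using degree_power_le[of "[:1, - a:]" "2 * k"] by (cases "a = 0") auto
      ultimately show ?thesis by (simp add: coeff_eq_0)
    qed (simp add: coeff_linear_poly_power)
    then show "fps_nth (binomial_series (2 * of_nat k) a) q = fps_nth (fps_of_poly ([:1, - a:] ^ (2 * k))) q"
      by (simp add: binomial_series_def binomial_gbinomial)
  qed
  ultimately have S: "selberg_series n (of_nat k) t = binomial_series (- 1 - of_nat \<kappa>) 1 * fps_of_poly (reflect_poly P)"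
    by (simp add: selberg_series_def fps_of_poly_prod \<kappa>_def)
  define m where "m j = moment_1 \<kappa> j - moment_0 \<kappa> j" for j
  have "(\<Sum>x\<in>nodes D. c x * (x ^ b * (\<Prod>l<n. (x - t l) ^ (2 * k)))) = (\<Sum>x\<in>nodes D. \<Sum>i\<le>N. coeff P i * (c x * x ^ (b + i)))"
  proof (intro sum.cong refl, goal_cases)
    case (1 x)
    have "(\<Prod>l<n. (x - t l) ^ (2 * k)) = (\<Sum>i\<le>N. coeff P i * x ^ i)"
      unfolding degP[symmetric] poly_altdef[symmetric] by (simp add: P_def poly_prod)
    then show ?case
      by (simp add: sum_distrib_left power_add mult_ac)
  qed
  also have "\<dots> = (\<Sum>i\<le>N. coeff P i * m (b + i))"
    by (subst sum.swap, unfold sum_distrib_left[symmetric])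
      (intro sum.cong refl, use c D in \<open>simp add: m_def \<kappa>_def N_def\<close>)
  also have "\<dots> = (\<Sum>j\<le>N. coeff (reflect_poly P) j * m (b + N - j))"
    by (rule sum.reindex_bij_witness[of _ "\<lambda>i. N - i" "\<lambda>i. N - i"]) (auto simp: coeff_reflect_poly degP)
  also have "\<dots> = (\<Sum>j\<le>N. if j < b then coeff (reflect_poly P) j * fps_nth (binomial_series (- 1 - of_nat \<kappa>) 1) (b - 1 - j) else 0)"
  proof (intro sum.cong refl, goal_cases)
    case j: (1 j)
    have N: "N = 2 * \<kappa>" by (simp add: N_def \<kappa>_def)
    \<comment> \<open>Up to \<kappa> the two moments cancel, and at \<kappa> + 1 + q their
      difference is (q choose \<kappa>), which is 0 for q < \<kappa>. As N = 2 \<kappa>, the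
      coefficients of (1 - z)^(-1-\<kappa>) remain.\<close>
    have "m (b + N - j) = (if j < b then fps_nth (binomial_series (- 1 - of_nat \<kappa>) 1) (b - 1 - j) else 0)"
    proof (cases "b + N - j \<le> \<kappa>")
      case True
      then show ?thesis using N j by (auto simp: m_def moment_0_def)
    next
      case False
      then obtain q where q: "b + N - j = \<kappa> + 1 + q" by (metis Suc_eq_plus1 add.assoc add.commute less_imp_Suc_add not_le)
      have "m (b + N - j) = of_nat (q choose \<kappa>)"
        using False by (simp add: m_def moment_0_def) (simp add: q moment_1_def binomial_gbinomial)
      also have "\<dots> = (if j < b then fps_nth (binomial_series (- 1 - of_nat \<kappa>) 1) (b - 1 - j) else 0)"
      proof (cases "j < b")
        case True
        then have q': "q = \<kappa> + (b - 1 - j)" using q N by auto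
        define e where "e = b - 1 - j"
        have "fps_nth (binomial_series (- 1 - of_nat \<kappa>) 1) e = of_nat ((\<kappa> + e) choose e)"
        proof -
          have "((- (of_nat \<kappa> + 1)) gchoose e) = (- 1) ^ e * ((of_nat (\<kappa> + e) :: complex) gchoose e)"
            using gbinomial_minus[of "of_nat \<kappa> + 1 :: complex" e] by (simp add: add_ac)
          then show ?thesis
            by (simp add: binomial_series_def binomial_gbinomial minus_add_distrib[symmetric] power_mult_distrib[symmetric] mult_ac del: minus_add_distrib)
              (simp add: algebra_simps flip: power_mult_distrib)
        qed
        then show ?thesis using True unfolding q' e_def[symmetric]
          by (simp add: binomial_symmetric[of \<kappa> "\<kappa> + e"])
      next
        case False
        then have "q < \<kappa>" using q N by auto
        then show ?thesis using False by simp
      qed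
      finally show ?thesis .
    qed
    then show ?case
      by simp
  qed
  also have "\<dots> = (if b = 0 then 0 else fps_nth (selberg_series n (of_nat k) t) (b - 1))"
  proof (cases "b = 0")
    case False
    define g where "g j = coeff (reflect_poly P) j * fps_nth (binomial_series (- 1 - of_nat \<kappa>) 1) (b - 1 - j)" for j
    have "(\<Sum>j\<le>N. if j < b then g j else 0) = (\<Sum>j\<in>{..N} \<inter> {j. j < b}. g j)"
      by (simp add: sum.If_cases)
    also have "\<dots> = (\<Sum>j\<le>b - 1. g j)"
      by (rule sum.mono_neutral_left) (use False in \<open>auto simp: g_def coeff_reflect_poly degP\<close>)
    also have "\<dots> = fps_nth (fps_of_poly (reflect_poly P) * binomial_series (- 1 - of_nat \<kappa>) 1) (b - 1)"
      by (simp add: fps_mult_nth g_def atLeast0AtMost)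
    finally show ?thesis using False unfolding g_def S by (simp add: mult.commute)
  qed simp
  finally show ?thesis .
qed

section \<open>Comparison of the two ends\<close>

lemma wsum_sum_list:
  "wsum C X n (\<lambda>t. (\<Sum>a\<leftarrow>xs. c a * h a t)) = (\<Sum>a\<leftarrow>xs. c a * wsum C X n (h a))"
  by (induction xs) (auto simp: wsum_add wsum_mult, simp add: wsum_def)

lemma wsum_weights_cong:
  "(\<And>i x. i < n \<Longrightarrow> C i x = C' i x) \<Longrightarrow> wsum C X n G = wsum C' X n G"
  unfolding wsum_def by (intro sum.cong refl arg_cong2[of _ _ _ _ "(*)"] prod.cong) auto

lemma poly_wsum:
  "poly (wsum C X n G) \<theta> = wsum (\<lambda>i x. poly (C i x) \<theta>) X n (\<lambda>t. poly (G t) \<theta>)"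
  by (simp add: wsum_def poly_sum poly_prod)

text \<open>By the product rule one of the n + 1 weights a + \<theta> b is replaced by b; the
  symmetry of \<open>G\<close> makes every choice equal to that of the last variable.\<close>

lemma pderiv_wsum:
  fixes G :: "(nat \<Rightarrow> complex) \<Rightarrow> complex"
  assumes X: "finite X" and sym: "\<And>t i. i < n \<Longrightarrow> G (t \<circ> sw i n) = G t"
  shows "pderiv (wsum (\<lambda>_ x. [:a x, b x:]) X (Suc n) (\<lambda>t. [:G t:])) =
    of_nat (Suc n) * wsum (\<lambda>_ x. [:a x, b x:]) X n (\<lambda>t. [:\<Sum>x\<in>X. b x * G (t(n := x)):])"
proof -
  define C where "C i j x = (if j = i then [:b x:] else [:a x, b x:])" for i j :: nat and x
  have "pderiv (\<Prod>i<Suc n. [:a (t i), b (t i):]) = (\<Sum>i<Suc n. \<Prod>j<Suc n. C i j (t j))" for t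
    unfolding pderiv_prod
  proof (intro sum.cong refl, goal_cases)
    case (1 i)
    then have "(\<Prod>j<Suc n. C i j (t j)) = C i i (t i) * (\<Prod>j\<in>{..<Suc n} - {i}. C i j (t j))"
      by (intro prod.remove) auto
    also have "(\<Prod>j\<in>{..<Suc n} - {i}. C i j (t j)) = (\<Prod>j\<in>{..<Suc n} - {i}. [:a (t j), b (t j):])"
      by (intro prod.cong) (auto simp: C_def)
    finally show ?case
      by (simp add: C_def pderiv_pCons)
  qed
  moreover have ps: "pderiv (sum h A) = (\<Sum>t\<in>A. pderiv (h t))" for h :: "(nat \<Rightarrow> complex) \<Rightarrow> complex poly" and A
    by (induction A rule: infinite_finite_induct) (auto simp: pderiv_add)
  ultimately have "pderiv (wsum (\<lambda>_ x. [:a x, b x:]) X (Suc n) (\<lambda>t. [:G t:])) = (\<Sum>i<Suc n. wsum (C i) X (Suc n) (\<lambda>t. [:G t:]))"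
    unfolding wsum_def sum.swap[of _ "{..<Suc n}"] ps pderiv_mult
    by (simp add: sum_distrib_left sum_distrib_right pderiv_pCons mult.commute del: prod.lessThan_Suc sum.lessThan_Suc)
      (rule sum.swap)
  also have "\<dots> = (\<Sum>i<Suc n. wsum (C n) X (Suc n) (\<lambda>t. [:G t:]))"
  proof (intro sum.cong refl, goal_cases)
    case (1 i)
    then have i: "i < Suc n" by simp
    have "(\<lambda>l. C i (sw i n l)) = C n" by (auto simp: C_def sw_def fun_eq_iff)
    moreover have "G (t \<circ> sw i n) = G t" for t
    proof (cases "i = n")
      case True
      have "t \<circ> sw n n = t" by (auto simp: sw_def fun_eq_iff)
      then show ?thesis using True by simp
    qed (use sym i in auto)
    ultimately show ?case
      using wsum_swap[OF i, of n "C i" X "\<lambda>t. [:G t:]"] by simp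
  qed
  also have "\<dots> = of_nat (Suc n) * wsum (C n) X (Suc n) (\<lambda>t. [:G t:])" by simp
  also have "wsum (C n) X (Suc n) (\<lambda>t. [:G t:]) = wsum (C n) X n (\<lambda>t. [:\<Sum>x\<in>X. b x * G (t(n := x)):])"
  proof -
    have "(\<Sum>x\<in>A. [:g x:]) = [:sum g A:]" for g :: "complex \<Rightarrow> complex" and A
      by (induction A rule: infinite_finite_induct) auto
    then show ?thesis unfolding wsum_Suc[OF X] C_def by (simp add: mult.commute)
  qed
  also have "\<dots> = wsum (\<lambda>_ x. [:a x, b x:]) X n (\<lambda>t. [:\<Sum>x\<in>X. b x * G (t(n := x)):])"
    by (rule wsum_weights_cong) (auto simp: C_def)
  finally show ?thesis .
qed

text \<open>The integrals over \<open>n + 1\<close> variables of \<open>f\<close> and of \<open>\<Sum>\<^sub>i t\<^sub>i\<close> are polynomials in \<open>\<theta>\<close> whose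
  derivatives are proportional, with factor \<open>B / A\<close>. Comparing the values at \<open>\<theta> = 0\<close> and \<open>\<theta> = 1\<close>
  yields \<open>A(k) (f(1,\<dots>,1) - f(0,\<dots>,0)) = (n + 1) B(k)\<close> for all positive integers \<open>k\<close>.\<close>

theorem selberg_key:
  fixes cf :: "'e \<Rightarrow> complex"
  assumes E: "finite E"
    and sym: "\<And>t i. i < n \<Longrightarrow> (\<Sum>e\<in>E. cf e * mon (Suc n) (\<nu> e) (t \<circ> sw i n)) = (\<Sum>e\<in>E. cf e * mon (Suc n) (\<nu> e) t)"
    and x: "\<And>a M. M < n \<Longrightarrow> of_nat a \<noteq> x * (2 + of_nat M)"
    and zero: "\<And>t. (\<Sum>e\<in>E. cf e * selberg_residue n (\<nu> e) x t) = 0"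
  shows "(\<Sum>e\<in>E. cf e * mon (Suc n) (\<nu> e) (\<lambda>_. 1)) = (\<Sum>e\<in>E. cf e * mon (Suc n) (\<nu> e) (\<lambda>_. 0))"
proof -
  define J where "J = (\<Sum>e\<in>E. cf e * mon (Suc n) (\<nu> e) (\<lambda>_. 1)) - (\<Sum>e\<in>E. cf e * mon (Suc n) (\<nu> e) (\<lambda>_. 0))"
  have "poly_fun n UNIV (\<lambda>x t. \<Sum>e\<in>E. cf e * selberg_residue n (\<nu> e) x t)"
    by (intro poly_fun_sum poly_fun_mult[where D = UNIV and D' = UNIV] poly_fun_const poly_fun_selberg_residue) auto
  then obtain xs where xs: "\<And>x t. (\<Sum>e\<in>E. cf e * selberg_residue n (\<nu> e) x t) = (\<Sum>(P, \<mu>)\<leftarrow>xs. poly P x * mon n \<mu> t)"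
    unfolding poly_fun_def by blast
  define T where "T = Max (insert 0 ((\<lambda>(P, \<mu>). \<Sum>i<n. \<mu> i) ` set xs))"
  have T: "\<forall>(P, \<mu>)\<in>set xs. (\<Sum>i<n. \<mu> i) \<le> T"
  proof safe
    fix P \<mu> assume "(P, \<mu>) \<in> set xs"
    then show "(\<Sum>i<n. \<mu> i) \<le> T"
      unfolding T_def by (intro Max_ge) (simp_all, force)
  qed
  obtain A B where A: "poly A x \<noteq> 0" and B: "poly B x = 0"
    and AB: "\<And>k F. k > 0 \<Longrightarrow> selberg_rec n T k F \<Longrightarrow>
        poly A (of_nat k) * (\<Sum>(P, \<mu>)\<leftarrow>xs. poly P (of_nat k) * F \<mu>) = poly B (of_nat k) * F (\<lambda>_. 0)"
  proof -
    have "\<exists>A B. poly A x \<noteq> 0 \<and> poly B x = 0 \<and> (\<forall>k F. k > 0 \<longrightarrow> selberg_rec n T k F \<longrightarrow>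
        poly A (of_nat k) * (\<Sum>(P, \<mu>)\<leftarrow>xs. poly P (of_nat k) * F \<mu>) = poly B (of_nat k) * F (\<lambda>_. 0))"
      by (rule selberg_reduction_poly_fun[OF x zero xs T])
    then show ?thesis using that by (elim exE conjE) simp
  qed
  have main: "poly A (of_nat k) * J = of_nat (Suc n) * poly B (of_nat k)" if k: "k > 0" for k
  proof -
    obtain v where v: "v \<noteq> 0"
      and v1: "\<And>D c \<mu>. \<forall>j\<le>D. (\<Sum>x\<in>nodes D. c x * x ^ j) = moment_1 (n * k) j \<Longrightarrow>
       (\<Sum>i<Suc n. \<mu> i) + Suc n * (n * k) \<le> D \<Longrightarrow>
       wsum (\<lambda>_. c) (nodes D) (Suc n) (\<lambda>t. mon (Suc n) \<mu> t * vandermonde k (Suc n) t) = v"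
      and v0: "\<And>D c \<mu>. \<forall>j\<le>D. (\<Sum>x\<in>nodes D. c x * x ^ j) = moment_0 (n * k) j \<Longrightarrow>
       (\<Sum>i<Suc n. \<mu> i) + Suc n * (n * k) \<le> D \<Longrightarrow>
       wsum (\<lambda>_. c) (nodes D) (Suc n) (\<lambda>t. mon (Suc n) \<mu> t * vandermonde k (Suc n) t) =
         (if \<forall>i<Suc n. \<mu> i = 0 then v else 0)"
    proof -
      show thesis by (rule selberg_endpoints[OF k, where n = n]) (fact that)
    qed
    define T' where "T' = (\<Sum>e\<in>E. \<Sum>i<Suc n. \<nu> e i)"
    have T': "(\<Sum>i<Suc n. \<nu> e i) \<le> T'" if "e \<in> E" for e
      unfolding T'_def using E that by (intro member_le_sum) auto
    \<comment> \<open>One number of nodes for all purposes: the recursion, the exponents of the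
      given polynomial, the evaluation at both ends and the residues.\<close>
    define D where "D = T + T' + Suc n * (n * k) + 2 * k * n + 2"
    obtain c1 where c1: "\<forall>j\<le>D. (\<Sum>x\<in>nodes D. c1 x * x ^ j) = moment_1 (n * k) j"
      using quadrature by blast
    obtain c0 where c0: "\<forall>j\<le>D. (\<Sum>x\<in>nodes D. c0 x * x ^ j) = moment_0 (n * k) j"
      using quadrature by blast
    define c where "c x = c1 x - c0 x" for x
    have c: "\<forall>j\<le>D. (\<Sum>x\<in>nodes D. c x * x ^ j) = moment_1 (n * k) j - moment_0 (n * k) j"
      using c1 c0 by (simp add: c_def left_diff_distrib sum_subtractf)
    have c\<theta>: "\<forall>j\<le>D. (\<Sum>x\<in>nodes D. (c0 x + \<theta> * c x) * x ^ j) = moment (n * k) \<theta> j" for \<theta>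
      using c c0 by (simp add: moment_def distrib_right sum.distrib mult.assoc sum_distrib_left[symmetric])
    define F where "F \<theta> \<mu> = wsum (\<lambda>_ x. c0 x + \<theta> * c x) (nodes D) n (\<lambda>t. mon n \<mu> t * vandermonde k n t)" for \<theta> \<mu>
    have F: "selberg_rec n T k (F \<theta>)" for \<theta>
      unfolding F_def by (rule selberg_rec_wsum[OF c\<theta> _ k]) (simp add: D_def)
    \<comment> \<open>The integral over n + 1 variables as a polynomial in \<theta>. Its derivative
      pairs the last variable with the residue at infinity, leaving n variables with the weights of
      the pencil.\<close>
    define \<Psi> where "\<Psi> f = wsum (\<lambda>_ x. [:c0 x, c x:]) (nodes D) (Suc n) (\<lambda>t. [:f t * vandermonde k (Suc n) t:])" for f
    have \<Psi>': "poly (pderiv (\<Psi> (\<lambda>t. \<Sum>e\<in>E'. cf' e * mon (Suc n) (\<nu>' e) t))) \<theta> =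
        of_nat (Suc n) * ((- 1) ^ (k * n) * wsum (\<lambda>_ x. c0 x + \<theta> * c x) (nodes D) n
          (\<lambda>t. (\<Sum>e\<in>E'. cf' e * selberg_residue n (\<nu>' e) (of_nat k) t) * vandermonde k n t))"
      if s: "\<And>t i. i < n \<Longrightarrow> (\<Sum>e\<in>E'. cf' e * mon (Suc n) (\<nu>' e) (t \<circ> sw i n)) = (\<Sum>e\<in>E'. cf' e * mon (Suc n) (\<nu>' e) t)"
      and b: "\<And>e. e \<in> E' \<Longrightarrow> \<nu>' e n + 2 * k * n \<le> D"
      for E' :: "'i set" and cf' \<nu>' \<theta>
    proof -
      let ?f = "\<lambda>t. \<Sum>e\<in>E'. cf' e * mon (Suc n) (\<nu>' e) t"
      have "(\<Sum>x\<in>nodes D. c x * (?f (t(n := x)) * vandermonde k (Suc n) (t(n := x)))) =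
          (- 1) ^ (k * n) * ((\<Sum>e\<in>E'. cf' e * selberg_residue n (\<nu>' e) (of_nat k) t) * vandermonde k n t)" for t
      proof -
        have "vandermonde k n (t(n := x)) = vandermonde k n t" for x by (rule vandermonde_cong) simp
        then have Vx: "vandermonde k (Suc n) (t(n := x)) = vandermonde k n t * ((- 1) ^ (k * n) * (\<Prod>l<n. (x - t l) ^ (2 * k)))" for x
          unfolding vandermonde_Suc by simp
        have mx: "mon (Suc n) (\<nu>' e) (t(n := x)) = mon n (\<nu>' e) t * x ^ \<nu>' e n" for e x
          by (simp add: mon_def)
        have "(\<Sum>x\<in>nodes D. c x * (?f (t(n := x)) * vandermonde k (Suc n) (t(n := x)))) =
          (\<Sum>x\<in>nodes D. \<Sum>e\<in>E'. (- 1) ^ (k * n) * (cf' e * mon n (\<nu>' e) t * vandermonde k n t * (c x * (x ^ \<nu>' e n * (\<Prod>l<n. (x - t l) ^ (2 * k))))))"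
          unfolding Vx mx sum_distrib_left sum_distrib_right by (intro sum.cong refl) (simp add: mult_ac)
        also have "\<dots> = (\<Sum>e\<in>E'. (- 1) ^ (k * n) * (cf' e * mon n (\<nu>' e) t * vandermonde k n t * (\<Sum>x\<in>nodes D. c x * (x ^ \<nu>' e n * (\<Prod>l<n. (x - t l) ^ (2 * k))))))"
          unfolding sum_distrib_left by (rule sum.swap)
        also have "\<dots> = (\<Sum>e\<in>E'. (- 1) ^ (k * n) * (cf' e * selberg_residue n (\<nu>' e) (of_nat k) t * vandermonde k n t))"
        proof (intro sum.cong refl, goal_cases)
          case (1 e)
          show ?case
            unfolding selberg_residue_quadrature[OF c b[OF \<open>e \<in> E'\<close>]] selberg_residue_def by (simp only: mult_ac)
        qed
        finally show ?thesis by (simp add: sum_distrib_left sum_distrib_right)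
      qed
      then have "pderiv (\<Psi> ?f) = of_nat (Suc n) * wsum (\<lambda>_ x. [:c0 x, c x:]) (nodes D) n
          (\<lambda>t. [:(- 1) ^ (k * n) * ((\<Sum>e\<in>E'. cf' e * selberg_residue n (\<nu>' e) (of_nat k) t) * vandermonde k n t):])"
        unfolding \<Psi>_def by (subst pderiv_wsum) (simp_all add: s vandermonde_swap)
      then show ?thesis by (simp add: poly_wsum wsum_mult)
    qed
    define u where "u e = (\<lambda>j. if j = e then 1 else 0 :: nat)" for e :: nat
    have mon_u: "mon (Suc n) (u e) t = t e" if "e < Suc n" for e t
    proof -
      have "mon (Suc n) (u e) t = (\<Prod>i<Suc n. if i = e then t i else 1)"
        unfolding mon_def u_def by (intro prod.cong) auto
      then show ?thesis using that by simp
    qed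
    define f where "f t = (\<Sum>e\<in>E. cf e * mon (Suc n) (\<nu> e) t)" for t
    \<comment> \<open>The sum of the variables serves for comparison: its residue is the constant 1,
      so the derivative of its integral is a fixed multiple of
      \<open>F \<theta> (\<lambda>_. 0)\<close>, to which all integrals are reduced.\<close>
    define g where "g t = (\<Sum>e\<in>{..<Suc n}. 1 * mon (Suc n) (u e) t)" for t
    have f': "poly A (of_nat k) * poly (pderiv (\<Psi> f)) \<theta> =
        of_nat (Suc n) * ((- 1) ^ (k * n) * (poly B (of_nat k) * F \<theta> (\<lambda>_. 0)))" for \<theta>
    proof -
      have "poly (pderiv (\<Psi> f)) \<theta> = of_nat (Suc n) * ((- 1) ^ (k * n) * wsum (\<lambda>_ x. c0 x + \<theta> * c x) (nodes D) n
          (\<lambda>t. (\<Sum>(P, \<mu>)\<leftarrow>xs. poly P (of_nat k) * mon n \<mu> t) * vandermonde k n t))"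
        unfolding f_def xs[symmetric]
      proof (rule \<Psi>'[OF sym])
        fix e assume "e \<in> E"
        then show "\<nu> e n + 2 * k * n \<le> D" using T'[of e] by (simp add: D_def)
      qed
      moreover have "wsum (\<lambda>_ x. c0 x + \<theta> * c x) (nodes D) n (\<lambda>t. (\<Sum>(P, \<mu>)\<leftarrow>xs. poly P (of_nat k) * mon n \<mu> t) * vandermonde k n t)
         = (\<Sum>(P, \<mu>)\<leftarrow>xs. poly P (of_nat k) * F \<theta> \<mu>)"
        using wsum_sum_list[of "\<lambda>_ x. c0 x + \<theta> * c x" "nodes D" n "\<lambda>a. poly (fst a) (of_nat k)" "\<lambda>a t. mon n (snd a) t * vandermonde k n t" xs]
        unfolding F_def by (simp add: case_prod_unfold sum_list_mult_const[symmetric] mult.assoc)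
      ultimately show ?thesis using AB[OF k F, of \<theta>] by (simp add: mult_ac)
    qed
    have g': "poly (pderiv (\<Psi> g)) \<theta> = of_nat (Suc n) * ((- 1) ^ (k * n) * F \<theta> (\<lambda>_. 0))" for \<theta>
    proof -
      have res: "(\<Sum>e\<in>{..<Suc n}. 1 * selberg_residue n (u e) (of_nat k) t) = 1" for t
      proof -
        have "selberg_residue n (u e) (of_nat k) t = (if e = n then 1 else 0)" if "e < Suc n" for e
        proof (cases "e = n")
          case True
          have "mon n (u n) t = 1" by (simp add: mon_def u_def)
          then show ?thesis using True by (simp add: selberg_residue_def u_def selberg_series_0)
        qed (simp add: selberg_residue_def u_def)
        then show ?thesis by simp
      qed
      have "poly (pderiv (\<Psi> g)) \<theta> = of_nat (Suc n) * ((- 1) ^ (k * n) * wsum (\<lambda>_ x. c0 x + \<theta> * c x) (nodes D) n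
          (\<lambda>t. (\<Sum>e\<in>{..<Suc n}. 1 * selberg_residue n (u e) (of_nat k) t) * vandermonde k n t))"
        unfolding g_def
      proof (rule \<Psi>')
        fix t :: "nat \<Rightarrow> complex" and i assume "i < n"
        have "(\<Sum>e\<in>{..<Suc n}. 1 * mon (Suc n) (u e) (t \<circ> sw i n)) = (\<Sum>e<Suc n. t (sw i n e))"
          by (intro sum.cong) (auto simp: mon_u)
        also have "\<dots> = (\<Sum>e<Suc n. t e)"
          using \<open>i < n\<close> by (intro sum.reindex_bij_betw bij_betw_sw) auto
        also have "\<dots> = (\<Sum>e\<in>{..<Suc n}. 1 * mon (Suc n) (u e) t)"
          by (intro sum.cong) (auto simp: mon_u)
        finally show "(\<Sum>e\<in>{..<Suc n}. 1 * mon (Suc n) (u e) (t \<circ> sw i n)) = (\<Sum>e\<in>{..<Suc n}. 1 * mon (Suc n) (u e) t)" .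
      qed (auto simp: u_def D_def)
      then show ?thesis unfolding res F_def by (simp add: mon_def)
    qed
    have "pderiv (smult (poly A (of_nat k)) (\<Psi> f) - smult (poly B (of_nat k)) (\<Psi> g)) = 0"
      unfolding pderiv_diff pderiv_smult
      by (intro poly_eqI_degree[where A = UNIV] poly_ext) (simp_all add: f' g' mult_ac)
    then have "degree (smult (poly A (of_nat k)) (\<Psi> f) - smult (poly B (of_nat k)) (\<Psi> g)) = 0"
      by (simp add: pderiv_eq_0_iff)
    then obtain z where "smult (poly A (of_nat k)) (\<Psi> f) - smult (poly B (of_nat k)) (\<Psi> g) = [:z:]"
      by (rule degree_eq_zeroE)
    then have eval: "poly A (of_nat k) * poly (\<Psi> f) \<theta> - poly B (of_nat k) * poly (\<Psi> g) \<theta> = z" for \<theta>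
      by (metis (no_types, lifting) poly_const_conv poly_diff poly_smult)
    have \<Psi>0: "poly (\<Psi> (\<lambda>t. \<Sum>e\<in>E'. cf' e * mon (Suc n) (\<nu>' e) t)) 0 = v * (\<Sum>e\<in>E'. cf' e * mon (Suc n) (\<nu>' e) (\<lambda>_. 0))"
      if b: "\<And>e. e \<in> E' \<Longrightarrow> (\<Sum>i<Suc n. \<nu>' e i) + Suc n * (n * k) \<le> D" for E' :: "'i set" and cf' \<nu>'
    proof -
      have "poly (\<Psi> (\<lambda>t. \<Sum>e\<in>E'. cf' e * mon (Suc n) (\<nu>' e) t)) 0 =
          (\<Sum>e\<in>E'. cf' e * wsum (\<lambda>_. c0) (nodes D) (Suc n) (\<lambda>t. mon (Suc n) (\<nu>' e) t * vandermonde k (Suc n) t))"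
        unfolding \<Psi>_def poly_wsum by (simp add: sum_distrib_right mult.assoc wsum_sum wsum_mult)
      also have "\<dots> = (\<Sum>e\<in>E'. cf' e * (v * mon (Suc n) (\<nu>' e) (\<lambda>_. 0)))"
      proof (intro sum.cong refl arg_cong2[of _ _ _ _ "(*)"])
        fix e assume "e \<in> E'"
        have "mon (Suc n) (\<nu>' e) (\<lambda>_. 0) = (if \<forall>i<Suc n. \<nu>' e i = 0 then 1 else 0)"
        proof (cases "\<forall>i<Suc n. \<nu>' e i = 0")
          case False
          then obtain i where "i < Suc n" "\<nu>' e i \<noteq> 0" by blast
          then show ?thesis using False unfolding mon_def
            by (subst prod_zero) (auto intro!: bexI[of _ i] simp: zero_power)
        qed (simp add: mon_def)
        then show "wsum (\<lambda>_. c0) (nodes D) (Suc n) (\<lambda>t. mon (Suc n) (\<nu>' e) t * vandermonde k (Suc n) t) = v * mon (Suc n) (\<nu>' e) (\<lambda>_. 0)"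
          using v0[OF c0 b[OF \<open>e \<in> E'\<close>]] by (cases "\<forall>i<Suc n. \<nu>' e i = 0") auto
      qed
      finally show ?thesis by (simp add: sum_distrib_left mult_ac)
    qed
    have \<Psi>1: "poly (\<Psi> (\<lambda>t. \<Sum>e\<in>E'. cf' e * mon (Suc n) (\<nu>' e) t)) 1 = v * (\<Sum>e\<in>E'. cf' e * mon (Suc n) (\<nu>' e) (\<lambda>_. 1))"
      if b: "\<And>e. e \<in> E' \<Longrightarrow> (\<Sum>i<Suc n. \<nu>' e i) + Suc n * (n * k) \<le> D" for E' :: "'i set" and cf' \<nu>'
    proof -
      have "poly (\<Psi> (\<lambda>t. \<Sum>e\<in>E'. cf' e * mon (Suc n) (\<nu>' e) t)) 1 =
          (\<Sum>e\<in>E'. cf' e * wsum (\<lambda>_. c1) (nodes D) (Suc n) (\<lambda>t. mon (Suc n) (\<nu>' e) t * vandermonde k (Suc n) t))"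
        unfolding \<Psi>_def poly_wsum by (simp add: c_def sum_distrib_right mult.assoc wsum_sum wsum_mult)
      also have "\<dots> = (\<Sum>e\<in>E'. cf' e * v)"
        by (intro sum.cong refl arg_cong2[of _ _ _ _ "(*)"] v1[OF c1 b])
      finally show ?thesis by (simp add: sum_distrib_left mon_def mult_ac)
    qed
    have bf: "(\<Sum>i<Suc n. \<nu> e i) + Suc n * (n * k) \<le> D" if "e \<in> E" for e
      using T'[OF that] unfolding D_def by linarith
    have bg: "(\<Sum>i<Suc n. u e i) + Suc n * (n * k) \<le> D" if "e \<in> {..<Suc n}" for e
    proof -
      have "(\<Sum>i<Suc n. u e i) = 1" unfolding u_def using that by (subst sum.delta) auto
      then show ?thesis by (simp add: D_def)
    qed
    have fv: "poly (\<Psi> f) 1 - poly (\<Psi> f) 0 = v * J"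
    proof -
      have "poly (\<Psi> f) 1 = v * (\<Sum>e\<in>E. cf e * mon (Suc n) (\<nu> e) (\<lambda>_. 1))"
        unfolding f_def by (rule \<Psi>1) (rule bf)
      moreover have "poly (\<Psi> f) 0 = v * (\<Sum>e\<in>E. cf e * mon (Suc n) (\<nu> e) (\<lambda>_. 0))"
        unfolding f_def by (rule \<Psi>0) (rule bf)
      ultimately show ?thesis by (simp add: J_def right_diff_distrib)
    qed
    have gv: "poly (\<Psi> g) 1 - poly (\<Psi> g) 0 = v * of_nat (Suc n)"
    proof -
      have *: "(\<Sum>e\<in>{..<Suc n}. 1 * mon (Suc n) (u e) (\<lambda>_. z)) = of_nat (Suc n) * z" for z
      proof -
        have "(\<Sum>e\<in>{..<Suc n}. 1 * mon (Suc n) (u e) (\<lambda>_. z)) = (\<Sum>e<Suc n. z)"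
          by (intro sum.cong) (auto simp: mon_u)
        then show ?thesis by simp
      qed
      have "poly (\<Psi> g) 1 = v * (\<Sum>e\<in>{..<Suc n}. 1 * mon (Suc n) (u e) (\<lambda>_. 1))"
        unfolding g_def by (rule \<Psi>1) (rule bg)
      moreover have "poly (\<Psi> g) 0 = v * (\<Sum>e\<in>{..<Suc n}. 1 * mon (Suc n) (u e) (\<lambda>_. 0))"
        unfolding g_def by (rule \<Psi>0) (rule bg)
      ultimately show ?thesis unfolding * by simp
    qed
    have "v * (poly A (of_nat k) * J) = poly A (of_nat k) * (poly (\<Psi> f) 1 - poly (\<Psi> f) 0)"
      unfolding fv by simp
    also have "\<dots> = poly B (of_nat k) * (poly (\<Psi> g) 1 - poly (\<Psi> g) 0)"
      using eval[of 1] eval[of 0] by (simp add: algebra_simps)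
    also have "\<dots> = v * (of_nat (Suc n) * poly B (of_nat k))"
      unfolding gv by simp
    finally show ?thesis using v by simp
  qed
  \<comment> \<open>An identity of polynomials in k that holds at all positive integers holds
    identically. At x the polynomial B vanishes and A does not, which forces J = 0.\<close>
  have "smult J A = smult (of_nat (Suc n)) B"
  proof (rule ccontr)
    assume "smult J A \<noteq> smult (of_nat (Suc n)) B"
    then have "finite {z. poly (smult J A - smult (of_nat (Suc n)) B) z = 0}"
      by (intro poly_roots_finite) simp
    moreover have "(\<lambda>k. of_nat (Suc k)) ` UNIV \<subseteq> {z. poly (smult J A - smult (of_nat (Suc n)) B) z = 0}"
      using main by (auto simp: mult.commute simp del: of_nat_Suc)
    ultimately have "finite (range (\<lambda>k. of_nat (Suc k) :: complex))" by (rule finite_subset[rotated])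
    then show False
      using range_inj_infinite[of "\<lambda>k. of_nat (Suc k) :: complex"] by (simp add: inj_on_def del: of_nat_Suc)
  qed
  then have "poly (smult J A) x = poly (smult (of_nat (Suc n)) B) x" by simp
  then have "J = 0" using A B by simp
  then show ?thesis by (simp add: J_def)
qed

section \<open>The kernel of the screening operator\<close>

text \<open>The lattice element is dropped and \<open>\<alpha>(-j-1)\<close> is replaced by the number \<open>a j\<close>.\<close>

definition substitute :: "(nat \<Rightarrow> complex) \<Rightarrow> fock \<Rightarrow> fock" where
  "substitute a = linear_extension (\<lambda>\<mu> m. smul (\<Prod>j\<in>#\<mu>. a j) (bv {#} 0))"

lemma lin_substitute: "lin (substitute a)"
  unfolding substitute_def by (rule lin_linear_extension)

lemma substitute_basis [simp]: "substitute a (bv \<mu> m) = smul (\<Prod>j\<in>#\<mu>. a j) (bv {#} 0)"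
  by (simp add: substitute_def)

lemma substitute_creation: "substitute a (heisenberg p (- int j - 1) w) = smul (a j) (substitute a w)"
  by (rule lin_ext[OF lin_comp[OF lin_substitute lin_heisenberg] lin_scale[OF lin_substitute]]) simp

lemma substitute_shift: "substitute a (lattice_shift m w) = substitute a w"
proof (rule lin_ext[OF lin_comp[OF lin_substitute] lin_substitute])
  show "lin (lattice_shift m)" unfolding lattice_shift_def by (rule lin_linear_extension)
qed (simp add: lattice_shift_def)

lemma fps_deriv_binomial_series:
  "fps_deriv (binomial_series a c) = binomial_series a c * Abs_fps (\<lambda>n. - a * c ^ Suc n)"
proof -
  let ?G = "Abs_fps (\<lambda>n. c ^ n)"
  have G: "?G * (1 - fps_const c * fps_X) = 1"
  proof (rule fps_ext)
    fix n
    have "?G * (1 - fps_const c * fps_X) = ?G - fps_const c * (?G * fps_X)"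
      by (simp only: right_diff_distrib mult_1_right mult.left_commute)
    then show "fps_nth (?G * (1 - fps_const c * fps_X)) n = fps_nth 1 n"
      by (cases n) simp_all
  qed
  have "(1 - fps_const c * fps_X) * fps_deriv (binomial_series a c) = fps_const (- a * c) * binomial_series a c"
  proof (rule fps_ext)
    fix n
    have s: "of_nat (Suc n) * (a gchoose Suc n) = (a - of_nat n) * (a gchoose n)" for n
      using gbinomial_mult_1[of a n] by (simp add: algebra_simps)
    have "fps_nth ((1 - fps_const c * fps_X) * fps_deriv (binomial_series a c)) n =
       of_nat (Suc n) * (a gchoose Suc n) * (- c) ^ Suc n - c * (of_nat n * (a gchoose n) * (- c) ^ n)"
      by (cases n) (simp_all add: binomial_series_def left_diff_distrib mult.assoc del: of_nat_Suc)
    also have "\<dots> = fps_nth (fps_const (- a * c) * binomial_series a c) n"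
      unfolding s by (simp add: binomial_series_def algebra_simps)
    finally show "fps_nth ((1 - fps_const c * fps_X) * fps_deriv (binomial_series a c)) n =
      fps_nth (fps_const (- a * c) * binomial_series a c) n" .
  qed
  then have "?G * (1 - fps_const c * fps_X) * fps_deriv (binomial_series a c) = ?G * (fps_const (- a * c) * binomial_series a c)"
    by (simp add: mult.assoc)
  also have "\<dots> = binomial_series a c * (fps_const (- a * c) * ?G)" by (simp add: mult_ac)
  also have "fps_const (- a * c) * ?G = Abs_fps (\<lambda>n. - a * c ^ Suc n)"
    by (rule fps_ext) simp
  finally show ?thesis unfolding G by simp
qed

text \<open>The logarithmic derivative of the product, written as a recursion so that it can be
  matched with the recursion \<open>cre_rec\<close> of the creation exponential.\<close>

lemma selberg_series_rec:
  "of_nat q * fps_nth (selberg_series n x t) q =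
    (\<Sum>j\<in>{1..q}. (1 + of_nat n * x - 2 * x * (\<Sum>i<n. t i ^ j)) * fps_nth (selberg_series n x t) (q - j))"
proof (cases q)
  case (Suc r)
  define L where "L a c = Abs_fps (\<lambda>n. - a * c ^ Suc n)" for a c :: complex
  have L: "fps_deriv (binomial_series a c) = binomial_series a c * L a c" for a c
    unfolding L_def by (rule fps_deriv_binomial_series)
  have prod: "fps_deriv (\<Prod>l\<in>I. binomial_series (2 * x) (t l)) =
      (\<Prod>l\<in>I. binomial_series (2 * x) (t l)) * (\<Sum>l\<in>I. L (2 * x) (t l))" if "finite I" for I
    using that
  proof (induction I rule: finite_induct)
    case (insert l I)
    then show ?case by (simp add: L algebra_simps)
  qed simp
  define D where "D = L (- 1 - of_nat n * x) 1 + (\<Sum>l<n. L (2 * x) (t l))"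
  have "fps_deriv (selberg_series n x t) = selberg_series n x t * D"
    unfolding selberg_series_def D_def fps_deriv_mult L prod[OF finite_lessThan]
    by (simp add: algebra_simps)
  then have "fps_nth (fps_deriv (selberg_series n x t)) r = fps_nth (D * selberg_series n x t) r"
    by (simp add: mult.commute)
  then have "of_nat (Suc r) * fps_nth (selberg_series n x t) (Suc r) =
      (\<Sum>i = 0..r. fps_nth D i * fps_nth (selberg_series n x t) (r - i))"
    by (simp add: fps_mult_nth)
  also have "\<dots> = (\<Sum>j\<in>{1..Suc r}. fps_nth D (j - 1) * fps_nth (selberg_series n x t) (Suc r - j))"
    by (rule sum.reindex_bij_witness[of _ "\<lambda>j. j - 1" Suc]) auto
  also have "\<dots> = (\<Sum>j\<in>{1..Suc r}. (1 + of_nat n * x - 2 * x * (\<Sum>i<n. t i ^ j)) * fps_nth (selberg_series n x t) (Suc r - j))"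
  proof (intro sum.cong refl arg_cong2[of _ _ _ _ "(*)"])
    fix j assume "j \<in> {1..Suc r}"
    then have "Suc (j - 1) = j" by auto
    then show "fps_nth D (j - 1) = 1 + of_nat n * x - 2 * x * (\<Sum>i<n. t i ^ j)"
      by (simp add: D_def L_def fps_sum_nth sum_negf sum_distrib_left del: power_Suc)
  qed
  finally show ?thesis unfolding Suc .
qed simp

context heisenberg_level
begin

text \<open>Substitution turns the creation operators in \<open>cre_rec\<close> into numbers, so the
  creation exponential becomes the scalar series with that logarithmic derivative.\<close>

lemma substitute_cre:
  assumes E0: "E 0 = 1"
    and E: "\<And>q. of_nat q * E q = (\<Sum>n\<in>{1..q}. of_int b / of_nat (2 * p) * a (n - 1) * E (q - n))"
  shows "substitute a (cre b (int q) w) = smul (E q) (substitute a w)"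
proof (induction q rule: less_induct)
  case (less q)
  show ?case
  proof (cases "q = 0")
    case False
    have "smul (of_nat q) (substitute a (cre b (int q) w)) =
        (\<Sum>n\<in>{1..q}. smul (of_int b / of_nat (2 * p)) (substitute a (h (- int n) (cre b (int (q - n)) w))))"
      unfolding lin_smul[OF lin_substitute, symmetric] lin_sum[OF lin_substitute, symmetric] cre_rec ..
    also have "\<dots> = (\<Sum>n\<in>{1..q}. smul (of_int b / of_nat (2 * p) * a (n - 1) * E (q - n)) (substitute a w))"
    proof (intro sum.cong refl, goal_cases)
      case n: (1 n)
      then have "- int n = - int (n - 1) - 1" by auto
      then have "substitute a (h (- int n) (cre b (int (q - n)) w)) = smul (a (n - 1)) (substitute a (cre b (int (q - n)) w))"
        by (simp only: substitute_creation)
      then show ?case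
        using less[of "q - n"] n by (simp add: mult.assoc)
    qed
    also have "\<dots> = smul (of_nat q) (smul (E q) (substitute a w))"
      unfolding smul.scale_sum_left[symmetric] E[symmetric] by simp
    finally show ?thesis using False unfolding smul.scale_cancel_left by simp
  qed (simp add: E0)
qed

text \<open>The mode \<alpha>(n) acts as 2pn times the derivative with respect to \<alpha>(-n). The
  annihilation exponential is thus a translation of the variables: \<alpha>(-j-1) is shifted by - c
  z^(j+1).\<close>

lemma substitute_ann:
  "deg \<mu> < N \<Longrightarrow> (\<Sum>d<N. smul (z ^ d) (substitute a (ann c (int d) (bv \<mu> m)))) =
    substitute (\<lambda>j. a j - of_int c * z ^ Suc j) (bv \<mu> m)"
proof (induction \<mu> arbitrary: N)
  case empty
  then obtain N' where N: "N = Suc N'" by (cases N) auto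
  have "ann c (int (Suc d)) (bv {#} m) = 0" for d
    by (rule ann_eq_0[OF homog_basis]) simp
  then show ?case unfolding N sum.lessThan_Suc_shift
    by (simp add: lin_zero[OF lin_substitute])
next
  case (add j \<mu>)
  let ?a = "\<lambda>j. a j - of_int c * z ^ Suc j"
  let ?w = "bv \<mu> m"
  have w: "bv (add_mset j \<mu>) m = h (- int j - 1) ?w" by simp
  have "ann c (int d) (h (- int j - 1) ?w) = h (- int j - 1) (ann c (int d) ?w) - smul (of_int c) (ann c (int d - int j - 1) ?w)" for d
    using ann_heis[of "- int j - 1" c "int d" ?w] by (simp add: algebra_simps)
  then have "(\<Sum>d<N. smul (z ^ d) (substitute a (ann c (int d) (h (- int j - 1) ?w)))) =
     (\<Sum>d<N. smul (a j) (smul (z ^ d) (substitute a (ann c (int d) ?w))) -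
        smul (of_int c) (smul (z ^ d) (substitute a (ann c (int d - int j - 1) ?w))))"
    by (intro sum.cong refl)
      (simp add: lin_diff[OF lin_substitute] lin_smul[OF lin_substitute] substitute_creation
        smul.scale_right_diff_distrib mult.commute)
  also have "\<dots> = smul (a j) (substitute ?a ?w) - smul (of_int c) (\<Sum>d<N. smul (z ^ d) (substitute a (ann c (int d - int j - 1) ?w)))"
    unfolding sum_subtractf smul.scale_sum_right[symmetric] using add by simp
  also have "(\<Sum>d<N. smul (z ^ d) (substitute a (ann c (int d - int j - 1) ?w))) = smul (z ^ Suc j) (substitute ?a ?w)"
  proof -
    have "(\<Sum>d<N. smul (z ^ d) (substitute a (ann c (int d - int j - 1) ?w))) =
      (\<Sum>d\<in>{Suc j..<N}. smul (z ^ d) (substitute a (ann c (int d - int j - 1) ?w)))"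
      by (rule sum.mono_neutral_right) (auto simp: ann_def lin_zero[OF lin_substitute])
    also have "\<dots> = (\<Sum>d<N - Suc j. smul (z ^ (d + Suc j)) (substitute a (ann c (int d) ?w)))"
      by (rule sum.reindex_bij_witness[of _ "\<lambda>d. d + Suc j" "\<lambda>d. d - Suc j"]) (auto simp: of_nat_diff algebra_simps)
    also have "\<dots> = smul (z ^ Suc j) (\<Sum>d<N - Suc j. smul (z ^ d) (substitute a (ann c (int d) ?w)))"
      by (simp add: smul.scale_sum_right power_add mult_ac)
    also have "(\<Sum>d<N - Suc j. smul (z ^ d) (substitute a (ann c (int d) ?w))) = substitute ?a ?w"
      by (rule add.IH) (use add.prems in simp)
    finally show ?thesis .
  qed
  also have "smul (a j) (substitute ?a ?w) - smul (of_int c) (smul (z ^ Suc j) (substitute ?a ?w)) =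
      substitute ?a (bv (add_mset j \<mu>) m)"
    by (simp only: w substitute_creation smul.scale_left_diff_distrib smul.scale_scale)
  finally show ?case unfolding w .
qed

lemma substitute_ann_homog:
  assumes w: "homog D m w" and N: "D < int N"
  shows "(\<Sum>d<N. smul (z ^ d) (substitute a (ann c (int d) w))) = substitute (\<lambda>j. a j - of_int c * z ^ Suc j) w"
proof (rule lin_ext_on[OF _ lin_substitute])
  show "lin (\<lambda>w. \<Sum>d<N. smul (z ^ d) (substitute a (ann c (int d) w)))"
    by (intro lin_setsum lin_scale lin_comp[OF lin_substitute lin_ann])
  show "(\<Sum>d<N. smul (z ^ d) (substitute a (ann c (int d) (bv \<mu> l)))) =
      substitute (\<lambda>j. a j - of_int c * z ^ Suc j) (bv \<mu> l)" if "(\<mu>, l) \<in> keys w" for \<mu> l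
    by (rule substitute_ann) (use w N that in \<open>auto simp: homog_def\<close>)
qed

text \<open>A momentum m together with n charges of momentum -2 at positions t_i. By
  \<open>vac_Y\<close> the value at (0, ..., 0) is an expectation value at momentum m, and the value
  at (1, ..., 1) one at momentum m - 2n.\<close>

definition charge_poly :: "nat \<Rightarrow> complex \<Rightarrow> fock \<Rightarrow> (nat \<Rightarrow> complex) \<Rightarrow> complex" where
  "charge_poly n m v t = vac 0 (substitute (\<lambda>j. (- 1) ^ j * (m - 2 * (\<Sum>i<n. t i ^ Suc j))) v)"

lemma poly_fun_charge_poly: "poly_fun n UNIV (\<lambda>x. charge_poly n m v)"
proof -
  have pp: "poly_fun n UNIV (\<lambda>x t. \<Prod>j\<in>#\<mu>. (- 1) ^ j * (m - 2 * (\<Sum>i<n. t i ^ Suc j)))" for \<mu>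
  proof (induction \<mu>)
    case (add j \<mu>)
    have "poly_fun n UNIV (\<lambda>x t. (- 1) ^ j * (m + (- 2) * (\<Sum>i<n. t i ^ Suc j)))"
      by (intro poly_fun_mult[where D = UNIV and D' = UNIV] poly_fun_add poly_fun_sum poly_fun_const
          poly_fun_power poly_fun_var) auto
    then have "poly_fun n UNIV (\<lambda>x t. (- 1) ^ j * (m - 2 * (\<Sum>i<n. t i ^ Suc j)))" by simp
    from poly_fun_mult[OF this add, of UNIV] show ?case by simp
  qed (simp add: poly_fun_const)
  have e: "charge_poly n m v t = (\<Sum>k\<in>keys v. lookup v k *
      (\<Prod>j\<in>#fst k. (- 1) ^ j * (m - 2 * (\<Sum>i<n. t i ^ Suc j))))" for t
    unfolding charge_poly_def vac_expand[OF lin_substitute, of 0 _ v]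
    by (simp add: vac_def lookup_basis_vector lookup_smul)
  show ?thesis
    unfolding e[abs_def]
    by (intro poly_fun_sum poly_fun_mult[where D = UNIV and D' = UNIV] poly_fun_const pp) auto
qed

text \<open>In the screening operator, the annihilation exponential inserts a further charge at -z
  and the creation exponential becomes \<open>selberg_series\<close> up to signs. The zero mode
  pairs the coefficient of z^d in the former with the coefficient d - 1 of the latter, which is the
  combination \<open>selberg_residue\<close>.\<close>

lemma screening_charge_poly:
  assumes v: "screening p v = 0" "homog D 0 v"
    and E: "finite E" "\<And>t. charge_poly (Suc n) (of_nat (p + n)) v t = (\<Sum>e\<in>E. cf e * mon (Suc n) (\<nu> e) t)"
  shows "(\<Sum>e\<in>E. cf e * selberg_residue n (\<nu> e) (1 / of_nat p) t) = 0"
proof -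
  \<comment> \<open>The charge p + n is forced: the creation exponential of -\<alpha>/p has, up to
    alternating signs, the logarithmic derivative with terms (p + n - 2 (t_0^j + ... +
    t_(n-1)^j))/p, and these are the terms in \<open>selberg_series_rec\<close> for x = 1/p.\<close>
  define a where "a j = (- 1) ^ j * (of_nat (p + n) - 2 * (\<Sum>i<n. t i ^ Suc j))" for j
  define S where "S q = (- 1) ^ q * fps_nth (selberg_series n (1 / of_nat p) t) q" for q
  define v' where "v' = lattice_shift (- 2) v"
  define N where "N = Suc (nat D + (\<Sum>e\<in>E. \<nu> e n))"
  have N: "D < int N" "\<And>e. e \<in> E \<Longrightarrow> \<nu> e n < N"
  proof -
    show "D < int N" unfolding N_def by linarith
    fix e assume "e \<in> E"
    then have "\<nu> e n \<le> (\<Sum>e\<in>E. \<nu> e n)" using E(1) by (intro member_le_sum) auto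
    then show "\<nu> e n < N" by (simp add: N_def)
  qed
  have hv': "homog D (- 2) v'" using homog_shift[OF v(2), of "- 2"] by (simp add: v'_def)
  define A where "A d = vac 0 (substitute a (ann (- 2) (int d) v'))" for d
  define B where "B d = (\<Sum>e\<in>{e\<in>E. \<nu> e n = d}. cf e * mon n (\<nu> e) t * (- 1) ^ d)" for d
  have "(\<Sum>d<N. A d * z ^ d) = (\<Sum>d<N. B d * z ^ d)" for z
  proof -
    have "(\<Sum>d<N. A d * z ^ d) = vac 0 (\<Sum>d<N. smul (z ^ d) (substitute a (ann (- 2) (int d) v')))"
      by (simp add: A_def mult.commute)
    also have "\<dots> = vac 0 (substitute (\<lambda>j. a j - of_int (- 2) * z ^ Suc j) v')"
      by (simp only: substitute_ann_homog[OF hv' N(1)])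
    also have "(\<lambda>j. a j - of_int (- 2) * z ^ Suc j) =
        (\<lambda>j. (- 1) ^ j * (of_nat (p + n) - 2 * (\<Sum>i<Suc n. (t(n := - z)) i ^ Suc j)))"
    proof (rule ext)
      fix j
      have sg: "(- 1) ^ j * (- z) ^ Suc j = - (z ^ Suc j)"
        by (simp add: power_mult_distrib[symmetric])
      have "(\<Sum>i<Suc n. (t(n := - z)) i ^ Suc j) = (\<Sum>i<n. t i ^ Suc j) + (- z) ^ Suc j"
        by (simp del: power_Suc)
      then have "(- 1) ^ j * (of_nat (p + n) - 2 * (\<Sum>i<Suc n. (t(n := - z)) i ^ Suc j)) =
          a j - 2 * ((- 1) ^ j * (- z) ^ Suc j)"
        unfolding a_def by (simp only:) (simp add: algebra_simps del: power_Suc)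
      then show "a j - of_int (- 2) * z ^ Suc j =
          (- 1) ^ j * (of_nat (p + n) - 2 * (\<Sum>i<Suc n. (t(n := - z)) i ^ Suc j))"
        unfolding sg by simp
    qed
    also have "vac 0 (substitute \<dots> v') = charge_poly (Suc n) (of_nat (p + n)) v (t(n := - z))"
      unfolding charge_poly_def v'_def substitute_shift ..
    also have "\<dots> = (\<Sum>e\<in>E. cf e * mon n (\<nu> e) t * (- 1) ^ \<nu> e n * z ^ \<nu> e n)"
    proof -
      have "mon (Suc n) (\<nu> e) (t(n := - z)) = mon n (\<nu> e) t * ((- 1) ^ \<nu> e n * z ^ \<nu> e n)" for e
        by (simp add: mon_def power_minus[of z])
      then show ?thesis unfolding E(2) by (simp add: mult.assoc)
    qed
    also have "\<dots> = (\<Sum>d<N. \<Sum>e\<in>{e\<in>E. \<nu> e n = d}. cf e * mon n (\<nu> e) t * (- 1) ^ \<nu> e n * z ^ \<nu> e n)"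
      by (rule sum.group[symmetric]) (use E(1) N(2) in auto)
    also have "\<dots> = (\<Sum>d<N. B d * z ^ d)"
      unfolding B_def sum_distrib_right by (intro sum.cong refl) auto
    finally show ?thesis .
  qed
  \<comment> \<open>Two polynomials in z agree everywhere, so their coefficients agree. This
    isolates the contribution of each single annihilation index d.\<close>
  then have "\<forall>z. (\<Sum>d\<le>nat D + (\<Sum>e\<in>E. \<nu> e n). A d * z ^ d) = (\<Sum>d\<le>nat D + (\<Sum>e\<in>E. \<nu> e n). B d * z ^ d)"
    unfolding N_def by (simp add: lessThan_Suc_atMost)
  then have AB: "A d = B d" if "d < N" for d
    using that polyfun_eq_coeffs[of A "nat D + (\<Sum>e\<in>E. \<nu> e n)" B] by (auto simp: N_def)
  have S0: "S 0 = 1" by (simp add: S_def selberg_series_0)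
  have Srec: "of_nat q * S q = (\<Sum>j\<in>{1..q}. of_int (- 2) / of_nat (2 * p) * a (j - 1) * S (q - j))" for q
  proof -
    have "of_nat q * S q = (- 1) ^ q * (of_nat q * fps_nth (selberg_series n (1 / of_nat p) t) q)"
      by (simp add: S_def)
    also have "\<dots> = (\<Sum>j\<in>{1..q}. (- 1) ^ q * ((1 + of_nat n * (1 / of_nat p) - 2 * (1 / of_nat p) * (\<Sum>i<n. t i ^ j)) *
        fps_nth (selberg_series n (1 / of_nat p) t) (q - j)))"
      unfolding selberg_series_rec sum_distrib_left ..
    also have "\<dots> = (\<Sum>j\<in>{1..q}. of_int (- 2) / of_nat (2 * p) * a (j - 1) * S (q - j))"
    proof (intro sum.cong refl, goal_cases)
      case j: (1 j)
      then obtain i where i: "j = Suc i" "i < q" by (cases j) auto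
      have sg: "(- 1) ^ q = - ((- 1) ^ i * (- 1) ^ (q - j) :: complex)"
      proof -
        have "q = Suc (i + (q - j))" using j i by auto
        then have "(- 1) ^ q = (- 1 :: complex) ^ Suc (i + (q - j))" by (rule arg_cong)
        then show ?thesis by (simp only: power_Suc power_add) simp
      qed
      have "1 + of_nat n * (1 / of_nat p) - 2 * (1 / of_nat p) * (\<Sum>i<n. t i ^ j) =
          (1 / of_nat p) * (of_nat (p + n) - 2 * (\<Sum>i<n. t i ^ j))"
        using p_pos by (simp add: field_simps)
      then show ?case
        unfolding sg S_def a_def i(1) by (simp only: diff_Suc_1) simp
    qed
    finally show ?thesis .
  qed
  have "screening p v = (\<Sum>d<N. cre (- 2) (int d - - 2 * 0 div int (2 * p) - 0 - 1) (ann (- 2) (int d) v'))"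
    unfolding screening_Y Y_e v'_def by (rule lf_homog_eq[OF _ v(2) N(1)]) simp
  then have "0 = vac 0 (substitute a (\<Sum>d<N. cre (- 2) (int d - 1) (ann (- 2) (int d) v')))"
    using v(1) lin_zero[OF lin_substitute] by simp
  also have "\<dots> = (\<Sum>d<N. vac 0 (substitute a (cre (- 2) (int d - 1) (ann (- 2) (int d) v'))))"
    by (simp add: lin_sum[OF lin_substitute])
  also have "\<dots> = (\<Sum>d<N. if d = 0 then 0 else S (d - 1) * B d)"
  proof (intro sum.cong refl, goal_cases)
    case d: (1 d)
    show ?case
    proof (cases d)
      case 0
      then show ?thesis by (simp add: cre_def lin_zero[OF lin_substitute])
    next
      case (Suc q)
      then have e: "int d - 1 = int q" by simp
      show ?thesis
        unfolding e substitute_cre[OF S0 Srec] using AB[of d] d Suc by (simp add: A_def)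
    qed
  qed
  also have "\<dots> = (\<Sum>d<N. \<Sum>e\<in>{e\<in>E. \<nu> e n = d}. - (cf e * selberg_residue n (\<nu> e) (1 / of_nat p) t))"
  proof (intro sum.cong refl, goal_cases)
    case (1 d)
    show ?case
    proof (cases d)
      case (Suc q)
      have "(- 1) ^ q * (- 1) ^ d = (- 1 :: complex)" by (simp add: Suc flip: power_mult_distrib)
      then have "S q * (cf e * mon n (\<nu> e) t * (- 1) ^ d) = - (cf e * selberg_residue n (\<nu> e) (1 / of_nat p) t)"
        if "\<nu> e n = d" for e
        using that by (simp add: S_def selberg_residue_def Suc mult_ac) 
      then have "(\<Sum>e\<in>{e\<in>E. \<nu> e n = d}. S q * (cf e * mon n (\<nu> e) t * (- 1) ^ d)) =
          (\<Sum>e\<in>{e\<in>E. \<nu> e n = d}. - (cf e * selberg_residue n (\<nu> e) (1 / of_nat p) t))"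
        by (intro sum.cong refl) auto
      moreover have "d \<noteq> 0" "d - 1 = q" using Suc by simp_all
      ultimately show ?thesis by (simp only: B_def sum_distrib_left if_False)
    qed (simp add: selberg_residue_def)
  qed
  also have "\<dots> = (\<Sum>e\<in>E. - (cf e * selberg_residue n (\<nu> e) (1 / of_nat p) t))"
    by (rule sum.group) (use E(1) N(2) in auto)
  finally show ?thesis by (simp add: sum_negf)
qed

lemma charge_poly_symmetric: "i < n \<Longrightarrow> charge_poly (Suc n) m v (t \<circ> sw i n) = charge_poly (Suc n) m v t"
proof -
  assume "i < n"
  then have "(\<Sum>l<Suc n. (t \<circ> sw i n) l ^ Suc j) = (\<Sum>l<Suc n. t l ^ Suc j)" for j
    using sum_sw[of i "Suc n" n "\<lambda>x. x ^ Suc j" t] sum.reindex_bij_betw[OF bij_betw_sw[of i "Suc n" n], of "\<lambda>l. t l ^ Suc j"]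
    by (simp add: o_def)
  then show ?thesis unfolding charge_poly_def by (simp only:)
qed

text \<open>Take r = n + 1 charges and total momentum p + n = p - 1 + r. With all charges at 0 this
  is the larger momentum, with all charges at 1 it is lowered by 2r to p - 1 - r.\<close>

lemma screening_values:
  assumes v: "screening p v = 0" "homog D 0 v" and r: "0 < r" "r < p" "prime p"
  shows "vac 0 (substitute (\<lambda>j. (- 1) ^ j * (of_nat p - 1 - of_nat r)) v) =
    vac 0 (substitute (\<lambda>j. (- 1) ^ j * (of_nat p - 1 + of_nat r)) v)"
proof -
  obtain n where n: "r = Suc n" using r(1) by (cases r) auto
  obtain xs where xs: "\<And>t. charge_poly (Suc n) (of_nat (p + n)) v t = (\<Sum>(P, \<nu>)\<leftarrow>xs. poly P 0 * mon (Suc n) \<nu> t)"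
    using poly_fun_charge_poly[of "Suc n" "of_nat (p + n)" v] unfolding poly_fun_def by blast
  define E where "E = {..<length xs}"
  define cf where "cf e = poly (fst (xs ! e)) 0" for e
  define \<nu> where "\<nu> e = snd (xs ! e)" for e
  have E: "charge_poly (Suc n) (of_nat (p + n)) v t = (\<Sum>e\<in>E. cf e * mon (Suc n) (\<nu> e) t)" for t
    unfolding xs E_def cf_def \<nu>_def by (simp add: sum_list_sum_nth atLeast0LessThan case_prod_unfold)
  have fin: "finite E" by (simp add: E_def)
  have "(\<Sum>e\<in>E. cf e * mon (Suc n) (\<nu> e) (\<lambda>_. 1)) = (\<Sum>e\<in>E. cf e * mon (Suc n) (\<nu> e) (\<lambda>_. 0))"
  proof (rule selberg_key[OF fin, where x = "1 / of_nat p"])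
    show "(\<Sum>e\<in>E. cf e * mon (Suc n) (\<nu> e) (t \<circ> sw i n)) = (\<Sum>e\<in>E. cf e * mon (Suc n) (\<nu> e) t)" if "i < n" for t i
      unfolding E[symmetric] by (rule charge_poly_symmetric[OF that])
    show "(\<Sum>e\<in>E. cf e * selberg_residue n (\<nu> e) (1 / of_nat p) t) = 0" for t
      by (rule screening_charge_poly[OF v fin E])
    \<comment> \<open>A denominator vanishing at 1/p would mean a p = 2 + M, which is impossible
      since 0 < 2 + M < p.\<close>
    show "of_nat a \<noteq> 1 / of_nat p * (2 + of_nat M :: complex)" if "M < n" for a M
    proof
      assume "of_nat a = 1 / of_nat p * (2 + of_nat M :: complex)"
      then have "of_nat (a * p) = (of_nat (2 + M) :: complex)"
        using p_pos by (simp add: field_simps)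
      then have "a * p = 2 + M" by (simp only: of_nat_eq_iff)
      moreover have "2 + M < p" using that r n by simp
      ultimately show False by (cases a) auto
    qed
  qed
  then have "charge_poly (Suc n) (of_nat (p + n)) v (\<lambda>_. 1) = charge_poly (Suc n) (of_nat (p + n)) v (\<lambda>_. 0)"
    unfolding E .
  then show ?thesis by (simp add: charge_poly_def n algebra_simps)
qed

text \<open>Only the component of \<open>v\<close> of momentum 0 and degree n + 1 contributes to the
  diagonal expectation value of the mode n. By \<open>W_restrict\<close> that component is again in
  the kernel, so \<open>screening_values\<close> applies to it.\<close>

theorem W_vac:
  assumes v: "v \<in> W" and r: "0 < r" "r < p" "prime p"
  defines "c \<equiv> int p - 1 - int r" and "c' \<equiv> int p - 1 + int r"
  shows "vac c (Y v n (bv {#} c)) = vac c' (Y v n (bv {#} c'))"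
proof -
  define P where "P = (\<lambda>\<mu> m. deg \<mu> = nat (n + 1) \<and> m = (0::int))"
  define v0 where "v0 = (if n + 1 \<ge> 0 then fock_restrict P v else 0)"
  have eq: "vac d (Y v n (bv {#} d)) = vac 0 (substitute (\<lambda>j. (- 1) ^ j * of_int d) v0)" for d
  proof -
    have "vac d (Y (bv \<mu> m) n (bv {#} d)) =
        vac 0 (substitute (\<lambda>j. (- 1) ^ j * of_int d) (if n + 1 \<ge> 0 then fock_restrict P (bv \<mu> m) else 0))" for \<mu> m
      unfolding vac_Y vac_lf
      by (auto simp: P_def lin_zero[OF lin_substitute] vac_def lookup_basis_vector lookup_smul)
    moreover have "lin (\<lambda>v. if n + 1 \<ge> 0 then fock_restrict P v else 0)"
      by (cases "n + 1 \<ge> 0") (simp_all add: lin_restrict lin_0)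
    ultimately show ?thesis
      unfolding v0_def
      by (subst vac_expand[OF lin_Y_left], subst vac_expand[OF lin_comp[OF lin_substitute]]) simp_all
  qed
  have W0: "0 \<in> W" using W_smul[OF v, of 0] by simp
  have "v0 \<in> W" unfolding v0_def P_def using W_restrict[OF v, of "nat (n + 1)" 0] W0 by simp
  then have "screening p v0 = 0" by (simp add: W_iff)
  moreover have "homog (int (nat (n + 1))) 0 v0"
    unfolding v0_def P_def using homog_restrict[of "nat (n + 1)" 0 v] by (cases "n + 1 \<ge> 0") simp_all
  ultimately show ?thesis
    unfolding eq c_def c'_def using screening_values[of v0 "int (nat (n + 1))" r] r by simp
qed

end

section \<open>The logarithmic module\<close>

definition supported :: "(nat multiset \<Rightarrow> int \<Rightarrow> bool) \<Rightarrow> fock \<Rightarrow> bool" where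
  "supported P z \<longleftrightarrow> (\<forall>(\<mu>, m) \<in> keys z. P \<mu> m)"

lemma supported_simps [simp]:
  "supported P 0" "supported P (bv \<mu> m) \<longleftrightarrow> P \<mu> m"
  by (auto simp: supported_def)

lemma supported_add: "supported P x \<Longrightarrow> supported P y \<Longrightarrow> supported P (x + y)"
  unfolding supported_def using Poly_Mapping.keys_add[of x y] by blast

lemma supported_smul: "supported P x \<Longrightarrow> supported P (smul c x)"
  unfolding supported_def using keys_smul[of c x] by blast

lemma supported_diff: "supported P x \<Longrightarrow> supported P y \<Longrightarrow> supported P (x - y)"
  using supported_add[of P x "smul (- 1) y"] supported_smul[of P y "- 1"] by simp

lemma supported_sum: "(\<And>x. x \<in> A \<Longrightarrow> supported P (f x)) \<Longrightarrow> supported P (sum f A)"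
  by (induction A rule: infinite_finite_induct) (auto intro: supported_add)

lemma supported_lin:
  assumes "lin T" "supported P z" "\<And>\<mu> m. P \<mu> m \<Longrightarrow> supported Q (T (bv \<mu> m))"
  shows "supported Q (T z)"
proof -
  have "T z = (\<Sum>k\<in>keys z. smul (lookup z k) (T (bv (fst k) (snd k))))"
    using arg_cong[OF fock_expand[of z], of T] by (simp only: lin_sum[OF assms(1)] lin_smul[OF assms(1)])
  also have "supported Q \<dots>"
    using assms(2) by (intro supported_sum supported_smul assms(3)) (auto simp: supported_def)
  finally show ?thesis .
qed

lemma supported_mono: "supported P z \<Longrightarrow> (\<And>\<mu> m. P \<mu> m \<Longrightarrow> Q \<mu> m) \<Longrightarrow> supported Q z"
  by (auto simp: supported_def)

lemma supported_Sum_any: "ez f \<Longrightarrow> (\<And>i::nat. supported P (f i)) \<Longrightarrow> supported P (Sum_any f)"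
  unfolding Sum_any.expand_set by (rule supported_sum)

lemma supported_fock_restrict: "supported P z \<Longrightarrow> supported (\<lambda>\<mu> m. P \<mu> m \<and> Q \<mu> m) (fock_restrict Q z)"
  by (auto simp: supported_def keys_restrict)

lemma homog_supported: "homog D m z \<longleftrightarrow> supported (\<lambda>\<mu> l. l = m \<and> int (deg \<mu>) = D) z"
  by (simp add: homog_def supported_def)

lemma lattice_space_supported: "v \<in> lattice_space p \<longleftrightarrow> supported (\<lambda>\<mu> m. int (2 * p) dvd m) v"
  by (simp add: lattice_space_def supported_def)

lemma lin_ext_supported:
  "lin S \<Longrightarrow> lin T \<Longrightarrow> supported P z \<Longrightarrow> (\<And>\<mu> m. P \<mu> m \<Longrightarrow> S (bv \<mu> m) = T (bv \<mu> m)) \<Longrightarrow> S z = T z"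
  by (rule lin_ext_on) (auto simp: supported_def)

locale log_module = heisenberg_level +
  fixes i :: nat
  assumes prime_p: "prime p" and i_pos: "1 \<le> i" and i_less: "i \<le> p - 1"
begin

text \<open>The two momenta of conformal weight \<open>h\<^sub>i\<^sub>,\<^sub>1\<close>. On momenta congruent to one of them, \<open>excess\<close> is
  the difference between the weight of a lattice element and \<open>h\<^sub>i\<^sub>,\<^sub>1\<close>.\<close>

definition "lo = int i - 1"
definition "hi = 2 * int p - 1 - int i"

definition admissible :: "int \<Rightarrow> bool" where
  "admissible m \<longleftrightarrow> int (2 * p) dvd m - lo \<or> int (2 * p) dvd m - hi"

definition excess :: "int \<Rightarrow> int" where
  "excess m = ((m - (int p - 1))\<^sup>2 - (int p - int i)\<^sup>2) div (4 * int p)"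

definition wt :: "nat multiset \<Rightarrow> int \<Rightarrow> int" where
  "wt \<mu> m = int (deg \<mu>) + excess m"

definition lattice_wt :: "nat multiset \<Rightarrow> int \<Rightarrow> int" where
  "lattice_wt \<mu> m = int (deg \<mu>) + m * (m - 2 * int p + 2) div (4 * int p)"

lemma i_less_p: "int i < int p" using i_less p_pos by linarith

lemma admissible_cases:
  assumes "admissible m"
  obtains q where "m = int p - 1 - (int p - int i) + 2 * int p * q" "excess m = q * (int p * q - (int p - int i))"
  | q where "m = int p - 1 + (int p - int i) + 2 * int p * q" "excess m = q * (int p * q + (int p - int i))"
proof -
  have e: "excess m = q * (int p * q + s)" if "m - (int p - 1) = s + 2 * int p * q" "s\<^sup>2 = (int p - int i)\<^sup>2" for q s
  proof -
    have "(m - (int p - 1))\<^sup>2 - (int p - int i)\<^sup>2 = 4 * int p * (q * (int p * q + s))"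
      unfolding that(1) that(2)[symmetric] by (simp add: power2_eq_square algebra_simps)
    then show ?thesis using p_pos by (simp add: excess_def)
  qed
  from assms consider q where "m - lo = int (2 * p) * q" | q where "m - hi = int (2 * p) * q"
    unfolding admissible_def by (elim disjE dvdE)
  then show ?thesis
  proof cases
    case 1
    have "m = int p - 1 - (int p - int i) + 2 * int p * q" using 1 by (simp add: lo_def)
    then show ?thesis using e[of "- (int p - int i)" q] that(1)[of q] by (simp add: power2_commute)
  next
    case 2
    have "m = int p - 1 + (int p - int i) + 2 * int p * q" using 2 by (simp add: hi_def)
    then show ?thesis using e[of "int p - int i" q] that(2)[of q] by simp
  qed
qed

lemma excess_mult: "admissible m \<Longrightarrow> 4 * int p * excess m = (m - (int p - 1))\<^sup>2 - (int p - int i)\<^sup>2"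
proof (erule admissible_cases)
  fix q assume q: "m = int p - 1 - (int p - int i) + 2 * int p * q" "excess m = q * (int p * q - (int p - int i))"
  have "m - (int p - 1) = 2 * int p * q - (int p - int i)" using q(1) by simp
  then show ?thesis unfolding q(2) by (simp only: power2_eq_square) (simp add: algebra_simps)
next
  fix q assume q: "m = int p - 1 + (int p - int i) + 2 * int p * q" "excess m = q * (int p * q + (int p - int i))"
  have "m - (int p - 1) = 2 * int p * q + (int p - int i)" using q(1) by simp
  then show ?thesis unfolding q(2) by (simp only: power2_eq_square) (simp add: algebra_simps)
qed

text \<open>On the two cosets \<open>excess\<close> is q (p q + s) with s = -(p - i) or s = p - i.
  As |s| < p, this is positive unless q = 0, so \<open>lo\<close> and \<open>hi\<close> are the only
  momenta of lowest weight.\<close>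

lemma excess_sign:
  assumes "admissible m"
  shows "0 \<le> excess m" and "excess m = 0 \<longleftrightarrow> m = lo \<or> m = hi"
proof -
  have *: "0 < q * (int p * q + s)" if "q \<noteq> 0" "\<bar>s\<bar> < int p" for q s
  proof (cases "q > 0")
    case True
    then have "int p * 1 \<le> int p * q" by (intro mult_left_mono) auto
    then show ?thesis using True that by (intro mult_pos_pos) auto
  next
    case False
    then have "int p * q \<le> int p * (- 1)" using that by (intro mult_left_mono) auto
    then show ?thesis using False that by (intro mult_neg_neg) auto
  qed
  have "\<bar>int p - int i\<bar> < int p" "\<bar>- (int p - int i)\<bar> < int p" using i_pos i_less_p by auto
  note pos = *[OF _ this(1)] *[OF _ this(2), unfolded add_uminus_conv_diff]
  have "0 \<le> excess m \<and> (excess m = 0 \<longleftrightarrow> m = lo \<or> m = hi)"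
    using assms
  proof (cases rule: admissible_cases)
    case (1 q)
    have "m \<noteq> hi"
    proof
      assume "m = hi"
      then have "int p * (1 - q) = int i" using 1 by (simp add: hi_def algebra_simps)
      then have "int p dvd int i" by (metis dvd_triv_left)
      then show False using zdvd_imp_le i_pos i_less_p by fastforce
    qed
    then show ?thesis using 1 pos(2)[of q] p_pos by (cases "q = 0") (auto simp: lo_def)
  next
    case (2 q)
    have "m \<noteq> lo"
    proof
      assume "m = lo"
      then have "int p * (q + 1) = int i" using 2 by (simp add: lo_def algebra_simps)
      then have "int p dvd int i" by (metis dvd_triv_left)
      then show False using zdvd_imp_le i_pos i_less_p by fastforce
    qed
    then show ?thesis using 2 pos(1)[of q] p_pos by (cases "q = 0") (auto simp: hi_def)
  qed
  then show "0 \<le> excess m" "excess m = 0 \<longleftrightarrow> m = lo \<or> m = hi" by auto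
qed

lemma admissible_lo_hi [simp]: "admissible lo" "admissible hi"
  by (simp_all add: admissible_def)

lemma excess_lo_hi [simp]: "excess lo = 0" "excess hi = 0"
  using excess_sign(2) by simp_all

text \<open>Here hi - lo = 2 (p - i), and p does not divide p - i. The cosets being distinct,
  \<open>sigma\<close> can act on them with different signs.\<close>

lemma hi_not_lo: "\<not> int (2 * p) dvd hi - lo" "\<not> int (2 * p) dvd lo - hi"
proof -
  have e: "hi - lo = 2 * (int p - int i)" by (simp add: hi_def lo_def)
  have "\<not> int p dvd int p - int i" using zdvd_imp_le[of "int p" "int p - int i"] i_pos i_less_p by auto
  then show "\<not> int (2 * p) dvd hi - lo"
    unfolding e by (simp only: of_nat_mult of_nat_numeral dvd_mult_cancel_left) simp
  then show "\<not> int (2 * p) dvd lo - hi" by (metis dvd_minus_iff minus_diff_eq)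
qed

lemma admissible_add: "int (2 * p) dvd a \<Longrightarrow> admissible (a + m) \<longleftrightarrow> admissible m"
  unfolding admissible_def by (metis add_diff_eq dvd_add_right_iff)

lemma excess_add:
  assumes a: "int (2 * p) dvd a" and m: "admissible m"
  shows "excess (a + m) = excess m + a * (a - 2 * int p + 2) div (4 * int p) + a * m div int (2 * p)"
proof -
  obtain q where q: "a = 2 * int p * q" using a by (auto elim: dvdE)
  have "a * (a - 2 * int p + 2) = 4 * int p * (q * (int p * q - int p + 1))"
    unfolding q by (simp add: algebra_simps)
  then have 1: "a * (a - 2 * int p + 2) div (4 * int p) = q * (int p * q - int p + 1)" using p_pos by simp
  have 2: "a * m div int (2 * p) = q * m" using p_pos by (simp add: q)
  have "4 * int p * excess (a + m) = 4 * int p * (excess m + q * (int p * q - int p + 1) + q * m)"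
    using excess_mult[OF m] excess_mult[of "a + m"] admissible_add[OF a, of m] m
    by (simp add: q power2_eq_square algebra_simps)
  then show ?thesis unfolding 1 2 using p_pos by simp
qed

abbreviation Adm :: "fock \<Rightarrow> bool" where "Adm \<equiv> supported (\<lambda>\<mu> m. admissible m)"
abbreviation Wt :: "int \<Rightarrow> fock \<Rightarrow> bool" where "Wt N \<equiv> supported (\<lambda>\<mu> m. admissible m \<and> wt \<mu> m = N)"
abbreviation LWt :: "int \<Rightarrow> fock \<Rightarrow> bool" where "LWt k \<equiv> supported (\<lambda>\<mu> m. int (2 * p) dvd m \<and> lattice_wt \<mu> m = k)"

lemma Wt_Adm: "Wt N z \<Longrightarrow> Adm z" by (erule supported_mono) auto

lemma Wt_neg: "Wt N z \<Longrightarrow> N < 0 \<Longrightarrow> z = 0"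
proof -
  assume "Wt N z" "N < 0"
  then have "keys z = {}"
    using excess_sign(1) by (fastforce simp: supported_def wt_def)
  then show "z = 0" by simp
qed

lemma Y_Wt:
  assumes "LWt k v" "Wt N z" shows "Wt (N + k - n - 1) (Y v n z)"
proof (rule supported_lin[OF lin_Y_left assms(1)])
  fix \<mu> a assume a: "int (2 * p) dvd a \<and> lattice_wt \<mu> a = k"
  show "Wt (N + k - n - 1) (Y (bv \<mu> a) n z)"
  proof (rule supported_lin[OF lin_Y assms(2)])
    fix \<nu> m assume m: "admissible m \<and> wt \<nu> m = N"
    have "homog (int (deg \<nu>) + int (deg \<mu>) - a * m div int (2 * p) - n - 1) (a + m) (Y (bv \<mu> a) n (bv \<nu> m))"
      by (rule homog_Y) (simp_all add: homog_def)
    then show "Wt (N + k - n - 1) (Y (bv \<mu> a) n (bv \<nu> m))"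
      unfolding homog_supported
    proof (rule supported_mono, intro conjI)
      fix \<kappa> l assume l: "l = a + m \<and> int (deg \<kappa>) = int (deg \<nu>) + int (deg \<mu>) - a * m div int (2 * p) - n - 1"
      then show "admissible l" using a m admissible_add by simp
      show "wt \<kappa> l = N + k - n - 1"
        using l a m excess_add[of a m] by (auto simp: wt_def lattice_wt_def)
    qed
  qed
qed

lemma Y_Adm:
  assumes "v \<in> lattice_space p" "Adm z" shows "Adm (Y v n z)"
proof (rule supported_lin[OF lin_Y_left assms(1)[unfolded lattice_space_supported]])
  fix \<mu> a assume a: "int (2 * p) dvd a"
  show "Adm (Y (bv \<mu> a) n z)"
  proof (rule supported_lin[OF lin_Y assms(2)])
    fix \<nu> m assume "admissible m"
    moreover have "mom (a + m) (Y (bv \<mu> a) n (bv \<nu> m))" by (rule mom_Y) simp_all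
    ultimately show "Adm (Y (bv \<mu> a) n (bv \<nu> m))"
      using admissible_add[OF a] by (auto simp: mom_def supported_def)
  qed
qed

lemma heis_LWt: "LWt k v \<Longrightarrow> LWt (k - j) (h j v)"
proof (rule supported_lin[OF lin_heisenberg])
  fix \<mu> a assume a: "int (2 * p) dvd a \<and> lattice_wt \<mu> a = k"
  have "homog (int (deg \<mu>) - j) a (h j (bv \<mu> a))" by (rule homog_heisenberg[OF homog_basis])
  then show "LWt (k - j) (h j (bv \<mu> a))"
    unfolding homog_supported by (rule supported_mono) (use a in \<open>auto simp: lattice_wt_def\<close>)
qed

lemma DY_Wt: assumes "LWt k v" "Wt N z" shows "Wt (N + k - n - 1) (DY v n z)"
  unfolding DY_def
proof (intro supported_Sum_any HC_ez supported_smul)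
  fix j show "Wt (N + k - n - 1) (Y (h (int j) v) (n - int j) z)"
    using Y_Wt[OF heis_LWt[OF assms(1), of "int j"] assms(2), of "n - int j"] by (simp add: algebra_simps)
qed

lemma DY_Adm: assumes "v \<in> lattice_space p" "Adm z" shows "Adm (DY v n z)"
  unfolding DY_def
  by (intro supported_Sum_any HC_ez supported_smul Y_Adm lattice_space_heis assms)

definition proj_wt :: "int \<Rightarrow> fock \<Rightarrow> fock" where
  "proj_wt N = fock_restrict (\<lambda>\<mu> m. wt \<mu> m = N)"

lemma lin_proj_wt: "lin (proj_wt N)"
  unfolding proj_wt_def by (rule lin_restrict)

lemma Wt_proj_wt: "Adm z \<Longrightarrow> Wt N (proj_wt N z)"
  unfolding proj_wt_def by (rule supported_fock_restrict)

lemma proj_wt_Wt: "Wt N z \<Longrightarrow> proj_wt N' z = (if N = N' then z else 0)"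
  unfolding proj_wt_def by (auto intro!: fock_restrict_id fock_restrict_0 simp: supported_def)

lemma sum_proj_wt:
  assumes "finite S" "\<And>\<mu> m. (\<mu>, m) \<in> keys z \<Longrightarrow> wt \<mu> m \<in> S"
  shows "z = (\<Sum>N\<in>S. proj_wt N z)"
proof (rule poly_mapping_eqI)
  fix k :: "nat multiset \<times> int"
  obtain \<mu> m where k: "k = (\<mu>, m)" by (cases k)
  have "lookup (\<Sum>N\<in>S. proj_wt N z) k = (\<Sum>N\<in>S. if N = wt \<mu> m then lookup z k else 0)"
    unfolding lookup_sum proj_wt_def k lookup_restrict by (intro sum.cong) auto
  also have "\<dots> = lookup z k"
    using assms by (cases "k \<in> keys z") (auto simp: k not_in_keys_iff_lookup_eq_zero)
  finally show "lookup z k = lookup (\<Sum>N\<in>S. proj_wt N z) k" ..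
qed

lemma W_components:
  assumes "v \<in> W"
  obtains S :: "(nat \<times> int) set" and f where "finite S" "v = sum f S"
    "\<forall>s\<in>S. f s \<in> W \<and> mom (snd s) (f s) \<and> (\<exists>k. LWt k (f s))"
proof
  let ?f = "\<lambda>s. fock_restrict (\<lambda>\<mu> m. deg \<mu> = fst s \<and> m = snd s) v"
  show "v = sum ?f ((\<lambda>(\<mu>, m). (deg \<mu>, m)) ` keys v)"
    using homogeneous_components[of v] by (simp add: case_prod_unfold)
  have "LWt (int (fst s) + snd s * (snd s - 2 * int p + 2) div (4 * int p)) (?f s)" for s
    using W_lattice[OF assms] by (auto simp: supported_def lattice_space_iff keys_restrict lattice_wt_def)
  then show "\<forall>s\<in>(\<lambda>(\<mu>, m). (deg \<mu>, m)) ` keys v. ?f s \<in> W \<and> mom (snd s) (?f s) \<and> (\<exists>k. LWt k (?f s))"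
    using W_restrict[OF assms] by (auto simp: mom_def keys_restrict)
qed simp

text \<open>The device for taking the derivative in opposite directions on the two cosets. Being
  constant on the cosets of L, the sign commutes with all modes of elements of V_L.\<close>

definition sigma :: "fock \<Rightarrow> fock" where
  "sigma = linear_extension (\<lambda>\<mu> m. if int (2 * p) dvd m - lo then bv \<mu> m else - bv \<mu> m)"

lemma lin_sigma: "lin sigma"
  unfolding sigma_def by (rule lin_linear_extension)

lemma sigma_basis [simp]:
  "sigma (bv \<mu> m) = (if int (2 * p) dvd m - lo then bv \<mu> m else - bv \<mu> m)"
  by (simp add: sigma_def)

lemma sigma_sigma [simp]: "sigma (sigma z) = z"
  by (rule lin_ext[OF lin_comp[OF lin_sigma lin_sigma] lin_id]) (simp add: lin_minus[OF lin_sigma])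

lemma sigma_mom: "mom c x \<Longrightarrow> sigma x = (if int (2 * p) dvd c - lo then x else - x)"
proof -
  assume x: "mom c x"
  have "lin (\<lambda>x. if int (2 * p) dvd c - lo then x else - x)"
    by (cases "int (2 * p) dvd c - lo") (simp_all add: lin_id lin_scale[of "\<lambda>x. x" "- 1", simplified])
  then show ?thesis by (rule lin_ext_on[OF lin_sigma]) (use x in \<open>auto simp: mom_def\<close>)
qed

lemma sigma_Y:
  assumes "v \<in> lattice_space p" shows "sigma (Y v n w) = Y v n (sigma w)"
proof (rule lin_ext_supported[OF lin_comp[OF lin_sigma lin_Y_left] lin_Y_left assms[unfolded lattice_space_supported]])
  fix \<mu> a assume a: "int (2 * p) dvd a"
  show "sigma (Y (bv \<mu> a) n w) = Y (bv \<mu> a) n (sigma w)"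
  proof (rule lin_ext[OF lin_comp[OF lin_sigma lin_Y] lin_comp[OF lin_Y lin_sigma]])
    fix \<nu> m
    have "int (2 * p) dvd a + m - lo \<longleftrightarrow> int (2 * p) dvd m - lo"
      using a by (metis add_diff_eq dvd_add_right_iff)
    moreover have "mom (a + m) (Y (bv \<mu> a) n (bv \<nu> m))" by (rule mom_Y) simp_all
    ultimately show "sigma (Y (bv \<mu> a) n (bv \<nu> m)) = Y (bv \<mu> a) n (sigma (bv \<nu> m))"
      by (simp add: sigma_mom lin_minus[OF lin_Y])
  qed
qed

lemma supported_sigma: "supported P z \<Longrightarrow> supported P (sigma z)"
proof (rule supported_lin[OF lin_sigma])
  fix \<mu> m assume "P \<mu> m"
  then show "supported P (sigma (bv \<mu> m))"
    using supported_smul[of P "bv \<mu> m" "- 1"] by simp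
qed

lemma proj_wt_sigma: "proj_wt N (sigma z) = sigma (proj_wt N z)"
  by (rule lin_ext[OF lin_comp[OF lin_proj_wt lin_sigma] lin_comp[OF lin_sigma lin_proj_wt]])
    (simp add: proj_wt_def lin_minus[OF lin_restrict] lin_zero[OF lin_sigma])

definition psi :: "fock \<Rightarrow> complex" where
  "psi z = vac lo z + vac hi z"

lemma psi_simps [simp]:
  "psi (x + y) = psi x + psi y" "psi (x - y) = psi x - psi y" "psi (- x) = - psi x" "psi (smul c x) = c * psi x"
  "psi 0 = 0" "psi (sum f A) = (\<Sum>x\<in>A. psi (f x))"
  by (simp_all add: psi_def algebra_simps sum.distrib)

lemma psi_Wt: "Wt N z \<Longrightarrow> N \<noteq> 0 \<Longrightarrow> psi z = 0"
proof -
  assume z: "Wt N z" "N \<noteq> 0"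
  have "lookup z ({#}, m) = 0" if "excess m = 0" for m
    using z that by (auto simp: supported_def wt_def not_in_keys_iff_lookup_eq_zero[symmetric])
  then show "psi z = 0" by (simp add: psi_def vac_def)
qed

definition Rad :: "fock set" where
  "Rad = {z. Adm z \<and> (\<forall>v\<in>W. \<forall>n. psi (Y v n z) = 0)}"

lemma Rad_Adm: "z \<in> Rad \<Longrightarrow> Adm z" and Rad_psi: "z \<in> Rad \<Longrightarrow> v \<in> W \<Longrightarrow> psi (Y v n z) = 0"
  by (simp_all add: Rad_def)

lemma subspace_Rad: "smul.subspace Rad"
  by (rule smul.subspaceI) (auto simp: Rad_def supported_add supported_smul lin_add[OF lin_Y] lin_smul[OF lin_Y] lin_zero[OF lin_Y])

lemmas Rad_0 [simp] = smul.subspace_0[OF subspace_Rad]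
  and Rad_add = smul.subspace_add[OF subspace_Rad]
  and Rad_diff = smul.subspace_diff[OF subspace_Rad]
  and Rad_smul = smul.subspace_scale[OF subspace_Rad]
  and Rad_sum = smul.subspace_sum[OF subspace_Rad]

lemma Rad_Sum_any: "ez f \<Longrightarrow> (\<And>i::nat. f i \<in> Rad) \<Longrightarrow> Sum_any f \<in> Rad"
  unfolding Sum_any.expand_set by (rule Rad_sum)

text \<open>A product \<open>u\<^sub>a v\<^sub>n\<close> acts on a given vector as a linear combination of modes of the \<open>u\<^sub>l v\<close>.\<close>

lemma Rad_Y:
  assumes u: "u \<in> W" and z: "z \<in> Rad" shows "Y u n z \<in> Rad"
proof -
  have "psi (Y v a (Y u n z)) = 0" if v: "v \<in> W" for v a
  proof -
    obtain N where N: "\<And>k. Y u (n + int N + int k) z = 0"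
    proof -
      obtain N where "\<forall>k\<ge>N. Y u (n + int k) z = 0" using ez_Y_up[of u n z] unfolding ez_def by blast
      then show ?thesis using that[of N] by (metis add.assoc le_add1 of_nat_add)
    qed
    obtain m where m: "\<And>k::nat. Y v (m + int k) z = 0"
    proof -
      obtain m where "\<forall>k\<ge>m. Y v (0 + int k) z = 0" using ez_Y_up[of v 0 z] unfolding ez_def by blast
      then show ?thesis using that[of "int m"] by (metis add_0 le_add1 of_nat_add)
    qed
    \<comment> \<open>Induction on the distance d of the inner mode from the truncation bound. As m
      lies beyond the truncation of Y(v, x) z, only one half of the right-hand side of the Borcherds
      identity remains; its term k = 0 is the product in question, and the terms k > 0 lie closer to
      the bound.\<close>
    have "\<forall>a. psi (Y v a (Y u (n + int N - int d) z)) = 0" for d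
    proof (induction d rule: less_induct)
      case (less d)
      show ?case
      proof
        fix a
        define n' where "n' = n + int N - int d"
        define t where "t k = smul ((- 1) ^ k * (of_int (a - m) gchoose k)) (Y v (a - int k) (Y u (n' + int k) z))" for k
        have "BL (a - m) m n' v u z = BR (a - m) m n' v u z"
          by (rule Borcherds) (use u v W_lattice in auto)
        also have "\<dots> = Sum_any t"
          unfolding BR_def t_def by (simp add: m)
        also have "\<dots> = (\<Sum>k<Suc d. t k)"
        proof (rule Sum_any_lessThan)
          fix k assume "k \<ge> Suc d"
          then have "n' + int k = n + int N + int (k - d)" by (simp add: n'_def)
          then show "t k = 0" unfolding t_def using N[of "k - d"] by (simp only: lin_zero[OF lin_Y] smul.scale_zero_right)
        qed
        finally have "psi (BL (a - m) m n' v u z) = (\<Sum>k<Suc d. psi (t k))" by simp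
        also have "\<dots> = psi (t 0) + (\<Sum>k<d. psi (t (Suc k)))" by (subst sum.lessThan_Suc_shift) simp
        also have "(\<Sum>k<d. psi (t (Suc k))) = 0"
        proof (rule sum.neutral, rule ballI)
          fix k assume "k \<in> {..<d}"
          then have "d - Suc k < d" "n' + int (Suc k) = n + int N - int (d - Suc k)" by (auto simp: n'_def)
          then show "psi (t (Suc k)) = 0" unfolding t_def using less[of "d - Suc k"] by (simp del: of_nat_Suc)
        qed
        also have "psi (BL (a - m) m n' v u z) = 0"
        proof -
          have "psi (Sum_any f) = 0" if "ez f" "\<And>k. psi (f k) = 0" for f :: "nat \<Rightarrow> fock"
            using that unfolding Sum_any.expand_set by simp
          then show ?thesis unfolding BL_def using Rad_psi[OF z W_Y[OF v u]] by (simp add: ez_BL)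
        qed
        finally show "psi (Y v a (Y u (n + int N - int d) z)) = 0" by (simp add: t_def n'_def)
      qed
    qed
    from this[of N] show ?thesis by simp
  qed
  then show ?thesis using Y_Adm[OF W_lattice[OF u] Rad_Adm[OF z]] by (simp add: Rad_def)
qed

text \<open>\<open>psi\<close> sees only weight 0, so a mode of a homogeneous \<open>v\<close> tests
  a single weight component of \<open>z\<close>. Splitting an arbitrary \<open>v\<close> into
  homogeneous elements of \<open>W\<close> completes the argument.\<close>

lemma Rad_proj_wt: assumes z: "z \<in> Rad" shows "proj_wt N z \<in> Rad"
proof -
  have az: "Adm z" by (rule Rad_Adm[OF z])
  have hom: "psi (Y v n (proj_wt N z)) = 0" if v: "v \<in> W" "LWt k v" for v n k
  proof (cases "N = n + 1 - k")
    case True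
    let ?S = "insert N ((\<lambda>(\<mu>, m). wt \<mu> m) ` keys z)"
    have "z = (\<Sum>N'\<in>?S. proj_wt N' z)" by (rule sum_proj_wt) force+
    then have "psi (Y v n z) = (\<Sum>N'\<in>?S. psi (Y v n (proj_wt N' z)))"
      by (metis lin_sum[OF lin_Y] psi_simps(6))
    also have "\<dots> = (\<Sum>N'\<in>?S. if N' = N then psi (Y v n (proj_wt N z)) else 0)"
    proof (intro sum.cong refl)
      fix N'
      show "psi (Y v n (proj_wt N' z)) = (if N' = N then psi (Y v n (proj_wt N z)) else 0)"
        using psi_Wt[OF Y_Wt[OF v(2) Wt_proj_wt[OF az, of N'], of n]] True by auto
    qed
    also have "\<dots> = psi (Y v n (proj_wt N z))" by simp
    finally show ?thesis using Rad_psi[OF z v(1)] by simp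
  next
    case False
    then show ?thesis by (intro psi_Wt[OF Y_Wt[OF v(2) Wt_proj_wt[OF az]]]) auto
  qed
  have "psi (Y v n (proj_wt N z)) = 0" if "v \<in> W" for v n
  proof -
    obtain S :: "(nat \<times> int) set" and f where S: "finite S" "v = sum f S" "\<forall>s\<in>S. f s \<in> W \<and> mom (snd s) (f s) \<and> (\<exists>k. LWt k (f s))"
      using \<open>v \<in> W\<close> by (rule W_components)
    show ?thesis unfolding S(2) lin_sum[OF lin_Y_left] psi_simps
      using S(3) hom by (intro sum.neutral) blast
  qed
  moreover have "Adm (proj_wt N z)" by (rule Wt_Adm[OF Wt_proj_wt[OF az]])
  ultimately show ?thesis by (simp add: Rad_def)
qed

lemma vacuum_W: "bv {#} 0 \<in> W"
  using lf_vac_cre[of "- 2" 0 0] by (simp add: W_iff lattice_space_iff screening_Y cre_def)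

lemma Rad_psi_0: "z \<in> Rad \<Longrightarrow> psi z = 0"
  using Rad_psi[OF _ vacuum_W, of z "- 1"] by (simp add: lf_vacuum)

text \<open>\<open>W_vac\<close> with r = p - i equates the two diagonal expectation values. The
  mixed ones vanish since modes of W(p) preserve the cosets.\<close>

lemma Rad_difference: "bv {#} lo - bv {#} hi \<in> Rad"
proof -
  define r where "r = p - i"
  have r: "0 < r" "r < p" "lo = int p - 1 - int r" "hi = int p - 1 + int r"
    using i_pos i_less p_pos by (auto simp: r_def lo_def hi_def)
  have "psi (Y v n (bv {#} lo - bv {#} hi)) = 0" if v: "v \<in> W" for v n
  proof -
    have z: "vac d (Y v n (bv {#} c)) = 0" if "\<not> int (2 * p) dvd d - c" for c d
    proof -
      have "supported (\<lambda>\<mu> m. int (2 * p) dvd m - c) (Y v n (bv {#} c))"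
      proof (rule supported_lin[OF lin_Y_left W_lattice[OF v, unfolded lattice_space_supported]])
        fix \<mu> a assume a: "int (2 * p) dvd a"
        have "mom (a + c) (Y (bv \<mu> a) n (bv {#} c))" by (rule mom_Y) simp_all
        then show "supported (\<lambda>\<mu> m. int (2 * p) dvd m - c) (Y (bv \<mu> a) n (bv {#} c))"
          using a by (auto simp: mom_def supported_def)
      qed
      then show ?thesis using that by (auto simp: supported_def vac_def not_in_keys_iff_lookup_eq_zero[symmetric])
    qed
    show ?thesis
      using W_vac[OF v r(1,2) prime_p, of n] z[OF hi_not_lo(1)] z[OF hi_not_lo(2)]
      by (simp add: psi_def lin_diff[OF lin_Y] r(3,4)[symmetric])
  qed
  then show ?thesis by (simp add: Rad_def supported_diff)
qed

lemma conformal_weight_wt0: "admissible m \<Longrightarrow> wt0 m = conformal_weight p i + of_int (excess m)"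
proof -
  assume m: "admissible m"
  have "of_int (m * (m - 2 * int p + 2)) = (of_int ((int i - 1) * (int i - 2 * int p + 1) + 4 * int p * excess m) :: complex)"
    unfolding excess_mult[OF m] by (intro arg_cong[of _ _ of_int]) (simp add: power2_eq_square algebra_simps)
  then show ?thesis
    using p_pos unfolding wt0_def conformal_weight_def by (simp add: add_divide_distrib)
qed

lemma L0_Wt: "Wt N z \<Longrightarrow> Y \<omega> 1 z = smul (conformal_weight p i + of_int N) z"
proof -
  assume "Wt N z"
  then show ?thesis
    by (rule lin_ext_supported[OF lin_Y lin_scale[OF lin_id]])
      (auto simp: L0_basis conformal_weight_wt0 wt_def add_ac)
qed

text \<open>L(0) is a scalar on each weight component, so this follows from the grading of
  \<open>Rad\<close> established in \<open>Rad_proj_wt\<close>.\<close>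

lemma Rad_L0: assumes z: "z \<in> Rad" shows "Y \<omega> 1 z \<in> Rad"
proof -
  let ?S = "(\<lambda>(\<mu>, m). wt \<mu> m) ` keys z"
  have "z = (\<Sum>N\<in>?S. proj_wt N z)" by (rule sum_proj_wt) force+
  then have "Y \<omega> 1 z = (\<Sum>N\<in>?S. Y \<omega> 1 (proj_wt N z))" by (metis lin_sum[OF lin_Y])
  also have "\<dots> \<in> Rad"
    by (rule Rad_sum) (simp add: L0_Wt[OF Wt_proj_wt[OF Rad_Adm[OF z]]] Rad_smul Rad_proj_wt z)
  finally show ?thesis .
qed

end

lemma smul_linear_projection:
  fixes K :: "fock set"
  assumes "smul.subspace K"
  shows "\<exists>f. lin f \<and> (\<forall>z\<in>K. f z = 0) \<and> (\<forall>z. z - f z \<in> K)"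
proof -
  interpret vp: vector_space_pair "smul :: complex \<Rightarrow> fock \<Rightarrow> fock" "smul :: complex \<Rightarrow> fock \<Rightarrow> fock" ..
  obtain B where B: "B \<subseteq> K" "smul.independent B" "K \<subseteq> smul.span B"
    using smul.maximal_independent_subset[of K] by auto
  let ?E = "smul.extend_basis B"
  obtain f where f: "Vector_Spaces.linear smul smul f" "\<forall>x\<in>?E. f x = (if x \<in> B then 0 else x)"
    using vp.linear_independent_extend[OF smul.independent_extend_basis[OF B(2)], of "\<lambda>x. if x \<in> B then 0 else x"] by blast
  interpret f: Vector_Spaces.linear "smul :: complex \<Rightarrow> fock \<Rightarrow> fock" "smul :: complex \<Rightarrow> fock \<Rightarrow> fock" f by (rule f(1))
  have BE: "B \<subseteq> ?E" by (rule smul.extend_basis_superset[OF B(2)])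
  have "f z = 0" if "z \<in> K" for z
    by (rule smul.span_induct[of z B "\<lambda>z. f z = 0"])
      (use that B BE f(2) in \<open>auto simp: smul.subspace_def f.add f.scale f.zero\<close>)
  moreover have "z - f z \<in> K" for z
  proof (rule smul.span_induct[of z ?E "\<lambda>z. z - f z \<in> K"])
    show "z \<in> smul.span ?E" using smul.span_extend_basis[OF B(2)] by simp
    show "smul.subspace {z. z - f z \<in> K}"
    proof (rule smul.subspaceI)
      fix x y assume "x \<in> {z. z - f z \<in> K}" "y \<in> {z. z - f z \<in> K}"
      then have "(x - f x) + (y - f y) \<in> K" by (intro smul.subspace_add[OF assms]) auto
      then show "x + y \<in> {z. z - f z \<in> K}" by (simp add: f.add algebra_simps)
    next
      fix c x assume "x \<in> {z. z - f z \<in> K}"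
      then have "smul c (x - f x) \<in> K" by (intro smul.subspace_scale[OF assms]) auto
      then show "smul c x \<in> {z. z - f z \<in> K}" by (simp add: f.scale smul.scale_right_diff_distrib)
    qed (simp add: f.zero smul.subspace_0[OF assms])
    show "x - f x \<in> K" if "x \<in> ?E" for x
      using that f(2) B(1) smul.subspace_0[OF assms] by auto
  qed
  moreover have "lin f" by (rule linI) (simp_all add: f.add f.scale)
  ultimately show ?thesis by blast
qed

context heisenberg_level
begin

lemma ez_DBR: "ez (DBR l m n u v w)"
proof -
  obtain Q1 Q2 where "\<forall>q\<ge>Q1. h (int q) u = 0" "\<forall>q\<ge>Q2. h (int q) v = 0"
    using ez_heisenberg[of p u] ez_heisenberg[of p v] unfolding ez_def by blast
  then show ?thesis by (intro DBR_sum(2)[of "max Q1 Q2"]) auto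
qed

lemma ez_DYL: "ez (\<lambda>i. smul (c i) (DY (Y u (l + int i) v) (f i) w))"
  using ez_Y_up[of u l v] unfolding ez_def
  by (metis lin_zero[OF lin_DY_left] smul.scale_zero_right)

end

section \<open>The extension and its action\<close>

context log_module
begin

text \<open>The module is \<open>sigma(Rad) \<oplus> U/Rad\<close>, where \<open>U\<close> is the admissible part of \<open>V\<^sub>L\<^sub>\<degree>\<close>. The quotient
  is realized by the image of a projection \<open>red\<close> with kernel \<open>Rad\<close>, and is moved to momenta of the
  other parity by \<open>emb\<close> in order to form the direct sum inside \<open>fock\<close>.\<close>

definition "red = (SOME f. lin f \<and> (\<forall>z\<in>Rad. f z = 0) \<and> (\<forall>z. z - f z \<in> Rad))"

lemma lin_red: "lin red" and red_Rad: "z \<in> Rad \<Longrightarrow> red z = 0" and red_diff: "z - red z \<in> Rad"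
  using someI_ex[OF smul_linear_projection[OF subspace_Rad]] unfolding red_def by auto

lemma red_cong: "x - y \<in> Rad \<Longrightarrow> red x = red y"
  using red_Rad[of "x - y"] by (simp add: lin_diff[OF lin_red])

lemma red_red [simp]: "red (red z) = red z"
  using red_cong[OF red_diff[of z]] by simp

lemma Adm_red: "Adm z \<Longrightarrow> Adm (red z)"
  using supported_diff[of _ z "z - red z"] Rad_Adm[OF red_diff[of z]] by simp

lemma red_Y_red: "v \<in> W \<Longrightarrow> red (Y v n (red z)) = red (Y v n z)"
  using Rad_Y[OF _ red_diff, of v n z] by (intro red_cong[symmetric]) (simp add: lin_diff[OF lin_Y])

lemma red_L0_red: "red (Y \<omega> 1 (red z)) = red (Y \<omega> 1 z)"
  using Rad_L0[OF red_diff, of z] by (intro red_cong[symmetric]) (simp add: lin_diff[OF lin_Y])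

lemma red_proj_wt_red: "red (proj_wt N (red z)) = red (proj_wt N z)"
  using Rad_proj_wt[OF red_diff, of N z] by (intro red_cong[symmetric]) (simp add: lin_diff[OF lin_proj_wt])

definition emb :: "fock \<Rightarrow> fock" where
  "emb = lattice_shift 1"

definition fst_part :: "fock \<Rightarrow> fock" where
  "fst_part = fock_restrict (\<lambda>\<mu> m. even (m - lo))"

definition snd_part :: "fock \<Rightarrow> fock" where
  "snd_part x = lattice_shift (- 1) (fock_restrict (\<lambda>\<mu> m. odd (m - lo)) x)"

lemma lin_emb: "lin emb" and lin_fst_part: "lin fst_part" and lin_snd_part: "lin snd_part"
  unfolding emb_def fst_part_def snd_part_def
  by (rule lin_shift lin_restrict lin_comp[OF lin_shift lin_restrict])+

text \<open>\<open>lo\<close> and \<open>hi\<close> differ by the even number 2 (p - i) and L shifts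
  momenta by multiples of 2p. All admissible momenta therefore have one parity, and a shift by 1
  gives a disjoint copy.\<close>

lemma admissible_even: "admissible m \<Longrightarrow> even (m - lo)"
proof -
  assume "admissible m"
  then have "int (2 * p) dvd m - lo \<or> int (2 * p) dvd m - hi" by (simp add: admissible_def)
  moreover have "(2::int) dvd int (2 * p)" by simp
  ultimately have "even (m - lo) \<or> even (m - hi)" by (metis dvd_trans)
  moreover have "m - lo = (m - hi) + 2 * (int p - int i)" by (simp add: hi_def lo_def)
  ultimately show "even (m - lo)" by presburger
qed

lemma parts:
  assumes "Adm c" "Adm y"
  shows "fst_part (c + emb y) = c" "snd_part (c + emb y) = y"
proof -
  have "fst_part c = c"
    by (rule lin_ext_supported[OF lin_fst_part lin_id assms(1)]) (drule admissible_even, simp add: fst_part_def)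
  moreover have "fst_part (emb y) = 0"
    by (rule lin_ext_supported[OF lin_comp[OF lin_fst_part lin_emb] lin_0 assms(2)]) (drule admissible_even, simp add: fst_part_def emb_def)
  moreover have "snd_part c = 0"
    by (rule lin_ext_supported[OF lin_snd_part lin_0 assms(1)]) (drule admissible_even, simp add: snd_part_def lin_zero[OF lin_shift])
  moreover have "snd_part (emb y) = y"
    by (rule lin_ext_supported[OF lin_comp[OF lin_snd_part lin_emb] lin_id assms(2)]) (drule admissible_even, simp add: snd_part_def emb_def)
  ultimately show "fst_part (c + emb y) = c" "snd_part (c + emb y) = y"
    by (simp_all add: lin_add[OF lin_fst_part] lin_add[OF lin_snd_part])
qed

lemma in_Cod: "sigma c \<in> Rad \<Longrightarrow> Adm c"
  using supported_sigma[OF Rad_Adm[of "sigma c"]] by simp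

lemma Cod_Y: "v \<in> W \<Longrightarrow> sigma c \<in> Rad \<Longrightarrow> sigma (Y v n c) \<in> Rad"
  by (simp add: sigma_Y W_lattice Rad_Y)

definition Mod :: "fock set" where
  "Mod = {c + emb y | c y. sigma c \<in> Rad \<and> Adm y \<and> red y = y}"

text \<open>Block triangular: the diagonal blocks are the actions on \<open>sigma(Rad)\<close> and
  on the quotient, and the block from the former to the latter is the derivative with opposite signs
  on the two cosets.\<close>

definition act :: "fock \<Rightarrow> int \<Rightarrow> fock \<Rightarrow> fock" where
  "act v n x = Y v n (fst_part x) + emb (red (Y v n (snd_part x) + sigma (DY v n (fst_part x))))"

lemma ModI: "sigma c \<in> Rad \<Longrightarrow> Adm y \<Longrightarrow> red y = y \<Longrightarrow> c + emb y \<in> Mod"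
  by (auto simp: Mod_def)

lemma ModE:
  assumes "x \<in> Mod"
  obtains c y where "x = c + emb y" "sigma c \<in> Rad" "Adm y" "red y = y"
  using assms by (auto simp: Mod_def)

lemma act_pair:
  "Adm c \<Longrightarrow> Adm y \<Longrightarrow> act v n (c + emb y) = Y v n c + emb (red (Y v n y + sigma (DY v n c)))"
  by (simp add: act_def parts)

lemma lin_act: "lin (act v n)" and lin_act_left: "lin (\<lambda>v. act v n x)"
  unfolding act_def
  by (intro lin_plus lin_comp[OF lin_Y lin_fst_part] lin_comp[OF lin_emb] lin_comp[OF lin_red]
      lin_comp[OF lin_Y lin_snd_part] lin_comp[OF lin_sigma] lin_comp[OF lin_DY lin_fst_part]
      lin_Y_left lin_DY_left)+

lemma act_Adm:
  assumes "v \<in> W" "Adm c" "Adm y"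
  shows "Adm (Y v n y + sigma (DY v n c))"
  using assms by (intro supported_add supported_sigma Y_Adm DY_Adm W_lattice)

lemma act_act:
  assumes "u \<in> W" "v \<in> W" "Adm c" "Adm y"
  shows "act u k (act v n (c + emb y)) = Y u k (Y v n c) + emb (red (Y u k (Y v n y) + sigma (DY u k (Y v n c) + Y u k (DY v n c))))"
proof -
  have "act u k (act v n (c + emb y)) = Y u k (Y v n c) + emb (red (Y u k (red (Y v n y + sigma (DY v n c))) + sigma (DY u k (Y v n c))))"
    unfolding act_pair[OF assms(3,4)]
    by (rule act_pair) (use assms in \<open>auto intro: Y_Adm W_lattice Adm_red act_Adm\<close>)
  also have "red (Y u k (red (Y v n y + sigma (DY v n c))) + sigma (DY u k (Y v n c))) =
     red (Y u k (Y v n y + sigma (DY v n c))) + red (sigma (DY u k (Y v n c)))"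
    using lin_add[OF lin_red, of "Y u k (red (Y v n y + sigma (DY v n c)))" "sigma (DY u k (Y v n c))"]
      red_Y_red[OF assms(1), of k "Y v n y + sigma (DY v n c)"] by (simp only:)
  also have "\<dots> = red (Y u k (Y v n y) + sigma (DY u k (Y v n c) + Y u k (DY v n c)))"
    using sigma_Y[OF W_lattice[OF assms(1)], of k "DY v n c"]
    by (simp add: lin_add[OF lin_red] lin_add[OF lin_Y] lin_add[OF lin_sigma])
  finally show ?thesis .
qed

text \<open>By \<open>DY_Borcherds\<close> the two sides differ by ordinary products of modes
  applied to \<open>c\<close>. As \<open>sigma c\<close> lies in the submodule \<open>Rad\<close>,
  so does \<open>sigma\<close> of these products, and \<open>red\<close> removes them. The
  correction is proportional to the momentum of u, so u is first split into components of fixed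
  momentum.\<close>

lemma cocycle:
  assumes u: "u \<in> W" and v: "v \<in> W" and c: "sigma c \<in> Rad"
  shows "red (sigma (Sum_any (\<lambda>j. smul (of_int m gchoose j) (DY (Y u (l + int j) v) (m + n - int j) c)))) =
    red (sigma (Sum_any (DBR l m n u v c)))"
proof -
  define T where "T u = Sum_any (\<lambda>j. smul (of_int m gchoose j) (DY (Y u (l + int j) v) (m + n - int j) c)) -
     Sum_any (DBR l m n u v c)" for u
  have "lin (\<lambda>u. DBR l m n u v c j)" for j
    unfolding DBR_def
    by (intro lin_scale lin_diff_fun lin_plus lin_DY_left lin_Y_left lin_comp[OF lin_DY lin_Y_left] lin_comp[OF lin_Y lin_DY_left])
  moreover have "lin (\<lambda>u. DY (Y u (l + int j) v) (m + n - int j) c)" for j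
    by (rule lin_comp[OF lin_DY_left lin_Y_left])
  ultimately have "lin T"
    unfolding T_def by (intro lin_diff_fun lin_Sum_any lin_scale ez_DYL ez_DBR)
  have mom: "red (sigma (T u)) = 0" if u: "u \<in> W" "mom a u" for u a
  proof -
    let ?S = "Sum_any (\<lambda>t. smul (\<Sum>j\<le>t. (of_int m gchoose j) * log_coeff (t - j)) (Y (Y u (l + int t) v) (m + n - int t) c))"
    have "T u = smul (of_int a) ?S"
      unfolding T_def DY_Borcherds[OF W_lattice[OF u(1)] u(2) W_lattice[OF v]] by simp
    moreover have "sigma ?S \<in> Rad"
      unfolding Sum_any_lin[OF ez_BL lin_sigma] lin_smul[OF lin_sigma]
    proof (rule Rad_Sum_any)
      fix t show "smul (\<Sum>j\<le>t. (of_int m gchoose j) * log_coeff (t - j)) (sigma (Y (Y u (l + int t) v) (m + n - int t) c)) \<in> Rad"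
        by (intro Rad_smul Cod_Y W_Y u v c)
    next
      show "ez (\<lambda>t. smul (\<Sum>j\<le>t. (of_int m gchoose j) * log_coeff (t - j)) (sigma (Y (Y u (l + int t) v) (m + n - int t) c)))"
        using ez_hom[OF ez_BL, of sigma] unfolding lin_smul[OF lin_sigma] by (simp add: lin_zero[OF lin_sigma])
    qed
    ultimately show ?thesis by (simp add: lin_smul[OF lin_sigma] lin_smul[OF lin_red] red_Rad)
  qed
  obtain S :: "(nat \<times> int) set" and f where S: "finite S" "u = sum f S"
    "\<forall>s\<in>S. f s \<in> W \<and> mom (snd s) (f s) \<and> (\<exists>k. LWt k (f s))"
    using u by (rule W_components)
  have "red (sigma (T u)) = (\<Sum>s\<in>S. red (sigma (T (f s))))"
    unfolding S(2) lin_sum[OF \<open>lin T\<close>] lin_sum[OF lin_sigma] lin_sum[OF lin_red] ..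
  also have "\<dots> = 0" using S(3) mom by (intro sum.neutral) blast
  finally show ?thesis by (simp add: T_def lin_diff[OF lin_sigma] lin_diff[OF lin_red])
qed

lemma ez_emb_red: "ez f \<Longrightarrow> ez (\<lambda>j. emb (red (f j)))" and ez_sigma: "ez f \<Longrightarrow> ez (\<lambda>j. sigma (f j))"
  by (erule ez_hom, simp add: lin_zero[OF lin_red] lin_zero[OF lin_emb] lin_zero[OF lin_sigma])+

lemma Sum_any_pair:
  assumes "ez f" "ez g" "ez k"
  shows "Sum_any (\<lambda>j. f j + emb (red (g j + sigma (k j)))) = Sum_any f + emb (red (Sum_any g + sigma (Sum_any k)))"
proof -
  note ez = ez_add[OF assms(2) ez_sigma[OF assms(3)]]
  have "Sum_any (\<lambda>j. f j + emb (red (g j + sigma (k j)))) = Sum_any f + Sum_any (\<lambda>j. emb (red (g j + sigma (k j))))"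
    by (rule Sum_any_plus[OF assms(1) ez_emb_red[OF ez]])
  also have "Sum_any (\<lambda>j. emb (red (g j + sigma (k j)))) = emb (red (Sum_any (\<lambda>j. g j + sigma (k j))))"
    by (rule Sum_any_lin[OF ez lin_comp[OF lin_emb lin_red], symmetric])
  also have "Sum_any (\<lambda>j. g j + sigma (k j)) = Sum_any g + sigma (Sum_any k)"
    by (simp only: Sum_any_plus[OF assms(2) ez_sigma[OF assms(3)]] Sum_any_lin[OF assms(3) lin_sigma])
  finally show ?thesis .
qed

text \<open>The diagonal blocks satisfy the identity by \<open>Borcherds\<close>. In the
  off-diagonal block \<open>act_act\<close> produces the product rule recorded in
  \<open>DBR\<close>, and \<open>cocycle\<close> provides the equality.\<close>

lemma jacobi_act:
  assumes u: "u \<in> W" and v: "v \<in> W" and x: "x \<in> Mod"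
  shows "Sum_any (\<lambda>j. smul (of_int m gchoose j) (act (Y u (l + int j) v) (m + n - int j) x)) =
    Sum_any (\<lambda>j. smul ((- 1) ^ j * (of_int l gchoose j))
      (act u (l + m - int j) (act v (n + int j) x) - smul ((- 1) powi l) (act v (l + n - int j) (act u (m + int j) x))))"
proof -
  obtain c y where x: "x = c + emb y" "sigma c \<in> Rad" "Adm y" "red y = y" using x by (rule ModE)
  note A = in_Cod[OF x(2)] x(3)
  have "Sum_any (\<lambda>j. smul (of_int m gchoose j) (act (Y u (l + int j) v) (m + n - int j) x)) =
     Sum_any (\<lambda>j. smul (of_int m gchoose j) (Y (Y u (l + int j) v) (m + n - int j) c) +
       emb (red (smul (of_int m gchoose j) (Y (Y u (l + int j) v) (m + n - int j) y) +
         sigma (smul (of_int m gchoose j) (DY (Y u (l + int j) v) (m + n - int j) c)))))"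
    unfolding x(1) act_pair[OF A]
    by (simp add: smul.scale_right_distrib lin_smul[OF lin_emb] lin_smul[OF lin_red] lin_smul[OF lin_sigma]
        lin_add[OF lin_red] lin_add[OF lin_emb])
  also have "\<dots> = BL l m n u v c + emb (red (BL l m n u v y +
      sigma (Sum_any (\<lambda>j. smul (of_int m gchoose j) (DY (Y u (l + int j) v) (m + n - int j) c)))))"
    unfolding BL_def by (rule Sum_any_pair[OF ez_BL ez_BL ez_DYL])
  also have "\<dots> = BR l m n u v c + emb (red (BR l m n u v y + sigma (Sum_any (DBR l m n u v c))))"
    by (simp only: Borcherds[OF W_lattice[OF u] W_lattice[OF v]] lin_add[OF lin_red] cocycle[OF u v x(2)])
  also have "\<dots> = Sum_any (\<lambda>j. smul ((- 1) ^ j * (of_int l gchoose j)) (Y u (l + m - int j) (Y v (n + int j) c) -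
        smul ((- 1) powi l) (Y v (l + n - int j) (Y u (m + int j) c))) +
      emb (red (smul ((- 1) ^ j * (of_int l gchoose j)) (Y u (l + m - int j) (Y v (n + int j) y) -
        smul ((- 1) powi l) (Y v (l + n - int j) (Y u (m + int j) y))) + sigma (DBR l m n u v c j))))"
    unfolding BR_def by (rule Sum_any_pair[OF ez_BR ez_BR ez_DBR, symmetric])
  also have "\<dots> = Sum_any (\<lambda>j. smul ((- 1) ^ j * (of_int l gchoose j))
      (act u (l + m - int j) (act v (n + int j) x) - smul ((- 1) powi l) (act v (l + n - int j) (act u (m + int j) x))))"
    unfolding x(1) act_act[OF u v A] act_act[OF v u A] DBR_def
    by (simp add: smul.scale_right_distrib smul.scale_right_diff_distrib
        lin_smul[OF lin_emb] lin_smul[OF lin_red] lin_smul[OF lin_sigma]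
        lin_add[OF lin_emb] lin_add[OF lin_red] lin_add[OF lin_sigma]
        lin_diff[OF lin_emb] lin_diff[OF lin_red] lin_diff[OF lin_sigma]) (simp add: algebra_simps)
  finally show ?thesis .
qed

lemma subspace_Mod: "smul.subspace Mod"
proof (rule smul.subspaceI)
  show "0 \<in> Mod" using ModI[of 0 0] by (simp add: lin_zero[OF lin_sigma] lin_zero[OF lin_red] lin_zero[OF lin_emb])
next
  fix x x' assume "x \<in> Mod" "x' \<in> Mod"
  then obtain c y c' y' where x: "x = c + emb y" "sigma c \<in> Rad" "Adm y" "red y = y"
    and x': "x' = c' + emb y'" "sigma c' \<in> Rad" "Adm y'" "red y' = y'" by (elim ModE)
  have "(c + c') + emb (y + y') \<in> Mod"
    by (rule ModI) (use x x' in \<open>auto simp: lin_add[OF lin_sigma] lin_add[OF lin_red] intro: Rad_add supported_add\<close>)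
  then show "x + x' \<in> Mod" by (simp add: x(1) x'(1) lin_add[OF lin_emb] add_ac)
next
  fix a x assume "x \<in> Mod"
  then obtain c y where x: "x = c + emb y" "sigma c \<in> Rad" "Adm y" "red y = y" by (rule ModE)
  have "smul a c + emb (smul a y) \<in> Mod"
    by (rule ModI) (use x in \<open>auto simp: lin_smul[OF lin_sigma] lin_smul[OF lin_red] intro: Rad_smul supported_smul\<close>)
  then show "smul a x \<in> Mod" by (simp add: x(1) lin_smul[OF lin_emb] smul.scale_right_distrib)
qed

section \<open>The module axioms and the grading\<close>

lemma triplet_simps [simp]:
  "scal (triplet p) = smul" "vacuum (triplet p) = bv {#} 0" "conformal (triplet p) = \<omega>" "mode (triplet p) = Y"
  by (auto simp: triplet_def Y_def fun_eq_iff)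

lemma weak_module_Mod: "weak_module smul (triplet p) Mod act"
proof (unfold_locales, unfold triplet_simps)
  show "smul.subspace Mod" by (rule subspace_Mod)
next
  fix v w n assume v: "v \<in> W" and "w \<in> Mod"
  then obtain c y where x: "w = c + emb y" "sigma c \<in> Rad" "Adm y" "red y = y" by (elim ModE)
  show "act v n w \<in> Mod"
    unfolding x(1) act_pair[OF in_Cod[OF x(2)] x(3)]
    by (rule ModI[OF Cod_Y[OF v x(2)] Adm_red[OF act_Adm[OF v in_Cod[OF x(2)] x(3)]]]) simp
next
  fix v w assume v: "v \<in> W" and "w \<in> Mod"
  obtain N1 where N1: "\<forall>k\<ge>N1. Y v (0 + int k) (fst_part w) = 0" using ez_Y_up unfolding ez_def by blast
  obtain N2 where N2: "\<forall>k\<ge>N2. Y v (0 + int k) (snd_part w) = 0" using ez_Y_up unfolding ez_def by blast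
  obtain N3 where N3: "\<forall>k\<ge>N3. DY v (0 + int k) (fst_part w) = 0" using ez_DY_up unfolding ez_def by blast
  have "act v n w = 0" if "n \<ge> int (max N1 (max N2 N3))" for n
  proof -
    define k where "k = nat n"
    have "n = 0 + int k" "k \<ge> max N1 (max N2 N3)" using that by (auto simp: k_def)
    then show ?thesis using N1 N2 N3
      by (simp add: act_def lin_zero[OF lin_sigma] lin_zero[OF lin_red] lin_zero[OF lin_emb])
  qed
  then show "\<exists>N. \<forall>n\<ge>N. act v n w = 0" by blast
next
  fix w n assume "w \<in> Mod"
  then obtain c y where x: "w = c + emb y" "sigma c \<in> Rad" "Adm y" "red y = y" by (rule ModE)
  show "act (bv {#} 0) n w = (if n = - 1 then w else 0)"
    unfolding x(1) act_pair[OF in_Cod[OF x(2)] x(3)] DY_vacuum Y_vacuum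
    using x(4) by (simp add: lin_zero[OF lin_sigma] lin_zero[OF lin_red] lin_zero[OF lin_emb])
qed (simp_all add: lin_add[OF lin_act] lin_add[OF lin_act_left] lin_smul[OF lin_act] lin_smul[OF lin_act_left] jacobi_act)

text \<open>The projection \<open>red\<close> was chosen without regard to weights and need not
  preserve them. Degree n of the quotient is therefore given by the classes of vectors z of weight
  n, not by the weight of the representatives \<open>red z\<close>.\<close>

definition Gr :: "nat \<Rightarrow> fock set" where
  "Gr n = {c + emb (red z) | c z. sigma c \<in> Rad \<and> Wt (int n) c \<and> Wt (int n) z}"

lemma GrI: "sigma c \<in> Rad \<Longrightarrow> Wt (int n) c \<Longrightarrow> Wt (int n) z \<Longrightarrow> c + emb (red z) \<in> Gr n"
  by (auto simp: Gr_def)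

lemma GrE:
  assumes "x \<in> Gr n"
  obtains c z where "x = c + emb (red z)" "sigma c \<in> Rad" "Wt (int n) c" "Wt (int n) z"
  using assms by (auto simp: Gr_def)

lemma Gr_Mod: "x \<in> Gr n \<Longrightarrow> x \<in> Mod"
  by (erule GrE) (simp, rule ModI, assumption, rule Adm_red, erule Wt_Adm, rule red_red)

lemma subspace_Gr: "smul.subspace (Gr n)"
proof (rule smul.subspaceI)
  show "0 \<in> Gr n" using GrI[of 0 n 0] by (simp add: lin_zero[OF lin_sigma] lin_zero[OF lin_red] lin_zero[OF lin_emb])
next
  fix x x' assume "x \<in> Gr n" "x' \<in> Gr n"
  then obtain c z c' z' where x: "x = c + emb (red z)" "sigma c \<in> Rad" "Wt (int n) c" "Wt (int n) z"
    and x': "x' = c' + emb (red z')" "sigma c' \<in> Rad" "Wt (int n) c'" "Wt (int n) z'" by (elim GrE)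
  have "(c + c') + emb (red (z + z')) \<in> Gr n"
    by (rule GrI) (use x x' in \<open>auto simp: lin_add[OF lin_sigma] intro: Rad_add supported_add\<close>)
  then show "x + x' \<in> Gr n" by (simp add: x(1) x'(1) lin_add[OF lin_emb] lin_add[OF lin_red] add_ac)
next
  fix a x assume "x \<in> Gr n"
  then obtain c z where x: "x = c + emb (red z)" "sigma c \<in> Rad" "Wt (int n) c" "Wt (int n) z" by (rule GrE)
  have "smul a c + emb (red (smul a z)) \<in> Gr n"
    by (rule GrI) (use x in \<open>auto simp: lin_smul[OF lin_sigma] intro: Rad_smul supported_smul\<close>)
  then show "smul a x \<in> Gr n" by (simp add: x(1) lin_smul[OF lin_emb] lin_smul[OF lin_red] smul.scale_right_distrib)
qed

definition proj_Gr :: "nat \<Rightarrow> fock \<Rightarrow> fock" where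
  "proj_Gr n x = proj_wt (int n) (fst_part x) + emb (red (proj_wt (int n) (snd_part x)))"

lemma lin_proj_Gr: "lin (proj_Gr n)"
  unfolding proj_Gr_def
  by (intro lin_plus lin_comp[OF lin_proj_wt lin_fst_part] lin_comp[OF lin_emb] lin_comp[OF lin_red] lin_comp[OF lin_proj_wt lin_snd_part])

lemma proj_Gr_Mod: "x \<in> Mod \<Longrightarrow> proj_Gr n x \<in> Gr n"
proof -
  assume "x \<in> Mod"
  then obtain c y where x: "x = c + emb y" "sigma c \<in> Rad" "Adm y" "red y = y" by (rule ModE)
  show ?thesis unfolding proj_Gr_def x(1) parts[OF in_Cod[OF x(2)] x(3)]
    by (rule GrI) (simp_all add: proj_wt_sigma[symmetric] Rad_proj_wt Wt_proj_wt x in_Cod)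
qed

lemma proj_Gr_Gr: "x \<in> Gr n \<Longrightarrow> proj_Gr n' x = (if n' = n then x else 0)"
proof -
  assume "x \<in> Gr n"
  then obtain c z where x: "x = c + emb (red z)" "sigma c \<in> Rad" "Wt (int n) c" "Wt (int n) z" by (rule GrE)
  show ?thesis unfolding proj_Gr_def x(1) parts[OF Wt_Adm[OF x(3)] Adm_red[OF Wt_Adm[OF x(4)]]] red_proj_wt_red
    using proj_wt_Wt[OF x(3)] proj_wt_Wt[OF x(4)] by (simp add: lin_zero[OF lin_red] lin_zero[OF lin_emb])
qed

lemma sum_proj_wt_nat:
  assumes "Adm z"
  obtains B where "\<And>B'. B' \<ge> B \<Longrightarrow> (\<Sum>n<B'. proj_wt (int n) z) = z" "\<And>n. n \<ge> B \<Longrightarrow> proj_wt (int n) z = 0"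
proof -
  define S where "S = (\<lambda>(\<mu>, m). nat (wt \<mu> m)) ` keys z"
  define B where "B = Suc (Max (insert 0 S))"
  have wt: "0 \<le> wt \<mu> m \<and> wt \<mu> m < int B" if "(\<mu>, m) \<in> keys z" for \<mu> m
  proof
    show "0 \<le> wt \<mu> m" using assms that excess_sign(1)[of m] by (auto simp: wt_def supported_def)
    have "nat (wt \<mu> m) \<in> S" unfolding S_def using that by force
    then have "nat (wt \<mu> m) < B" unfolding B_def by (intro le_imp_less_Suc Max_ge) (simp_all add: S_def)
    then show "wt \<mu> m < int B" by simp
  qed
  have "(\<Sum>n<B'. proj_wt (int n) z) = z" if "B' \<ge> B" for B'
  proof -
    have "z = (\<Sum>N\<in>int ` {..<B'}. proj_wt N z)"
    proof (rule sum_proj_wt)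
      fix \<mu> m assume "(\<mu>, m) \<in> keys z"
      then show "wt \<mu> m \<in> int ` {..<B'}" using wt[of \<mu> m] that by (intro image_eqI[of _ _ "nat (wt \<mu> m)"]) auto
    qed simp
    then show ?thesis by (simp add: sum.reindex)
  qed
  moreover have "proj_wt (int n) z = 0" if "n \<ge> B" for n
    unfolding proj_wt_def by (rule fock_restrict_0) (use wt that in fastforce)
  ultimately show ?thesis by (rule that)
qed

lemma decomposition_Gr: "smul.direct_sum_decomposition Gr Mod"
  unfolding smul.direct_sum_decomposition_def
proof (intro conjI allI ballI)
  fix w assume "w \<in> Mod"
  then obtain c y where x: "w = c + emb y" "sigma c \<in> Rad" "Adm y" "red y = y" by (rule ModE)
  obtain B1 where B1: "\<And>B'. B' \<ge> B1 \<Longrightarrow> (\<Sum>n<B'. proj_wt (int n) c) = c" "\<And>n. n \<ge> B1 \<Longrightarrow> proj_wt (int n) c = 0"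
    using sum_proj_wt_nat[OF in_Cod[OF x(2)]] by blast
  obtain B2 where B2: "\<And>B'. B' \<ge> B2 \<Longrightarrow> (\<Sum>n<B'. proj_wt (int n) y) = y" "\<And>n. n \<ge> B2 \<Longrightarrow> proj_wt (int n) y = 0"
    using sum_proj_wt_nat[OF x(3)] by blast
  define B where "B = max B1 B2"
  have P: "proj_Gr n w = proj_wt (int n) c + emb (red (proj_wt (int n) y))" for n
    unfolding proj_Gr_def x(1) parts[OF in_Cod[OF x(2)] x(3)] ..
  have z: "proj_Gr n w = 0" if "n \<ge> B" for n
    unfolding P using B1(2) B2(2) that by (simp add: B_def lin_zero[OF lin_red] lin_zero[OF lin_emb])
  have "Sum_any (\<lambda>n. proj_Gr n w) = (\<Sum>n<B. proj_Gr n w)" by (rule Sum_any_lessThan[OF z])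
  also have "\<dots> = (\<Sum>n<B. proj_wt (int n) c) + emb (red (\<Sum>n<B. proj_wt (int n) y))"
    unfolding P sum.distrib lin_sum[OF lin_red] lin_sum[OF lin_emb] ..
  also have "\<dots> = w" using B1(1)[of B] B2(1)[of B] x(1,4) by (simp add: B_def)
  finally have s: "Sum_any (\<lambda>n. proj_Gr n w) = w" .
  have fin: "finite {n. proj_Gr n w \<noteq> 0}" by (rule finite_subset[of _ "{..<B}"]) (use z in \<open>auto simp: not_le[symmetric]\<close>)
  show "\<exists>!f. (\<forall>n. f n \<in> Gr n) \<and> finite {n. f n \<noteq> 0} \<and> w = Sum_any f"
  proof (rule ex1I[of _ "\<lambda>n. proj_Gr n w"])
    show "(\<forall>n. proj_Gr n w \<in> Gr n) \<and> finite {n. proj_Gr n w \<noteq> 0} \<and> w = Sum_any (\<lambda>n. proj_Gr n w)"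
      using proj_Gr_Mod[OF \<open>w \<in> Mod\<close>] fin s by simp
    fix f assume f: "(\<forall>n. f n \<in> Gr n) \<and> finite {n. f n \<noteq> 0} \<and> w = Sum_any f"
    show "f = (\<lambda>n. proj_Gr n w)"
    proof (rule ext)
      fix n
      have "proj_Gr n w = (\<Sum>k\<in>{k. f k \<noteq> 0}. proj_Gr n (f k))"
        using f by (simp add: Sum_any.expand_set lin_sum[OF lin_proj_Gr])
      also have "\<dots> = (\<Sum>k\<in>{k. f k \<noteq> 0}. if k = n then f n else 0)"
      proof (intro sum.cong refl, goal_cases)
        case (1 k)
        have "f k \<in> Gr k" using f by blast
        then show ?case using proj_Gr_Gr[of "f k" k n] by auto
      qed
      also have "\<dots> = f n" using f by auto
      finally show "f n = proj_Gr n w" ..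
    qed
  qed
qed (use subspace_Gr Gr_Mod in auto)

text \<open>The grading axiom speaks of eigenvectors of L(0) in W(p), while weights are tracked on
  basis vectors. L(0) is diagonal in this basis, so comparing coefficients makes the two notions
  agree.\<close>

lemma LWt_L0:
  assumes v: "v \<in> W" and k: "Y \<omega> 1 v = smul (of_int k) v" shows "LWt k v"
  unfolding supported_def
proof clarify
  fix \<mu> a assume key: "(\<mu>, a) \<in> keys v"
  have a: "int (2 * p) dvd a" using W_lattice[OF v] key unfolding lattice_space_iff by blast
  have "lookup (Y \<omega> 1 v) (\<mu>, a) = (\<Sum>k\<in>keys v. lookup v k *
      ((wt0 (snd k) + of_nat (deg (fst k))) * lookup (bv (fst k) (snd k)) (\<mu>, a)))"
    using arg_cong[OF fock_expand[of v], of "\<lambda>w. lookup (Y \<omega> 1 w) (\<mu>, a)"]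
    by (simp only: lin_sum[OF lin_Y] lin_smul[OF lin_Y] L0_basis lookup_sum lookup_smul)
  also have "\<dots> = (\<Sum>k\<in>keys v. if k = (\<mu>, a) then (wt0 a + of_nat (deg \<mu>)) * lookup v k else 0)"
    by (intro sum.cong) (auto simp: lookup_basis_vector)
  also have "\<dots> = (wt0 a + of_nat (deg \<mu>)) * lookup v (\<mu>, a)" using key by simp
  finally have "of_int k * lookup v (\<mu>, a) = (wt0 a + of_nat (deg \<mu>)) * lookup v (\<mu>, a)"
    unfolding k lookup_smul .
  then have e: "wt0 a + of_nat (deg \<mu>) = of_int k" using key by (simp add: in_keys_iff)
  obtain q where q: "a = 2 * int p * q" using a by (auto elim: dvdE)
  have d: "a * (a - 2 * int p + 2) = 4 * int p * (q * (int p * q - int p + 1))"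
    unfolding q by (simp add: algebra_simps)
  have "wt0 a = of_int (a * (a - 2 * int p + 2) div (4 * int p))"
    unfolding wt0_def d using p_pos by simp
  then have "of_int (lattice_wt \<mu> a) = (of_int k :: complex)" using e by (simp add: lattice_wt_def add.commute)
  then show "int (2 * p) dvd a \<and> lattice_wt \<mu> a = k" using a by simp
qed

lemma graded_weak_module_Mod: "graded_weak_module smul (triplet p) Mod act Gr"
proof -
  interpret weak_module smul "triplet p" Mod act by (rule weak_module_Mod)
  show ?thesis
  proof (unfold_locales, unfold triplet_simps)
    fix v k w n m
    assume v: "v \<in> W" "Y \<omega> 1 v = smul (of_int k) v" and "w \<in> Gr n"
    then obtain c z where x: "w = c + emb (red z)" "sigma c \<in> Rad" "Wt (int n) c" "Wt (int n) z" by (elim GrE)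
    note L = LWt_L0[OF v]
    define N where "N = int n + k - m - 1"
    have e: "act v m w = Y v m c + emb (red (Y v m z + sigma (DY v m c)))"
      unfolding x(1) act_pair[OF Wt_Adm[OF x(3)] Adm_red[OF Wt_Adm[OF x(4)]]]
      by (simp only: lin_add[OF lin_red] red_Y_red[OF v(1)])
    have 1: "Wt N (Y v m c)" unfolding N_def by (rule Y_Wt[OF L x(3)])
    have 2: "Wt N (Y v m z + sigma (DY v m c))"
      unfolding N_def by (intro supported_add supported_sigma Y_Wt[OF L x(4)] DY_Wt[OF L x(3)])
    show "if N < 0 then act v m w = 0 else act v m w \<in> Gr (nat N)"
    proof (cases "N < 0")
      case True
      then show ?thesis using Wt_neg[OF 1] Wt_neg[OF 2] unfolding e by (simp add: lin_zero[OF lin_red] lin_zero[OF lin_emb])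
    next
      case False
      then show ?thesis unfolding e using 1 2 by (auto intro!: GrI Cod_Y v(1) x(2))
    qed
  qed (rule decomposition_Gr)
qed

text \<open>Both diagonal blocks are the scalar h + n. The off-diagonal block of L(0) is
  \<open>DY_omega1\<close>, the derivative of the weight with the signs of
  \<open>sigma\<close>.\<close>

lemma L0_Gr:
  assumes "x = c + emb (red z)" "sigma c \<in> Rad" "Wt (int n) c" "Wt (int n) z"
  shows "act \<omega> 1 x = smul (conformal_weight p i + of_nat n) x + emb (red (sigma (h 0 c - smul (of_nat p - 1) c)))"
proof -
  have "act \<omega> 1 x = Y \<omega> 1 c + emb (red (Y \<omega> 1 z) + red (sigma (DY \<omega> 1 c)))"
    unfolding assms(1) act_pair[OF Wt_Adm[OF assms(3)] Adm_red[OF Wt_Adm[OF assms(4)]]]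
    by (simp only: lin_add[OF lin_red] red_L0_red)
  then show ?thesis
    unfolding L0_Wt[OF assms(3)] L0_Wt[OF assms(4)] DY_omega1 assms(1)
    by (simp add: lin_add[OF lin_emb] lin_smul[OF lin_emb] lin_smul[OF lin_red] smul.scale_right_distrib)
qed

text \<open>The nilpotent part maps into the quotient component and is zero on it, so its square
  vanishes.\<close>

lemma Gr_generalized:
  assumes "x \<in> Gr n"
  shows "((\<lambda>u. act \<omega> 1 u - smul (conformal_weight p i + of_nat n) u) ^^ 2) x = 0"
proof -
  obtain c z where x: "x = c + emb (red z)" "sigma c \<in> Rad" "Wt (int n) c" "Wt (int n) z" using assms by (rule GrE)
  define y where "y = sigma (h 0 c - smul (of_nat p - 1) c)"
  have "Wt (int n) (h 0 c)"
    by (rule supported_lin[OF lin_heisenberg x(3)]) (simp add: supported_smul)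
  then have "Wt (int n) y" unfolding y_def by (intro supported_sigma supported_diff supported_smul x(3))
  moreover have "sigma 0 \<in> Rad" by (simp add: lin_zero[OF lin_sigma])
  ultimately have "act \<omega> 1 (0 + emb (red y)) = smul (conformal_weight p i + of_nat n) (0 + emb (red y))"
    using L0_Gr[OF refl, of 0 n y] by (simp add: lin_zero[OF lin_sigma] lin_zero[OF lin_red] lin_zero[OF lin_emb])
  then show ?thesis using L0_Gr[OF x] by (simp add: numeral_2_eq_2 y_def)
qed

section \<open>The lowest weight space\<close>

definition "top_gen = bv {#} lo + bv {#} hi"
definition "top_vec = emb (red (bv {#} lo))"

lemma lo_neq_hi [simp]: "lo \<noteq> hi" "hi \<noteq> lo"
  using hi_not_lo by auto

lemma psi_lo_hi [simp]: "psi (bv {#} lo) = 1" "psi (bv {#} hi) = 1"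
  by (simp_all add: psi_def vac_def lookup_basis_vector)

text \<open>\<open>sigma\<close> reverses the sign on the coset of \<open>hi\<close>, so this is
  \<open>Rad_difference\<close>. It is the reason for the sign in the first component of the
  module.\<close>

lemma sigma_top_gen: "sigma top_gen \<in> Rad"
  using Rad_difference hi_not_lo by (simp add: top_gen_def lin_add[OF lin_sigma])

lemma Wt_lo_hi: "Wt 0 (bv {#} lo)" "Wt 0 (bv {#} hi)" "Wt 0 top_gen"
  by (simp_all add: top_gen_def wt_def supported_add)

lemma top_Gr: "top_gen \<in> Gr 0" "top_vec \<in> Gr 0"
proof -
  show "top_gen \<in> Gr 0"
    using GrI[of top_gen 0 0] sigma_top_gen Wt_lo_hi by (simp add: lin_zero[OF lin_red] lin_zero[OF lin_emb])
  show "top_vec \<in> Gr 0"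
    using GrI[of 0 0 "bv {#} lo"] Wt_lo_hi by (simp add: top_vec_def lin_zero[OF lin_sigma])
qed

lemma red_not_0: "psi z \<noteq> 0 \<Longrightarrow> red z \<noteq> 0"
  using red_diff[of z] Rad_psi_0[of z] by auto

lemma top_independent: "smul a top_gen + smul b top_vec = 0 \<Longrightarrow> a = 0 \<and> b = 0"
proof -
  assume "smul a top_gen + smul b top_vec = 0"
  then have e: "smul a top_gen + emb (smul b (red (bv {#} lo))) = 0"
    by (simp add: top_vec_def lin_smul[OF lin_emb])
  have A: "Adm (smul a top_gen)" "Adm (smul b (red (bv {#} lo)))"
    by (simp_all add: supported_smul Wt_Adm[OF Wt_lo_hi(3)] Adm_red)
  have "smul a top_gen = 0" "smul b (red (bv {#} lo)) = 0"
    using parts[OF A] unfolding e by (simp_all add: lin_zero[OF lin_fst_part] lin_zero[OF lin_snd_part])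
  moreover have "red (bv {#} lo) \<noteq> 0" by (rule red_not_0) simp
  moreover have "psi top_gen = 2" by (simp add: top_gen_def)
  then have "top_gen \<noteq> 0" by auto
  ultimately show ?thesis by simp
qed

lemma Wt_0_expand:
  assumes "Wt 0 z" obtains a b where "z = smul a (bv {#} lo) + smul b (bv {#} hi)"
proof -
  have keys: "keys z \<subseteq> {({#}, lo), ({#}, hi)}"
  proof
    fix k assume k: "k \<in> keys z"
    obtain \<mu> m where km: "k = (\<mu>, m)" by (cases k)
    have m: "admissible m" "int (deg \<mu>) + excess m = 0" using assms k km by (auto simp: supported_def wt_def)
    then have "deg \<mu> = 0" "excess m = 0" using excess_sign(1)[of m] by linarith+
    moreover have "\<mu> = {#}" using \<open>deg \<mu> = 0\<close> by (cases \<mu>) auto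
    ultimately show "k \<in> {({#}, lo), ({#}, hi)}" using excess_sign(2)[OF m(1)] km by auto
  qed
  have "z = (\<Sum>k\<in>{({#}, lo), ({#}, hi)}. smul (lookup z k) (bv (fst k) (snd k)))"
    by (rule fock_expand_superset[OF _ keys]) simp
  then show ?thesis by (intro that) simp
qed

text \<open>In the first component \<open>psi (sigma c) = 0\<close> forces equal coefficients at
  \<open>lo\<close> and \<open>hi\<close>, leaving a line; the quotient also contributes a line,
  since the two lattice elements are congruent modulo \<open>Rad\<close>.\<close>

lemma Gr_0_expand:
  assumes "x \<in> Gr 0" obtains a b where "x = smul a top_gen + smul b top_vec"
proof -
  obtain c z where x: "x = c + emb (red z)" "sigma c \<in> Rad" "Wt (int 0) c" "Wt (int 0) z" using assms by (rule GrE)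
  obtain a a' where c: "c = smul a (bv {#} lo) + smul a' (bv {#} hi)"
    using x(3) Wt_0_expand by auto
  obtain b b' where z: "z = smul b (bv {#} lo) + smul b' (bv {#} hi)"
    using x(4) Wt_0_expand by auto
  have "a = a'" using Rad_psi_0[OF x(2)] hi_not_lo
    by (simp add: c lin_add[OF lin_sigma] lin_smul[OF lin_sigma])
  moreover have "red (bv {#} hi) = red (bv {#} lo)"
    by (rule red_cong[OF Rad_difference, symmetric])
  ultimately have "x = smul a top_gen + smul (b + b') top_vec"
    by (simp add: x(1) c z top_gen_def top_vec_def lin_add[OF lin_emb] lin_smul[OF lin_emb] lin_add[OF lin_red] lin_smul[OF lin_red]
        smul.scale_right_distrib smul.scale_left_distrib)
  then show ?thesis by (rule that)
qed

lemma dim_Gr_0: "smul.dim (Gr 0) = 2"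
proof -
  have neq: "top_gen \<noteq> top_vec" using top_independent[of 1 "- 1"] by auto
  have nz: "top_vec \<noteq> 0" using top_independent[of 0 1] by auto
  have "top_gen \<notin> smul.span {top_vec}"
  proof
    assume "top_gen \<in> smul.span {top_vec}"
    then obtain k where "top_gen = smul k top_vec" by (auto simp: smul.span_singleton)
    then show False using top_independent[of 1 "- k"] by simp
  qed
  then have ind: "smul.independent {top_gen, top_vec}"
    using nz neq by (simp add: smul.independent_insert)
  have "Gr 0 = smul.span {top_gen, top_vec}"
  proof
    show "Gr 0 \<subseteq> smul.span {top_gen, top_vec}"
    proof
      fix x assume "x \<in> Gr 0"
      then obtain a b where "x = smul a top_gen + smul b top_vec" by (rule Gr_0_expand)
      then show "x \<in> smul.span {top_gen, top_vec}"
        by (auto intro!: smul.span_add smul.span_scale intro: smul.span_base)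
    qed
    show "smul.span {top_gen, top_vec} \<subseteq> Gr 0"
      by (rule smul.span_minimal) (use top_Gr subspace_Gr in auto)
  qed
  then show ?thesis using smul.dim_span_eq_card_independent[OF ind] neq by simp
qed

text \<open>The derivative of the weight is proportional to -(p - i) at \<open>lo\<close> and to p -
  i at \<open>hi\<close>. Because of the sign in \<open>sigma\<close> the two values add up under
  \<open>psi\<close> to -2 (p - i) instead of cancelling, so the image of \<open>top_gen\<close> is
  not zero in the quotient.\<close>

lemma L0_top:
  obtains w where "act \<omega> 1 top_gen = smul (conformal_weight p i) top_gen + w" "w \<noteq> 0" "w \<in> Gr 0"
    "act \<omega> 1 w = smul (conformal_weight p i) w"
proof -
  define y where "y = sigma (h 0 top_gen - smul (of_nat p - 1) top_gen)"
  have y: "y = smul (of_int lo - of_nat p + 1) (bv {#} lo) - smul (of_int hi - of_nat p + 1) (bv {#} hi)"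
    using hi_not_lo unfolding y_def top_gen_def
    by (simp add: lin_add[OF lin_sigma] lin_diff[OF lin_sigma] lin_smul[OF lin_sigma] smul.scale_left_distrib
        smul.scale_left_diff_distrib smul.scale_right_distrib)
  have "psi y = (of_int lo - of_nat p + 1) - (of_int hi - of_nat p + 1)" by (simp add: y)
  also have "\<dots> = - 2 * of_int (int p - int i)" by (simp add: lo_def hi_def)
  finally have "psi y = - 2 * of_int (int p - int i)" .
  moreover have "int p - int i \<noteq> 0" using i_less_p by simp
  ultimately have "psi y \<noteq> 0" by (metis mult_eq_0_iff neg_equal_0_iff_equal of_int_eq_0_iff zero_neq_numeral)
  then have "red y \<noteq> 0" by (rule red_not_0)
  have Wy: "Wt (int 0) y" unfolding y using Wt_lo_hi by (auto intro!: supported_diff supported_smul)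
  have "emb (red y) \<noteq> 0"
  proof
    assume "emb (red y) = 0"
    then show False using parts(2)[of 0 "red y"] Adm_red[OF Wt_Adm[OF Wy]] \<open>red y \<noteq> 0\<close> lin_zero[OF lin_snd_part] by simp
  qed
  moreover have "act \<omega> 1 top_gen = smul (conformal_weight p i) top_gen + emb (red y)"
    using L0_Gr[of top_gen top_gen 0 0] sigma_top_gen Wt_lo_hi by (simp add: y_def lin_zero[OF lin_red] lin_zero[OF lin_emb])
  moreover have "act \<omega> 1 (emb (red y)) = smul (conformal_weight p i) (emb (red y))"
    using L0_Gr[of "emb (red y)" 0 y 0] Wy by (simp add: lin_zero[OF lin_red] lin_zero[OF lin_emb] lin_zero[OF lin_sigma])
  moreover have "emb (red y) \<in> Gr 0" using GrI[of 0 0 y] Wy by (simp add: lin_zero[OF lin_sigma])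
  ultimately show ?thesis by (intro that)
qed

theorem log_module_Mod:
  "logarithmic_module smul (triplet p) Mod act \<and>
   graded_weak_module smul (triplet p) Mod act Gr \<and>
   smul.dim (Gr 0) = 2 \<and>
   Gr 0 \<subseteq> smul.gen_eigenspace (weak_module.L (triplet p) act 0) Mod (conformal_weight p i) \<and>
   \<not> smul.diagonalizable_on (weak_module.L (triplet p) act 0) (Gr 0)"
proof -
  interpret weak_module smul "triplet p" Mod act by (rule weak_module_Mod)
  have L0: "L 0 = act \<omega> 1" by (simp add: L_def[abs_def])
  have gen: "Gr n \<subseteq> smul.gen_eigenspace (act \<omega> 1) Mod (conformal_weight p i + of_nat n)" for n
    using Gr_Mod Gr_generalized[of _ n] unfolding smul.gen_eigenspace_def by blast
  obtain w where w: "act \<omega> 1 top_gen = smul (conformal_weight p i) top_gen + w" "w \<noteq> 0" "w \<in> Gr 0"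
    "act \<omega> 1 w = smul (conformal_weight p i) w" by (rule L0_top)
  have "smul.span (\<Union>c. smul.gen_eigenspace (act \<omega> 1) Mod c) = Mod"
  proof
    show "smul.span (\<Union>c. smul.gen_eigenspace (act \<omega> 1) Mod c) \<subseteq> Mod"
      by (rule smul.span_minimal[OF _ subspace_Mod]) (auto simp: smul.gen_eigenspace_def)
    show "Mod \<subseteq> smul.span (\<Union>c. smul.gen_eigenspace (act \<omega> 1) Mod c)"
    proof
      fix x assume "x \<in> Mod"
      then obtain f where f: "\<forall>n. f n \<in> Gr n" "x = Sum_any f"
        using decomposition_Gr unfolding smul.direct_sum_decomposition_def by blast
      show "x \<in> smul.span (\<Union>c. smul.gen_eigenspace (act \<omega> 1) Mod c)"
        unfolding f(2) Sum_any.expand_set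
        by (intro smul.span_sum smul.span_base) (use f(1) gen in blast)
    qed
  qed
  moreover have "smul.has_nontrivial_jordan_block (act \<omega> 1) Mod"
    unfolding smul.has_nontrivial_jordan_block_def using w Gr_Mod top_Gr(1) by blast
  ultimately have "logarithmic_module smul (triplet p) Mod act"
    by unfold_locales (simp_all add: L0)
  moreover have "\<not> smul.diagonalizable_on (act \<omega> 1) (Gr 0)"
  proof
    assume "smul.diagonalizable_on (act \<omega> 1) (Gr 0)"
    then have sp: "Gr 0 \<subseteq> smul.span {u \<in> Gr 0. \<exists>c. act \<omega> 1 u = smul c u}"
      unfolding smul.diagonalizable_on_def .
    let ?K = "{u. act \<omega> 1 u = smul (conformal_weight p i) u}"
    \<comment> \<open>L(0) - h squares to zero on \<open>Gr 0\<close>, so h is its only eigenvalue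
      there. If eigenvectors spanned \<open>Gr 0\<close>, then \<open>top_gen\<close> would be an
      eigenvector with eigenvalue h.\<close>
    have "u \<in> ?K" if "u \<in> Gr 0" "act \<omega> 1 u = smul c u" for u c
    proof -
      define N where "N u = act \<omega> 1 u - smul (conformal_weight p i) u" for u
      have "N u = smul (c - conformal_weight p i) u"
        by (simp add: N_def that(2) smul.scale_left_diff_distrib)
      moreover have "N (smul d u) = smul d (N u)" for d
        by (simp add: N_def lin_smul[OF lin_act] smul.scale_right_diff_distrib mult.commute)
      moreover have "N (N u) = 0" using Gr_generalized[OF that(1)] by (simp add: N_def numeral_2_eq_2)
      ultimately have "smul ((c - conformal_weight p i) * (c - conformal_weight p i)) u = 0" by simp
      then have "c = conformal_weight p i \<or> u = 0" by simp
      then show ?thesis using that(2) by (auto simp: lin_zero[OF lin_act])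
    qed
    then have "{u \<in> Gr 0. \<exists>c. act \<omega> 1 u = smul c u} \<subseteq> ?K" by auto
    moreover have "smul.subspace ?K"
      by (rule smul.subspaceI) (auto simp: lin_add[OF lin_act] lin_smul[OF lin_act] lin_zero[OF lin_act]
          smul.scale_right_distrib mult.commute)
    ultimately have "smul.span {u \<in> Gr 0. \<exists>c. act \<omega> 1 u = smul c u} \<subseteq> ?K" by (rule smul.span_minimal)
    then have "top_gen \<in> ?K" using sp top_Gr(1) by blast
    then show False using w(1,2) by simp
  qed
  moreover have "Gr 0 \<subseteq> smul.gen_eigenspace (act \<omega> 1) Mod (conformal_weight p i)"
    using gen[of 0] by simp
  ultimately show ?thesis
    using graded_weak_module_Mod dim_Gr_0 unfolding L0 by blast
qed

end

theorem theorem6p4: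
  fixes p i :: nat
  assumes "prime p" and "i \<in> {1..p - 1}"
  shows "\<exists>(M :: fock set) (act :: fock \<Rightarrow> int \<Rightarrow> fock \<Rightarrow> fock) (G :: nat \<Rightarrow> fock set).
     logarithmic_module smul (triplet p) M act \<and>
     graded_weak_module smul (triplet p) M act G \<and>
     smul.dim (G 0) = 2 \<and>
     G 0 \<subseteq> smul.gen_eigenspace (weak_module.L (triplet p) act 0) M (conformal_weight p i) \<and>
     \<not> smul.diagonalizable_on (weak_module.L (triplet p) act 0) (G 0)"
proof -
  have "log_module p i"
    by unfold_locales (use assms prime_gt_0_nat in auto)
  then show ?thesis by (intro exI) (rule log_module.log_module_Mod)
qed

end
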